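(* Let $\Phi\in\mathbb{C}\langle\!\langle x,y\rangle\!\rangle$ be a Drinfeld associator, let $\mathfrak g$ and $\mathfrak h$ be Lie algebras with chosen elements $t_{\mathfrak g}\in(S^2\mathfrak g)^{\mathfrak g}$, $t_{\mathfrak h}\in(S^2\mathfrak h)^{\mathfrak h}$, and let $\mathfrak c\subset\mathfrak g$ be a coisotropic Lie subalgebra. The functor $$X\mapsto X^{\mathfrak c}\ (\mathfrak c\text{-invariants}):\quad U(\mathfrak g\oplus\mathfrak h)\text{-Mod}^\Phi\to U\mathfrak h\text{-Mod}^\Phi$$ is braided monoidal, with the coherence maps $X^{\mathfrak c}\otimes Y^{\mathfrak c}\to(X\otimes Y)^{\mathfrak c}$ being the natural inclusions.
   Context: **Drinfeld category.** For a Lie algebra $\mathfrak a$ with a chosen $t\in(S^2\mathfrak a)^{\mathfrak a}$ and a Drinfeld associator $\Phi\in\mathbb C\langle\!\langle x,y\rangle\!\rangle$ (normalized so that $\Phi(x,y)=1+\frac1{24}[x,y]+\cdots$), $U\mathfrak a\text{-Mod}^\Phi$ is the braided monoidal category with the same objects and tensor products as $U\mathfrak a\text{-Mod}$, with $\mathrm{Hom}_{U\mathfrak a\text{-Mod}^\Phi}(X,Y)=\mathrm{Hom}_{U\mathfrak a\text{-Mod}}(X,Y)[\![\hbar]\!]$, with associativity constraint $(X\otimes Y)\otimes Z\to X\otimes(Y\otimes Z)$ given by the action of $\Phi(\hbar t^{1,2},\hbar t^{2,3})$, and with braiding $X\otimes Y\to Y\otimes X$ given by the action of $\exp(\hbar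 t^{1,2}/2)$ followed by the flip. Here $t^{i,j}$ is $t$ acting in the $i$-th and $j$-th tensor factors. Everything is over $\mathbb C$. The Lie algebra $\mathfrak g\oplus\mathfrak h$ carries the element $t_{\mathfrak g}+t_{\mathfrak h}$. A Lie subalgebra $\mathfrak c\subset\mathfrak g$ is coisotropic if the image of $t_{\mathfrak g}$ in $S^2(\mathfrak g/\mathfrak c)$ vanishes. For a $\mathfrak g\oplus\mathfrak h$-module $X$, $X^{\mathfrak c}=\{x\in X: u\cdot x=0\ \forall u\in\mathfrak c\}$, an $\mathfrak h$-submodule. "Monoidal functor" is meant in the lax sense (the coherence maps need not be isomorphisms); "braided" means the coherence maps intertwine the braidings. *)

theory Defs
  imports
    Complex_Main
    "HOL-Library.Poly_Mapping"
    "HOL-Algebra.Module"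
    "HOL-Algebra.AbelCoset"
begin

section \<open>Braided monoidal categories and functors\<close>

text \<open>Composition is written in the usual order, \<open>g \<cdot> f\<close> being first \<open>f\<close>, then \<open>g\<close>.\<close>

record ('o, 'm) bmcat =
  obj :: "'o set"
  hom_set :: "'o \<Rightarrow> 'o \<Rightarrow> 'm set"  (\<open>Hom\<index>\<close>)
  ident :: "'o \<Rightarrow> 'm"  (\<open>\<ii>\<index>\<close>)
  comp_arr :: "'m \<Rightarrow> 'm \<Rightarrow> 'm"  (infixl \<open>\<cdot>\<index>\<close> 55)
  tens_obj :: "'o \<Rightarrow> 'o \<Rightarrow> 'o"  (infixr \<open>\<odot>\<^sub>o\<index>\<close> 70)
  tens_arr :: "'m \<Rightarrow> 'm \<Rightarrow> 'm"  (infixr \<open>\<odot>\<^sub>a\<index>\<close> 70)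
  unit_obj :: "'o"  (\<open>\<I>\<index>\<close>)
  associator :: "'o \<Rightarrow> 'o \<Rightarrow> 'o \<Rightarrow> 'm"  (\<open>\<a>\<index>\<close>)
  left_unitor :: "'o \<Rightarrow> 'm"  (\<open>\<l>\<index>\<close>)
  right_unitor :: "'o \<Rightarrow> 'm"  (\<open>\<r>\<index>\<close>)
  braiding :: "'o \<Rightarrow> 'o \<Rightarrow> 'm"  (\<open>\<b>\<index>\<close>)

definition inverse_arrows :: "('o, 'm, 'z) bmcat_scheme \<Rightarrow> 'o \<Rightarrow> 'o \<Rightarrow> 'm \<Rightarrow> 'm \<Rightarrow> bool" where
  "inverse_arrows C X Y f g \<longleftrightarrow>
     f \<in> Hom\<^bsub>C\<^esub> X Y \<and> g \<in> Hom\<^bsub>C\<^esub> Y X \<and> g \<cdot>\<^bsub>C\<^esub> f = \<ii>\<^bsub>C\<^esub> X \<and> f \<cdot>\<^bsub>C\<^esub> g = \<ii>\<^bsub>C\<^esub> Y"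

definition iso_arrows :: "('o, 'm, 'z) bmcat_scheme \<Rightarrow> 'o \<Rightarrow> 'o \<Rightarrow> 'm set" where
  "iso_arrows C X Y = {f. \<exists>g. inverse_arrows C X Y f g}"

definition arrow_inverse :: "('o, 'm, 'z) bmcat_scheme \<Rightarrow> 'o \<Rightarrow> 'o \<Rightarrow> 'm \<Rightarrow> 'm" where
  "arrow_inverse C X Y f = (THE g. inverse_arrows C X Y f g)"

locale braided_monoidal_category =
  fixes C :: "('o, 'm, 'z) bmcat_scheme" (structure)
  assumes ident_hom: "X \<in> obj C \<Longrightarrow> \<ii> X \<in> Hom X X"
    and comp_hom: "\<lbrakk>X \<in> obj C; Y \<in> obj C; Z \<in> obj C; f \<in> Hom X Y; g \<in> Hom Y Z\<rbrakk> \<Longrightarrow> g \<cdot> f \<in> Hom X Z"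
    and ident_comp: "\<lbrakk>X \<in> obj C; Y \<in> obj C; f \<in> Hom X Y\<rbrakk> \<Longrightarrow> \<ii> Y \<cdot> f = f"
    and comp_ident: "\<lbrakk>X \<in> obj C; Y \<in> obj C; f \<in> Hom X Y\<rbrakk> \<Longrightarrow> f \<cdot> \<ii> X = f"
    and comp_assoc: "\<lbrakk>W \<in> obj C; X \<in> obj C; Y \<in> obj C; Z \<in> obj C;
          f \<in> Hom W X; g \<in> Hom X Y; h \<in> Hom Y Z\<rbrakk> \<Longrightarrow> (h \<cdot> g) \<cdot> f = h \<cdot> (g \<cdot> f)"
    and tens_obj: "\<lbrakk>X \<in> obj C; Y \<in> obj C\<rbrakk> \<Longrightarrow> X \<odot>\<^sub>o Y \<in> obj C"
    and unit_obj: "\<I> \<in> obj C"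
    and tens_hom: "\<lbrakk>X \<in> obj C; X' \<in> obj C; Y \<in> obj C; Y' \<in> obj C; f \<in> Hom X X'; g \<in> Hom Y Y'\<rbrakk>
          \<Longrightarrow> f \<odot>\<^sub>a g \<in> Hom (X \<odot>\<^sub>o Y) (X' \<odot>\<^sub>o Y')"
    and tens_ident: "\<lbrakk>X \<in> obj C; Y \<in> obj C\<rbrakk> \<Longrightarrow> \<ii> X \<odot>\<^sub>a \<ii> Y = \<ii> (X \<odot>\<^sub>o Y)"
    and tens_comp: "\<lbrakk>X \<in> obj C; X' \<in> obj C; X'' \<in> obj C; Y \<in> obj C; Y' \<in> obj C; Y'' \<in> obj C;
          f \<in> Hom X X'; f' \<in> Hom X' X''; g \<in> Hom Y Y'; g' \<in> Hom Y' Y''\<rbrakk>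
          \<Longrightarrow> (f' \<cdot> f) \<odot>\<^sub>a (g' \<cdot> g) = (f' \<odot>\<^sub>a g') \<cdot> (f \<odot>\<^sub>a g)"
    and associator_iso: "\<lbrakk>X \<in> obj C; Y \<in> obj C; Z \<in> obj C\<rbrakk>
          \<Longrightarrow> \<a> X Y Z \<in> iso_arrows C ((X \<odot>\<^sub>o Y) \<odot>\<^sub>o Z) (X \<odot>\<^sub>o (Y \<odot>\<^sub>o Z))"
    and associator_natural: "\<lbrakk>X \<in> obj C; X' \<in> obj C; Y \<in> obj C; Y' \<in> obj C; Z \<in> obj C; Z' \<in> obj C;
          f \<in> Hom X X'; g \<in> Hom Y Y'; h \<in> Hom Z Z'\<rbrakk>
          \<Longrightarrow> \<a> X' Y' Z' \<cdot> ((f \<odot>\<^sub>a g) \<odot>\<^sub>a h) = (f \<odot>\<^sub>a (g \<odot>\<^sub>a h)) \<cdot> \<a> X Y Z"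
    and left_unitor_iso: "X \<in> obj C \<Longrightarrow> \<l> X \<in> iso_arrows C (\<I> \<odot>\<^sub>o X) X"
    and left_unitor_natural: "\<lbrakk>X \<in> obj C; X' \<in> obj C; f \<in> Hom X X'\<rbrakk>
          \<Longrightarrow> \<l> X' \<cdot> (\<ii> \<I> \<odot>\<^sub>a f) = f \<cdot> \<l> X"
    and right_unitor_iso: "X \<in> obj C \<Longrightarrow> \<r> X \<in> iso_arrows C (X \<odot>\<^sub>o \<I>) X"
    and right_unitor_natural: "\<lbrakk>X \<in> obj C; X' \<in> obj C; f \<in> Hom X X'\<rbrakk>
          \<Longrightarrow> \<r> X' \<cdot> (f \<odot>\<^sub>a \<ii> \<I>) = f \<cdot> \<r> X"
    and pentagon: "\<lbrakk>W \<in> obj C; X \<in> obj C; Y \<in> obj C; Z \<in> obj C\<rbrakk>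
          \<Longrightarrow> (\<ii> W \<odot>\<^sub>a \<a> X Y Z) \<cdot> \<a> W (X \<odot>\<^sub>o Y) Z \<cdot> (\<a> W X Y \<odot>\<^sub>a \<ii> Z)
            = \<a> W X (Y \<odot>\<^sub>o Z) \<cdot> \<a> (W \<odot>\<^sub>o X) Y Z"
    and triangle: "\<lbrakk>X \<in> obj C; Y \<in> obj C\<rbrakk>
          \<Longrightarrow> (\<ii> X \<odot>\<^sub>a \<l> Y) \<cdot> \<a> X \<I> Y = \<r> X \<odot>\<^sub>a \<ii> Y"
    and braiding_iso: "\<lbrakk>X \<in> obj C; Y \<in> obj C\<rbrakk> \<Longrightarrow> \<b> X Y \<in> iso_arrows C (X \<odot>\<^sub>o Y) (Y \<odot>\<^sub>o X)"
    and braiding_natural: "\<lbrakk>X \<in> obj C; X' \<in> obj C; Y \<in> obj C; Y' \<in> obj C; f \<in> Hom X X'; g \<in> Hom Y Y'\<rbrakk>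
          \<Longrightarrow> \<b> X' Y' \<cdot> (f \<odot>\<^sub>a g) = (g \<odot>\<^sub>a f) \<cdot> \<b> X Y"
    and hexagon_left: "\<lbrakk>X \<in> obj C; Y \<in> obj C; Z \<in> obj C\<rbrakk>
          \<Longrightarrow> \<a> Y Z X \<cdot> \<b> X (Y \<odot>\<^sub>o Z) \<cdot> \<a> X Y Z
            = (\<ii> Y \<odot>\<^sub>a \<b> X Z) \<cdot> \<a> Y X Z \<cdot> (\<b> X Y \<odot>\<^sub>a \<ii> Z)"
    and hexagon_right: "\<lbrakk>X \<in> obj C; Y \<in> obj C; Z \<in> obj C\<rbrakk>
          \<Longrightarrow> arrow_inverse C ((Z \<odot>\<^sub>o X) \<odot>\<^sub>o Y) (Z \<odot>\<^sub>o (X \<odot>\<^sub>o Y)) (\<a> Z X Y)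
              \<cdot> \<b> (X \<odot>\<^sub>o Y) Z
              \<cdot> arrow_inverse C ((X \<odot>\<^sub>o Y) \<odot>\<^sub>o Z) (X \<odot>\<^sub>o (Y \<odot>\<^sub>o Z)) (\<a> X Y Z)
            = (\<b> X Z \<odot>\<^sub>a \<ii> Y)
              \<cdot> arrow_inverse C ((X \<odot>\<^sub>o Z) \<odot>\<^sub>o Y) (X \<odot>\<^sub>o (Z \<odot>\<^sub>o Y)) (\<a> X Z Y)
              \<cdot> (\<ii> X \<odot>\<^sub>a \<b> Y Z)"

text \<open>
  Monoidal functors are lax: the coherence maps \<open>J\<close> and \<open>J0\<close> need not be invertible.
\<close>

locale braided_monoidal_functor =
  C: braided_monoidal_category C + D: braided_monoidal_category D
  for C :: "('o, 'm, 'z) bmcat_scheme" and D :: "('p, 'n, 'w) bmcat_scheme" +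
  fixes F :: "'o \<Rightarrow> 'p" and Fa :: "'m \<Rightarrow> 'n" and J :: "'o \<Rightarrow> 'o \<Rightarrow> 'n" and J0 :: 'n
  assumes F_obj: "X \<in> obj C \<Longrightarrow> F X \<in> obj D"
    and F_hom: "\<lbrakk>X \<in> obj C; Y \<in> obj C; f \<in> Hom\<^bsub>C\<^esub> X Y\<rbrakk> \<Longrightarrow> Fa f \<in> Hom\<^bsub>D\<^esub> (F X) (F Y)"
    and F_ident: "X \<in> obj C \<Longrightarrow> Fa (\<ii>\<^bsub>C\<^esub> X) = \<ii>\<^bsub>D\<^esub> (F X)"
    and F_comp: "\<lbrakk>X \<in> obj C; Y \<in> obj C; Z \<in> obj C; f \<in> Hom\<^bsub>C\<^esub> X Y; g \<in> Hom\<^bsub>C\<^esub> Y Z\<rbrakk>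
          \<Longrightarrow> Fa (g \<cdot>\<^bsub>C\<^esub> f) = Fa g \<cdot>\<^bsub>D\<^esub> Fa f"
    and J_hom: "\<lbrakk>X \<in> obj C; Y \<in> obj C\<rbrakk> \<Longrightarrow> J X Y \<in> Hom\<^bsub>D\<^esub> (F X \<odot>\<^sub>o\<^bsub>D\<^esub> F Y) (F (X \<odot>\<^sub>o\<^bsub>C\<^esub> Y))"
    and J_natural: "\<lbrakk>X \<in> obj C; X' \<in> obj C; Y \<in> obj C; Y' \<in> obj C;
          f \<in> Hom\<^bsub>C\<^esub> X X'; g \<in> Hom\<^bsub>C\<^esub> Y Y'\<rbrakk>
          \<Longrightarrow> Fa (f \<odot>\<^sub>a\<^bsub>C\<^esub> g) \<cdot>\<^bsub>D\<^esub> J X Y = J X' Y' \<cdot>\<^bsub>D\<^esub> (Fa f \<odot>\<^sub>a\<^bsub>D\<^esub> Fa g)"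
    and J0_hom: "J0 \<in> Hom\<^bsub>D\<^esub> \<I>\<^bsub>D\<^esub> (F \<I>\<^bsub>C\<^esub>)"
    and J_assoc: "\<lbrakk>X \<in> obj C; Y \<in> obj C; Z \<in> obj C\<rbrakk>
          \<Longrightarrow> Fa (\<a>\<^bsub>C\<^esub> X Y Z) \<cdot>\<^bsub>D\<^esub> J (X \<odot>\<^sub>o\<^bsub>C\<^esub> Y) Z \<cdot>\<^bsub>D\<^esub> (J X Y \<odot>\<^sub>a\<^bsub>D\<^esub> \<ii>\<^bsub>D\<^esub> (F Z))
            = J X (Y \<odot>\<^sub>o\<^bsub>C\<^esub> Z) \<cdot>\<^bsub>D\<^esub> (\<ii>\<^bsub>D\<^esub> (F X) \<odot>\<^sub>a\<^bsub>D\<^esub> J Y Z) \<cdot>\<^bsub>D\<^esub> \<a>\<^bsub>D\<^esub> (F X) (F Y) (F Z)"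
    and J_left_unit: "X \<in> obj C
          \<Longrightarrow> Fa (\<l>\<^bsub>C\<^esub> X) \<cdot>\<^bsub>D\<^esub> J \<I>\<^bsub>C\<^esub> X \<cdot>\<^bsub>D\<^esub> (J0 \<odot>\<^sub>a\<^bsub>D\<^esub> \<ii>\<^bsub>D\<^esub> (F X)) = \<l>\<^bsub>D\<^esub> (F X)"
    and J_right_unit: "X \<in> obj C
          \<Longrightarrow> Fa (\<r>\<^bsub>C\<^esub> X) \<cdot>\<^bsub>D\<^esub> J X \<I>\<^bsub>C\<^esub> \<cdot>\<^bsub>D\<^esub> (\<ii>\<^bsub>D\<^esub> (F X) \<odot>\<^sub>a\<^bsub>D\<^esub> J0) = \<r>\<^bsub>D\<^esub> (F X)"
    and J_braided: "\<lbrakk>X \<in> obj C; Y \<in> obj C\<rbrakk>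
          \<Longrightarrow> Fa (\<b>\<^bsub>C\<^esub> X Y) \<cdot>\<^bsub>D\<^esub> J X Y = J Y X \<cdot>\<^bsub>D\<^esub> \<b>\<^bsub>D\<^esub> (F X) (F Y)"

section \<open>Noncommutative formal power series and Drinfeld associators\<close>

text \<open>\<open>'i ncseries\<close> is the algebra of noncommutative series over \<open>\<complex>\<close> with variables indexed by \<open>'i\<close>.\<close>

datatype 'i ncseries = NCS (coeff: "'i list \<Rightarrow> complex")

lemma ncseries_eqI: "(\<And>w. coeff f w = coeff g w) \<Longrightarrow> f = g"
  by (rule ncseries.expand) (rule ext)

instantiation ncseries :: (type) ring_1
begin

definition "0 = NCS (\<lambda>w. 0)"
definition "1 = NCS (\<lambda>w. if w = [] then 1 else 0)"
definition "f + g = NCS (\<lambda>w. coeff f w + coeff g w)"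
definition "- f = NCS (\<lambda>w. - coeff f w)"
definition "f - g = NCS (\<lambda>w. coeff f w - coeff g w)"
definition "f * g = NCS (\<lambda>w. \<Sum>k\<le>length w. coeff f (take k w) * coeff g (drop k w))"

lemmas ncseries_defs = zero_ncseries_def one_ncseries_def plus_ncseries_def
  uminus_ncseries_def minus_ncseries_def times_ncseries_def

instance
proof
  fix f g h :: "'a ncseries"
  show "f * g * h = f * (g * h)"
  proof (rule ncseries_eqI)
    fix w :: "'a list"
    let ?t = "\<lambda>j k. coeff f (take j w) * coeff g (take (k - j) (drop j w)) * coeff h (drop k w)"
    have "coeff (f * g * h) w = (\<Sum>k\<le>length w. \<Sum>j\<le>k. ?t j k)"
      by (auto simp: times_ncseries_def sum_distrib_right min_def drop_take intro!: sum.cong)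
    also have "\<dots> = (\<Sum>(k, j)\<in>Sigma {..length w} (\<lambda>k. {..k}). ?t j k)"
      by (subst sum.Sigma) auto
    also have "\<dots> = (\<Sum>(j, i)\<in>Sigma {..length w} (\<lambda>j. {..length w - j}). ?t j (j + i))"
      by (rule sum.reindex_bij_witness[where i = "\<lambda>(j, i). (j + i, j)" and j = "\<lambda>(k, j). (j, k - j)"]) auto
    also have "\<dots> = (\<Sum>j\<le>length w. \<Sum>i\<le>length w - j. ?t j (j + i))"
      by (subst sum.Sigma) auto
    also have "\<dots> = coeff (f * (g * h)) w"
      by (auto simp: times_ncseries_def sum_distrib_left mult.assoc add.commute intro!: sum.cong)
    finally show "coeff (f * g * h) w = coeff (f * (g * h)) w" .
  qed
  show "1 * f = f"
  proof (rule ncseries_eqI)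
    fix w :: "'a list"
    have "coeff (1 * f) w = (\<Sum>k\<le>length w. if k = 0 then coeff f w else 0)"
      unfolding times_ncseries_def one_ncseries_def ncseries.sel
      by (rule sum.cong) auto
    then show "coeff (1 * f) w = coeff f w" by simp
  qed
  show "f * 1 = f"
  proof (rule ncseries_eqI)
    fix w :: "'a list"
    have "coeff (f * 1) w = (\<Sum>k\<le>length w. if k = length w then coeff f w else 0)"
      unfolding times_ncseries_def one_ncseries_def ncseries.sel
      by (rule sum.cong) auto
    then show "coeff (f * 1) w = coeff f w" by simp
  qed
  show "(0 :: 'a ncseries) \<noteq> 1"
    by (auto simp: zero_ncseries_def one_ncseries_def fun_eq_iff)
qed (auto simp: ncseries_defs algebra_simps sum.distrib intro!: ncseries_eqI)

end

definition nc_const :: "complex \<Rightarrow> 'i ncseries" where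
  "nc_const c = NCS (\<lambda>w. if w = [] then c else 0)"

definition nc_var :: "'i \<Rightarrow> 'i ncseries" where
  "nc_var i = NCS (\<lambda>w. if w = [i] then 1 else 0)"

definition nc_inverse :: "'i ncseries \<Rightarrow> 'i ncseries" where
  "nc_inverse f = (THE g. f * g = 1 \<and> g * f = 1)"

text \<open>
  The exponential and the substitution \<open>\<Phi>(A, B)\<close> are only meant for series \<open>A\<close>, \<open>B\<close> without
  constant term; products of more than \<open>n\<close> such series vanish on words of length \<open>n\<close>, which is why
  the sums below may be truncated.
\<close>

definition nc_exp :: "'i ncseries \<Rightarrow> 'i ncseries" where
  "nc_exp A = NCS (\<lambda>w. \<Sum>n\<le>length w. coeff (A ^ n) w / fact n)"

datatype letter = LX | LY

definition nc_subst :: "letter ncseries \<Rightarrow> 'i ncseries \<Rightarrow> 'i ncseries \<Rightarrow> 'i ncseries" where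
  "nc_subst \<Phi> A B = NCS (\<lambda>w. \<Sum>u | length u \<le> length w.
     coeff \<Phi> u * coeff (prod_list (map (\<lambda>i. case i of LX \<Rightarrow> A | LY \<Rightarrow> B) u)) w)"

text \<open>
  For the coproduct making the variables primitive, the coefficient of \<open>u \<otimes> v\<close> in \<open>\<Delta>(w)\<close> is the
  number of ways to split \<open>w\<close> into complementary subwords \<open>u\<close> and \<open>v\<close>; thus the condition says
  that \<open>\<Delta>(\<Phi>) = \<Phi> \<otimes> \<Phi>\<close> and that \<open>\<Phi>\<close> has constant term \<open>1\<close>.
\<close>

definition splittings :: "'i list \<Rightarrow> 'i list \<Rightarrow> 'i list \<Rightarrow> nat" where
  "splittings w u v =
     card {S. S \<subseteq> {..<length w} \<and> nths w S = u \<and> nths w ({..<length w} - S) = v}"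

definition grouplike :: "letter ncseries \<Rightarrow> bool" where
  "grouplike \<Phi> \<longleftrightarrow> coeff \<Phi> [] = 1 \<and>
     (\<forall>u v. (\<Sum>w | length w = length u + length v. of_nat (splittings w u v) * coeff \<Phi> w)
            = coeff \<Phi> u * coeff \<Phi> v)"

text \<open>
  The Drinfeld--Kohno algebra \<open>U(t\<^sub>n)\<close> is generated by \<open>t\<^sub>i\<^sub>j = t\<^sub>j\<^sub>i\<close>, \<open>i \<noteq> j\<close> in \<open>{1..n}\<close>, with the
  relations listed as ideal generators below. They are homogeneous, so two series agree in the
  degree completion of \<open>U(t\<^sub>n)\<close> iff every homogeneous part of their difference lies in the ideal.
\<close>

abbreviation dk_t :: "nat \<Rightarrow> nat \<Rightarrow> (nat \<times> nat) ncseries" where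
  "dk_t i j \<equiv> nc_var (i, j)"

inductive_set dk_ideal :: "nat \<Rightarrow> (nat \<times> nat) ncseries set" for n :: nat where
  dk_sym: "\<lbrakk>i \<in> {1..n}; j \<in> {1..n}; i \<noteq> j\<rbrakk> \<Longrightarrow> dk_t i j - dk_t j i \<in> dk_ideal n"
| dk_comm4: "\<lbrakk>{i, j, k, l} \<subseteq> {1..n}; distinct [i, j, k, l]\<rbrakk>
    \<Longrightarrow> dk_t i j * dk_t k l - dk_t k l * dk_t i j \<in> dk_ideal n"
| dk_comm3: "\<lbrakk>{i, j, k} \<subseteq> {1..n}; distinct [i, j, k]\<rbrakk>
    \<Longrightarrow> dk_t i j * (dk_t i k + dk_t j k) - (dk_t i k + dk_t j k) * dk_t i j \<in> dk_ideal n"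
| dk_zero: "0 \<in> dk_ideal n"
| dk_add: "\<lbrakk>f \<in> dk_ideal n; g \<in> dk_ideal n\<rbrakk> \<Longrightarrow> f + g \<in> dk_ideal n"
| dk_mult: "f \<in> dk_ideal n \<Longrightarrow> a * f * b \<in> dk_ideal n"

definition nc_part :: "nat \<Rightarrow> 'i ncseries \<Rightarrow> 'i ncseries" where
  "nc_part d f = NCS (\<lambda>w. if length w = d then coeff f w else 0)"

definition dk_eq :: "nat \<Rightarrow> (nat \<times> nat) ncseries \<Rightarrow> (nat \<times> nat) ncseries \<Rightarrow> bool" where
  "dk_eq n f g \<longleftrightarrow> (\<forall>d. nc_part d (f - g) \<in> dk_ideal n)"

text \<open>
  The hexagons are normalised for the R-matrix \<open>exp(t/2)\<close>, in agreement with
  \<open>\<Phi>(x, y) = 1 + [x, y]/24 + \<dots>\<close>.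
\<close>

definition drinfeld_associator :: "letter ncseries \<Rightarrow> bool" where
  "drinfeld_associator \<Phi> \<longleftrightarrow>
     grouplike \<Phi> \<and>
     (\<forall>w. length w \<le> 2 \<longrightarrow> coeff \<Phi> w =
        coeff (1 + nc_const (1/24) * (nc_var LX * nc_var LY - nc_var LY * nc_var LX)) w) \<and>
     dk_eq 4
       (nc_subst \<Phi> (dk_t 1 2) (dk_t 2 3 + dk_t 2 4) * nc_subst \<Phi> (dk_t 1 3 + dk_t 2 3) (dk_t 3 4))
       (nc_subst \<Phi> (dk_t 2 3) (dk_t 3 4) * nc_subst \<Phi> (dk_t 1 2 + dk_t 1 3) (dk_t 2 4 + dk_t 3 4)
         * nc_subst \<Phi> (dk_t 1 2) (dk_t 2 3)) \<and>
     dk_eq 3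
       (nc_exp (nc_const (1/2) * (dk_t 1 3 + dk_t 2 3)))
       (nc_subst \<Phi> (dk_t 1 3) (dk_t 1 2) * nc_exp (nc_const (1/2) * dk_t 1 3)
         * nc_inverse (nc_subst \<Phi> (dk_t 1 3) (dk_t 2 3)) * nc_exp (nc_const (1/2) * dk_t 2 3)
         * nc_subst \<Phi> (dk_t 1 2) (dk_t 2 3)) \<and>
     dk_eq 3
       (nc_exp (nc_const (1/2) * (dk_t 1 2 + dk_t 1 3)))
       (nc_inverse (nc_subst \<Phi> (dk_t 2 3) (dk_t 1 3)) * nc_exp (nc_const (1/2) * dk_t 1 3)
         * nc_subst \<Phi> (dk_t 1 2) (dk_t 1 3) * nc_exp (nc_const (1/2) * dk_t 1 2)
         * nc_inverse (nc_subst \<Phi> (dk_t 1 2) (dk_t 2 3)))"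

section \<open>Vector spaces, tensor products and Lie algebras\<close>

definition complex_ring :: "complex ring" where
  "complex_ring = \<lparr>carrier = UNIV, mult = (*), one = 1, zero = 0, add = (+)\<rparr>"

text \<open>
  A complex vector space is a \<open>module\<close> over \<open>complex_ring\<close>; the inherited record fields
  \<open>mult\<close> and \<open>one\<close> play no role and are left undefined.

  The tensor product \<open>V \<otimes> W\<close> is the free vector space on the pairs \<open>(x, y)\<close> modulo the subspace
  generated by the bilinearity relations. A list \<open>[(c\<^sub>1, x\<^sub>1, y\<^sub>1), \<dots>]\<close> stands for the formal sum
  \<open>\<Sum> c\<^sub>i (x\<^sub>i \<otimes> y\<^sub>i)\<close>, and a class is represented by one chosen list, so that elements of
  tensor products are finitary data and can be iterated within a single type.
\<close>

type_synonym ('v, 'w) formal_sum = "(complex \<times> 'v \<times> 'w) list"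

definition free_sum :: "('v, 'w) formal_sum \<Rightarrow> ('v \<times> 'w \<Rightarrow>\<^sub>0 complex)" where
  "free_sum l = (\<Sum>(c, x, y)\<leftarrow>l. Poly_Mapping.single (x, y) c)"

inductive_set tensor_rel ::
    "(complex, 'v, 'p) module_scheme \<Rightarrow> (complex, 'w, 'q) module_scheme \<Rightarrow> ('v \<times> 'w \<Rightarrow>\<^sub>0 complex) set"
  for V :: "(complex, 'v, 'p) module_scheme" and W :: "(complex, 'w, 'q) module_scheme" where
  rel_zero: "0 \<in> tensor_rel V W"
| rel_add: "\<lbrakk>p \<in> tensor_rel V W; q \<in> tensor_rel V W\<rbrakk> \<Longrightarrow> p + q \<in> tensor_rel V W"
| rel_add_left: "\<lbrakk>x \<in> carrier V; x' \<in> carrier V; y \<in> carrier W\<rbrakk> \<Longrightarrow>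
    Poly_Mapping.single (x \<oplus>\<^bsub>V\<^esub> x', y) c - Poly_Mapping.single (x, y) c - Poly_Mapping.single (x', y) c
      \<in> tensor_rel V W"
| rel_add_right: "\<lbrakk>x \<in> carrier V; y \<in> carrier W; y' \<in> carrier W\<rbrakk> \<Longrightarrow>
    Poly_Mapping.single (x, y \<oplus>\<^bsub>W\<^esub> y') c - Poly_Mapping.single (x, y) c - Poly_Mapping.single (x, y') c
      \<in> tensor_rel V W"
| rel_smult_left: "\<lbrakk>x \<in> carrier V; y \<in> carrier W\<rbrakk> \<Longrightarrow>
    Poly_Mapping.single (a \<odot>\<^bsub>V\<^esub> x, y) c - Poly_Mapping.single (x, y) (c * a) \<in> tensor_rel V W"
| rel_smult_right: "\<lbrakk>x \<in> carrier V; y \<in> carrier W\<rbrakk> \<Longrightarrow>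
    Poly_Mapping.single (x, a \<odot>\<^bsub>W\<^esub> y) c - Poly_Mapping.single (x, y) (c * a) \<in> tensor_rel V W"

definition formal_sums ::
    "(complex, 'v, 'p) module_scheme \<Rightarrow> (complex, 'w, 'q) module_scheme \<Rightarrow> ('v, 'w) formal_sum set" where
  "formal_sums V W = lists (UNIV \<times> carrier V \<times> carrier W)"

definition tensor_class ::
    "(complex, 'v, 'p) module_scheme \<Rightarrow> (complex, 'w, 'q) module_scheme
      \<Rightarrow> ('v, 'w) formal_sum \<Rightarrow> ('v, 'w) formal_sum" where
  "tensor_class V W l =
     (SOME l'. l' \<in> formal_sums V W \<and> free_sum l' - free_sum l \<in> tensor_rel V W)"

definition tensor ::
    "(complex, 'v, 'p) module_scheme \<Rightarrow> (complex, 'w, 'q) module_scheme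
      \<Rightarrow> (complex, ('v, 'w) formal_sum) module" where
  "tensor V W =
     \<lparr>carrier = tensor_class V W ` formal_sums V W, mult = undefined, one = undefined,
      zero = tensor_class V W [], add = (\<lambda>l m. tensor_class V W (l @ m)),
      smult = (\<lambda>a l. tensor_class V W (map (\<lambda>(c, x, y). (a * c, x, y)) l))\<rparr>"

definition pure_tensor ::
    "(complex, 'v, 'p) module_scheme \<Rightarrow> (complex, 'w, 'q) module_scheme
      \<Rightarrow> 'v \<Rightarrow> 'w \<Rightarrow> ('v, 'w) formal_sum" where
  "pure_tensor V W x y = tensor_class V W [(1, x, y)]"

text \<open>
  \<open>tensor_lift M \<phi>\<close> sends \<open>\<Sum> c\<^sub>i (x\<^sub>i \<otimes> y\<^sub>i)\<close> to \<open>\<Sum> c\<^sub>i \<phi>(x\<^sub>i, y\<^sub>i)\<close> in \<open>M\<close>: for bilinear \<open>\<phi>\<close> it is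
  the induced linear map.
\<close>

definition tensor_lift ::
    "(complex, 'u, 'r) module_scheme \<Rightarrow> ('v \<Rightarrow> 'w \<Rightarrow> 'u) \<Rightarrow> ('v, 'w) formal_sum \<Rightarrow> 'u" where
  "tensor_lift M \<phi> l = foldr (\<lambda>(c, x, y) s. c \<odot>\<^bsub>M\<^esub> \<phi> x y \<oplus>\<^bsub>M\<^esub> s) l \<zero>\<^bsub>M\<^esub>"

definition tensor_map ::
    "(complex, 'v, 'p) module_scheme \<Rightarrow> (complex, 'w, 'q) module_scheme
      \<Rightarrow> ('x \<Rightarrow> 'v) \<Rightarrow> ('y \<Rightarrow> 'w) \<Rightarrow> ('x, 'y) formal_sum \<Rightarrow> ('v, 'w) formal_sum" where
  "tensor_map V W f g = tensor_lift (tensor V W) (\<lambda>x y. pure_tensor V W (f x) (g y))"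

definition quotient_space ::
    "(complex, 'v, 'p) module_scheme \<Rightarrow> 'v set \<Rightarrow> (complex, 'v set) module" where
  "quotient_space V H =
     \<lparr>carrier = a_rcosets\<^bsub>V\<^esub> H, mult = undefined, one = undefined,
      zero = H, add = (<+>\<^bsub>V\<^esub>), smult = (\<lambda>a K. \<Union>x\<in>K. H +>\<^bsub>V\<^esub> (a \<odot>\<^bsub>V\<^esub> x))\<rparr>"

record 'g lie = "(complex, 'g) module" +
  bracket :: "'g \<Rightarrow> 'g \<Rightarrow> 'g"  (\<open>\<lbrakk>_, _\<rbrakk>\<index>\<close>)

locale lie_algebra = module complex_ring L for L :: "('g, 'z) lie_scheme" (structure) +
  assumes bracket_closed: "\<lbrakk>x \<in> carrier L; y \<in> carrier L\<rbrakk> \<Longrightarrow> \<lbrakk>x, y\<rbrakk> \<in> carrier L"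
    and bracket_add_left: "\<lbrakk>x \<in> carrier L; y \<in> carrier L; z \<in> carrier L\<rbrakk>
          \<Longrightarrow> \<lbrakk>x \<oplus>\<^bsub>L\<^esub> y, z\<rbrakk> = \<lbrakk>x, z\<rbrakk> \<oplus>\<^bsub>L\<^esub> \<lbrakk>y, z\<rbrakk>"
    and bracket_add_right: "\<lbrakk>x \<in> carrier L; y \<in> carrier L; z \<in> carrier L\<rbrakk>
          \<Longrightarrow> \<lbrakk>x, y \<oplus>\<^bsub>L\<^esub> z\<rbrakk> = \<lbrakk>x, y\<rbrakk> \<oplus>\<^bsub>L\<^esub> \<lbrakk>x, z\<rbrakk>"
    and bracket_smult_left: "\<lbrakk>x \<in> carrier L; y \<in> carrier L\<rbrakk> \<Longrightarrow> \<lbrakk>a \<odot>\<^bsub>L\<^esub> x, y\<rbrakk> = a \<odot>\<^bsub>L\<^esub> \<lbrakk>x, y\<rbrakk>"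
    and bracket_smult_right: "\<lbrakk>x \<in> carrier L; y \<in> carrier L\<rbrakk> \<Longrightarrow> \<lbrakk>x, a \<odot>\<^bsub>L\<^esub> y\<rbrakk> = a \<odot>\<^bsub>L\<^esub> \<lbrakk>x, y\<rbrakk>"
    and bracket_self: "x \<in> carrier L \<Longrightarrow> \<lbrakk>x, x\<rbrakk> = \<zero>\<^bsub>L\<^esub>"
    and jacobi: "\<lbrakk>x \<in> carrier L; y \<in> carrier L; z \<in> carrier L\<rbrakk>
          \<Longrightarrow> \<lbrakk>x, \<lbrakk>y, z\<rbrakk>\<rbrakk> \<oplus>\<^bsub>L\<^esub> \<lbrakk>y, \<lbrakk>z, x\<rbrakk>\<rbrakk> \<oplus>\<^bsub>L\<^esub> \<lbrakk>z, \<lbrakk>x, y\<rbrakk>\<rbrakk> = \<zero>\<^bsub>L\<^esub>"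

definition lie_subalgebra :: "'g set \<Rightarrow> ('g, 'z) lie_scheme \<Rightarrow> bool" where
  "lie_subalgebra H L \<longleftrightarrow>
     submodule H complex_ring L \<and> (\<forall>x\<in>H. \<forall>y\<in>H. \<lbrakk>x, y\<rbrakk>\<^bsub>L\<^esub> \<in> H)"

definition lie_sum :: "('g, 'y) lie_scheme \<Rightarrow> ('h, 'z) lie_scheme \<Rightarrow> ('g \<times> 'h) lie" where
  "lie_sum G H =
     \<lparr>carrier = carrier G \<times> carrier H, mult = undefined, one = undefined,
      zero = (\<zero>\<^bsub>G\<^esub>, \<zero>\<^bsub>H\<^esub>), add = (\<lambda>(x, y) (x', y'). (x \<oplus>\<^bsub>G\<^esub> x', y \<oplus>\<^bsub>H\<^esub> y')),
      smult = (\<lambda>a (x, y). (a \<odot>\<^bsub>G\<^esub> x, a \<odot>\<^bsub>H\<^esub> y)),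
      bracket = (\<lambda>(x, y) (x', y'). (\<lbrakk>x, x'\<rbrakk>\<^bsub>G\<^esub>, \<lbrakk>y, y'\<rbrakk>\<^bsub>H\<^esub>))\<rparr>"

text \<open>
  Over \<open>\<complex>\<close>, \<open>S\<^sup>2 V\<close> is the space of symmetric tensors in \<open>V \<otimes> V\<close>; it is in this form that elements of
  \<open>S\<^sup>2\<close> act on two tensor factors.
\<close>

definition sym_square :: "(complex, 'v, 'p) module_scheme \<Rightarrow> ('v, 'v) formal_sum set" where
  "sym_square V =
     {t \<in> carrier (tensor V V). tensor_lift (tensor V V) (\<lambda>x y. pure_tensor V V y x) t = t}"

definition sym_square_invariants :: "('g, 'z) lie_scheme \<Rightarrow> ('g, 'g) formal_sum set" where
  "sym_square_invariants L =
     {t \<in> sym_square L. \<forall>u\<in>carrier L.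
        tensor_lift (tensor L L)
          (\<lambda>x y. pure_tensor L L \<lbrakk>u, x\<rbrakk>\<^bsub>L\<^esub> y \<oplus>\<^bsub>tensor L L\<^esub> pure_tensor L L x \<lbrakk>u, y\<rbrakk>\<^bsub>L\<^esub>) t
        = \<zero>\<^bsub>tensor L L\<^esub>}"

definition coisotropic :: "'g set \<Rightarrow> ('g, 'z) lie_scheme \<Rightarrow> ('g, 'g) formal_sum \<Rightarrow> bool" where
  "coisotropic H L t \<longleftrightarrow>
     tensor_map (quotient_space L H) (quotient_space L H) (\<lambda>x. H +>\<^bsub>L\<^esub> x) (\<lambda>x. H +>\<^bsub>L\<^esub> x) t
     = \<zero>\<^bsub>tensor (quotient_space L H) (quotient_space L H)\<^esub>"

definition sum_form ::
    "('g, 'y) lie_scheme \<Rightarrow> ('h, 'z) lie_scheme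
      \<Rightarrow> ('g, 'g) formal_sum \<Rightarrow> ('h, 'h) formal_sum \<Rightarrow> ('g \<times> 'h, 'g \<times> 'h) formal_sum" where
  "sum_form G H tG tH =
     tensor_map (lie_sum G H) (lie_sum G H) (\<lambda>x. (x, \<zero>\<^bsub>H\<^esub>)) (\<lambda>x. (x, \<zero>\<^bsub>H\<^esub>)) tG
     \<oplus>\<^bsub>tensor (lie_sum G H) (lie_sum G H)\<^esub>
     tensor_map (lie_sum G H) (lie_sum G H) (\<lambda>y. (\<zero>\<^bsub>G\<^esub>, y)) (\<lambda>y. (\<zero>\<^bsub>G\<^esub>, y)) tH"

section \<open>The Drinfeld category\<close>

record ('l, 'v) lmod = "(complex, 'v) module" +
  act :: "'l \<Rightarrow> 'v \<Rightarrow> 'v"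

locale lie_module = L: lie_algebra L + X: module complex_ring X
  for L :: "('l, 'z) lie_scheme" and X :: "('l, 'v, 'w) lmod_scheme" +
  assumes act_closed: "\<lbrakk>a \<in> carrier L; x \<in> carrier X\<rbrakk> \<Longrightarrow> act X a x \<in> carrier X"
    and act_add_left: "\<lbrakk>a \<in> carrier L; b \<in> carrier L; x \<in> carrier X\<rbrakk>
          \<Longrightarrow> act X (a \<oplus>\<^bsub>L\<^esub> b) x = act X a x \<oplus>\<^bsub>X\<^esub> act X b x"
    and act_smult_left: "\<lbrakk>a \<in> carrier L; x \<in> carrier X\<rbrakk>
          \<Longrightarrow> act X (c \<odot>\<^bsub>L\<^esub> a) x = c \<odot>\<^bsub>X\<^esub> act X a x"
    and act_add_right: "\<lbrakk>a \<in> carrier L; x \<in> carrier X; y \<in> carrier X\<rbrakk>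
          \<Longrightarrow> act X a (x \<oplus>\<^bsub>X\<^esub> y) = act X a x \<oplus>\<^bsub>X\<^esub> act X a y"
    and act_smult_right: "\<lbrakk>a \<in> carrier L; x \<in> carrier X\<rbrakk>
          \<Longrightarrow> act X a (c \<odot>\<^bsub>X\<^esub> x) = c \<odot>\<^bsub>X\<^esub> act X a x"
    and act_bracket: "\<lbrakk>a \<in> carrier L; b \<in> carrier L; x \<in> carrier X\<rbrakk>
          \<Longrightarrow> act X \<lbrakk>a, b\<rbrakk>\<^bsub>L\<^esub> x = act X a (act X b x) \<ominus>\<^bsub>X\<^esub> act X b (act X a x)"

definition module_homs ::
    "('l, 'z) lie_scheme \<Rightarrow> ('l, 'v) lmod \<Rightarrow> ('l, 'w) lmod \<Rightarrow> ('v \<Rightarrow> 'w) set" where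
  "module_homs L X Y = {f \<in> carrier X \<rightarrow>\<^sub>E carrier Y.
     (\<forall>x\<in>carrier X. \<forall>y\<in>carrier X. f (x \<oplus>\<^bsub>X\<^esub> y) = f x \<oplus>\<^bsub>Y\<^esub> f y) \<and>
     (\<forall>c. \<forall>x\<in>carrier X. f (c \<odot>\<^bsub>X\<^esub> x) = c \<odot>\<^bsub>Y\<^esub> f x) \<and>
     (\<forall>a\<in>carrier L. \<forall>x\<in>carrier X. f (act X a x) = act Y a (f x))}"

text \<open>
  The underlying sets of the modules in the category are subsets of \<open>'a tuniv\<close>, a type which contains
  an arbitrary type \<open>'a\<close> and the ground field, and is closed under tensor products.
\<close>

datatype 'a tuniv = Atom 'a | Scalar (scalar: complex) | Tensor (untensor: "(complex \<times> 'a tuniv \<times> 'a tuniv) list")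

type_synonym ('l, 'a) umod = "('l, 'a tuniv) lmod"

definition trivial_module :: "('l, 'a) umod" where
  "trivial_module =
     \<lparr>carrier = range Scalar, mult = undefined, one = undefined, zero = Scalar 0,
      add = (\<lambda>x y. Scalar (scalar x + scalar y)), smult = (\<lambda>c x. Scalar (c * scalar x)),
      act = (\<lambda>a x. Scalar 0)\<rparr>"

definition tensor_module :: "('l, 'a) umod \<Rightarrow> ('l, 'a) umod \<Rightarrow> ('l, 'a) umod"  (infixr \<open>\<boxtimes>\<close> 75) where
  "X \<boxtimes> Y =
     \<lparr>carrier = Tensor ` carrier (tensor X Y), mult = undefined, one = undefined,
      zero = Tensor \<zero>\<^bsub>tensor X Y\<^esub>,
      add = (\<lambda>u v. Tensor (untensor u \<oplus>\<^bsub>tensor X Y\<^esub> untensor v)),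
      smult = (\<lambda>c u. Tensor (c \<odot>\<^bsub>tensor X Y\<^esub> untensor u)),
      act = (\<lambda>a u. Tensor (tensor_lift (tensor X Y)
        (\<lambda>x y. pure_tensor X Y (act X a x) y \<oplus>\<^bsub>tensor X Y\<^esub> pure_tensor X Y x (act Y a y))
        (untensor u)))\<rparr>"

definition elem_tensor ::
    "('l, 'a) umod \<Rightarrow> ('l, 'a) umod \<Rightarrow> 'a tuniv \<Rightarrow> 'a tuniv \<Rightarrow> 'a tuniv" where
  "elem_tensor X Y x y = Tensor (pure_tensor X Y x y)"

definition module_lift ::
    "('l, 'a) umod \<Rightarrow> ('l, 'a) umod \<Rightarrow> ('l, 'a) umod
      \<Rightarrow> ('a tuniv \<Rightarrow> 'a tuniv \<Rightarrow> 'a tuniv) \<Rightarrow> 'a tuniv \<Rightarrow> 'a tuniv" where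
  "module_lift X Y M \<phi> = (\<lambda>u\<in>carrier (X \<boxtimes> Y). tensor_lift M \<phi> (untensor u))"

definition map_tensor ::
    "('l, 'a) umod \<Rightarrow> ('l, 'a) umod \<Rightarrow> ('l, 'a) umod \<Rightarrow> ('l, 'a) umod
      \<Rightarrow> ('a tuniv \<Rightarrow> 'a tuniv) \<Rightarrow> ('a tuniv \<Rightarrow> 'a tuniv) \<Rightarrow> 'a tuniv \<Rightarrow> 'a tuniv" where
  "map_tensor X Y X' Y' f g = module_lift X Y (X' \<boxtimes> Y') (\<lambda>x y. elem_tensor X' Y' (f x) (g y))"

definition flip_tensor :: "('l, 'a) umod \<Rightarrow> ('l, 'a) umod \<Rightarrow> 'a tuniv \<Rightarrow> 'a tuniv" where
  "flip_tensor X Y = module_lift X Y (Y \<boxtimes> X) (\<lambda>x y. elem_tensor Y X y x)"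

definition assoc_tensor ::
    "('l, 'a) umod \<Rightarrow> ('l, 'a) umod \<Rightarrow> ('l, 'a) umod \<Rightarrow> 'a tuniv \<Rightarrow> 'a tuniv" where
  "assoc_tensor X Y Z =
     module_lift (X \<boxtimes> Y) Z (X \<boxtimes> (Y \<boxtimes> Z))
       (\<lambda>u z. module_lift X Y (X \<boxtimes> (Y \<boxtimes> Z))
         (\<lambda>x y. elem_tensor X (Y \<boxtimes> Z) x (elem_tensor Y Z y z)) u)"

text \<open>The actions of \<open>t\<close> on \<open>X \<otimes> Y\<close>, and of \<open>t\<^sup>1\<^sup>2\<close> and \<open>t\<^sup>2\<^sup>3\<close> on \<open>(X \<otimes> Y) \<otimes> Z\<close>.\<close>

definition t_act ::
    "('l, 'l) formal_sum \<Rightarrow> ('l, 'a) umod \<Rightarrow> ('l, 'a) umod \<Rightarrow> 'a tuniv \<Rightarrow> 'a tuniv" where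
  "t_act t X Y u = tensor_lift (X \<boxtimes> Y) (\<lambda>a b. map_tensor X Y X Y (act X a) (act Y b) u) t"

definition t12_act ::
    "('l, 'l) formal_sum \<Rightarrow> ('l, 'a) umod \<Rightarrow> ('l, 'a) umod \<Rightarrow> ('l, 'a) umod \<Rightarrow> 'a tuniv \<Rightarrow> 'a tuniv" where
  "t12_act t X Y Z u = tensor_lift ((X \<boxtimes> Y) \<boxtimes> Z)
     (\<lambda>a b. map_tensor (X \<boxtimes> Y) Z (X \<boxtimes> Y) Z (map_tensor X Y X Y (act X a) (act Y b)) (\<lambda>z. z) u) t"

definition t23_act ::
    "('l, 'l) formal_sum \<Rightarrow> ('l, 'a) umod \<Rightarrow> ('l, 'a) umod \<Rightarrow> ('l, 'a) umod \<Rightarrow> 'a tuniv \<Rightarrow> 'a tuniv" where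
  "t23_act t X Y Z u = tensor_lift ((X \<boxtimes> Y) \<boxtimes> Z)
     (\<lambda>a b. map_tensor (X \<boxtimes> Y) Z (X \<boxtimes> Y) Z (map_tensor X Y X Y (\<lambda>x. x) (act Y a)) (act Z b) u) t"

text \<open>
  Coefficients of \<open>\<hbar>\<^sup>n\<close> in \<open>\<Phi>(\<hbar> A, \<hbar> B)\<close> and in \<open>exp(\<hbar> A / 2)\<close>, for operators \<open>A\<close>, \<open>B\<close> on \<open>M\<close>;
  a word acts by the composition of its letters, the last letter first.
\<close>

definition series_act ::
    "('l, 'a) umod \<Rightarrow> letter ncseries \<Rightarrow> ('a tuniv \<Rightarrow> 'a tuniv) \<Rightarrow> ('a tuniv \<Rightarrow> 'a tuniv)
      \<Rightarrow> nat \<Rightarrow> 'a tuniv \<Rightarrow> 'a tuniv" where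
  "series_act M \<Phi> A B n u =
     (\<Oplus>\<^bsub>M\<^esub>w\<in>{w. length w = n}. coeff \<Phi> w \<odot>\<^bsub>M\<^esub> foldr (\<lambda>i. case i of LX \<Rightarrow> A | LY \<Rightarrow> B) w u)"

definition half_exp_act ::
    "('l, 'a) umod \<Rightarrow> ('a tuniv \<Rightarrow> 'a tuniv) \<Rightarrow> nat \<Rightarrow> 'a tuniv \<Rightarrow> 'a tuniv" where
  "half_exp_act M A n u = (1 / (2 ^ n * fact n)) \<odot>\<^bsub>M\<^esub> (A ^^ n) u"

text \<open>
  An element of \<open>Hom(X, Y)[[\<hbar>]]\<close> is given by the sequence of its coefficients, which are module
  homomorphisms, extensional on the carrier of \<open>X\<close>.
\<close>

record ('l, 'a) hmap =
  source :: "('l, 'a) umod"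
  target :: "('l, 'a) umod"
  terms :: "nat \<Rightarrow> 'a tuniv \<Rightarrow> 'a tuniv"

definition const_hmap :: "('l, 'a) umod \<Rightarrow> ('l, 'a) umod \<Rightarrow> ('a tuniv \<Rightarrow> 'a tuniv) \<Rightarrow> ('l, 'a) hmap" where
  "const_hmap X Y f =
     \<lparr>source = X, target = Y, terms = (\<lambda>n. \<lambda>x\<in>carrier X. if n = 0 then f x else \<zero>\<^bsub>Y\<^esub>)\<rparr>"

definition comp_hmap :: "('l, 'a) hmap \<Rightarrow> ('l, 'a) hmap \<Rightarrow> ('l, 'a) hmap" where
  "comp_hmap g f =
     \<lparr>source = source f, target = target g,
      terms = (\<lambda>n. \<lambda>x\<in>carrier (source f). \<Oplus>\<^bsub>target g\<^esub>k\<in>{..n}. terms g k (terms f (n - k) x))\<rparr>"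

definition tensor_hmap :: "('l, 'a) hmap \<Rightarrow> ('l, 'a) hmap \<Rightarrow> ('l, 'a) hmap" where
  "tensor_hmap f g =
     \<lparr>source = source f \<boxtimes> source g, target = target f \<boxtimes> target g,
      terms = (\<lambda>n. \<lambda>u\<in>carrier (source f \<boxtimes> source g). \<Oplus>\<^bsub>target f \<boxtimes> target g\<^esub>k\<in>{..n}.
        map_tensor (source f) (source g) (target f) (target g) (terms f k) (terms g (n - k)) u)\<rparr>"

definition drinfeld_category ::
    "letter ncseries \<Rightarrow> ('l, 'z) lie_scheme \<Rightarrow> ('l, 'l) formal_sum
      \<Rightarrow> (('l, 'a) umod, ('l, 'a) hmap) bmcat" where
  "drinfeld_category \<Phi> L t =
     \<lparr>obj = {X. lie_module L X},
      hom_set = (\<lambda>X Y. {f. source f = X \<and> target f = Y \<and> (\<forall>n. terms f n \<in> module_homs L X Y)}),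
      ident = (\<lambda>X. const_hmap X X (\<lambda>x. x)),
      comp_arr = comp_hmap,
      tens_obj = (\<boxtimes>),
      tens_arr = tensor_hmap,
      unit_obj = trivial_module,
      associator = (\<lambda>X Y Z.
        \<lparr>source = (X \<boxtimes> Y) \<boxtimes> Z, target = X \<boxtimes> (Y \<boxtimes> Z),
         terms = (\<lambda>n. \<lambda>u\<in>carrier ((X \<boxtimes> Y) \<boxtimes> Z). assoc_tensor X Y Z
           (series_act ((X \<boxtimes> Y) \<boxtimes> Z) \<Phi> (t12_act t X Y Z) (t23_act t X Y Z) n u))\<rparr>),
      left_unitor = (\<lambda>X. const_hmap (trivial_module \<boxtimes> X) X
        (module_lift trivial_module X X (\<lambda>c x. scalar c \<odot>\<^bsub>X\<^esub> x))),
      right_unitor = (\<lambda>X. const_hmap (X \<boxtimes> trivial_module) X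
        (module_lift X trivial_module X (\<lambda>x c. scalar c \<odot>\<^bsub>X\<^esub> x))),
      braiding = (\<lambda>X Y.
        \<lparr>source = X \<boxtimes> Y, target = Y \<boxtimes> X,
         terms = (\<lambda>n. \<lambda>u\<in>carrier (X \<boxtimes> Y). flip_tensor X Y (half_exp_act (X \<boxtimes> Y) (t_act t X Y) n u))\<rparr>)\<rparr>"

section \<open>Invariants\<close>

definition invariants ::
    "('g, 'y) lie_scheme \<Rightarrow> ('h, 'z) lie_scheme \<Rightarrow> 'g set \<Rightarrow> ('g \<times> 'h, 'a) umod \<Rightarrow> ('h, 'a) umod" where
  "invariants G H K X =
     \<lparr>carrier = {x \<in> carrier X. \<forall>u\<in>K. act X (u, \<zero>\<^bsub>H\<^esub>) x = \<zero>\<^bsub>X\<^esub>}, mult = undefined, one = undefined,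
      zero = \<zero>\<^bsub>X\<^esub>, add = add X, smult = smult X, act = (\<lambda>v. act X (\<zero>\<^bsub>G\<^esub>, v))\<rparr>"

definition invariants_map ::
    "('g, 'y) lie_scheme \<Rightarrow> ('h, 'z) lie_scheme \<Rightarrow> 'g set \<Rightarrow> ('g \<times> 'h, 'a) hmap \<Rightarrow> ('h, 'a) hmap" where
  "invariants_map G H K f =
     \<lparr>source = invariants G H K (source f), target = invariants G H K (target f),
      terms = (\<lambda>n. restrict (terms f n) (carrier (invariants G H K (source f))))\<rparr>"

text \<open>
  The inclusion \<open>X\<^sup>K \<otimes> Y\<^sup>K \<rightarrow> (X \<otimes> Y)\<^sup>K\<close>, \<open>x \<otimes> y \<mapsto> x \<otimes> y\<close>, and the identification of the unit
  objects, both constant in \<open>\<hbar>\<close>.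
\<close>

definition invariants_incl ::
    "('g, 'y) lie_scheme \<Rightarrow> ('h, 'z) lie_scheme \<Rightarrow> 'g set
      \<Rightarrow> ('g \<times> 'h, 'a) umod \<Rightarrow> ('g \<times> 'h, 'a) umod \<Rightarrow> ('h, 'a) hmap" where
  "invariants_incl G H K X Y =
     const_hmap (invariants G H K X \<boxtimes> invariants G H K Y) (invariants G H K (X \<boxtimes> Y))
       (\<lambda>u. tensor_lift (X \<boxtimes> Y) (elem_tensor X Y) (untensor u))"

definition invariants_unit ::
    "('g, 'y) lie_scheme \<Rightarrow> ('h, 'z) lie_scheme \<Rightarrow> 'g set \<Rightarrow> ('h, 'a) hmap" where
  "invariants_unit G H K =
     const_hmap trivial_module (invariants G H K trivial_module) (\<lambda>c. c)"

end

theory Submission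
  imports Defs
begin

text \<open>
  An arrow is a formal power series of linear maps, and the structural arrows are given by
  noncommutative series evaluated at operators which multiply by \<open>\<hbar>\<close>. On a tensor product
  of \<open>m\<close> modules the operators \<open>t\<^sup>i\<^sup>j\<close> satisfy the Drinfeld--Kohno relations by the symmetry and
  invariance of \<open>t\<close>, so equations between series modulo these relations, in particular the
  pentagon and the hexagons for \<open>\<Phi>\<close>, become equations between arrows.

  For \<open>x \<in> X\<^sup>\<cc>\<close> and \<open>y \<in> Y\<^sup>\<cc>\<close> the bilinear map \<open>(a, b) \<mapsto> a x \<otimes> b y\<close> vanishes when \<open>a\<close> or \<open>b\<close> lies
  in \<open>\<cc>\<close>, hence factors through \<open>\<gg>/\<cc> \<times> \<gg>/\<cc>\<close>. As \<open>\<cc>\<close> is coisotropic, \<open>t\<^sub>g\<close> acts by zero on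
  \<open>X\<^sup>\<cc> \<otimes> Y\<^sup>\<cc>\<close>. The inclusion therefore intertwines \<open>t\<^sub>h\<close> with \<open>t\<^sub>g + t\<^sub>h\<close>, and consequently every series in
  the operators \<open>t\<^sup>i\<^sup>j\<close> that occur in the braiding and the associator.
\<close>

section \<open>Complex vector spaces and linear maps\<close>

text \<open>That a functor is braided monoidal presupposes that both Drinfeld categories are braided
  monoidal, and most of the work goes into this; the functor itself adds only the vanishing of the
  action of t_g. Two features shape the proof. The categories are not strict, so operators on
  differently bracketed or permuted products live on different spaces. Everything is therefore
  carried back to the left-bracketed product with the factors in their original order: rebracketings
  and flips are constant in \<hbar>, they move past a series at the price of substituting other
  linear forms in the \<open>t\<^sup>i\<^sup>j\<close>, and what remains on one fixed space is a
  product of series, to which the axioms for \<Phi> apply. Moreover, elements of tensor products are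
  chosen representatives that depend on the factors, so the elements of
  \<open>X\<^sup>\<cc> \<otimes> Y\<^sup>\<cc>\<close> are not literally elements of
  \<open>X \<otimes> Y\<close>. The coherence map is the one induced by the bilinear map (x, y)
  \<mapsto> x \<otimes> y, and identities about it are tested on pure tensors.\<close>

abbreviation cvs :: "(complex, 'v, 'z) module_scheme \<Rightarrow> bool" where
  "cvs M \<equiv> module complex_ring M"

lemma complex_ring_simps [simp]:
  "carrier complex_ring = UNIV" "a \<otimes>\<^bsub>complex_ring\<^esub> b = a * b" "a \<oplus>\<^bsub>complex_ring\<^esub> b = a + b"
  "\<one>\<^bsub>complex_ring\<^esub> = 1" "\<zero>\<^bsub>complex_ring\<^esub> = 0"
  by (simp_all add: complex_ring_def)

lemma cring_complex_ring: "cring complex_ring"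
  by (rule cringI, rule abelian_groupI, auto simp: algebra_simps intro!: comm_monoidI)
    (metis add.right_inverse)

text \<open>Additive inverses need not be supplied: \<open>(-1) \<odot> x\<close> is one, because
  scalar multiplication distributes over the sum -1 + 1 and the scalar 0 annihilates. This is the
  reason for the premise on the scalar 0.\<close>

lemma cvsI:
  assumes "\<And>x y. x \<in> carrier M \<Longrightarrow> y \<in> carrier M \<Longrightarrow> x \<oplus>\<^bsub>M\<^esub> y \<in> carrier M"
    and "\<zero>\<^bsub>M\<^esub> \<in> carrier M"
    and "\<And>x y z. x \<in> carrier M \<Longrightarrow> y \<in> carrier M \<Longrightarrow> z \<in> carrier M \<Longrightarrow>
      (x \<oplus>\<^bsub>M\<^esub> y) \<oplus>\<^bsub>M\<^esub> z = x \<oplus>\<^bsub>M\<^esub> (y \<oplus>\<^bsub>M\<^esub> z)"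
    and "\<And>x y. x \<in> carrier M \<Longrightarrow> y \<in> carrier M \<Longrightarrow> x \<oplus>\<^bsub>M\<^esub> y = y \<oplus>\<^bsub>M\<^esub> x"
    and "\<And>x. x \<in> carrier M \<Longrightarrow> \<zero>\<^bsub>M\<^esub> \<oplus>\<^bsub>M\<^esub> x = x"
    and sc: "\<And>a x. x \<in> carrier M \<Longrightarrow> a \<odot>\<^bsub>M\<^esub> x \<in> carrier M"
    and sl: "\<And>a b x. x \<in> carrier M \<Longrightarrow> (a + b) \<odot>\<^bsub>M\<^esub> x = a \<odot>\<^bsub>M\<^esub> x \<oplus>\<^bsub>M\<^esub> b \<odot>\<^bsub>M\<^esub> x"
    and sr: "\<And>a x y. x \<in> carrier M \<Longrightarrow> y \<in> carrier M \<Longrightarrow>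
      a \<odot>\<^bsub>M\<^esub> (x \<oplus>\<^bsub>M\<^esub> y) = a \<odot>\<^bsub>M\<^esub> x \<oplus>\<^bsub>M\<^esub> a \<odot>\<^bsub>M\<^esub> y"
    and sa: "\<And>a b x. x \<in> carrier M \<Longrightarrow> (a * b) \<odot>\<^bsub>M\<^esub> x = a \<odot>\<^bsub>M\<^esub> (b \<odot>\<^bsub>M\<^esub> x)"
    and one: "\<And>x. x \<in> carrier M \<Longrightarrow> 1 \<odot>\<^bsub>M\<^esub> x = x"
    and zero: "\<And>x. x \<in> carrier M \<Longrightarrow> 0 \<odot>\<^bsub>M\<^esub> x = \<zero>\<^bsub>M\<^esub>"
  shows "cvs M"
proof (rule moduleI[OF cring_complex_ring])
  have "\<exists>y\<in>carrier M. y \<oplus>\<^bsub>M\<^esub> x = \<zero>\<^bsub>M\<^esub>" if x: "x \<in> carrier M" for x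
  proof
    show "(-1) \<odot>\<^bsub>M\<^esub> x \<oplus>\<^bsub>M\<^esub> x = \<zero>\<^bsub>M\<^esub>"
      using sl[OF x, of "-1" 1] one[OF x] zero[OF x] by simp
  qed (use sc x in auto)
  then show "abelian_group M" using assms(1-5) by (intro abelian_groupI) auto
qed (use sc sl sr sa one in auto)

lemma cvs_abelian_group: "cvs M \<Longrightarrow> abelian_group M"
  by (simp add: module_def)

text \<open>The module hypothesis is a premise and not a locale context, since a single formula
  below speaks of several spaces at once and the simplifier has to discharge the hypothesis for each
  of them.\<close>

lemma cvs_closed [simp]:
  assumes "cvs M"
  shows "\<zero>\<^bsub>M\<^esub> \<in> carrier M"
    and "x \<in> carrier M \<Longrightarrow> y \<in> carrier M \<Longrightarrow> x \<oplus>\<^bsub>M\<^esub> y \<in> carrier M"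
    and "x \<in> carrier M \<Longrightarrow> y \<in> carrier M \<Longrightarrow> x \<ominus>\<^bsub>M\<^esub> y \<in> carrier M"
    and "x \<in> carrier M \<Longrightarrow> a \<odot>\<^bsub>M\<^esub> x \<in> carrier M"
    and "x \<in> carrier M \<Longrightarrow> \<zero>\<^bsub>M\<^esub> \<oplus>\<^bsub>M\<^esub> x = x"
    and "x \<in> carrier M \<Longrightarrow> x \<oplus>\<^bsub>M\<^esub> \<zero>\<^bsub>M\<^esub> = x"
    and "x \<in> carrier M \<Longrightarrow> 0 \<odot>\<^bsub>M\<^esub> x = \<zero>\<^bsub>M\<^esub>"
    and "x \<in> carrier M \<Longrightarrow> 1 \<odot>\<^bsub>M\<^esub> x = x"
    and "a \<odot>\<^bsub>M\<^esub> \<zero>\<^bsub>M\<^esub> = \<zero>\<^bsub>M\<^esub>"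
    and "x \<in> carrier M \<Longrightarrow> x \<ominus>\<^bsub>M\<^esub> x = \<zero>\<^bsub>M\<^esub>"
proof -
  interpret module complex_ring M by fact
  show "x \<in> carrier M \<Longrightarrow> 0 \<odot>\<^bsub>M\<^esub> x = \<zero>\<^bsub>M\<^esub>" using smult_l_null[of x] by simp
  show "x \<in> carrier M \<Longrightarrow> 1 \<odot>\<^bsub>M\<^esub> x = x" using smult_one[of x] by simp
  show "a \<odot>\<^bsub>M\<^esub> \<zero>\<^bsub>M\<^esub> = \<zero>\<^bsub>M\<^esub>" using smult_r_null[of a] by simp
  show "x \<in> carrier M \<Longrightarrow> x \<ominus>\<^bsub>M\<^esub> x = \<zero>\<^bsub>M\<^esub>" by (simp add: M.minus_eq M.r_neg)
  show "\<zero>\<^bsub>M\<^esub> \<in> carrier M"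
    and "x \<in> carrier M \<Longrightarrow> y \<in> carrier M \<Longrightarrow> x \<oplus>\<^bsub>M\<^esub> y \<in> carrier M"
    and "x \<in> carrier M \<Longrightarrow> y \<in> carrier M \<Longrightarrow> x \<ominus>\<^bsub>M\<^esub> y \<in> carrier M"
    and "x \<in> carrier M \<Longrightarrow> a \<odot>\<^bsub>M\<^esub> x \<in> carrier M"
    and "x \<in> carrier M \<Longrightarrow> \<zero>\<^bsub>M\<^esub> \<oplus>\<^bsub>M\<^esub> x = x"
    and "x \<in> carrier M \<Longrightarrow> x \<oplus>\<^bsub>M\<^esub> \<zero>\<^bsub>M\<^esub> = x" by simp_all
qed

lemma cvs_rules:
  assumes "cvs M"
  shows cvs_add_assoc: "x \<in> carrier M \<Longrightarrow> y \<in> carrier M \<Longrightarrow> z \<in> carrier M \<Longrightarrow>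
      (x \<oplus>\<^bsub>M\<^esub> y) \<oplus>\<^bsub>M\<^esub> z = x \<oplus>\<^bsub>M\<^esub> (y \<oplus>\<^bsub>M\<^esub> z)"
    and cvs_add_comm: "x \<in> carrier M \<Longrightarrow> y \<in> carrier M \<Longrightarrow> x \<oplus>\<^bsub>M\<^esub> y = y \<oplus>\<^bsub>M\<^esub> x"
    and cvs_add_left_comm: "x \<in> carrier M \<Longrightarrow> y \<in> carrier M \<Longrightarrow> z \<in> carrier M \<Longrightarrow>
      x \<oplus>\<^bsub>M\<^esub> (y \<oplus>\<^bsub>M\<^esub> z) = y \<oplus>\<^bsub>M\<^esub> (x \<oplus>\<^bsub>M\<^esub> z)"
    and cvs_smult_add_left: "x \<in> carrier M \<Longrightarrow> (a + b) \<odot>\<^bsub>M\<^esub> x = a \<odot>\<^bsub>M\<^esub> x \<oplus>\<^bsub>M\<^esub> b \<odot>\<^bsub>M\<^esub> x"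
    and cvs_smult_add: "x \<in> carrier M \<Longrightarrow> y \<in> carrier M \<Longrightarrow>
      a \<odot>\<^bsub>M\<^esub> (x \<oplus>\<^bsub>M\<^esub> y) = a \<odot>\<^bsub>M\<^esub> x \<oplus>\<^bsub>M\<^esub> a \<odot>\<^bsub>M\<^esub> y"
    and cvs_smult_smult: "x \<in> carrier M \<Longrightarrow> a \<odot>\<^bsub>M\<^esub> (b \<odot>\<^bsub>M\<^esub> x) = (a * b) \<odot>\<^bsub>M\<^esub> x"
    and cvs_add_cancel: "x \<in> carrier M \<Longrightarrow> y \<in> carrier M \<Longrightarrow> z \<in> carrier M \<Longrightarrow>
      x \<oplus>\<^bsub>M\<^esub> z = y \<oplus>\<^bsub>M\<^esub> z \<longleftrightarrow> x = y"
    and cvs_minus_eq_iff: "x \<in> carrier M \<Longrightarrow> y \<in> carrier M \<Longrightarrow> z \<in> carrier M \<Longrightarrow>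
      z = x \<ominus>\<^bsub>M\<^esub> y \<longleftrightarrow> z \<oplus>\<^bsub>M\<^esub> y = x"
proof -
  interpret module complex_ring M by fact
  show "x \<in> carrier M \<Longrightarrow> y \<in> carrier M \<Longrightarrow> z \<in> carrier M \<Longrightarrow>
      (x \<oplus>\<^bsub>M\<^esub> y) \<oplus>\<^bsub>M\<^esub> z = x \<oplus>\<^bsub>M\<^esub> (y \<oplus>\<^bsub>M\<^esub> z)" by (rule M.a_assoc)
  show "x \<in> carrier M \<Longrightarrow> y \<in> carrier M \<Longrightarrow> x \<oplus>\<^bsub>M\<^esub> y = y \<oplus>\<^bsub>M\<^esub> x" by (rule M.a_comm)
  show "x \<in> carrier M \<Longrightarrow> y \<in> carrier M \<Longrightarrow> z \<in> carrier M \<Longrightarrow>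
      x \<oplus>\<^bsub>M\<^esub> (y \<oplus>\<^bsub>M\<^esub> z) = y \<oplus>\<^bsub>M\<^esub> (x \<oplus>\<^bsub>M\<^esub> z)" by (rule M.a_lcomm)
  show "x \<in> carrier M \<Longrightarrow> (a + b) \<odot>\<^bsub>M\<^esub> x = a \<odot>\<^bsub>M\<^esub> x \<oplus>\<^bsub>M\<^esub> b \<odot>\<^bsub>M\<^esub> x"
    using smult_l_distr[of a b x] by simp
  show "x \<in> carrier M \<Longrightarrow> y \<in> carrier M \<Longrightarrow>
      a \<odot>\<^bsub>M\<^esub> (x \<oplus>\<^bsub>M\<^esub> y) = a \<odot>\<^bsub>M\<^esub> x \<oplus>\<^bsub>M\<^esub> a \<odot>\<^bsub>M\<^esub> y" using smult_r_distr[of a x y] by simp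
  show "x \<in> carrier M \<Longrightarrow> a \<odot>\<^bsub>M\<^esub> (b \<odot>\<^bsub>M\<^esub> x) = (a * b) \<odot>\<^bsub>M\<^esub> x"
    using smult_assoc1[of a b x] by simp
  show "x \<in> carrier M \<Longrightarrow> y \<in> carrier M \<Longrightarrow> z \<in> carrier M \<Longrightarrow> x \<oplus>\<^bsub>M\<^esub> z = y \<oplus>\<^bsub>M\<^esub> z \<longleftrightarrow> x = y"
    by (rule M.add.right_cancel)
  have ma: "(x \<ominus>\<^bsub>M\<^esub> y) \<oplus>\<^bsub>M\<^esub> y = x" if "x \<in> carrier M" "y \<in> carrier M" for x y
    using that by (simp add: M.minus_eq M.a_assoc M.l_neg)
  show "z = x \<ominus>\<^bsub>M\<^esub> y \<longleftrightarrow> z \<oplus>\<^bsub>M\<^esub> y = x" if "x \<in> carrier M" "y \<in> carrier M" "z \<in> carrier M"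
    using that ma[of x y] M.add.right_cancel[of y z "x \<ominus>\<^bsub>M\<^esub> y"] by auto
qed

lemma cvs_add_add:
  assumes "cvs M" "a \<in> carrier M" "b \<in> carrier M" "c \<in> carrier M" "d \<in> carrier M"
  shows "(a \<oplus>\<^bsub>M\<^esub> b) \<oplus>\<^bsub>M\<^esub> (c \<oplus>\<^bsub>M\<^esub> d) = (a \<oplus>\<^bsub>M\<^esub> c) \<oplus>\<^bsub>M\<^esub> (b \<oplus>\<^bsub>M\<^esub> d)"
  using assms by (simp add: cvs_add_assoc cvs_add_left_comm)

lemma cvs_finsum [simp]:
  assumes "cvs M"
  shows "(\<And>i. i \<in> A \<Longrightarrow> f i \<in> carrier M) \<Longrightarrow> finsum M f A \<in> carrier M"
    and "finsum M f {} = \<zero>\<^bsub>M\<^esub>" and "finsum M (\<lambda>_. \<zero>\<^bsub>M\<^esub>) A = \<zero>\<^bsub>M\<^esub>"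
proof -
  interpret module complex_ring M by fact
  show "(\<And>i. i \<in> A \<Longrightarrow> f i \<in> carrier M) \<Longrightarrow> finsum M f A \<in> carrier M" by (rule M.finsum_closed) auto
  show "finsum M f {} = \<zero>\<^bsub>M\<^esub>" and "finsum M (\<lambda>_. \<zero>\<^bsub>M\<^esub>) A = \<zero>\<^bsub>M\<^esub>" by simp_all
qed

lemma cvs_finsum_insert:
  assumes "cvs M" "finite A" "a \<notin> A" "\<And>i. i \<in> A \<Longrightarrow> f i \<in> carrier M" "f a \<in> carrier M"
  shows "finsum M f (insert a A) = f a \<oplus>\<^bsub>M\<^esub> finsum M f A"
proof -
  interpret module complex_ring M by fact
  show ?thesis using assms by (intro M.finsum_insert) auto
qed

lemma cvs_finsum_cong:
  assumes "cvs M" "A = B" "\<And>i. i \<in> B \<Longrightarrow> g i \<in> carrier M" "\<And>i. i \<in> B \<Longrightarrow> f i = g i"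
  shows "finsum M f A = finsum M g B"
proof -
  interpret module complex_ring M by fact
  show ?thesis using assms by (intro M.finsum_cong') auto
qed

lemma cvs_finsum_add:
  assumes "cvs M" "\<And>i. i \<in> A \<Longrightarrow> f i \<in> carrier M" "\<And>i. i \<in> A \<Longrightarrow> g i \<in> carrier M"
  shows "finsum M (\<lambda>i. f i \<oplus>\<^bsub>M\<^esub> g i) A = finsum M f A \<oplus>\<^bsub>M\<^esub> finsum M g A"
proof -
  interpret module complex_ring M by fact
  show ?thesis using assms by (intro M.finsum_addf) auto
qed

lemma cvs_finsum_mono_neutral:
  assumes "cvs M" "finite B" "A \<subseteq> B" "\<And>i. i \<in> B - A \<Longrightarrow> f i = \<zero>\<^bsub>M\<^esub>"
    and "\<And>i. i \<in> A \<Longrightarrow> f i \<in> carrier M"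
  shows "finsum M f B = finsum M f A"
proof -
  interpret module complex_ring M by fact
  have "f i \<in> carrier M" if "i \<in> B" for i using assms that by (cases "i \<in> A") auto
  then show ?thesis using assms by (intro M.add.finprod_mono_neutral_cong_right) auto
qed

lemma cvs_finsum_single:
  assumes "cvs M" "finite B" "a \<in> B" "f a \<in> carrier M" "\<And>i. i \<in> B \<Longrightarrow> i \<noteq> a \<Longrightarrow> f i = \<zero>\<^bsub>M\<^esub>"
  shows "finsum M f B = f a"
proof -
  have "finsum M f B = finsum M f {a}"
    by (rule cvs_finsum_mono_neutral) (use assms in auto)
  also have "\<dots> = f a" using cvs_finsum_insert[of M "{}" a f] assms by simp
  finally show ?thesis .
qed

lemma cvs_finsum_reindex:
  assumes "cvs M" "inj_on h A" "\<And>a. a \<in> A \<Longrightarrow> f (h a) \<in> carrier M"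
  shows "finsum M f (h ` A) = finsum M (\<lambda>a. f (h a)) A"
proof -
  interpret module complex_ring M by fact
  show ?thesis using assms by (intro M.finsum_reindex) auto
qed

lemma cvs_finsum_swap:
  assumes M: "cvs M" and "finite A" "finite B" and f: "\<And>a b. a \<in> A \<Longrightarrow> b \<in> B \<Longrightarrow> f a b \<in> carrier M"
  shows "finsum M (\<lambda>a. finsum M (f a) B) A = finsum M (\<lambda>b. finsum M (\<lambda>a. f a b) A) B"
  using assms(2) f
proof (induction A)
  case empty
  then show ?case using M by simp
next
  case (insert a A)
  have "finsum M (\<lambda>b. finsum M (\<lambda>a. f a b) (insert a A)) B
      = finsum M (\<lambda>b. f a b \<oplus>\<^bsub>M\<^esub> finsum M (\<lambda>a. f a b) A) B"
    using insert M by (intro cvs_finsum_cong) (auto simp: cvs_finsum_insert)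
  also have "\<dots> = finsum M (f a) B \<oplus>\<^bsub>M\<^esub> finsum M (\<lambda>b. finsum M (\<lambda>a. f a b) A) B"
    using insert M by (intro cvs_finsum_add) auto
  finally show ?case using insert M by (simp add: cvs_finsum_insert)
qed

lemma cvs_finsum_product:
  assumes M: "cvs M" and "finite A" "finite B" and f: "\<And>a b. a \<in> A \<Longrightarrow> b \<in> B \<Longrightarrow> f (a, b) \<in> carrier M"
  shows "finsum M f (A \<times> B) = finsum M (\<lambda>a. finsum M (\<lambda>b. f (a, b)) B) A"
  using assms(2) f
proof (induction A)
  case empty
  then show ?case using M by simp
next
  case (insert a A)
  interpret module complex_ring M by fact
  have "finsum M f (insert a A \<times> B) = finsum M f (Pair a ` B \<union> A \<times> B)"
    by (rule arg_cong[where f = "finsum M f"]) auto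
  also have "\<dots> = finsum M f (Pair a ` B) \<oplus>\<^bsub>M\<^esub> finsum M f (A \<times> B)"
    using insert assms by (intro M.finsum_Un_disjoint) auto
  also have "finsum M f (Pair a ` B) = finsum M (\<lambda>b. f (a, b)) B"
    using insert M by (intro cvs_finsum_reindex) (auto simp: inj_on_def)
  finally show ?case using insert M by (simp add: cvs_finsum_insert)
qed

lemma cvs_finsum_singleton [simp]: "cvs M \<Longrightarrow> f a \<in> carrier M \<Longrightarrow> finsum M f {a} = f a"
  by (rule cvs_finsum_single) auto

lemma cvs_finsum_atMost_Suc:
  assumes "cvs M" "\<And>i. i \<le> Suc n \<Longrightarrow> f i \<in> carrier M"
  shows "finsum M f {..Suc n} = finsum M f {..n} \<oplus>\<^bsub>M\<^esub> f (Suc n)"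
proof -
  have "finsum M f {..n} \<in> carrier M" using assms by (intro cvs_finsum(1)) auto
  then show ?thesis using assms cvs_add_comm[of M "f (Suc n)" "finsum M f {..n}"]
    cvs_finsum_insert[of M "{..n}" "Suc n" f] by (simp add: atMost_Suc)
qed

lemma cvs_finsum_reflect:
  assumes "cvs M" "\<And>k. k \<le> n \<Longrightarrow> f k \<in> carrier M"
  shows "finsum M f {..n} = finsum M (\<lambda>k. f (n - k)) {..n :: nat}"
proof -
  have "i \<in> (\<lambda>k. n - k) ` {..n}" if "i \<le> n" for i
    using that by (intro image_eqI[of _ _ "n - i"]) auto
  then have "{..n} = (\<lambda>k. n - k) ` {..n}" by auto
  then have "finsum M f {..n} = finsum M f ((\<lambda>k. n - k) ` {..n})" by simp
  also have "\<dots> = finsum M (\<lambda>k. f (n - k)) {..n}"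
    using assms by (intro cvs_finsum_reindex) (auto simp: inj_on_def)
  finally show ?thesis .
qed

text \<open>The associativity of convolution products rests on this exchange of summations.\<close>

lemma cvs_finsum_triangle:
  fixes n :: nat
  assumes M: "cvs M" and f: "\<And>i j. i + j \<le> n \<Longrightarrow> f i j \<in> carrier M"
  shows "finsum M (\<lambda>k. finsum M (\<lambda>j. f j (k - j)) {..k}) {..n}
       = finsum M (\<lambda>j. finsum M (\<lambda>i. f j i) {..n - j}) {..n}"
  using assms(2)
proof (induction n)
  case 0
  then show ?case using M by (simp add: cvs_finsum_insert)
next
  case (Suc n)
  let ?A = "finsum M (\<lambda>j. finsum M (f j) {..n - j}) {..n}"
  let ?B = "finsum M (\<lambda>j. f j (Suc n - j)) {..n}"
  have closed: "?A \<in> carrier M" "?B \<in> carrier M" "f (Suc n) 0 \<in> carrier M"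
    using Suc.prems M by (auto intro!: cvs_finsum(1))
  have "finsum M (\<lambda>j. finsum M (f j) {..Suc n - j}) {..Suc n}
     = finsum M (\<lambda>j. finsum M (f j) {..Suc n - j}) {..n} \<oplus>\<^bsub>M\<^esub> f (Suc n) 0"
    using Suc.prems M by (subst cvs_finsum_atMost_Suc) (auto intro!: cvs_finsum(1))
  also have "finsum M (\<lambda>j. finsum M (f j) {..Suc n - j}) {..n}
     = finsum M (\<lambda>j. finsum M (f j) {..n - j} \<oplus>\<^bsub>M\<^esub> f j (Suc n - j)) {..n}"
    using Suc.prems M
    by (intro cvs_finsum_cong)
      (auto simp: Suc_diff_le cvs_finsum_atMost_Suc intro!: cvs_closed(2) cvs_finsum(1))
  also have "\<dots> = ?A \<oplus>\<^bsub>M\<^esub> ?B"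
    using Suc.prems M by (intro cvs_finsum_add) (auto intro!: cvs_finsum(1))
  also have "(?A \<oplus>\<^bsub>M\<^esub> ?B) \<oplus>\<^bsub>M\<^esub> f (Suc n) 0 = ?A \<oplus>\<^bsub>M\<^esub> (?B \<oplus>\<^bsub>M\<^esub> f (Suc n) 0)"
    using M closed by (simp add: cvs_add_assoc)
  also have "?B \<oplus>\<^bsub>M\<^esub> f (Suc n) 0 = finsum M (\<lambda>j. f j (Suc n - j)) {..Suc n}"
    using Suc.prems M by (subst cvs_finsum_atMost_Suc) auto
  also have "?A = finsum M (\<lambda>k. finsum M (\<lambda>j. f j (k - j)) {..k}) {..n}"
    using Suc by simp
  also have "\<dots> \<oplus>\<^bsub>M\<^esub> finsum M (\<lambda>j. f j (Suc n - j)) {..Suc n}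
      = finsum M (\<lambda>k. finsum M (\<lambda>j. f j (k - j)) {..k}) {..Suc n}"
    using Suc.prems M by (intro cvs_finsum_atMost_Suc[symmetric]) (auto intro!: cvs_finsum(1))
  finally show ?case by simp
qed

text \<open>Nothing is required outside the carrier of \<open>M\<close>, so unrestricted lambda
  terms can be composed and added freely. Extensionality is imposed only on the coefficients of
  arrows, where equality of functions matters.\<close>

definition linmap ::
    "(complex, 'v, 'p) module_scheme \<Rightarrow> (complex, 'w, 'q) module_scheme \<Rightarrow> ('v \<Rightarrow> 'w) \<Rightarrow> bool" where
  "linmap M N f \<longleftrightarrow> (\<forall>x\<in>carrier M. f x \<in> carrier N) \<and>
     (\<forall>x\<in>carrier M. \<forall>y\<in>carrier M. f (x \<oplus>\<^bsub>M\<^esub> y) = f x \<oplus>\<^bsub>N\<^esub> f y) \<and>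
     (\<forall>c. \<forall>x\<in>carrier M. f (c \<odot>\<^bsub>M\<^esub> x) = c \<odot>\<^bsub>N\<^esub> f x)"

lemma linmapI:
  "\<lbrakk>\<And>x. x \<in> carrier M \<Longrightarrow> f x \<in> carrier N;
    \<And>x y. x \<in> carrier M \<Longrightarrow> y \<in> carrier M \<Longrightarrow> f (x \<oplus>\<^bsub>M\<^esub> y) = f x \<oplus>\<^bsub>N\<^esub> f y;
    \<And>c x. x \<in> carrier M \<Longrightarrow> f (c \<odot>\<^bsub>M\<^esub> x) = c \<odot>\<^bsub>N\<^esub> f x\<rbrakk> \<Longrightarrow> linmap M N f"
  by (simp add: linmap_def)

lemma linmap_closed: "linmap M N f \<Longrightarrow> x \<in> carrier M \<Longrightarrow> f x \<in> carrier N"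
  by (simp add: linmap_def)

lemma linmap_add:
  "linmap M N f \<Longrightarrow> x \<in> carrier M \<Longrightarrow> y \<in> carrier M \<Longrightarrow> f (x \<oplus>\<^bsub>M\<^esub> y) = f x \<oplus>\<^bsub>N\<^esub> f y"
  by (simp add: linmap_def)

lemma linmap_smult: "linmap M N f \<Longrightarrow> x \<in> carrier M \<Longrightarrow> f (c \<odot>\<^bsub>M\<^esub> x) = c \<odot>\<^bsub>N\<^esub> f x"
  by (simp add: linmap_def)

lemma linmap_zero: "linmap M N f \<Longrightarrow> cvs M \<Longrightarrow> cvs N \<Longrightarrow> f \<zero>\<^bsub>M\<^esub> = \<zero>\<^bsub>N\<^esub>"
  using linmap_smult[of M N f "\<zero>\<^bsub>M\<^esub>" 0] by (simp add: linmap_closed)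

lemma linmap_finsum:
  assumes "linmap M N f" "cvs M" "cvs N" "\<And>i. i \<in> A \<Longrightarrow> g i \<in> carrier M"
  shows "f (finsum M g A) = finsum N (\<lambda>i. f (g i)) A"
proof (cases "finite A")
  case True
  then show ?thesis using assms(4)
  proof (induction A)
    case empty
    then show ?case using assms by (simp add: linmap_zero)
  next
    case (insert a A)
    then show ?case using assms(1-3)
      by (simp add: cvs_finsum_insert linmap_add[OF assms(1)] linmap_closed[OF assms(1)])
  qed
next
  \<comment> \<open>On an infinite index set \<open>finsum\<close> is zero by convention, and linear
    maps preserve zero.\<close>
  case False
  interpret M: module complex_ring M by fact
  interpret N: module complex_ring N by fact
  show ?thesis using False assms by (simp add: linmap_zero M.finsum_infinite N.finsum_infinite)
qed

lemma linmap_id: "linmap M M (\<lambda>x. x)"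
  by (simp add: linmap_def)

lemma linmap_comp: "linmap N P f \<Longrightarrow> linmap M N h \<Longrightarrow> linmap M P (\<lambda>x. f (h x))"
  by (simp add: linmap_def)

lemma linmap_plus:
  "\<lbrakk>cvs N; linmap M N f; linmap M N g\<rbrakk> \<Longrightarrow> linmap M N (\<lambda>x. f x \<oplus>\<^bsub>N\<^esub> g x)"
  by (rule linmapI) (simp_all add: linmap_closed linmap_add linmap_smult cvs_add_add cvs_smult_add)

lemma linmap_scale: "\<lbrakk>cvs N; linmap M N f\<rbrakk> \<Longrightarrow> linmap M N (\<lambda>x. c \<odot>\<^bsub>N\<^esub> f x)"
  by (rule linmapI)
    (simp_all add: linmap_closed linmap_add linmap_smult cvs_smult_add cvs_smult_smult mult.commute)

lemma linmap_zero_map: "cvs N \<Longrightarrow> linmap M N (\<lambda>x. \<zero>\<^bsub>N\<^esub>)"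
  by (rule linmapI) simp_all

lemma linmap_finsum_maps:
  assumes N: "cvs N" and M: "cvs M" and f: "\<And>i. i \<in> A \<Longrightarrow> linmap M N (f i)"
  shows "linmap M N (\<lambda>x. finsum N (\<lambda>i. f i x) A)"
proof (rule linmapI)
  note c = f[THEN linmap_closed]
  show "finsum N (\<lambda>i. f i x) A \<in> carrier N" if "x \<in> carrier M" for x
    using N c that by simp
  show "finsum N (\<lambda>i. f i (x \<oplus>\<^bsub>M\<^esub> y)) A = finsum N (\<lambda>i. f i x) A \<oplus>\<^bsub>N\<^esub> finsum N (\<lambda>i. f i y) A"
    if "x \<in> carrier M" "y \<in> carrier M" for x y
    using N M c f that by (subst cvs_finsum_add[symmetric]) (auto intro!: cvs_finsum_cong simp: linmap_add)
  \<comment> \<open>Multiplication by \<open>k\<close> is itself a linear endomorphism of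
    \<open>N\<close>, so it passes through the sum.\<close>
  show "finsum N (\<lambda>i. f i (k \<odot>\<^bsub>M\<^esub> x)) A = k \<odot>\<^bsub>N\<^esub> finsum N (\<lambda>i. f i x) A" if "x \<in> carrier M" for k x
    using linmap_finsum[OF linmap_scale[OF N linmap_id, of k] N N, of A "\<lambda>i. f i x"] c[OF _ that] N M f that
    by (auto intro!: cvs_finsum_cong simp: linmap_smult)
qed

lemma cvs_smult_sum:
  assumes "cvs M" "x \<in> carrier M" "finite A"
  shows "(\<Sum>i\<in>A. c i) \<odot>\<^bsub>M\<^esub> x = finsum M (\<lambda>i. c i \<odot>\<^bsub>M\<^esub> x) A"
  using assms(3,1,2) by (induction A) (simp_all add: cvs_finsum_insert cvs_smult_add_left)

lemma cvs_smult_finsum: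
  assumes "cvs M" "\<And>i. i \<in> A \<Longrightarrow> f i \<in> carrier M"
  shows "c \<odot>\<^bsub>M\<^esub> finsum M f A = finsum M (\<lambda>i. c \<odot>\<^bsub>M\<^esub> f i) A"
  using linmap_finsum[OF linmap_scale[OF assms(1) linmap_id, of c] assms(1,1)] assms by blast

section \<open>Tensor products\<close>

lemma free_sum_simps [simp]:
  "free_sum [] = 0" "free_sum ((c, x, y) # l) = Poly_Mapping.single (x, y) c + free_sum l"
  "free_sum (l @ m) = free_sum l + free_sum m"
  by (simp_all add: free_sum_def)

definition pm_scale :: "complex \<Rightarrow> ('k \<Rightarrow>\<^sub>0 complex) \<Rightarrow> 'k \<Rightarrow>\<^sub>0 complex" where
  "pm_scale a p = Poly_Mapping.map ((*) a) p"

lemma lookup_pm_scale [simp]: "Poly_Mapping.lookup (pm_scale a p) k = a * Poly_Mapping.lookup p k"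
  by (cases "Poly_Mapping.lookup p k = 0") (simp_all add: pm_scale_def Poly_Mapping.map.rep_eq)

lemma pm_scale_simps:
  "pm_scale a (p + q) = pm_scale a p + pm_scale a q"
  "pm_scale a (p - q) = pm_scale a p - pm_scale a q"
  "pm_scale a 0 = 0" "pm_scale a (Poly_Mapping.single k c) = Poly_Mapping.single k (a * c)"
  "pm_scale (a + b) p = pm_scale a p + pm_scale b p"
  "pm_scale a (pm_scale b p) = pm_scale (a * b) p"
  "pm_scale 1 p = p" "pm_scale 0 p = 0" "pm_scale (-1) p = - p"
  by (auto intro!: poly_mapping_eqI simp: lookup_add lookup_minus lookup_single algebra_simps when_def)

definition scale_sum :: "complex \<Rightarrow> ('v, 'w) formal_sum \<Rightarrow> ('v, 'w) formal_sum" where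
  "scale_sum a l = map (\<lambda>(c, x, y). (a * c, x, y)) l"

lemma scale_sum_simps [simp]:
  "scale_sum a [] = []" "scale_sum a ((c, x, y) # l) = (a * c, x, y) # scale_sum a l"
  "scale_sum a (l @ m) = scale_sum a l @ scale_sum a m"
  by (simp_all add: scale_sum_def)

lemma free_sum_scale: "free_sum (scale_sum a l) = pm_scale a (free_sum l)"
  by (induction l) (auto simp: pm_scale_simps)

text \<open>\<open>tensor_rel\<close> has no rule for scaling. It is a subspace all the same,
  because every generator comes with an arbitrary coefficient \<open>c\<close> that absorbs the
  scalar.\<close>

lemma tensor_rel_scale: "p \<in> tensor_rel V W \<Longrightarrow> pm_scale a p \<in> tensor_rel V W"
proof (induction rule: tensor_rel.induct)
  case (rel_smult_left x y b c)
  then show ?case using tensor_rel.rel_smult_left[of x V y W b "a * c"] by (simp add: pm_scale_simps mult.assoc)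
next
  case (rel_smult_right x y b c)
  then show ?case using tensor_rel.rel_smult_right[of x V y W b "a * c"] by (simp add: pm_scale_simps mult.assoc)
qed (auto simp: pm_scale_simps intro: tensor_rel.intros)

lemma tensor_rel_uminus: "p \<in> tensor_rel V W \<Longrightarrow> - p \<in> tensor_rel V W"
  using tensor_rel_scale[of p V W "-1"] by (simp add: pm_scale_simps)

lemma tensor_rel_diff: "p \<in> tensor_rel V W \<Longrightarrow> q \<in> tensor_rel V W \<Longrightarrow> p - q \<in> tensor_rel V W"
  using tensor_rel.rel_add[OF _ tensor_rel_uminus] by fastforce

lemma formal_sums_simps [simp]:
  "[] \<in> formal_sums V W"
  "(c, x, y) # l \<in> formal_sums V W \<longleftrightarrow> x \<in> carrier V \<and> y \<in> carrier W \<and> l \<in> formal_sums V W"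
  "l @ m \<in> formal_sums V W \<longleftrightarrow> l \<in> formal_sums V W \<and> m \<in> formal_sums V W"
  "scale_sum a l \<in> formal_sums V W \<longleftrightarrow> l \<in> formal_sums V W"
  by (auto simp: formal_sums_def lists_eq_set scale_sum_def)

lemma formal_sums_induct [consumes 1, case_names Nil Cons]:
  assumes "l \<in> formal_sums V W" and "P []"
    and "\<And>c x y l. \<lbrakk>x \<in> carrier V; y \<in> carrier W; l \<in> formal_sums V W; P l\<rbrakk> \<Longrightarrow> P ((c, x, y) # l)"
  shows "P l"
  using assms(1)
proof (induction l)
  case (Cons e l)
  then show ?case using assms(3) by (cases e) auto
qed (rule assms)

text \<open>The list \<open>l\<close> is congruent to itself, so the choice in
  \<open>tensor_class\<close> always has a candidate.\<close>

lemma tensor_class_props: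
  assumes "l \<in> formal_sums V W"
  shows tensor_class_closed: "tensor_class V W l \<in> formal_sums V W"
    and tensor_class_rel: "free_sum (tensor_class V W l) - free_sum l \<in> tensor_rel V W"
proof -
  have "tensor_class V W l \<in> formal_sums V W \<and> free_sum (tensor_class V W l) - free_sum l \<in> tensor_rel V W"
    unfolding tensor_class_def by (rule someI[of _ l]) (use assms in \<open>simp add: rel_zero\<close>)
  then show "tensor_class V W l \<in> formal_sums V W"
    "free_sum (tensor_class V W l) - free_sum l \<in> tensor_rel V W" by auto
qed

text \<open>Congruent lists have the same candidates for a representative, hence the choice operator
  is applied to one and the same predicate. Equality in the quotient thereby becomes literal
  equality of lists.\<close>

lemma tensor_class_cong:
  assumes "free_sum l - free_sum m \<in> tensor_rel V W"
  shows "tensor_class V W l = tensor_class V W m"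
proof -
  have "free_sum k - free_sum l \<in> tensor_rel V W \<longleftrightarrow> free_sum k - free_sum m \<in> tensor_rel V W" for k
  proof
    show "free_sum k - free_sum m \<in> tensor_rel V W" if "free_sum k - free_sum l \<in> tensor_rel V W"
      using tensor_rel.rel_add[OF that assms] by simp
    show "free_sum k - free_sum l \<in> tensor_rel V W" if "free_sum k - free_sum m \<in> tensor_rel V W"
      using tensor_rel_diff[OF that assms] by simp
  qed
  then show ?thesis by (simp add: tensor_class_def)
qed

lemma tensor_class_cong': "free_sum l = free_sum m \<Longrightarrow> tensor_class V W l = tensor_class V W m"
  by (rule tensor_class_cong) (simp add: rel_zero)

lemma tensor_class_idem:
  "l \<in> formal_sums V W \<Longrightarrow> tensor_class V W (tensor_class V W l) = tensor_class V W l"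
  by (rule tensor_class_cong) (rule tensor_class_rel)

lemma tensor_class_append:
  assumes "l \<in> formal_sums V W" "m \<in> formal_sums V W"
  shows "tensor_class V W (tensor_class V W l @ tensor_class V W m) = tensor_class V W (l @ m)"
  using tensor_rel.rel_add[OF tensor_class_rel[OF assms(1)] tensor_class_rel[OF assms(2)]]
  by (intro tensor_class_cong) (simp add: algebra_simps)

lemma tensor_class_scale:
  assumes "l \<in> formal_sums V W"
  shows "tensor_class V W (scale_sum a (tensor_class V W l)) = tensor_class V W (scale_sum a l)"
  using tensor_rel_scale[OF tensor_class_rel[OF assms], of a]
  by (intro tensor_class_cong) (simp add: free_sum_scale pm_scale_simps)

text \<open>Idempotence of \<open>tensor_class\<close> turns the carrier into its set of fixed
  points. An element is then itself a formal sum, to which \<open>tensor_lift\<close> can be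
  applied.\<close>

lemma carrier_tensor_iff:
  "u \<in> carrier (tensor V W) \<longleftrightarrow> u \<in> formal_sums V W \<and> tensor_class V W u = u"
proof
  assume "u \<in> carrier (tensor V W)"
  then show "u \<in> formal_sums V W \<and> tensor_class V W u = u"
    by (auto simp: tensor_def tensor_class_closed tensor_class_idem)
next
  assume "u \<in> formal_sums V W \<and> tensor_class V W u = u"
  then show "u \<in> carrier (tensor V W)" by (simp add: tensor_def) (metis imageI)
qed

lemma tensor_simps:
  "\<zero>\<^bsub>tensor V W\<^esub> = tensor_class V W []"
  "u \<oplus>\<^bsub>tensor V W\<^esub> v = tensor_class V W (u @ v)"
  "a \<odot>\<^bsub>tensor V W\<^esub> u = tensor_class V W (scale_sum a u)"
  by (simp_all add: tensor_def scale_sum_def)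

lemma tensor_class_carrier: "l \<in> formal_sums V W \<Longrightarrow> tensor_class V W l \<in> carrier (tensor V W)"
  by (simp add: tensor_def)

lemma tensor_class_sum:
  "\<lbrakk>l \<in> formal_sums V W; m \<in> formal_sums V W\<rbrakk> \<Longrightarrow>
    tensor_class V W l \<oplus>\<^bsub>tensor V W\<^esub> tensor_class V W m = tensor_class V W (l @ m)"
  "l \<in> formal_sums V W \<Longrightarrow> a \<odot>\<^bsub>tensor V W\<^esub> tensor_class V W l = tensor_class V W (scale_sum a l)"
  by (simp_all add: tensor_simps tensor_class_append tensor_class_scale)

text \<open>A quotient of a free vector space by a subspace is a vector space, whatever
  \<open>V\<close> and \<open>W\<close> are; each axiom comes down to an identity between free sums
  of lists.\<close>

lemma cvs_tensor [simp]: "cvs (tensor V W)"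
proof -
  have ex: "\<exists>l\<in>formal_sums V W. u = tensor_class V W l" if "u \<in> carrier (tensor V W)" for u
    using that by (auto simp: tensor_def)
  note [simp] = tensor_class_sum tensor_class_carrier
  show ?thesis
  proof (rule cvsI)
    fix x y z assume xyz: "x \<in> carrier (tensor V W)" "y \<in> carrier (tensor V W)" "z \<in> carrier (tensor V W)"
    then show "(x \<oplus>\<^bsub>tensor V W\<^esub> y) \<oplus>\<^bsub>tensor V W\<^esub> z = x \<oplus>\<^bsub>tensor V W\<^esub> (y \<oplus>\<^bsub>tensor V W\<^esub> z)"
      by (auto dest!: ex)
  next
    fix x y assume "x \<in> carrier (tensor V W)" "y \<in> carrier (tensor V W)"
    then show "x \<oplus>\<^bsub>tensor V W\<^esub> y = y \<oplus>\<^bsub>tensor V W\<^esub> x"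
      by (auto dest!: ex intro!: tensor_class_cong' simp: add.commute)
  next
    fix x y assume "x \<in> carrier (tensor V W)" "y \<in> carrier (tensor V W)"
    then show "x \<oplus>\<^bsub>tensor V W\<^esub> y \<in> carrier (tensor V W)" by (auto dest!: ex)
  qed (auto dest!: ex intro!: tensor_class_cong'
      simp: tensor_simps(1) free_sum_scale pm_scale_simps)
qed

section \<open>The universal property of the tensor product\<close>

definition pm_value ::
    "(complex, 'u, 'r) module_scheme \<Rightarrow> ('k \<Rightarrow> 'u) \<Rightarrow> ('k \<Rightarrow>\<^sub>0 complex) \<Rightarrow> 'u" where
  "pm_value M \<phi> p = finsum M (\<lambda>k. Poly_Mapping.lookup p k \<odot>\<^bsub>M\<^esub> \<phi> k) (Poly_Mapping.keys p)"

context
  fixes M :: "(complex, 'u, 'r) module_scheme" and \<phi> :: "'k \<Rightarrow> 'u"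
  assumes M: "cvs M" and \<phi>: "\<And>k. \<phi> k \<in> carrier M"
begin

lemma pm_value_superset:
  "finite S \<Longrightarrow> Poly_Mapping.keys p \<subseteq> S \<Longrightarrow> pm_value M \<phi> p = finsum M (\<lambda>k. Poly_Mapping.lookup p k \<odot>\<^bsub>M\<^esub> \<phi> k) S"
  unfolding pm_value_def using M \<phi>
  by (intro cvs_finsum_mono_neutral[symmetric]) (auto simp: in_keys_iff)

lemma pm_value_closed: "pm_value M \<phi> p \<in> carrier M"
  unfolding pm_value_def using M \<phi> by simp

lemma pm_value_add: "pm_value M \<phi> (p + q) = pm_value M \<phi> p \<oplus>\<^bsub>M\<^esub> pm_value M \<phi> q"
proof -
  let ?S = "Poly_Mapping.keys p \<union> Poly_Mapping.keys q"
  have "pm_value M \<phi> (p + q) = finsum M (\<lambda>k. Poly_Mapping.lookup (p + q) k \<odot>\<^bsub>M\<^esub> \<phi> k) ?S"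
    using Poly_Mapping.keys_add[of p q] by (intro pm_value_superset) auto
  also have "\<dots> = finsum M (\<lambda>k. Poly_Mapping.lookup p k \<odot>\<^bsub>M\<^esub> \<phi> k) ?S \<oplus>\<^bsub>M\<^esub> finsum M (\<lambda>k. Poly_Mapping.lookup q k \<odot>\<^bsub>M\<^esub> \<phi> k) ?S"
    using M \<phi> by (subst cvs_finsum_add[symmetric])
      (auto intro!: cvs_finsum_cong simp: lookup_add cvs_smult_add_left)
  also have "\<dots> = pm_value M \<phi> p \<oplus>\<^bsub>M\<^esub> pm_value M \<phi> q"
    by (subst (1 2) pm_value_superset[of ?S]) auto
  finally show ?thesis .
qed

lemma pm_value_single: "pm_value M \<phi> (Poly_Mapping.single k c) = c \<odot>\<^bsub>M\<^esub> \<phi> k"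
  using pm_value_superset[of "{k}" "Poly_Mapping.single k c"] M \<phi> by simp

lemma pm_value_0: "pm_value M \<phi> 0 = \<zero>\<^bsub>M\<^esub>"
  using M by (simp add: pm_value_def)

text \<open>Subtraction in \<open>M\<close> is avoided: the value at \<open>q\<close> is added back
  and then cancelled.\<close>

lemma pm_value_diff_zeroI:
  assumes "pm_value M \<phi> p = pm_value M \<phi> q"
  shows "pm_value M \<phi> (p - q) = \<zero>\<^bsub>M\<^esub>"
proof -
  have "pm_value M \<phi> (p - q) \<oplus>\<^bsub>M\<^esub> pm_value M \<phi> q = \<zero>\<^bsub>M\<^esub> \<oplus>\<^bsub>M\<^esub> pm_value M \<phi> q"
    using assms pm_value_closed M pm_value_add[of "p - q" q] by simp
  then show ?thesis
    using cvs_add_cancel[OF M pm_value_closed cvs_closed(1)[OF M] pm_value_closed] by blast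
qed

end

definition bilin ::
    "(complex, 'v, 'p) module_scheme \<Rightarrow> (complex, 'w, 'q) module_scheme
      \<Rightarrow> (complex, 'u, 'r) module_scheme \<Rightarrow> ('v \<Rightarrow> 'w \<Rightarrow> 'u) \<Rightarrow> bool" where
  "bilin V W M \<phi> \<longleftrightarrow> (\<forall>y\<in>carrier W. linmap V M (\<lambda>x. \<phi> x y)) \<and> (\<forall>x\<in>carrier V. linmap W M (\<phi> x))"

lemma bilinI:
  "\<lbrakk>\<And>y. y \<in> carrier W \<Longrightarrow> linmap V M (\<lambda>x. \<phi> x y); \<And>x. x \<in> carrier V \<Longrightarrow> linmap W M (\<lambda>y. \<phi> x y)\<rbrakk>
    \<Longrightarrow> bilin V W M \<phi>"
  by (simp add: bilin_def)

lemma bilin_closed: "bilin V W M \<phi> \<Longrightarrow> x \<in> carrier V \<Longrightarrow> y \<in> carrier W \<Longrightarrow> \<phi> x y \<in> carrier M"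
  using linmap_closed[of V M "\<lambda>x. \<phi> x y" x] by (simp add: bilin_def)

lemma bilinD:
  "bilin V W M \<phi> \<Longrightarrow> y \<in> carrier W \<Longrightarrow> linmap V M (\<lambda>x. \<phi> x y)"
  "bilin V W M \<phi> \<Longrightarrow> x \<in> carrier V \<Longrightarrow> linmap W M (\<lambda>y. \<phi> x y)"
  by (auto simp: bilin_def)

lemma tensor_lift_simps [simp]:
  "tensor_lift M \<phi> [] = \<zero>\<^bsub>M\<^esub>"
  "tensor_lift M \<phi> ((c, x, y) # l) = c \<odot>\<^bsub>M\<^esub> \<phi> x y \<oplus>\<^bsub>M\<^esub> tensor_lift M \<phi> l"
  by (simp_all add: tensor_lift_def)

lemma tensor_lift_closed:
  assumes "l \<in> formal_sums V W" "cvs M"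
    and "\<And>x y. x \<in> carrier V \<Longrightarrow> y \<in> carrier W \<Longrightarrow> \<phi> x y \<in> carrier M"
  shows "tensor_lift M \<phi> l \<in> carrier M"
  using assms by (induction rule: formal_sums_induct) auto

lemma tensor_lift_cong:
  assumes "l \<in> formal_sums V W"
    and "\<And>x y. x \<in> carrier V \<Longrightarrow> y \<in> carrier W \<Longrightarrow> \<phi> x y = \<psi> x y"
  shows "tensor_lift M \<phi> l = tensor_lift M \<psi> l"
  using assms by (induction rule: formal_sums_induct) auto

text \<open>\<open>pm_value\<close> wants all values of its function in \<open>M\<close>, while
  \<phi> is controlled only on the carriers. Pairs outside them are sent to zero; they do not occur
  in the lists of \<open>formal_sums\<close>.\<close>

definition extend_zero ::
    "(complex, 'v, 'p) module_scheme \<Rightarrow> (complex, 'w, 'q) module_scheme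
      \<Rightarrow> (complex, 'u, 'r) module_scheme \<Rightarrow> ('v \<Rightarrow> 'w \<Rightarrow> 'u) \<Rightarrow> 'v \<times> 'w \<Rightarrow> 'u" where
  "extend_zero V W M \<phi> k =
     (if fst k \<in> carrier V \<and> snd k \<in> carrier W then \<phi> (fst k) (snd k) else \<zero>\<^bsub>M\<^esub>)"

lemma tensor_lift_pm_value:
  assumes "l \<in> formal_sums V W" "cvs M"
    and \<phi>: "\<And>x y. x \<in> carrier V \<Longrightarrow> y \<in> carrier W \<Longrightarrow> \<phi> x y \<in> carrier M"
  shows "tensor_lift M \<phi> l = pm_value M
    (extend_zero V W M \<phi>) (free_sum l)"
  using assms(1)
proof (induction rule: formal_sums_induct)
  case Nil
  then show ?case using assms(2) by (simp add: pm_value_def)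
next
  case (Cons c x y l)
  have \<psi>: "extend_zero V W M \<phi> k \<in> carrier M" for k using assms by (simp add: extend_zero_def)
  show ?case using Cons assms(2)
    by (simp add: pm_value_add[where \<phi> = "extend_zero V W M \<phi>", OF _ \<psi>] pm_value_single[where \<phi> = "extend_zero V W M \<phi>", OF _ \<psi>]
        extend_zero_def[of V W M \<phi> "(x, y)"])
qed

text \<open>Every generator of \<open>tensor_rel\<close> expresses one of the four laws of
  bilinearity, so the linear extension of a bilinear \<phi> annihilates it.\<close>

lemma pm_value_tensor_rel:
  assumes V: "cvs V" and W: "cvs W" and M: "cvs M" and \<phi>: "bilin V W M \<phi>"
    and "p \<in> tensor_rel V W"
  shows "pm_value M (extend_zero V W M \<phi>) p = \<zero>\<^bsub>M\<^esub>"
proof -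
  let ?\<psi> = "extend_zero V W M \<phi>"
  have \<psi>: "?\<psi> k \<in> carrier M" for k using M \<phi> by (auto simp: bilin_closed extend_zero_def)
  note simps [simp] = pm_value_add[where \<phi> = ?\<psi>, OF M \<psi>] pm_value_single[where \<phi> = ?\<psi>, OF M \<psi>] pm_value_0[OF M]
    V W M bilin_closed[OF \<phi>] cvs_smult_add cvs_smult_smult
    bilinD(1)[OF \<phi>, THEN linmap_add] bilinD(2)[OF \<phi>, THEN linmap_add]
    bilinD(1)[OF \<phi>, THEN linmap_smult] bilinD(2)[OF \<phi>, THEN linmap_smult] extend_zero_def[of V W M \<phi> "(a, b)" for a b]
  show ?thesis using assms(5)
  proof (induction rule: tensor_rel.induct)
    case (rel_add_left x x' y c)
    then show ?case unfolding diff_diff_eq by (intro pm_value_diff_zeroI[where \<phi> = ?\<psi>, OF M \<psi>]) simp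
  next
    case (rel_add_right x y y' c)
    then show ?case unfolding diff_diff_eq by (intro pm_value_diff_zeroI[where \<phi> = ?\<psi>, OF M \<psi>]) simp
  next
    case (rel_smult_left x y a c)
    then show ?case by (intro pm_value_diff_zeroI[where \<phi> = ?\<psi>, OF M \<psi>]) simp
  next
    case (rel_smult_right x y a c)
    then show ?case by (intro pm_value_diff_zeroI[where \<phi> = ?\<psi>, OF M \<psi>]) simp
  next
    case rel_zero
    show ?case by (rule pm_value_0[where \<phi> = ?\<psi>, OF M \<psi>])
  next
    case (rel_add p q)
    then show ?case by simp
  qed
qed

text \<open>\<open>tensor_lift\<close> reads a list, and two lists for the same tensor may differ.
  Bilinearity makes the result independent of the representative, since the difference of the free
  sums lies in \<open>tensor_rel\<close>.\<close>

lemma tensor_lift_class: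
  assumes V: "cvs V" and W: "cvs W" and M: "cvs M" and \<phi>: "bilin V W M \<phi>" and l: "l \<in> formal_sums V W"
  shows "tensor_lift M \<phi> (tensor_class V W l) = tensor_lift M \<phi> l"
proof -
  let ?\<psi> = "extend_zero V W M \<phi>"
  have \<psi>: "?\<psi> k \<in> carrier M" for k using M \<phi> by (auto simp: bilin_closed extend_zero_def)
  have "pm_value M ?\<psi> (free_sum (tensor_class V W l))
      = pm_value M ?\<psi> ((free_sum (tensor_class V W l) - free_sum l) + free_sum l)" by simp
  also have "\<dots> = pm_value M ?\<psi> (free_sum l)"
    unfolding pm_value_add[where \<phi> = ?\<psi>, OF M \<psi>] pm_value_tensor_rel[OF V W M \<phi> tensor_class_rel[OF l]]
    using pm_value_closed[where \<phi> = ?\<psi>, OF M \<psi>] M by simp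
  finally show ?thesis using M l \<phi> tensor_class_closed[OF l]
    by (simp add: tensor_lift_pm_value bilin_closed)
qed

lemma tensor_lift_append:
  assumes "l \<in> formal_sums V W" "m \<in> formal_sums V W" "cvs M"
    and "\<And>x y. x \<in> carrier V \<Longrightarrow> y \<in> carrier W \<Longrightarrow> \<phi> x y \<in> carrier M"
  shows "tensor_lift M \<phi> (l @ m) = tensor_lift M \<phi> l \<oplus>\<^bsub>M\<^esub> tensor_lift M \<phi> m"
  using assms
  by (induction rule: formal_sums_induct) (auto simp: cvs_add_assoc tensor_lift_closed)

lemma tensor_lift_scale:
  assumes "l \<in> formal_sums V W" "cvs M"
    and "\<And>x y. x \<in> carrier V \<Longrightarrow> y \<in> carrier W \<Longrightarrow> \<phi> x y \<in> carrier M"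
  shows "tensor_lift M \<phi> (scale_sum a l) = a \<odot>\<^bsub>M\<^esub> tensor_lift M \<phi> l"
  using assms
  by (induction rule: formal_sums_induct) (auto simp: cvs_smult_add cvs_smult_smult tensor_lift_closed)

lemma linmap_tensor_lift:
  assumes V: "cvs V" and W: "cvs W" and M: "cvs M" and \<phi>: "bilin V W M \<phi>"
  shows "linmap (tensor V W) M (tensor_lift M \<phi>)"
proof (rule linmapI)
  note closed = bilin_closed[OF \<phi>]
  fix u v assume u: "u \<in> carrier (tensor V W)"
  then show "tensor_lift M \<phi> u \<in> carrier M"
    using M closed by (auto simp: carrier_tensor_iff intro: tensor_lift_closed)
  show "tensor_lift M \<phi> (a \<odot>\<^bsub>tensor V W\<^esub> u) = a \<odot>\<^bsub>M\<^esub> tensor_lift M \<phi> u" for a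
    using u M closed
    by (simp add: carrier_tensor_iff tensor_simps tensor_lift_class[OF assms] tensor_lift_scale[of _ V W])
  assume v: "v \<in> carrier (tensor V W)"
  show "tensor_lift M \<phi> (u \<oplus>\<^bsub>tensor V W\<^esub> v) = tensor_lift M \<phi> u \<oplus>\<^bsub>M\<^esub> tensor_lift M \<phi> v"
    using u v M closed
    by (simp add: carrier_tensor_iff tensor_simps tensor_lift_class[OF assms] tensor_lift_append[of _ V W])
qed

lemma tensor_lift_pure:
  assumes "cvs V" "cvs W" "cvs M" "bilin V W M \<phi>" "x \<in> carrier V" "y \<in> carrier W"
  shows "tensor_lift M \<phi> (pure_tensor V W x y) = \<phi> x y"
  using assms by (simp add: pure_tensor_def tensor_lift_class bilin_closed)

text \<open>On a given list the lift is a finite sum, so linearity of \<open>f\<close> alone carries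
  it inside. This is how maps are moved past operators that are sums over t.\<close>

lemma linmap_comp_tensor_lift:
  assumes "linmap M N f" "cvs M" "cvs N" "l \<in> formal_sums V W"
    and "\<And>x y. x \<in> carrier V \<Longrightarrow> y \<in> carrier W \<Longrightarrow> \<phi> x y \<in> carrier M"
  shows "f (tensor_lift M \<phi> l) = tensor_lift N (\<lambda>x y. f (\<phi> x y)) l"
  using assms(4,5)
  by (induction rule: formal_sums_induct)
    (auto simp: assms(1-3) linmap_zero[OF assms(1)] linmap_add[OF assms(1)] linmap_smult[OF assms(1)]
      tensor_lift_closed)

lemma tensor_lift_plus:
  assumes "l \<in> formal_sums V W" "cvs M"
    and "\<And>x y. x \<in> carrier V \<Longrightarrow> y \<in> carrier W \<Longrightarrow> \<phi> x y \<in> carrier M"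
    and "\<And>x y. x \<in> carrier V \<Longrightarrow> y \<in> carrier W \<Longrightarrow> \<psi> x y \<in> carrier M"
  shows "tensor_lift M (\<lambda>x y. \<phi> x y \<oplus>\<^bsub>M\<^esub> \<psi> x y) l = tensor_lift M \<phi> l \<oplus>\<^bsub>M\<^esub> tensor_lift M \<psi> l"
  using assms
  by (induction rule: formal_sums_induct) (auto simp: cvs_smult_add cvs_add_add tensor_lift_closed)

lemma tensor_lift_zero:
  assumes "l \<in> formal_sums V W" "cvs M"
    and "\<And>x y. x \<in> carrier V \<Longrightarrow> y \<in> carrier W \<Longrightarrow> \<phi> x y = \<zero>\<^bsub>M\<^esub>"
  shows "tensor_lift M \<phi> l = \<zero>\<^bsub>M\<^esub>"
  using assms by (induction rule: formal_sums_induct) auto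

text \<open>Linearity in a parameter: on a fixed list the lift is a finite linear combination of
  linear maps of \<open>u\<close>. For the list t it shows that t acts by linear operators.\<close>

lemma linmap_of_tensor_lift:
  assumes "l \<in> formal_sums V W" "cvs N"
    and "\<And>x y. x \<in> carrier V \<Longrightarrow> y \<in> carrier W \<Longrightarrow> linmap M N (\<lambda>u. \<phi> u x y)"
  shows "linmap M N (\<lambda>u. tensor_lift N (\<phi> u) l)"
  using assms
  by (induction rule: formal_sums_induct) (auto intro!: linmap_plus linmap_scale linmap_zero_map)

lemma pure_tensor_carrier [simp]:
  "x \<in> carrier V \<Longrightarrow> y \<in> carrier W \<Longrightarrow> pure_tensor V W x y \<in> carrier (tensor V W)"
  by (simp add: pure_tensor_def tensor_class_carrier)

text \<open>The laws of bilinearity are the generators of \<open>tensor_rel\<close> with coefficient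
  1, read as equalities of representatives.\<close>

lemma bilin_pure_tensor:
  assumes V: "cvs V" and W: "cvs W"
  shows "bilin V W (tensor V W) (pure_tensor V W)"
proof -
  have *: "free_sum [(1, x, y)] - free_sum [(1, x', y'), (1, x'', y'')] =
      Poly_Mapping.single (x, y) (1 :: complex) - Poly_Mapping.single (x', y') 1 - Poly_Mapping.single (x'', y'') 1"
    for x x' x'' :: 'a and y y' y'' :: 'c by simp
  show ?thesis
    by (intro bilinI linmapI)
      (use assms in \<open>auto simp: pure_tensor_def tensor_class_sum tensor_class_carrier intro!: tensor_class_cong\<close>,
       use rel_add_left[of _ V _ _ W 1] rel_add_right[of _ V _ W _ 1] rel_smult_left[of _ V _ W _ 1]
        rel_smult_right[of _ V _ W _ 1] * in \<open>auto simp: diff_diff_eq\<close>)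
qed

text \<open>Every nonempty list splits off its head as a scaled pure tensor, so pure tensors
  span.\<close>

lemma linmap_tensor_unique:
  assumes "cvs M" "linmap (tensor V W) M f" "linmap (tensor V W) M g"
    and pure: "\<And>x y. x \<in> carrier V \<Longrightarrow> y \<in> carrier W \<Longrightarrow> f (pure_tensor V W x y) = g (pure_tensor V W x y)"
    and u: "u \<in> carrier (tensor V W)"
  shows "f u = g u"
proof -
  note f = linmap_zero[OF assms(2)] linmap_add[OF assms(2)] linmap_smult[OF assms(2)]
  note g = linmap_zero[OF assms(3)] linmap_add[OF assms(3)] linmap_smult[OF assms(3)]
  have "f (tensor_class V W l) = g (tensor_class V W l)" if "l \<in> formal_sums V W" for l
    using that
  proof (induction rule: formal_sums_induct)
    case Nil
    then show ?case using f(1) g(1) assms(1) by (simp add: tensor_simps)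
  next
    case (Cons c x y l)
    then have "tensor_class V W ((c, x, y) # l)
        = c \<odot>\<^bsub>tensor V W\<^esub> pure_tensor V W x y \<oplus>\<^bsub>tensor V W\<^esub> tensor_class V W l"
      by (simp add: pure_tensor_def tensor_class_sum)
    then show ?case using Cons f(2,3) g(2,3) assms(1) pure by (simp add: tensor_class_carrier)
  qed
  from this[of u] show ?thesis using u by (simp add: carrier_tensor_iff)
qed

subsection \<open>Tensor products of Lie modules\<close>

lemma tensor_module_simps:
  "carrier (X \<boxtimes> Y) = Tensor ` carrier (tensor X Y)"
  "\<zero>\<^bsub>X \<boxtimes> Y\<^esub> = Tensor \<zero>\<^bsub>tensor X Y\<^esub>"
  "Tensor u \<oplus>\<^bsub>X \<boxtimes> Y\<^esub> Tensor v = Tensor (u \<oplus>\<^bsub>tensor X Y\<^esub> v)"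
  "c \<odot>\<^bsub>X \<boxtimes> Y\<^esub> Tensor u = Tensor (c \<odot>\<^bsub>tensor X Y\<^esub> u)"
  by (simp_all add: tensor_module_def)

lemma cvs_tensor_module [simp]: "cvs (X \<boxtimes> Y)"
  by (rule cvsI) (auto simp: tensor_module_simps cvs_add_assoc cvs_smult_add cvs_smult_add_left
    cvs_smult_smult intro: cvs_add_comm[OF cvs_tensor])

lemma linmap_Tensor: "linmap (tensor X Y) (X \<boxtimes> Y) Tensor"
  by (rule linmapI) (auto simp: tensor_module_simps)

lemma linmap_untensor: "linmap (X \<boxtimes> Y) (tensor X Y) untensor"
  by (rule linmapI) (auto simp: tensor_module_simps)

lemma elem_tensor_closed [simp]:
  "x \<in> carrier X \<Longrightarrow> y \<in> carrier Y \<Longrightarrow> elem_tensor X Y x y \<in> carrier (X \<boxtimes> Y)"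
  by (simp add: elem_tensor_def tensor_module_simps)

lemma bilin_elem_tensor: "cvs X \<Longrightarrow> cvs Y \<Longrightarrow> bilin X Y (X \<boxtimes> Y) (elem_tensor X Y)"
  unfolding elem_tensor_def
  by (intro bilinI linmap_comp[OF linmap_Tensor]) (auto intro: bilinD bilin_pure_tensor)

lemma linmap_tlift:
  "\<lbrakk>cvs X; cvs Y; cvs M; bilin X Y M \<phi>\<rbrakk> \<Longrightarrow> linmap (X \<boxtimes> Y) M (\<lambda>u. tensor_lift M \<phi> (untensor u))"
  by (intro linmap_comp[OF linmap_tensor_lift linmap_untensor])

lemma tlift_elem:
  "\<lbrakk>cvs X; cvs Y; cvs M; bilin X Y M \<phi>; x \<in> carrier X; y \<in> carrier Y\<rbrakk>
    \<Longrightarrow> tensor_lift M \<phi> (untensor (elem_tensor X Y x y)) = \<phi> x y"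
  by (simp add: elem_tensor_def tensor_lift_pure)

text \<open>The form in which spanning by pure tensors is used: identities between structural maps
  are reduced by this rule to a computation on pure tensors.\<close>

lemma linmap_tensor_ext:
  assumes "cvs M" "linmap (X \<boxtimes> Y) M f" "linmap (X \<boxtimes> Y) M g"
    and "\<And>x y. x \<in> carrier X \<Longrightarrow> y \<in> carrier Y \<Longrightarrow> f (elem_tensor X Y x y) = g (elem_tensor X Y x y)"
    and u: "u \<in> carrier (X \<boxtimes> Y)"
  shows "f u = g u"
proof -
  have "f (Tensor v) = g (Tensor v)" if "v \<in> carrier (tensor X Y)" for v
    by (rule linmap_tensor_unique[OF assms(1), where f = "\<lambda>v. f (Tensor v)"])
      (use assms that in \<open>auto simp: elem_tensor_def intro: linmap_comp[OF _ linmap_Tensor]\<close>)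
  then show ?thesis using u by (auto simp: tensor_module_simps)
qed

lemma linmap_restrict: "linmap M N f \<Longrightarrow> cvs M \<Longrightarrow> linmap M N (restrict f (carrier M))"
  by (simp add: linmap_def)

lemma linmap_module_lift:
  "\<lbrakk>cvs X; cvs Y; cvs M; bilin X Y M \<phi>\<rbrakk> \<Longrightarrow> linmap (X \<boxtimes> Y) M (module_lift X Y M \<phi>)"
  unfolding module_lift_def by (intro linmap_restrict linmap_tlift) auto

lemma module_lift_elem:
  "\<lbrakk>cvs X; cvs Y; cvs M; bilin X Y M \<phi>; x \<in> carrier X; y \<in> carrier Y\<rbrakk>
    \<Longrightarrow> module_lift X Y M \<phi> (elem_tensor X Y x y) = \<phi> x y"
  by (simp add: module_lift_def tlift_elem)

lemma bilin_elem_maps: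
  "\<lbrakk>cvs X'; cvs Y'; linmap X X' f; linmap Y Y' g\<rbrakk>
    \<Longrightarrow> bilin X Y (X' \<boxtimes> Y') (\<lambda>x y. elem_tensor X' Y' (f x) (g y))"
  by (intro bilinI linmap_comp[OF bilinD(1)[OF bilin_elem_tensor]] linmap_comp[OF bilinD(2)[OF bilin_elem_tensor]])
    (auto simp: linmap_closed)

lemma linmap_elem_left: "\<lbrakk>cvs X; cvs Y; y \<in> carrier Y\<rbrakk> \<Longrightarrow> linmap X (X \<boxtimes> Y) (\<lambda>x. elem_tensor X Y x y)"
  by (rule bilinD(1)[OF bilin_elem_tensor])

lemma linmap_elem_right: "\<lbrakk>cvs X; cvs Y; x \<in> carrier X\<rbrakk> \<Longrightarrow> linmap Y (X \<boxtimes> Y) (elem_tensor X Y x)"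
  by (rule bilinD(2)[OF bilin_elem_tensor])

lemma linmap_map_tensor:
  "\<lbrakk>cvs X; cvs Y; cvs X'; cvs Y'; linmap X X' f; linmap Y Y' g\<rbrakk>
    \<Longrightarrow> linmap (X \<boxtimes> Y) (X' \<boxtimes> Y') (map_tensor X Y X' Y' f g)"
  unfolding map_tensor_def by (intro linmap_module_lift bilin_elem_maps) auto

lemma map_tensor_elem [simp]:
  "\<lbrakk>cvs X; cvs Y; cvs X'; cvs Y'; linmap X X' f; linmap Y Y' g; x \<in> carrier X; y \<in> carrier Y\<rbrakk>
    \<Longrightarrow> map_tensor X Y X' Y' f g (elem_tensor X Y x y) = elem_tensor X' Y' (f x) (g y)"
  unfolding map_tensor_def by (subst module_lift_elem) (auto intro: bilin_elem_maps)

lemma linmap_flip_tensor: "\<lbrakk>cvs X; cvs Y\<rbrakk> \<Longrightarrow> linmap (X \<boxtimes> Y) (Y \<boxtimes> X) (flip_tensor X Y)"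
  unfolding flip_tensor_def
  by (intro linmap_module_lift bilinI) (auto intro: linmap_elem_left linmap_elem_right)

lemma flip_tensor_elem [simp]:
  "\<lbrakk>cvs X; cvs Y; x \<in> carrier X; y \<in> carrier Y\<rbrakk> \<Longrightarrow> flip_tensor X Y (elem_tensor X Y x y) = elem_tensor Y X y x"
  unfolding flip_tensor_def
  by (subst module_lift_elem) (auto intro!: bilinI intro: linmap_elem_left linmap_elem_right)

text \<open>The associativity map is a lift of a lift whose inner bilinear map still depends on the
  outer variable; this gives linearity in that variable.\<close>

lemma linmap_module_lift_parameter:
  assumes "cvs X" "cvs Y" "cvs M" "u \<in> carrier (X \<boxtimes> Y)"
    and "\<And>x y. x \<in> carrier X \<Longrightarrow> y \<in> carrier Y \<Longrightarrow> linmap Z M (\<lambda>z. \<phi> z x y)"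
  shows "linmap Z M (\<lambda>z. module_lift X Y M (\<phi> z) u)"
proof -
  have "untensor u \<in> formal_sums X Y" using assms(4) by (auto simp: tensor_module_simps carrier_tensor_iff)
  then show ?thesis using assms by (auto simp: module_lift_def intro!: linmap_of_tensor_lift)
qed

lemma bilin_triple:
  assumes "cvs X" "cvs Y" "cvs Z"
  shows "z \<in> carrier Z \<Longrightarrow> bilin X Y (X \<boxtimes> (Y \<boxtimes> Z)) (\<lambda>x y. elem_tensor X (Y \<boxtimes> Z) x (elem_tensor Y Z y z))"
    and "x \<in> carrier X \<Longrightarrow> bilin Y Z ((X \<boxtimes> Y) \<boxtimes> Z) (\<lambda>y z. elem_tensor (X \<boxtimes> Y) Z (elem_tensor X Y x y) z)"
  using assms
  by (auto intro!: bilinI linmap_elem_left linmap_elem_right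
      linmap_comp[OF linmap_elem_left[of X Y]] linmap_comp[OF linmap_elem_left[of "X \<boxtimes> Y" Z]]
      linmap_comp[OF linmap_elem_right[of X "Y \<boxtimes> Z"]])

lemma bilin_assoc:
  assumes "cvs X" "cvs Y" "cvs Z"
  shows "bilin (X \<boxtimes> Y) Z (X \<boxtimes> (Y \<boxtimes> Z)) (\<lambda>u z. module_lift X Y (X \<boxtimes> (Y \<boxtimes> Z))
         (\<lambda>x y. elem_tensor X (Y \<boxtimes> Z) x (elem_tensor Y Z y z)) u)"
  using assms
  by (intro bilinI linmap_module_lift bilin_triple linmap_module_lift_parameter
      linmap_comp[OF linmap_elem_right[of X "Y \<boxtimes> Z"]] linmap_elem_right) auto

lemma linmap_assoc_tensor:
  "\<lbrakk>cvs X; cvs Y; cvs Z\<rbrakk> \<Longrightarrow> linmap ((X \<boxtimes> Y) \<boxtimes> Z) (X \<boxtimes> (Y \<boxtimes> Z)) (assoc_tensor X Y Z)"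
  unfolding assoc_tensor_def by (intro linmap_module_lift bilin_assoc) auto

lemma assoc_tensor_elem [simp]:
  "\<lbrakk>cvs X; cvs Y; cvs Z; x \<in> carrier X; y \<in> carrier Y; z \<in> carrier Z\<rbrakk> \<Longrightarrow>
    assoc_tensor X Y Z (elem_tensor (X \<boxtimes> Y) Z (elem_tensor X Y x y) z)
    = elem_tensor X (Y \<boxtimes> Z) x (elem_tensor Y Z y z)"
  unfolding assoc_tensor_def by (simp add: module_lift_elem bilin_assoc bilin_triple)

text \<open>An explicit inverse of the rebracketing is required because the associator must be an
  isomorphism and the second hexagon is stated with inverse associators.\<close>

definition assoc_tensor_inv ::
    "('l, 'a) umod \<Rightarrow> ('l, 'a) umod \<Rightarrow> ('l, 'a) umod \<Rightarrow> 'a tuniv \<Rightarrow> 'a tuniv" where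
  "assoc_tensor_inv X Y Z =
     module_lift X (Y \<boxtimes> Z) ((X \<boxtimes> Y) \<boxtimes> Z)
       (\<lambda>x u. module_lift Y Z ((X \<boxtimes> Y) \<boxtimes> Z)
         (\<lambda>y z. elem_tensor (X \<boxtimes> Y) Z (elem_tensor X Y x y) z) u)"

lemma bilin_assoc_inv:
  assumes "cvs X" "cvs Y" "cvs Z"
  shows "bilin X (Y \<boxtimes> Z) ((X \<boxtimes> Y) \<boxtimes> Z) (\<lambda>x u. module_lift Y Z ((X \<boxtimes> Y) \<boxtimes> Z)
         (\<lambda>y z. elem_tensor (X \<boxtimes> Y) Z (elem_tensor X Y x y) z) u)"
  using assms
  by (intro bilinI linmap_module_lift bilin_triple linmap_module_lift_parameter
      linmap_comp[OF linmap_elem_left[of "X \<boxtimes> Y" Z]] linmap_elem_left) auto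

lemma linmap_assoc_tensor_inv:
  "\<lbrakk>cvs X; cvs Y; cvs Z\<rbrakk> \<Longrightarrow> linmap (X \<boxtimes> (Y \<boxtimes> Z)) ((X \<boxtimes> Y) \<boxtimes> Z) (assoc_tensor_inv X Y Z)"
  unfolding assoc_tensor_inv_def by (intro linmap_module_lift bilin_assoc_inv) auto

lemma assoc_tensor_inv_elem [simp]:
  "\<lbrakk>cvs X; cvs Y; cvs Z; x \<in> carrier X; y \<in> carrier Y; z \<in> carrier Z\<rbrakk> \<Longrightarrow>
    assoc_tensor_inv X Y Z (elem_tensor X (Y \<boxtimes> Z) x (elem_tensor Y Z y z))
    = elem_tensor (X \<boxtimes> Y) Z (elem_tensor X Y x y) z"
  unfolding assoc_tensor_inv_def by (simp add: module_lift_elem bilin_assoc_inv bilin_triple)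

text \<open>With the last factor frozen, both sides are linear maps on
  \<open>X \<boxtimes> Y\<close>, and extensionality applies a second time.\<close>

lemma linmap_tensor_ext3:
  assumes "cvs X" "cvs Y" "cvs Z" "cvs M" "linmap ((X \<boxtimes> Y) \<boxtimes> Z) M f" "linmap ((X \<boxtimes> Y) \<boxtimes> Z) M g"
    and "\<And>x y z. \<lbrakk>x \<in> carrier X; y \<in> carrier Y; z \<in> carrier Z\<rbrakk> \<Longrightarrow>
      f (elem_tensor (X \<boxtimes> Y) Z (elem_tensor X Y x y) z) = g (elem_tensor (X \<boxtimes> Y) Z (elem_tensor X Y x y) z)"
    and u: "u \<in> carrier ((X \<boxtimes> Y) \<boxtimes> Z)"
  shows "f u = g u"
proof (rule linmap_tensor_ext[OF assms(4-6) _ u])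
  fix v z assume v: "v \<in> carrier (X \<boxtimes> Y)" and z: "z \<in> carrier Z"
  show "f (elem_tensor (X \<boxtimes> Y) Z v z) = g (elem_tensor (X \<boxtimes> Y) Z v z)"
    by (rule linmap_tensor_ext[OF assms(4) _ _ _ v])
      (use assms z in \<open>auto intro: linmap_comp[OF _ linmap_elem_left]\<close>)
qed

lemma linmap_tensor_ext3':
  assumes "cvs X" "cvs Y" "cvs Z" "cvs M" "linmap (X \<boxtimes> (Y \<boxtimes> Z)) M f" "linmap (X \<boxtimes> (Y \<boxtimes> Z)) M g"
    and "\<And>x y z. \<lbrakk>x \<in> carrier X; y \<in> carrier Y; z \<in> carrier Z\<rbrakk> \<Longrightarrow>
      f (elem_tensor X (Y \<boxtimes> Z) x (elem_tensor Y Z y z)) = g (elem_tensor X (Y \<boxtimes> Z) x (elem_tensor Y Z y z))"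
    and u: "u \<in> carrier (X \<boxtimes> (Y \<boxtimes> Z))"
  shows "f u = g u"
proof (rule linmap_tensor_ext[OF assms(4-6) _ u])
  fix x v assume x: "x \<in> carrier X" and v: "v \<in> carrier (Y \<boxtimes> Z)"
  show "f (elem_tensor X (Y \<boxtimes> Z) x v) = g (elem_tensor X (Y \<boxtimes> Z) x v)"
    by (rule linmap_tensor_ext[OF assms(4) _ _ _ v])
      (use assms x in \<open>auto intro: linmap_comp[OF _ linmap_elem_right]\<close>)
qed

lemma linmap_tensor_ext4:
  assumes "cvs W" "cvs X" "cvs Y" "cvs Z" "cvs M"
    "linmap (((W \<boxtimes> X) \<boxtimes> Y) \<boxtimes> Z) M f" "linmap (((W \<boxtimes> X) \<boxtimes> Y) \<boxtimes> Z) M g"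
    and "\<And>w x y z. \<lbrakk>w \<in> carrier W; x \<in> carrier X; y \<in> carrier Y; z \<in> carrier Z\<rbrakk> \<Longrightarrow>
      f (elem_tensor ((W \<boxtimes> X) \<boxtimes> Y) Z (elem_tensor (W \<boxtimes> X) Y (elem_tensor W X w x) y) z)
      = g (elem_tensor ((W \<boxtimes> X) \<boxtimes> Y) Z (elem_tensor (W \<boxtimes> X) Y (elem_tensor W X w x) y) z)"
    and u: "u \<in> carrier (((W \<boxtimes> X) \<boxtimes> Y) \<boxtimes> Z)"
  shows "f u = g u"
proof (rule linmap_tensor_ext[OF assms(5-7) _ u])
  fix v z assume v: "v \<in> carrier ((W \<boxtimes> X) \<boxtimes> Y)" and z: "z \<in> carrier Z"
  show "f (elem_tensor ((W \<boxtimes> X) \<boxtimes> Y) Z v z) = g (elem_tensor ((W \<boxtimes> X) \<boxtimes> Y) Z v z)"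
    by (rule linmap_tensor_ext3[OF assms(1-3,5) _ _ _ v])
      (use assms z in \<open>auto intro: linmap_comp[OF _ linmap_elem_left]\<close>)
qed

section \<open>Formal power series of linear maps\<close>

text \<open>An arrow stripped of equivariance. Composition, tensor products and their laws hold for
  all series of linear maps, so equivariance can be added later as a separate condition. The
  coefficients are extensional so that equal maps give equal records.\<close>

definition lin_hmap :: "('l, 'a) hmap \<Rightarrow> ('l, 'a) umod \<Rightarrow> ('l, 'a) umod \<Rightarrow> bool" where
  "lin_hmap f X Y \<longleftrightarrow> cvs X \<and> cvs Y \<and> source f = X \<and> target f = Y \<and>
     (\<forall>n. linmap X Y (terms f n) \<and> terms f n \<in> extensional (carrier X))"

notation comp_hmap (infixl \<open>\<circ>\<^sub>h\<close> 55)
notation tensor_hmap (infixr \<open>\<otimes>\<^sub>h\<close> 70)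

abbreviation id_hmap :: "('l, 'a) umod \<Rightarrow> ('l, 'a) hmap" where
  "id_hmap X \<equiv> const_hmap X X (\<lambda>x. x)"

lemma lin_hmapD:
  assumes "lin_hmap f X Y"
  shows "cvs X" "cvs Y" "source f = X" "target f = Y" "linmap X Y (terms f n)"
    "terms f n \<in> extensional (carrier X)" "x \<in> carrier X \<Longrightarrow> terms f n x \<in> carrier Y"
  using assms by (auto simp: lin_hmap_def intro: linmap_closed)

lemma hmap_eqI:
  assumes "lin_hmap f X Y" "lin_hmap g X Y"
    and "\<And>n x. x \<in> carrier X \<Longrightarrow> terms f n x = terms g n x"
  shows "f = g"
proof (rule hmap.equality)
  show "terms f = terms g"
  proof (intro ext)
    fix n x
    show "terms f n x = terms g n x"
      using assms lin_hmapD(6)[OF assms(1)] lin_hmapD(6)[OF assms(2)]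
      by (cases "x \<in> carrier X") (auto simp: extensional_def)
  qed
qed (use assms in \<open>auto simp: lin_hmap_def\<close>)

lemma hmap_tensor_eqI:
  assumes "lin_hmap f (X \<boxtimes> Y) M" "lin_hmap g (X \<boxtimes> Y) M"
    and "\<And>n x y. x \<in> carrier X \<Longrightarrow> y \<in> carrier Y \<Longrightarrow>
      terms f n (elem_tensor X Y x y) = terms g n (elem_tensor X Y x y)"
  shows "f = g"
proof (rule hmap_eqI[OF assms(1,2)])
  fix n u assume u: "u \<in> carrier (X \<boxtimes> Y)"
  show "terms f n u = terms g n u"
    by (rule linmap_tensor_ext[OF lin_hmapD(2)[OF assms(1)] lin_hmapD(5)[OF assms(1)]
      lin_hmapD(5)[OF assms(2)] assms(3) u])
qed

lemma terms_comp:
  assumes "lin_hmap f X Y" "lin_hmap g Y Z" "x \<in> carrier X"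
  shows "terms (g \<circ>\<^sub>h f) n x = finsum Z (\<lambda>k. terms g k (terms f (n - k) x)) {..n}"
  using assms(3) by (simp add: comp_hmap_def lin_hmapD(3,4)[OF assms(1)] lin_hmapD(3,4)[OF assms(2)])

lemma lin_hmap_comp [intro]:
  assumes f: "lin_hmap f X Y" and g: "lin_hmap g Y Z"
  shows "lin_hmap (g \<circ>\<^sub>h f) X Z"
proof -
  have "linmap X Z (\<lambda>x. terms g k (terms f (n - k) x))" for k n
    using lin_hmapD(5)[OF f] lin_hmapD(5)[OF g] by (rule linmap_comp[rotated])
  then show ?thesis
    using lin_hmapD(1-4)[OF f] lin_hmapD(1-4)[OF g]
    by (auto simp: lin_hmap_def comp_hmap_def intro!: linmap_restrict linmap_finsum_maps)
qed

lemma comp_hmap_assoc: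
  assumes f: "lin_hmap f W X" and g: "lin_hmap g X Y" and h: "lin_hmap h Y Z"
  shows "h \<circ>\<^sub>h g \<circ>\<^sub>h f = h \<circ>\<^sub>h (g \<circ>\<^sub>h f)"
proof (rule hmap_eqI)
  fix n x assume x: "x \<in> carrier W"
  note D = lin_hmapD[OF f] lin_hmapD[OF g] lin_hmapD[OF h]
  have "terms (h \<circ>\<^sub>h g \<circ>\<^sub>h f) n x
      = finsum Z (\<lambda>k. finsum Z (\<lambda>j. terms h j (terms g (k - j) (terms f (n - k) x))) {..k}) {..n}"
    using x by (simp add: terms_comp[OF f lin_hmap_comp[OF g h]] terms_comp[OF g h] D)
  \<comment> \<open>Writing n - k as (n - j) - (k - j), valid for j \<le> k \<le> n, makes the
    summand a function of j and k - j, the shape required for exchanging the sums.\<close>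
  also have "\<dots> = finsum Z (\<lambda>k. finsum Z (\<lambda>j. terms h j (terms g (k - j) (terms f (n - j - (k - j)) x))) {..k}) {..n}"
    using x by (intro cvs_finsum_cong) (auto simp: D intro!: cvs_finsum(1))
  also have "\<dots> = finsum Z (\<lambda>j. finsum Z (\<lambda>i. terms h j (terms g i (terms f (n - j - i) x))) {..n - j}) {..n}"
    using x by (intro cvs_finsum_triangle[where f = "\<lambda>j i. terms h j (terms g i (terms f (n - j - i) x))"])
      (simp_all add: D)
  also have "\<dots> = finsum Z (\<lambda>j. terms h j (finsum Y (\<lambda>i. terms g i (terms f (n - j - i) x)) {..n - j})) {..n}"
    using x by (intro cvs_finsum_cong linmap_finsum[symmetric])
      (auto simp: D intro!: D linmap_closed[of Y Z "terms h _"] cvs_finsum(1))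
  also have "\<dots> = terms (h \<circ>\<^sub>h (g \<circ>\<^sub>h f)) n x"
    using x by (simp add: terms_comp[OF lin_hmap_comp[OF f g] h] terms_comp[OF f g])
  finally show "terms (h \<circ>\<^sub>h g \<circ>\<^sub>h f) n x = terms (h \<circ>\<^sub>h (g \<circ>\<^sub>h f)) n x" .
qed (use assms in auto)

lemma lin_hmap_const [intro]:
  "\<lbrakk>cvs X; cvs Y; linmap X Y p\<rbrakk> \<Longrightarrow> lin_hmap (const_hmap X Y p) X Y"
  by (auto simp: lin_hmap_def const_hmap_def intro!: linmap_restrict)
    (auto simp: linmap_def)

lemma lin_hmap_id [intro, simp]: "cvs X \<Longrightarrow> lin_hmap (id_hmap X) X X"
  by (simp add: lin_hmap_const linmap_id)

lemma terms_const: "x \<in> carrier X \<Longrightarrow> terms (const_hmap X Y p) n x = (if n = 0 then p x else \<zero>\<^bsub>Y\<^esub>)"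
  by (simp add: const_hmap_def)

text \<open>A map constant in \<hbar> lives in degree 0, so the Cauchy product keeps a single
  term.\<close>

lemma terms_const_comp:
  assumes f: "lin_hmap f X Y" and p: "linmap Y Z p" and "cvs Z" and x: "x \<in> carrier X"
  shows "terms (const_hmap Y Z p \<circ>\<^sub>h f) n x = p (terms f n x)"
proof -
  note D = lin_hmapD[OF f] assms linmap_closed[OF p]
  have "terms (const_hmap Y Z p \<circ>\<^sub>h f) n x
      = finsum Z (\<lambda>k. terms (const_hmap Y Z p) k (terms f (n - k) x)) {..n}"
    using D by (intro terms_comp[OF f lin_hmap_const]) auto
  also have "\<dots> = terms (const_hmap Y Z p) 0 (terms f (n - 0) x)"
    by (intro cvs_finsum_single) (auto simp: D terms_const)
  finally show ?thesis by (simp add: terms_const D)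
qed

lemma terms_comp_const:
  assumes f: "lin_hmap f Y Z" and p: "linmap X Y p" and "cvs X" and x: "x \<in> carrier X"
  shows "terms (f \<circ>\<^sub>h const_hmap X Y p) n x = terms f n (p x)"
proof -
  note D = lin_hmapD[OF f] assms linmap_closed[OF p]
  have "terms (f \<circ>\<^sub>h const_hmap X Y p) n x
      = finsum Z (\<lambda>k. terms f k (terms (const_hmap X Y p) (n - k) x)) {..n}"
    using D by (intro terms_comp[OF lin_hmap_const f]) auto
  also have "\<dots> = terms f n (terms (const_hmap X Y p) (n - n) x)"
    by (intro cvs_finsum_single) (auto simp: D terms_const linmap_zero)
  finally show ?thesis by (simp add: terms_const D)
qed

lemma comp_id_hmap [simp]: "lin_hmap f X Y \<Longrightarrow> f \<circ>\<^sub>h id_hmap X = f"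
  by (rule hmap_eqI[of _ X Y]) (auto simp: terms_comp_const linmap_id lin_hmapD(1) intro!: lin_hmap_comp[of _ X X])

lemma id_comp_hmap [simp]: "lin_hmap f X Y \<Longrightarrow> id_hmap Y \<circ>\<^sub>h f = f"
  by (rule hmap_eqI[of _ X Y]) (auto simp: terms_const_comp linmap_id lin_hmapD(2) intro!: lin_hmap_comp[of f X Y])

lemma const_hmap_cong:
  "(\<And>x. x \<in> carrier X \<Longrightarrow> p x = q x) \<Longrightarrow> const_hmap X Y p = const_hmap X Y q"
  by (auto simp: const_hmap_def intro!: ext)

lemma const_comp_const:
  assumes "cvs X" "cvs Y" "cvs Z" "linmap X Y p" "linmap Y Z q"
  shows "const_hmap Y Z q \<circ>\<^sub>h const_hmap X Y p = const_hmap X Z (\<lambda>x. q (p x))"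
proof (rule hmap_eqI)
  have l: "lin_hmap (const_hmap X Y p) X Y" "lin_hmap (const_hmap Y Z q) Y Z" using assms by auto
  show "lin_hmap (const_hmap Y Z q \<circ>\<^sub>h const_hmap X Y p) X Z" using l by (rule lin_hmap_comp)
  show "lin_hmap (const_hmap X Z (\<lambda>x. q (p x))) X Z"
    using assms by (auto intro!: lin_hmap_const linmap_comp[of Y Z q])
  fix n x assume "x \<in> carrier X"
  then show "terms (const_hmap Y Z q \<circ>\<^sub>h const_hmap X Y p) n x = terms (const_hmap X Z (\<lambda>x. q (p x))) n x"
    using assms terms_const_comp[OF l(1) assms(5,3)] linmap_zero[OF assms(5)] by (simp add: terms_const)
qed

lemma lin_hmap_tensor [intro]:
  assumes "lin_hmap f X X'" "lin_hmap g Y Y'"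
  shows "lin_hmap (f \<otimes>\<^sub>h g) (X \<boxtimes> Y) (X' \<boxtimes> Y')"
  using assms
  by (auto simp: lin_hmap_def tensor_hmap_def intro!: linmap_restrict linmap_finsum_maps linmap_map_tensor)

lemma terms_tensor_elem:
  assumes f: "lin_hmap f X X'" and g: "lin_hmap g Y Y'" and "x \<in> carrier X" "y \<in> carrier Y"
  shows "terms (f \<otimes>\<^sub>h g) n (elem_tensor X Y x y)
    = finsum (X' \<boxtimes> Y') (\<lambda>k. elem_tensor X' Y' (terms f k x) (terms g (n - k) y)) {..n}"
proof -
  have "terms (f \<otimes>\<^sub>h g) n (elem_tensor X Y x y) = finsum (X' \<boxtimes> Y')
      (\<lambda>k. map_tensor X Y X' Y' (terms f k) (terms g (n - k)) (elem_tensor X Y x y)) {..n}"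
    using assms by (simp add: tensor_hmap_def lin_hmapD)
  also have "\<dots> = finsum (X' \<boxtimes> Y') (\<lambda>k. elem_tensor X' Y' (terms f k x) (terms g (n - k) y)) {..n}"
    using assms lin_hmapD[OF f] lin_hmapD[OF g] by (intro cvs_finsum_cong) auto
  finally show ?thesis .
qed

lemma elem_tensor_zero [simp]:
  assumes "cvs X" "cvs Y"
  shows "x \<in> carrier X \<Longrightarrow> elem_tensor X Y x \<zero>\<^bsub>Y\<^esub> = \<zero>\<^bsub>X \<boxtimes> Y\<^esub>"
    and "y \<in> carrier Y \<Longrightarrow> elem_tensor X Y \<zero>\<^bsub>X\<^esub> y = \<zero>\<^bsub>X \<boxtimes> Y\<^esub>"
  using linmap_zero[OF linmap_elem_left[of X Y y]] linmap_zero[OF linmap_elem_right[of X Y x]] assms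
  by auto

lemma terms_tensor_const:
  assumes f: "lin_hmap f X X'" and q: "linmap Y Y' q" and "cvs Y" "cvs Y'"
    and "x \<in> carrier X" "y \<in> carrier Y"
  shows "terms (f \<otimes>\<^sub>h const_hmap Y Y' q) n (elem_tensor X Y x y) = elem_tensor X' Y' (terms f n x) (q y)"
proof -
  note D = lin_hmapD[OF f] assms linmap_closed[OF q]
  have "terms (f \<otimes>\<^sub>h const_hmap Y Y' q) n (elem_tensor X Y x y)
    = finsum (X' \<boxtimes> Y') (\<lambda>k. elem_tensor X' Y' (terms f k x) (terms (const_hmap Y Y' q) (n - k) y)) {..n}"
    using D by (intro terms_tensor_elem) auto
  also have "\<dots> = elem_tensor X' Y' (terms f n x) (terms (const_hmap Y Y' q) (n - n) y)"
    by (intro cvs_finsum_single) (auto simp: D terms_const)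
  finally show ?thesis by (simp add: terms_const D)
qed

lemma terms_const_tensor:
  assumes p: "linmap X X' p" and g: "lin_hmap g Y Y'" and "cvs X" "cvs X'"
    and "x \<in> carrier X" "y \<in> carrier Y"
  shows "terms (const_hmap X X' p \<otimes>\<^sub>h g) n (elem_tensor X Y x y) = elem_tensor X' Y' (p x) (terms g n y)"
proof -
  note D = lin_hmapD[OF g] assms linmap_closed[OF p]
  have "terms (const_hmap X X' p \<otimes>\<^sub>h g) n (elem_tensor X Y x y)
    = finsum (X' \<boxtimes> Y') (\<lambda>k. elem_tensor X' Y' (terms (const_hmap X X' p) k x) (terms g (n - k) y)) {..n}"
    using D by (intro terms_tensor_elem) auto
  also have "\<dots> = elem_tensor X' Y' (terms (const_hmap X X' p) 0 x) (terms g (n - 0) y)"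
    by (intro cvs_finsum_single) (auto simp: D terms_const)
  finally show ?thesis by (simp add: terms_const D)
qed

lemma const_tensor_const:
  assumes "cvs X" "cvs X'" "cvs Y" "cvs Y'" "linmap X X' p" "linmap Y Y' q"
  shows "const_hmap X X' p \<otimes>\<^sub>h const_hmap Y Y' q
    = const_hmap (X \<boxtimes> Y) (X' \<boxtimes> Y') (map_tensor X Y X' Y' p q)"
proof (rule hmap_tensor_eqI)
  have l: "lin_hmap (const_hmap X X' p) X X'" "lin_hmap (const_hmap Y Y' q) Y Y'" using assms by auto
  show "lin_hmap (const_hmap X X' p \<otimes>\<^sub>h const_hmap Y Y' q) (X \<boxtimes> Y) (X' \<boxtimes> Y')"
    using l by (rule lin_hmap_tensor)
  show "lin_hmap (const_hmap (X \<boxtimes> Y) (X' \<boxtimes> Y') (map_tensor X Y X' Y' p q)) (X \<boxtimes> Y) (X' \<boxtimes> Y')"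
    using assms by (auto intro: linmap_map_tensor)
  fix n x y assume "x \<in> carrier X" "y \<in> carrier Y"
  then show "terms (const_hmap X X' p \<otimes>\<^sub>h const_hmap Y Y' q) n (elem_tensor X Y x y)
      = terms (const_hmap (X \<boxtimes> Y) (X' \<boxtimes> Y') (map_tensor X Y X' Y' p q)) n (elem_tensor X Y x y)"
    using assms terms_tensor_const[OF l(1) assms(6,3,4)]
    by (simp add: terms_const linmap_closed[OF assms(6)])
qed

lemma id_tensor_id:
  assumes "cvs X" "cvs Y"
  shows "id_hmap X \<otimes>\<^sub>h id_hmap Y = id_hmap (X \<boxtimes> Y)"
proof -
  have "id_hmap X \<otimes>\<^sub>h id_hmap Y
      = const_hmap (X \<boxtimes> Y) (X \<boxtimes> Y) (map_tensor X Y X Y (\<lambda>x. x) (\<lambda>y. y))"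
    using assms by (intro const_tensor_const) (auto intro: linmap_id)
  also have "\<dots> = id_hmap (X \<boxtimes> Y)"
  proof (rule const_hmap_cong)
    fix u assume "u \<in> carrier (X \<boxtimes> Y)"
    then show "map_tensor X Y X Y (\<lambda>x. x) (\<lambda>y. y) u = u"
      by (rule linmap_tensor_ext[of "X \<boxtimes> Y" X Y _ "\<lambda>u. u", rotated -1])
        (use assms in \<open>auto simp: linmap_id intro!: linmap_map_tensor\<close>)
  qed
  finally show ?thesis .
qed

text \<open>The interchange law, in both orders. On a pure tensor an identity factor contributes in
  degree 0 only, so either composite is again the convolution that defines the tensor product of
  arrows.\<close>

lemma tensor_hmap_split:
  assumes f: "lin_hmap f X X'" and g: "lin_hmap g Y Y'"
  shows "f \<otimes>\<^sub>h g = (f \<otimes>\<^sub>h id_hmap Y') \<circ>\<^sub>h (id_hmap X \<otimes>\<^sub>h g)"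
    and "f \<otimes>\<^sub>h g = (id_hmap X' \<otimes>\<^sub>h g) \<circ>\<^sub>h (f \<otimes>\<^sub>h id_hmap Y)"
proof -
  note D = lin_hmapD[OF f] lin_hmapD[OF g]
  have l: "lin_hmap (f \<otimes>\<^sub>h id_hmap Y') (X \<boxtimes> Y') (X' \<boxtimes> Y')" "lin_hmap (id_hmap X \<otimes>\<^sub>h g) (X \<boxtimes> Y) (X \<boxtimes> Y')"
    "lin_hmap (id_hmap X' \<otimes>\<^sub>h g) (X' \<boxtimes> Y) (X' \<boxtimes> Y')" "lin_hmap (f \<otimes>\<^sub>h id_hmap Y) (X \<boxtimes> Y) (X' \<boxtimes> Y)"
    using f g D by auto
  show "f \<otimes>\<^sub>h g = (f \<otimes>\<^sub>h id_hmap Y') \<circ>\<^sub>h (id_hmap X \<otimes>\<^sub>h g)"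
  proof (rule hmap_tensor_eqI[OF lin_hmap_tensor[OF f g] lin_hmap_comp[OF l(2,1)]])
    fix n x y assume xy: "x \<in> carrier X" "y \<in> carrier Y"
    have "terms ((f \<otimes>\<^sub>h id_hmap Y') \<circ>\<^sub>h (id_hmap X \<otimes>\<^sub>h g)) n (elem_tensor X Y x y)
        = finsum (X' \<boxtimes> Y') (\<lambda>k. elem_tensor X' Y' (terms f k x) (terms g (n - k) y)) {..n}"
      by (subst terms_comp[OF l(2,1)])
        (use xy D f g in \<open>simp_all add: terms_tensor_const terms_const_tensor linmap_id\<close>)
    then show "terms (f \<otimes>\<^sub>h g) n (elem_tensor X Y x y)
        = terms ((f \<otimes>\<^sub>h id_hmap Y') \<circ>\<^sub>h (id_hmap X \<otimes>\<^sub>h g)) n (elem_tensor X Y x y)"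
      using xy by (simp add: terms_tensor_elem[OF f g])
  qed
  show "f \<otimes>\<^sub>h g = (id_hmap X' \<otimes>\<^sub>h g) \<circ>\<^sub>h (f \<otimes>\<^sub>h id_hmap Y)"
  proof (rule hmap_tensor_eqI[OF lin_hmap_tensor[OF f g] lin_hmap_comp[OF l(4,3)]])
    fix n x y assume xy: "x \<in> carrier X" "y \<in> carrier Y"
    have "terms ((id_hmap X' \<otimes>\<^sub>h g) \<circ>\<^sub>h (f \<otimes>\<^sub>h id_hmap Y)) n (elem_tensor X Y x y)
        = finsum (X' \<boxtimes> Y') (\<lambda>k. elem_tensor X' Y' (terms f (n - k) x) (terms g k y)) {..n}"
      by (subst terms_comp[OF l(4,3)])
        (use xy D f g in \<open>simp_all add: terms_tensor_const terms_const_tensor linmap_id\<close>)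
    \<comment> \<open>In this order the summation index counts the coefficient of \<open>g\<close>;
      the reflection k \<mapsto> n - k restores the convention of
      \<open>tensor_hmap\<close>.\<close>
    also have "\<dots> = finsum (X' \<boxtimes> Y') (\<lambda>k. elem_tensor X' Y' (terms f (n - k) x) (terms g k y)) ((\<lambda>k. n - k) ` {..n})"
    proof (rule cvs_finsum_cong)
      have "i \<in> (\<lambda>k. n - k) ` {..n}" if "i \<le> n" for i
        using that by (intro image_eqI[of _ _ "n - i"]) auto
      then show "{..n} = (\<lambda>k. n - k) ` {..n}" by auto
    qed (use xy D in auto)
    also have "\<dots> = finsum (X' \<boxtimes> Y') (\<lambda>k. elem_tensor X' Y' (terms f (n - (n - k)) x) (terms g (n - k) y)) {..n}"
      using xy D by (intro cvs_finsum_reindex) (auto simp: inj_on_def)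
    also have "\<dots> = finsum (X' \<boxtimes> Y') (\<lambda>k. elem_tensor X' Y' (terms f k x) (terms g (n - k) y)) {..n}"
      using xy D by (intro cvs_finsum_cong) auto
    finally show "terms (f \<otimes>\<^sub>h g) n (elem_tensor X Y x y)
        = terms ((id_hmap X' \<otimes>\<^sub>h g) \<circ>\<^sub>h (f \<otimes>\<^sub>h id_hmap Y)) n (elem_tensor X Y x y)"
      using xy by (simp add: terms_tensor_elem[OF f g])
  qed
qed

lemma comp_tensor_id:
  assumes f: "lin_hmap f X X'" and f': "lin_hmap f' X' X''" and Y: "cvs Y"
  shows "(f' \<circ>\<^sub>h f) \<otimes>\<^sub>h id_hmap Y = (f' \<otimes>\<^sub>h id_hmap Y) \<circ>\<^sub>h (f \<otimes>\<^sub>h id_hmap Y)"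
proof (rule hmap_tensor_eqI[of _ X Y "X'' \<boxtimes> Y"])
  note D = lin_hmapD[OF f] lin_hmapD[OF f']
  show "lin_hmap ((f' \<circ>\<^sub>h f) \<otimes>\<^sub>h id_hmap Y) (X \<boxtimes> Y) (X'' \<boxtimes> Y)"
    "lin_hmap ((f' \<otimes>\<^sub>h id_hmap Y) \<circ>\<^sub>h (f \<otimes>\<^sub>h id_hmap Y)) (X \<boxtimes> Y) (X'' \<boxtimes> Y)"
    using assms by (auto intro!: lin_hmap_comp[of "f \<otimes>\<^sub>h id_hmap Y" _ "X' \<boxtimes> Y"])
  fix n x y assume xy: "x \<in> carrier X" "y \<in> carrier Y"
  have "terms ((f' \<circ>\<^sub>h f) \<otimes>\<^sub>h id_hmap Y) n (elem_tensor X Y x y)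
      = elem_tensor X'' Y (finsum X'' (\<lambda>k. terms f' k (terms f (n - k) x)) {..n}) y"
    using assms xy by (simp add: terms_tensor_const[OF lin_hmap_comp[OF f f']] linmap_id terms_comp[OF f f'])
  also have "\<dots> = finsum (X'' \<boxtimes> Y) (\<lambda>k. elem_tensor X'' Y (terms f' k (terms f (n - k) x)) y) {..n}"
    using D Y xy by (intro linmap_finsum[OF linmap_elem_left]) auto
  also have "\<dots> = terms ((f' \<otimes>\<^sub>h id_hmap Y) \<circ>\<^sub>h (f \<otimes>\<^sub>h id_hmap Y)) n (elem_tensor X Y x y)"
    by (subst terms_comp[of _ "X \<boxtimes> Y" "X' \<boxtimes> Y" _ "X'' \<boxtimes> Y"])
      (use xy D f f' Y in \<open>auto simp: terms_tensor_const linmap_id\<close>)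
  finally show "terms ((f' \<circ>\<^sub>h f) \<otimes>\<^sub>h id_hmap Y) n (elem_tensor X Y x y)
      = terms ((f' \<otimes>\<^sub>h id_hmap Y) \<circ>\<^sub>h (f \<otimes>\<^sub>h id_hmap Y)) n (elem_tensor X Y x y)" .
qed

lemma id_tensor_comp:
  assumes g: "lin_hmap g Y Y'" and g': "lin_hmap g' Y' Y''" and X: "cvs X"
  shows "id_hmap X \<otimes>\<^sub>h (g' \<circ>\<^sub>h g) = (id_hmap X \<otimes>\<^sub>h g') \<circ>\<^sub>h (id_hmap X \<otimes>\<^sub>h g)"
proof (rule hmap_tensor_eqI[of _ X Y "X \<boxtimes> Y''"])
  note D = lin_hmapD[OF g] lin_hmapD[OF g']
  show "lin_hmap (id_hmap X \<otimes>\<^sub>h (g' \<circ>\<^sub>h g)) (X \<boxtimes> Y) (X \<boxtimes> Y'')"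
    "lin_hmap ((id_hmap X \<otimes>\<^sub>h g') \<circ>\<^sub>h (id_hmap X \<otimes>\<^sub>h g)) (X \<boxtimes> Y) (X \<boxtimes> Y'')"
    using assms by (auto intro!: lin_hmap_comp[of "id_hmap X \<otimes>\<^sub>h g" _ "X \<boxtimes> Y'"])
  fix n x y assume xy: "x \<in> carrier X" "y \<in> carrier Y"
  have "terms (id_hmap X \<otimes>\<^sub>h (g' \<circ>\<^sub>h g)) n (elem_tensor X Y x y)
      = elem_tensor X Y'' x (finsum Y'' (\<lambda>k. terms g' k (terms g (n - k) y)) {..n})"
    using assms xy by (simp add: terms_const_tensor[OF _ lin_hmap_comp[OF g g']] linmap_id terms_comp[OF g g'])
  also have "\<dots> = finsum (X \<boxtimes> Y'') (\<lambda>k. elem_tensor X Y'' x (terms g' k (terms g (n - k) y))) {..n}"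
    using D X xy by (intro linmap_finsum[OF linmap_elem_right]) auto
  also have "\<dots> = terms ((id_hmap X \<otimes>\<^sub>h g') \<circ>\<^sub>h (id_hmap X \<otimes>\<^sub>h g)) n (elem_tensor X Y x y)"
    by (subst terms_comp[of _ "X \<boxtimes> Y" "X \<boxtimes> Y'" _ "X \<boxtimes> Y''"])
      (use xy D g g' X in \<open>auto simp: terms_const_tensor linmap_id\<close>)
  finally show "terms (id_hmap X \<otimes>\<^sub>h (g' \<circ>\<^sub>h g)) n (elem_tensor X Y x y)
      = terms ((id_hmap X \<otimes>\<^sub>h g') \<circ>\<^sub>h (id_hmap X \<otimes>\<^sub>h g)) n (elem_tensor X Y x y)" .
qed

text \<open>Functoriality in each variable separately, together with the interchange law for the two
  middle factors \<open>f'\<close> and \<open>g\<close>.\<close>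

lemma comp_tensor_comp:
  assumes f: "lin_hmap f X X'" and f': "lin_hmap f' X' X''" and g: "lin_hmap g Y Y'" and g': "lin_hmap g' Y' Y''"
  shows "(f' \<circ>\<^sub>h f) \<otimes>\<^sub>h (g' \<circ>\<^sub>h g) = (f' \<otimes>\<^sub>h g') \<circ>\<^sub>h (f \<otimes>\<^sub>h g)"
proof -
  note D = lin_hmapD(1,2)[OF f] lin_hmapD(1,2)[OF f'] lin_hmapD(1,2)[OF g] lin_hmapD(1,2)[OF g']
  let ?f = "f \<otimes>\<^sub>h id_hmap Y" and ?f1 = "f \<otimes>\<^sub>h id_hmap Y'" and ?f' = "f' \<otimes>\<^sub>h id_hmap Y'"
  let ?g = "id_hmap X' \<otimes>\<^sub>h g" and ?g' = "id_hmap X'' \<otimes>\<^sub>h g'" and ?g1 = "id_hmap X' \<otimes>\<^sub>h g'"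
  have l: "lin_hmap ?f (X \<boxtimes> Y) (X' \<boxtimes> Y)" "lin_hmap (f' \<otimes>\<^sub>h id_hmap Y) (X' \<boxtimes> Y) (X'' \<boxtimes> Y)"
    "lin_hmap (id_hmap X'' \<otimes>\<^sub>h g) (X'' \<boxtimes> Y) (X'' \<boxtimes> Y')" "lin_hmap ?g' (X'' \<boxtimes> Y') (X'' \<boxtimes> Y'')"
    "lin_hmap ?g (X' \<boxtimes> Y) (X' \<boxtimes> Y')" "lin_hmap ?f' (X' \<boxtimes> Y') (X'' \<boxtimes> Y')"
    "lin_hmap (f' \<otimes>\<^sub>h g) (X' \<boxtimes> Y) (X'' \<boxtimes> Y')"
    using f f' g g' D by auto
  have "(f' \<circ>\<^sub>h f) \<otimes>\<^sub>h (g' \<circ>\<^sub>h g) = (?g' \<circ>\<^sub>h (id_hmap X'' \<otimes>\<^sub>h g)) \<circ>\<^sub>h ((f' \<otimes>\<^sub>h id_hmap Y) \<circ>\<^sub>h ?f)"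
    using D f f' g g' by (simp add: tensor_hmap_split(2)[of _ X X'' _ Y Y''] lin_hmap_comp
        comp_tensor_id[OF f f'] id_tensor_comp[OF g g'])
  also have "\<dots> = (?g' \<circ>\<^sub>h ((id_hmap X'' \<otimes>\<^sub>h g) \<circ>\<^sub>h (f' \<otimes>\<^sub>h id_hmap Y))) \<circ>\<^sub>h ?f"
    using comp_hmap_assoc[OF l(2,3,4)] comp_hmap_assoc[OF l(1,2) lin_hmap_comp[OF l(3,4)]] by simp
  also have "(id_hmap X'' \<otimes>\<^sub>h g) \<circ>\<^sub>h (f' \<otimes>\<^sub>h id_hmap Y) = ?f' \<circ>\<^sub>h ?g"
    using tensor_hmap_split[OF f' g] by simp
  also have "?g' \<circ>\<^sub>h (?f' \<circ>\<^sub>h ?g) \<circ>\<^sub>h ?f = (?g' \<circ>\<^sub>h ?f') \<circ>\<^sub>h (?g \<circ>\<^sub>h ?f)"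
    using l comp_hmap_assoc[OF l(5,6,4)] comp_hmap_assoc[OF l(1,5) lin_hmap_comp[OF l(6,4)]] by simp
  also have "\<dots> = (f' \<otimes>\<^sub>h g') \<circ>\<^sub>h (f \<otimes>\<^sub>h g)"
    using tensor_hmap_split(2)[OF f' g'] tensor_hmap_split(2)[OF f g] by simp
  finally show ?thesis .
qed

section \<open>Evaluation of noncommutative series\<close>

abbreviation words :: "'i set \<Rightarrow> nat \<Rightarrow> 'i list set" where
  "words A n \<equiv> {w. set w \<subseteq> A \<and> length w = n}"

definition series_value ::
    "(complex, 'v, 'z) module_scheme \<Rightarrow> 'i set \<Rightarrow> ('i \<Rightarrow> 'v \<Rightarrow> 'v) \<Rightarrow> 'i ncseries \<Rightarrow> nat \<Rightarrow> 'v \<Rightarrow> 'v" where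
  "series_value M A T f n u = finsum M (\<lambda>w. coeff f w \<odot>\<^bsub>M\<^esub> foldr T w u) (words A n)"

text \<open>The substitutions below insert linear forms in the generators. These preserve degree, so
  that the power of \<hbar> stays equal to the word length.\<close>

definition homogeneous1 :: "'i ncseries \<Rightarrow> bool" where
  "homogeneous1 a \<longleftrightarrow> (\<forall>w. coeff a w \<noteq> 0 \<longrightarrow> length w = 1)"

text \<open>Common generalisation of \<open>nc_subst\<close>, with two letters, and of the
  exponential, with a single letter, so that associators and braidings share one theory of
  substitution.\<close>

definition nc_gsubst :: "'j ncseries \<Rightarrow> ('j \<Rightarrow> 'i ncseries) \<Rightarrow> 'i ncseries" where
  "nc_gsubst \<Phi> a = NCS (\<lambda>w. \<Sum>u | length u \<le> length w. coeff \<Phi> u * coeff (prod_list (map a u)) w)"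

lemma coeff_mult_homogeneous1:
  assumes "homogeneous1 a"
  shows "coeff (a * p) [] = 0" and "coeff (a * p) (i # w) = coeff a [i] * coeff p w"
proof -
  have a: "coeff a w = 0" if "length w \<noteq> 1" for w using assms that by (auto simp: homogeneous1_def)
  show "coeff (a * p) [] = 0" using a by (simp add: times_ncseries_def)
  have "coeff (a * p) (i # w) = (\<Sum>k\<le>Suc (length w). coeff a (take k (i # w)) * coeff p (drop k (i # w)))"
    by (simp add: times_ncseries_def)
  \<comment> \<open>Only the cut after the first letter leaves a prefix of length 1.\<close>
  also have "\<dots> = (\<Sum>k\<in>{1}. coeff a (take k (i # w)) * coeff p (drop k (i # w)))"
    by (rule sum.mono_neutral_right) (auto simp: a min_def)
  finally show "coeff (a * p) (i # w) = coeff a [i] * coeff p w" by simp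
qed

lemma coeff_prod_homogeneous1:
  assumes "\<And>j. homogeneous1 (a j)" and "length w \<noteq> length u"
  shows "coeff (prod_list (map a u)) w = 0"
  using assms(2)
proof (induction u arbitrary: w)
  case Nil
  then show ?case by (auto simp: one_ncseries_def)
next
  case (Cons j u)
  then show ?case using assms(1) by (cases w) (auto simp: coeff_mult_homogeneous1)
qed

lemma homogeneous1_simps [simp]:
  "homogeneous1 (nc_var i)" "homogeneous1 a \<Longrightarrow> homogeneous1 b \<Longrightarrow> homogeneous1 (a + b)"
  by (auto simp: homogeneous1_def nc_var_def plus_ncseries_def split: if_splits)
    (metis add.right_neutral)

locale operators =
  fixes M :: "(complex, 'v, 'z) module_scheme" and A :: "'i set" and T :: "'i \<Rightarrow> 'v \<Rightarrow> 'v"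
  assumes cvs: "cvs M" and finite_index: "finite A" and linmap_op: "i \<in> A \<Longrightarrow> linmap M M (T i)"
begin

abbreviation val :: "'i ncseries \<Rightarrow> nat \<Rightarrow> 'v \<Rightarrow> 'v" where
  "val \<equiv> series_value M A T"

lemma finite_words: "finite (words A n)"
  using finite_index by (rule finite_lists_length_eq)

lemma linmap_word: "set w \<subseteq> A \<Longrightarrow> linmap M M (foldr T w)"
proof (induction w)
  case Nil
  then show ?case using linmap_id by (simp add: id_def)
next
  case (Cons i w)
  then show ?case using linmap_comp[OF linmap_op[of i], of M "foldr T w"] by (simp add: comp_def)
qed

lemma word_closed [simp]: "set w \<subseteq> A \<Longrightarrow> u \<in> carrier M \<Longrightarrow> foldr T w u \<in> carrier M"
  by (rule linmap_closed[OF linmap_word])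

lemma linmap_val: "linmap M M (val f n)"
proof -
  have "val f n = (\<lambda>u. finsum M (\<lambda>w. coeff f w \<odot>\<^bsub>M\<^esub> foldr T w u) (words A n))"
    by (simp add: series_value_def fun_eq_iff)
  then show ?thesis using cvs by (auto intro!: linmap_finsum_maps linmap_scale linmap_word)
qed

lemma val_closed [simp]: "u \<in> carrier M \<Longrightarrow> val f n u \<in> carrier M"
  by (rule linmap_closed[OF linmap_val])

lemma val_cong: "(\<And>w. length w = n \<Longrightarrow> set w \<subseteq> A \<Longrightarrow> coeff f w = coeff g w) \<Longrightarrow> u \<in> carrier M \<Longrightarrow>
    val f n u = val g n u"
  unfolding series_value_def using cvs by (intro cvs_finsum_cong) auto

lemma val_eq_zero: "(\<And>w. length w = n \<Longrightarrow> set w \<subseteq> A \<Longrightarrow> coeff f w = 0) \<Longrightarrow> u \<in> carrier M \<Longrightarrow>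
    val f n u = \<zero>\<^bsub>M\<^esub>"
  unfolding series_value_def using cvs
  by (subst cvs_finsum_cong[of M "words A n" "words A n" "\<lambda>_. \<zero>\<^bsub>M\<^esub>"]) auto

lemma val_add: "u \<in> carrier M \<Longrightarrow> val (f + g) n u = val f n u \<oplus>\<^bsub>M\<^esub> val g n u"
  unfolding series_value_def using cvs
  by (subst cvs_finsum_add[symmetric])
    (auto intro!: cvs_finsum_cong simp: plus_ncseries_def cvs_smult_add_left)

text \<open>Links the ideal, whose generators are differences, with the relations between operators,
  which are equations.\<close>

lemma val_diff_eq_zero_iff:
  assumes u: "u \<in> carrier M"
  shows "val (f - g) n u = \<zero>\<^bsub>M\<^esub> \<longleftrightarrow> val f n u = val g n u"
proof -
  have "val f n u = val (f - g) n u \<oplus>\<^bsub>M\<^esub> val g n u"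
    using val_add[OF u, of "f - g" g n] by simp
  then show ?thesis
    using cvs u cvs_add_cancel[OF cvs val_closed[OF u] cvs_closed(1)[OF cvs] val_closed[OF u], of "f - g" n g n]
    by simp
qed

lemma val_single:
  assumes "set w \<subseteq> A" "\<And>v. length v = length w \<Longrightarrow> v \<noteq> w \<Longrightarrow> coeff f v = 0" "u \<in> carrier M"
  shows "val f (length w) u = coeff f w \<odot>\<^bsub>M\<^esub> foldr T w u"
  unfolding series_value_def using assms cvs finite_words by (intro cvs_finsum_single) auto

lemma val_one: "u \<in> carrier M \<Longrightarrow> val 1 n u = (if n = 0 then u else \<zero>\<^bsub>M\<^esub>)"
  using val_single[of "[]" 1 u] cvs by (auto simp: one_ncseries_def intro: val_eq_zero)

lemma val_homogeneous1: "homogeneous1 a \<Longrightarrow> u \<in> carrier M \<Longrightarrow> n \<noteq> 1 \<Longrightarrow> val a n u = \<zero>\<^bsub>M\<^esub>"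
  by (rule val_eq_zero) (auto simp: homogeneous1_def)

lemma val_var: "i \<in> A \<Longrightarrow> u \<in> carrier M \<Longrightarrow> val (nc_var i) (Suc 0) u = T i u"
  using val_single[of "[i]" "nc_var i" u] cvs linmap_closed[OF linmap_op, of i u] by (auto simp: nc_var_def)

text \<open>Cutting words of length n after k letters is a bijection onto pairs of words of lengths
  k and n - k. The product of series therefore turns into the Cauchy product in \<hbar>, which is
  the composition of arrows.\<close>

lemma val_mult:
  assumes u: "u \<in> carrier M"
  shows "val (f * g) n u = finsum M (\<lambda>k. val f k (val g (n - k) u)) {..n}"
proof -
  let ?t = "\<lambda>k w. (coeff f (take k w) * coeff g (drop k w)) \<odot>\<^bsub>M\<^esub> foldr T w u"
  have "val (f * g) n u = finsum M (\<lambda>w. finsum M (\<lambda>k. ?t k w) {..n}) (words A n)"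
    unfolding series_value_def using cvs u
    by (intro cvs_finsum_cong) (auto simp: times_ncseries_def cvs_smult_sum)
  also have "\<dots> = finsum M (\<lambda>k. finsum M (?t k) (words A n)) {..n}"
    using cvs u finite_words by (intro cvs_finsum_swap) auto
  also have "\<dots> = finsum M (\<lambda>k. val f k (val g (n - k) u)) {..n}"
  proof (rule cvs_finsum_cong[OF cvs refl])
    fix k assume k: "k \<in> {..n}"
    show "val f k (val g (n - k) u) \<in> carrier M" using u by simp
    have img: "words A n = (\<lambda>(v, w). v @ w) ` (words A k \<times> words A (n - k))"
    proof (intro equalityI subsetI)
      fix w assume "w \<in> words A n"
      then have "(take k w, drop k w) \<in> words A k \<times> words A (n - k)"
        using k by (auto dest: in_set_takeD in_set_dropD)
      then show "w \<in> (\<lambda>(v, w). v @ w) ` (words A k \<times> words A (n - k))"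
        by (rule rev_image_eqI) simp
    qed (use k in auto)
    have "finsum M (?t k) (words A n)
        = finsum M (\<lambda>p. ?t k (case p of (v, w) \<Rightarrow> v @ w)) (words A k \<times> words A (n - k))"
      unfolding img using cvs u k by (intro cvs_finsum_reindex) (auto simp: inj_on_def)
    also have "\<dots> = finsum M (\<lambda>v. finsum M (\<lambda>w. ?t k (v @ w)) (words A (n - k))) (words A k)"
      using cvs u finite_words by (subst cvs_finsum_product) auto
    also have "\<dots> = finsum M (\<lambda>v. coeff f v \<odot>\<^bsub>M\<^esub> foldr T v (val g (n - k) u)) (words A k)"
    proof (rule cvs_finsum_cong[OF cvs refl])
      fix v assume v: "v \<in> words A k"
      have "coeff f v \<odot>\<^bsub>M\<^esub> foldr T v (val g (n - k) u)
          = finsum M (\<lambda>w. coeff f v \<odot>\<^bsub>M\<^esub> (coeff g w \<odot>\<^bsub>M\<^esub> foldr T v (foldr T w u))) (words A (n - k))"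
        unfolding series_value_def using v u cvs
        by (subst linmap_finsum[OF linmap_word cvs cvs], force, force, subst cvs_smult_finsum)
          (auto simp: linmap_smult[OF linmap_word] intro!: cvs_finsum_cong)
      also have "\<dots> = finsum M (\<lambda>w. ?t k (v @ w)) (words A (n - k))"
        using v u cvs by (intro cvs_finsum_cong) (auto simp: cvs_smult_smult)
      finally show "finsum M (\<lambda>w. ?t k (v @ w)) (words A (n - k)) = coeff f v \<odot>\<^bsub>M\<^esub> foldr T v (val g (n - k) u)"
        by simp
    qed (use u cvs in auto)
    finally show "finsum M (?t k) (words A n) = val f k (val g (n - k) u)"
      by (simp add: series_value_def[of M A T f])
  qed
  finally show ?thesis .
qed

lemma val_homogeneous1_mult:
  assumes "homogeneous1 a" "u \<in> carrier M"
  shows "val (a * p) (Suc n) u = val a 1 (val p n u)" and "val (a * p) 0 u = \<zero>\<^bsub>M\<^esub>"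
proof -
  show "val (a * p) (Suc n) u = val a 1 (val p n u)"
    unfolding val_mult[OF assms(2)] using assms cvs
    by (subst cvs_finsum_single[of M _ 1]) (auto simp: val_homogeneous1)
  show "val (a * p) 0 u = \<zero>\<^bsub>M\<^esub>"
    using assms by (intro val_eq_zero) (auto simp: coeff_mult_homogeneous1)
qed

lemma val_part: "u \<in> carrier M \<Longrightarrow> val (nc_part n f) n u = val f n u"
  by (rule val_cong) (auto simp: nc_part_def)

text \<open>Each linear form accounts for exactly one degree, so in degree \<open>length u\<close>
  the product acts by applying the forms one after the other.\<close>

lemma val_prod_homogeneous1:
  assumes a: "\<And>j. homogeneous1 (a j)" and S: "\<And>j x. x \<in> carrier M \<Longrightarrow> S j x = val (a j) 1 x"
    and x: "x \<in> carrier M"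
  shows "val (prod_list (map a u)) (length u) x = foldr S u x"
proof -
  have closed: "foldr S u x \<in> carrier M" for u by (induction u) (use S x in auto)
  show ?thesis
  proof (induction u)
    case Nil
    then show ?case using x by (simp add: val_one)
  next
    case (Cons j u)
    then show ?case using a x S[OF closed] by (simp add: val_homogeneous1_mult)
  qed
qed

text \<open>Substituting linear forms and then evaluating is evaluating at the values of those
  forms. Both sides are double sums over words \<open>u\<close> in the new letters and words
  \<open>w\<close> in the old ones, taken in different orders.\<close>

lemma val_gsubst:
  fixes \<Phi> :: "'j ncseries"
  assumes fin: "finite (UNIV :: 'j set)" and a: "\<And>j. homogeneous1 (a j)"
    and S: "\<And>j x. x \<in> carrier M \<Longrightarrow> S j x = val (a j) 1 x" and x: "x \<in> carrier M"
  shows "val (nc_gsubst \<Phi> a) n x = series_value M UNIV S \<Phi> n x"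
proof -
  have closed: "foldr S u x \<in> carrier M" for u by (induction u) (use S x in auto)
  have finu: "finite (words (UNIV :: 'j set) n)" using fin by (rule finite_lists_length_eq)
  let ?p = "\<lambda>u. prod_list (map a u)"
  \<comment> \<open>The truncation \<open>length u \<le> length w\<close> in the substitution
    shrinks to equality, as a product of linear forms is homogeneous of degree
    \<open>length u\<close>.\<close>
  have "coeff (nc_gsubst \<Phi> a) w = (\<Sum>u\<in>words UNIV n. coeff \<Phi> u * coeff (?p u) w)" if "length w = n" for w
  proof -
    have "finite {u :: 'j list. length u \<le> n}" using finite_lists_length_le[OF fin, of n] by simp
    then show ?thesis using that
      using coeff_prod_homogeneous1[where a = a, OF a, of w]
      by (auto simp: nc_gsubst_def intro!: sum.mono_neutral_right) metis
  qed
  then have "val (nc_gsubst \<Phi> a) n x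
      = finsum M (\<lambda>w. finsum M (\<lambda>u. (coeff \<Phi> u * coeff (?p u) w) \<odot>\<^bsub>M\<^esub> foldr T w x) (words UNIV n)) (words A n)"
    unfolding series_value_def[of M A] using cvs x finu
    by (intro cvs_finsum_cong) (auto simp: cvs_smult_sum)
  also have "\<dots> = finsum M (\<lambda>u. finsum M (\<lambda>w. (coeff \<Phi> u * coeff (?p u) w) \<odot>\<^bsub>M\<^esub> foldr T w x) (words A n)) (words UNIV n)"
    using cvs x finu finite_words by (intro cvs_finsum_swap) auto
  also have "\<dots> = finsum M (\<lambda>u. coeff \<Phi> u \<odot>\<^bsub>M\<^esub> val (?p u) n x) (words UNIV n)"
  proof (rule cvs_finsum_cong[OF cvs refl])
    fix u
    have "coeff \<Phi> u \<odot>\<^bsub>M\<^esub> val (?p u) n x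
        = finsum M (\<lambda>w. coeff \<Phi> u \<odot>\<^bsub>M\<^esub> (coeff (?p u) w \<odot>\<^bsub>M\<^esub> foldr T w x)) (words A n)"
      unfolding series_value_def using cvs x by (intro cvs_smult_finsum) auto
    also have "\<dots> = finsum M (\<lambda>w. (coeff \<Phi> u * coeff (?p u) w) \<odot>\<^bsub>M\<^esub> foldr T w x) (words A n)"
      using cvs x by (intro cvs_finsum_cong) (auto simp: cvs_smult_smult)
    finally show "finsum M (\<lambda>w. (coeff \<Phi> u * coeff (?p u) w) \<odot>\<^bsub>M\<^esub> foldr T w x) (words A n)
        = coeff \<Phi> u \<odot>\<^bsub>M\<^esub> val (?p u) n x" by simp
  qed (use cvs x in simp)
  also have "\<dots> = series_value M UNIV S \<Phi> n x"
    unfolding series_value_def[of M UNIV S]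
    using cvs x closed val_prod_homogeneous1[of a S x] a S by (intro cvs_finsum_cong) auto
  finally show ?thesis .
qed

end

text \<open>\<open>P\<close> carries each word in the \<open>T i\<close> to the same word in the
  \<open>S i\<close>, and a series is a combination of words.\<close>

lemma series_value_intertwine:
  assumes "operators M A T" "operators N A S" and P: "linmap M N P"
    and PT: "\<And>i u. i \<in> A \<Longrightarrow> u \<in> carrier M \<Longrightarrow> P (T i u) = S i (P u)" and u: "u \<in> carrier M"
  shows "P (series_value M A T f n u) = series_value N A S f n (P u)"
proof -
  interpret M: operators M A T by fact
  interpret N: operators N A S by fact
  have w: "P (foldr T w u) = foldr S w (P u)" if "set w \<subseteq> A" for w
    using that by (induction w) (use PT u in auto)
  have "P (series_value M A T f n u) = finsum N (\<lambda>w. P (coeff f w \<odot>\<^bsub>M\<^esub> foldr T w u)) (words A n)"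
    unfolding series_value_def using M.cvs N.cvs u by (intro linmap_finsum[OF P]) auto
  also have "\<dots> = series_value N A S f n (P u)"
    unfolding series_value_def using M.cvs N.cvs u w linmap_closed[OF P]
    by (intro cvs_finsum_cong) (auto simp: linmap_smult[OF P])
  finally show ?thesis .
qed

definition dk_index :: "nat \<Rightarrow> (nat \<times> nat) set" where
  "dk_index m = {1..m} \<times> {1..m}"

lemma dk_index_iff [simp]: "(i, j) \<in> dk_index m \<longleftrightarrow> i \<in> {1..m} \<and> j \<in> {1..m}"
  by (simp add: dk_index_def)

lemma finite_dk_index [simp]: "finite (dk_index m)"
  by (simp add: dk_index_def)

locale dk_operators = operators M "dk_index m" T
  for M :: "(complex, 'v, 'z) module_scheme" and m :: nat and T :: "nat \<times> nat \<Rightarrow> 'v \<Rightarrow> 'v" +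
  assumes op_sym: "\<lbrakk>i \<in> {1..m}; j \<in> {1..m}; i \<noteq> j; u \<in> carrier M\<rbrakk> \<Longrightarrow> T (i, j) u = T (j, i) u"
    and op_comm4: "\<lbrakk>{i, j, k, l} \<subseteq> {1..m}; distinct [i, j, k, l]; u \<in> carrier M\<rbrakk>
      \<Longrightarrow> T (i, j) (T (k, l) u) = T (k, l) (T (i, j) u)"
    and op_comm3: "\<lbrakk>{i, j, k} \<subseteq> {1..m}; distinct [i, j, k]; u \<in> carrier M\<rbrakk>
      \<Longrightarrow> T (i, j) (T (i, k) u \<oplus>\<^bsub>M\<^esub> T (j, k) u) = T (i, k) (T (i, j) u) \<oplus>\<^bsub>M\<^esub> T (j, k) (T (i, j) u)"
begin

text \<open>A generator vanishes outside its degree, 1 or 2, by homogeneity, and in that degree by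
  the corresponding relation between operators. In a product a f b every term of the Cauchy product
  passes through some coefficient of f, applied to some vector; hence the induction is over
  arbitrary \<open>n\<close> and \<open>u\<close>.\<close>

lemma val_dk_ideal:
  assumes "f \<in> dk_ideal m" "u \<in> carrier M"
  shows "val f n u = \<zero>\<^bsub>M\<^esub>"
  using assms
proof (induction arbitrary: n u)
  note closed = linmap_closed[OF linmap_op]
  case (dk_sym i j)
  then show ?case
    by (cases "n = 1") (simp_all add: val_diff_eq_zero_iff val_homogeneous1 val_var op_sym[of i j])
next
  case (dk_comm4 i j k l)
  have op: "T (k, l) u \<in> carrier M" "T (i, j) u \<in> carrier M"
    using dk_comm4 by (auto intro!: linmap_closed[OF linmap_op])
  show ?case
  proof (cases n)
    case (Suc n')
    then show ?thesis using dk_comm4 op op_comm4[of i j k l u]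
        linmap_zero[OF linmap_val cvs cvs]
      by (cases "n' = 1") (simp_all add: val_diff_eq_zero_iff val_homogeneous1_mult val_homogeneous1 val_var)
  qed (use dk_comm4 in \<open>simp add: val_diff_eq_zero_iff val_homogeneous1_mult\<close>)
next
  case (dk_comm3 i j k)
  have op: "T (i, j) u \<in> carrier M" "T (i, k) u \<in> carrier M" "T (j, k) u \<in> carrier M"
    using dk_comm3 by (auto intro!: linmap_closed[OF linmap_op])
  show ?case
  proof (cases n)
    case (Suc n')
    then show ?thesis using dk_comm3 op op_comm3[of i j k u] cvs
        linmap_zero[OF linmap_val cvs cvs]
      by (cases "n' = 1")
        (simp_all add: val_diff_eq_zero_iff val_homogeneous1_mult val_homogeneous1 val_var val_add)
  qed (use dk_comm3 in \<open>simp add: val_diff_eq_zero_iff val_homogeneous1_mult\<close>)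
next
  case dk_zero
  then show ?case by (intro val_eq_zero) (simp_all add: zero_ncseries_def)
next
  case (dk_add f g)
  then show ?case using cvs by (simp add: val_add)
next
  case (dk_mult f a b)
  then show ?case using cvs linmap_zero[OF linmap_val cvs cvs] by (simp add: val_mult)
qed

text \<open>The coefficient of \<open>\<hbar>^n\<close> sees only the part of degree n, and
  \<open>dk_eq\<close> puts each such part of the difference into the ideal.\<close>

lemma val_dk_eq: "dk_eq m f g \<Longrightarrow> u \<in> carrier M \<Longrightarrow> val f n u = val g n u"
  using val_dk_ideal[of "nc_part n (f - g)" u n]
  by (simp add: dk_eq_def val_part flip: val_diff_eq_zero_iff)

end

subsection \<open>The hmap given by a series\<close>

definition series_hmap ::
    "('l, 'a) umod \<Rightarrow> 'i set \<Rightarrow> ('i \<Rightarrow> 'a tuniv \<Rightarrow> 'a tuniv) \<Rightarrow> 'i ncseries \<Rightarrow> ('l, 'a) hmap" where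
  "series_hmap M A T f =
     \<lparr>source = M, target = M, terms = (\<lambda>n. restrict (series_value M A T f n) (carrier M))\<rparr>"

lemma terms_series_hmap: "u \<in> carrier M \<Longrightarrow> terms (series_hmap M A T f) n u = series_value M A T f n u"
  by (simp add: series_hmap_def)

lemma lin_hmap_series [intro]: "operators M A T \<Longrightarrow> lin_hmap (series_hmap M A T f) M M"
  by (auto simp: lin_hmap_def series_hmap_def operators.cvs intro!: linmap_restrict operators.linmap_val)

lemma series_hmap_mult:
  assumes "operators M A T"
  shows "series_hmap M A T (f * g) = series_hmap M A T f \<circ>\<^sub>h series_hmap M A T g"
proof (rule hmap_eqI[of _ M M])
  interpret operators M A T by fact
  fix n u assume u: "u \<in> carrier M"
  then show "terms (series_hmap M A T (f * g)) n u
      = terms (series_hmap M A T f \<circ>\<^sub>h series_hmap M A T g) n u"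
    using assms by (subst terms_comp[of _ M M _ M]) (auto simp: terms_series_hmap val_mult)
qed (use assms in auto)

lemma series_hmap_one:
  assumes "operators M A T"
  shows "series_hmap M A T 1 = id_hmap M"
proof (rule hmap_eqI[of _ M M])
  interpret operators M A T by fact
  show "lin_hmap (id_hmap M) M M" using cvs by simp
  show "terms (series_hmap M A T 1) n u = terms (id_hmap M) n u" if "u \<in> carrier M" for n u
    using that by (simp add: terms_series_hmap val_one terms_const)
qed (use assms in auto)

definition intertwines :: "('l, 'a) hmap \<Rightarrow> ('a tuniv \<Rightarrow> 'a tuniv) \<Rightarrow> ('a tuniv \<Rightarrow> 'a tuniv) \<Rightarrow> bool" where
  "intertwines F T S \<longleftrightarrow> (\<forall>n. \<forall>u\<in>carrier (source F). terms F n (T u) = S (terms F n u))"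

text \<open>All coefficients of \<open>F\<close> intertwine the operators, so each of them passes
  through the series. Interchanging the two factors reverses the Cauchy product, hence the
  reflection of the summation index.\<close>

lemma series_hmap_natural:
  assumes M: "operators M A T" and N: "operators N A S" and F: "lin_hmap F M N"
    and FT: "\<And>i. i \<in> A \<Longrightarrow> intertwines F (T i) (S i)"
  shows "F \<circ>\<^sub>h series_hmap M A T f = series_hmap N A S f \<circ>\<^sub>h F"
proof (rule hmap_eqI[of _ M N])
  interpret M: operators M A T by fact
  interpret N: operators N A S by fact
  show "lin_hmap (F \<circ>\<^sub>h series_hmap M A T f) M N" "lin_hmap (series_hmap N A S f \<circ>\<^sub>h F) M N"
    using assms by auto
  note D = lin_hmapD[OF F]
  fix n u assume u: "u \<in> carrier M"
  have "terms (F \<circ>\<^sub>h series_hmap M A T f) n u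
      = finsum N (\<lambda>k. terms F k (series_value M A T f (n - k) u)) {..n}"
    using u by (subst terms_comp[OF lin_hmap_series F]) (auto simp: terms_series_hmap M)
  also have "\<dots> = finsum N (\<lambda>k. series_value N A S f (n - k) (terms F k u)) {..n}"
    using u D FT by (intro cvs_finsum_cong series_value_intertwine[OF M N])
      (auto simp: intertwines_def)
  also have "\<dots> = finsum N (\<lambda>k. series_value N A S f (n - k) (terms F k u)) ((\<lambda>k. n - k) ` {..n})"
  proof (rule cvs_finsum_cong)
    have "i \<in> (\<lambda>k. n - k) ` {..n}" if "i \<le> n" for i
      using that by (intro image_eqI[of _ _ "n - i"]) auto
    then show "{..n} = (\<lambda>k. n - k) ` {..n}" by auto
  qed (use u D in auto)
  also have "\<dots> = finsum N (\<lambda>k. series_value N A S f (n - (n - k)) (terms F (n - k) u)) {..n}"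
    using u D by (intro cvs_finsum_reindex) (auto simp: inj_on_def)
  also have "\<dots> = finsum N (\<lambda>k. series_value N A S f k (terms F (n - k) u)) {..n}"
    using u D by (intro cvs_finsum_cong) auto
  also have "\<dots> = terms (series_hmap N A S f \<circ>\<^sub>h F) n u"
    using u by (subst terms_comp[OF F lin_hmap_series]) (auto simp: terms_series_hmap N D)
  finally show "terms (F \<circ>\<^sub>h series_hmap M A T f) n u = terms (series_hmap N A S f \<circ>\<^sub>h F) n u" .
qed

lemma series_hmap_dk_eq:
  assumes "dk_operators M m T" "dk_eq m f g"
  shows "series_hmap M (dk_index m) T f = series_hmap M (dk_index m) T g"
  using dk_operators.val_dk_eq[OF assms] by (auto simp: series_hmap_def intro: restrict_ext)

lemma series_hmap_gsubst:
  fixes \<Phi> :: "'j ncseries"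
  assumes "operators M A T" "finite (UNIV :: 'j set)" "\<And>j. homogeneous1 (a j)"
    and "\<And>j x. x \<in> carrier M \<Longrightarrow> S j x = series_value M A T (a j) 1 x"
  shows "series_hmap M A T (nc_gsubst \<Phi> a) = series_hmap M UNIV S \<Phi>"
  using operators.val_gsubst[OF assms(1), of a S _ \<Phi>] assms
  by (auto simp: series_hmap_def intro!: restrict_ext)

subsection \<open>Substitution, exponentials and inverses of series\<close>

lemma finite_UNIV_letter: "finite (UNIV :: letter set)"
proof -
  have "(UNIV :: letter set) \<subseteq> {LX, LY}" using letter.exhaust by auto
  then show ?thesis by (rule finite_subset) simp
qed

lemma nc_subst_eq_gsubst: "nc_subst \<Phi> a b = nc_gsubst \<Phi> (case_letter a b)"
  by (simp add: nc_subst_def nc_gsubst_def)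

text \<open>The series exp(x/2) in one variable: words over \<open>unit\<close> are the powers of
  x.\<close>

definition half_exp :: "unit ncseries" where
  "half_exp = NCS (\<lambda>w. 1 / (2 ^ length w * fact (length w)))"

lemma coeff_const_mult: "coeff (nc_const c * f) w = c * coeff f w"
proof -
  have "coeff (nc_const c * f) w = (\<Sum>k\<in>{0}. coeff (nc_const c) (take k w) * coeff f (drop k w))"
    unfolding times_ncseries_def ncseries.sel
    by (rule sum.mono_neutral_right) (auto simp: nc_const_def)
  then show ?thesis by (simp add: nc_const_def)
qed

lemma coeff_mult_scale:
  "(\<And>w. coeff g w = c * coeff g' w) \<Longrightarrow> coeff (f * g) w = c * coeff (f * g') w"
  by (simp add: times_ncseries_def sum_distrib_left mult_ac)

lemma coeff_const_mult_power: "coeff ((nc_const c * f) ^ n) w = c ^ n * coeff (f ^ n) w"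
proof (induction n arbitrary: w)
  case (Suc n)
  have "(nc_const c * f) ^ Suc n = nc_const c * (f * (nc_const c * f) ^ n)"
    by (simp add: mult.assoc)
  then have "coeff ((nc_const c * f) ^ Suc n) w = c * coeff (f * (nc_const c * f) ^ n) w"
    by (simp add: coeff_const_mult)
  also have "\<dots> = c ^ Suc n * coeff (f ^ Suc n) w"
    using coeff_mult_scale[of "(nc_const c * f) ^ n" "c ^ n" "f ^ n" f w] Suc by simp
  finally show ?case .
qed simp

lemma unit_words: "{w :: unit list. P (length w)} = (\<lambda>n. replicate n ()) ` {n. P n}"
proof -
  have "w = replicate (length w) ()" for w :: "unit list" by (induction w) auto
  then show ?thesis by (auto intro: rev_image_eqI)
qed

text \<open>Presents the exponential as a substitution, so that the braiding is subject to the same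
  transport rules as the associator.\<close>

lemma nc_exp_half: "nc_exp (nc_const (1/2) * a) = nc_gsubst half_exp (\<lambda>_. a)"
proof (rule ncseries_eqI)
  fix w
  have "coeff (nc_gsubst half_exp (\<lambda>_. a)) w
      = (\<Sum>u\<in>(\<lambda>n. replicate n ()) ` {n. n \<le> length w}. coeff half_exp u * coeff (prod_list (map (\<lambda>_. a) u)) w)"
    unfolding nc_gsubst_def by (simp add: unit_words[of "\<lambda>k. k \<le> length w"])
  also have "\<dots> = (\<Sum>n\<le>length w. coeff half_exp (replicate n ()) * coeff (a ^ n) w)"
    by (subst sum.reindex) (auto simp: inj_on_def replicate_eq_replicate atMost_def map_replicate_const prod_list_replicate)
  also have "\<dots> = coeff (nc_exp (nc_const (1/2) * a)) w"
    by (simp add: nc_exp_def half_exp_def coeff_const_mult_power power_divide field_simps)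
  finally show "coeff (nc_exp (nc_const (1/2) * a)) w = coeff (nc_gsubst half_exp (\<lambda>_. a)) w" by simp
qed

text \<open>There is exactly one word of each length over \<open>unit\<close>, so the sum over words
  of length \<open>n\<close> has a single term.\<close>

lemma half_exp_act_eq:
  assumes "cvs M" "linmap M M A" "u \<in> carrier M"
  shows "half_exp_act M A n u = series_value M UNIV (\<lambda>_ :: unit. A) half_exp n u"
proof -
  interpret operators M "UNIV :: unit set" "\<lambda>_. A" using assms by (intro operators.intro) auto
  have "foldr (\<lambda>_. A) (replicate n ()) = A ^^ n" by (induction n) auto
  moreover have "v = w" if "length v = length w" for v w :: "unit list"
    using that by (induction v w rule: list_induct2) auto
  ultimately show ?thesis
    using val_single[of "replicate n ()" half_exp u] assms by (simp add: half_exp_act_def half_exp_def)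
qed

lemma series_act_eq:
  "series_act M \<Phi> A B n u = series_value M UNIV (case_letter A B) \<Phi> n u"
  by (simp add: series_act_def series_value_def)

text \<open>The equation f g = 1 solved for the coefficients of g by recursion on the word, when f
  has constant term 1: the nonempty prefixes involve g only at shorter words.\<close>

fun inverse_coeff :: "'i ncseries \<Rightarrow> 'i list \<Rightarrow> complex" where
  "inverse_coeff f [] = 1"
| "inverse_coeff f (i # w) =
     - (\<Sum>k\<le>length w. coeff f (take (Suc k) (i # w)) * inverse_coeff f (drop k w))"

lemma right_inverse_exists:
  assumes "coeff f [] = 1"
  shows "\<exists>g. f * g = 1 \<and> coeff g [] = 1"
proof (intro exI conjI)
  show "f * NCS (inverse_coeff f) = 1"
  proof (rule ncseries_eqI)
    fix w
    show "coeff (f * NCS (inverse_coeff f)) w = coeff 1 w"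
      using assms by (cases w) (simp_all add: times_ncseries_def one_ncseries_def sum.atMost_Suc_shift del: sum.atMost_Suc)
  qed
qed simp

text \<open>A right inverse \<open>g\<close> of \<open>f\<close> with constant term 1 has in turn a
  right inverse \<open>h\<close>; associativity gives f = h, and so \<open>g\<close> is an inverse
  on both sides.\<close>

lemma inverse_exists:
  assumes "coeff f [] = 1"
  shows "\<exists>g. f * g = 1 \<and> g * f = 1"
proof -
  obtain g where g: "f * g = 1" "coeff g [] = 1" using right_inverse_exists[OF assms] by blast
  obtain h where h: "g * h = 1" using right_inverse_exists[OF g(2)] by blast
  have "f = f * (g * h)" using h by simp
  also have "\<dots> = h" using g(1) by (simp flip: mult.assoc)
  finally show ?thesis using g h by blast
qed

text \<open>Two-sided inverses are unique, so the definite description in \<open>nc_inverse\<close>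
  denotes one.\<close>

lemma nc_inverse:
  assumes "coeff f [] = 1"
  shows "f * nc_inverse f = 1" "nc_inverse f * f = 1"
proof -
  obtain g where g: "f * g = 1" "g * f = 1" using inverse_exists[OF assms] by blast
  have "nc_inverse f = g"
    unfolding nc_inverse_def
  proof (rule the_equality)
    fix h assume h: "f * h = 1 \<and> h * f = 1"
    then have "h = h * (f * g)" using g by simp
    also have "\<dots> = g" using h by (simp flip: mult.assoc)
    finally show "h = g" .
  qed (use g in auto)
  then show "f * nc_inverse f = 1" "nc_inverse f * f = 1" using g by auto
qed

lemma coeff_gsubst_Nil [simp]: "coeff (nc_gsubst \<Phi> a) [] = coeff \<Phi> []"
  by (simp add: nc_gsubst_def one_ncseries_def)

section \<open>Commuting Lie algebra actions and the Drinfeld--Kohno relations\<close>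

lemma lie_algebra_cvs: "lie_algebra L \<Longrightarrow> cvs L"
  by (simp add: lie_algebra_def)

text \<open>Isolates what the Drinfeld--Kohno relations depend on: commuting actions of
  \<open>L\<close> on a single space, numbered by places. How that space arises as an iterated
  tensor product no longer matters. The bracket rule is written additively to avoid subtraction in
  \<open>M\<close>.\<close>

locale lie_actions =
  fixes L :: "('l, 'y) lie_scheme" and M :: "(complex, 'v, 'z) module_scheme" and I :: "nat set"
    and E :: "nat \<Rightarrow> 'l \<Rightarrow> 'v \<Rightarrow> 'v" and t :: "('l, 'l) formal_sum"
  assumes lie: "lie_algebra L" and cvs: "cvs M" and t: "t \<in> sym_square_invariants L"
    and linmap_E: "\<lbrakk>i \<in> I; a \<in> carrier L\<rbrakk> \<Longrightarrow> linmap M M (E i a)"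
    and linmap_E_left: "\<lbrakk>i \<in> I; u \<in> carrier M\<rbrakk> \<Longrightarrow> linmap L M (\<lambda>a. E i a u)"
    and E_comm: "\<lbrakk>i \<in> I; j \<in> I; i \<noteq> j; a \<in> carrier L; b \<in> carrier L; u \<in> carrier M\<rbrakk>
      \<Longrightarrow> E i a (E j b u) = E j b (E i a u)"
    and E_bracket: "\<lbrakk>i \<in> I; a \<in> carrier L; b \<in> carrier L; u \<in> carrier M\<rbrakk>
      \<Longrightarrow> E i a (E i b u) = E i b (E i a u) \<oplus>\<^bsub>M\<^esub> E i \<lbrakk>a, b\<rbrakk>\<^bsub>L\<^esub> u"
begin

definition tens :: "nat \<Rightarrow> nat \<Rightarrow> 'v \<Rightarrow> 'v" where
  "tens i j u = tensor_lift M (\<lambda>a b. E i a (E j b u)) t"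

lemma cvs_L: "cvs L"
  using lie by (rule lie_algebra_cvs)

lemma bracket_closed [simp]: "a \<in> carrier L \<Longrightarrow> b \<in> carrier L \<Longrightarrow> \<lbrakk>a, b\<rbrakk>\<^bsub>L\<^esub> \<in> carrier L"
  using lie by (rule lie_algebra.bracket_closed)

lemma E_closed [simp]: "\<lbrakk>i \<in> I; a \<in> carrier L; u \<in> carrier M\<rbrakk> \<Longrightarrow> E i a u \<in> carrier M"
  by (rule linmap_closed[OF linmap_E])

lemma t_formal: "t \<in> formal_sums L L"
  using t by (auto simp: sym_square_invariants_def sym_square_def carrier_tensor_iff)

lemma bilin_E: "\<lbrakk>i \<in> I; j \<in> I; u \<in> carrier M\<rbrakk> \<Longrightarrow> bilin L L M (\<lambda>a b. E i a (E j b u))"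
  by (intro bilinI linmap_E_left linmap_comp[OF linmap_E linmap_E_left]) auto

lemma linmap_tens: "\<lbrakk>i \<in> I; j \<in> I\<rbrakk> \<Longrightarrow> linmap M M (tens i j)"
  unfolding tens_def[abs_def]
  by (rule linmap_of_tensor_lift[OF t_formal cvs]) (intro linmap_comp[OF linmap_E linmap_E])

lemma tens_closed [simp]: "\<lbrakk>i \<in> I; j \<in> I; u \<in> carrier M\<rbrakk> \<Longrightarrow> tens i j u \<in> carrier M"
  by (rule linmap_closed[OF linmap_tens])

lemma tens_commute:
  assumes D: "linmap M M D" and "i \<in> I" "j \<in> I" and u: "u \<in> carrier M"
    and DE: "\<And>a b. a \<in> carrier L \<Longrightarrow> b \<in> carrier L \<Longrightarrow> D (E i a (E j b u)) = E i a (E j b (D u))"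
  shows "D (tens i j u) = tens i j (D u)"
proof -
  have "D (tens i j u) = tensor_lift M (\<lambda>a b. D (E i a (E j b u))) t"
    unfolding tens_def by (rule linmap_comp_tensor_lift[OF D cvs cvs t_formal]) (use assms in auto)
  also have "\<dots> = tens i j (D u)"
    unfolding tens_def by (rule tensor_lift_cong[OF t_formal]) (rule DE)
  finally show ?thesis .
qed

text \<open>Symmetry of t allows replacing it by its flip under the lift, which exchanges the legs;
  commutation of the actions at different places then restores their order.\<close>

lemma tens_sym:
  assumes ij: "i \<in> I" "j \<in> I" "i \<noteq> j" and u: "u \<in> carrier M"
  shows "tens i j u = tens j i u"
proof -
  have bil: "bilin L L M (\<lambda>a b. E i a (E j b u))" using assms by (intro bilin_E)
  have swap: "tensor_lift (tensor L L) (\<lambda>x y. pure_tensor L L y x) t = t"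
    using t by (simp add: sym_square_invariants_def sym_square_def)
  have "tens i j u = tensor_lift M (\<lambda>a b. E i a (E j b u)) (tensor_lift (tensor L L) (\<lambda>x y. pure_tensor L L y x) t)"
    by (simp add: swap tens_def)
  also have "\<dots> = tensor_lift M (\<lambda>x y. tensor_lift M (\<lambda>a b. E i a (E j b u)) (pure_tensor L L y x)) t"
    by (rule linmap_comp_tensor_lift[OF linmap_tensor_lift[OF cvs_L cvs_L cvs bil] cvs_tensor cvs t_formal]) simp
  also have "\<dots> = tensor_lift M (\<lambda>x y. E j x (E i y u)) t"
    by (rule tensor_lift_cong[OF t_formal])
      (simp add: tensor_lift_pure[OF cvs_L cvs_L cvs bil] E_comm[OF ij _ _ u])
  finally show ?thesis by (simp add: tens_def)
qed

text \<open>Moving the sum of the actions of c at places i and j past \<open>E i a\<close> and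
  \<open>E j b\<close> leaves error terms with [c, a] and [c, b]. Summed over t they are the image
  of the adjoint action of c on t, which is zero.\<close>

lemma tens_invariant:
  assumes ij: "i \<in> I" "j \<in> I" "i \<noteq> j" and c: "c \<in> carrier L" and u: "u \<in> carrier M"
  shows "E i c (tens i j u) \<oplus>\<^bsub>M\<^esub> E j c (tens i j u) = tens i j (E i c u \<oplus>\<^bsub>M\<^esub> E j c u)"
proof -
  let ?D = "\<lambda>v. E i c v \<oplus>\<^bsub>M\<^esub> E j c v"
  let ?\<phi> = "\<lambda>a b. E i a (E j b u)"
  let ?B = "\<lambda>x y. E i \<lbrakk>c, x\<rbrakk>\<^bsub>L\<^esub> (E j y u) \<oplus>\<^bsub>M\<^esub> E i x (E j \<lbrakk>c, y\<rbrakk>\<^bsub>L\<^esub> u)"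
  have D: "linmap M M ?D" using ij c cvs by (intro linmap_plus linmap_E)
  have bil: "bilin L L M ?\<phi>" using assms by (intro bilin_E)
  note lift = linmap_tensor_lift[OF cvs_L cvs_L cvs bil]
  have inv: "tensor_lift (tensor L L) (\<lambda>x y. pure_tensor L L \<lbrakk>c, x\<rbrakk>\<^bsub>L\<^esub> y \<oplus>\<^bsub>tensor L L\<^esub> pure_tensor L L x \<lbrakk>c, y\<rbrakk>\<^bsub>L\<^esub>) t
        = \<zero>\<^bsub>tensor L L\<^esub>"
    using t c by (simp add: sym_square_invariants_def)
  \<comment> \<open>Invariance is an equation in \<open>tensor L L\<close>; applying the lift of
    \<open>?\<phi>\<close> to both sides brings it to \<open>M\<close>.\<close>
  have "\<zero>\<^bsub>M\<^esub> = tensor_lift M ?\<phi> \<zero>\<^bsub>tensor L L\<^esub>" using linmap_zero[OF lift cvs_tensor cvs] by simp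
  also have "\<dots> = tensor_lift M (\<lambda>x y. tensor_lift M ?\<phi>
      (pure_tensor L L \<lbrakk>c, x\<rbrakk>\<^bsub>L\<^esub> y \<oplus>\<^bsub>tensor L L\<^esub> pure_tensor L L x \<lbrakk>c, y\<rbrakk>\<^bsub>L\<^esub>)) t"
    unfolding inv[symmetric]
    by (rule linmap_comp_tensor_lift[OF lift cvs_tensor cvs t_formal]) (use c in simp)
  also have "\<dots> = tensor_lift M ?B t"
    by (rule tensor_lift_cong[OF t_formal])
      (use c in \<open>simp add: linmap_add[OF lift] tensor_lift_pure[OF cvs_L cvs_L cvs bil]\<close>)
  finally have B: "tensor_lift M ?B t = \<zero>\<^bsub>M\<^esub>" by simp
  have "?D (tens i j u) = tensor_lift M (\<lambda>a b. ?D (?\<phi> a b)) t"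
    unfolding tens_def using ij u by (intro linmap_comp_tensor_lift[OF D cvs cvs t_formal]) auto
  also have "\<dots> = tensor_lift M (\<lambda>a b. E i a (E j b (?D u)) \<oplus>\<^bsub>M\<^esub> ?B a b) t"
  proof (rule tensor_lift_cong[OF t_formal])
    fix a b assume ab: "a \<in> carrier L" "b \<in> carrier L"
    have "E i c (?\<phi> a b) = E i a (E j b (E i c u)) \<oplus>\<^bsub>M\<^esub> E i \<lbrakk>c, a\<rbrakk>\<^bsub>L\<^esub> (E j b u)"
      using ij c u ab by (simp add: E_bracket[of i c a] E_comm[of i j c b])
    moreover have "E j c (?\<phi> a b) = E i a (E j b (E j c u)) \<oplus>\<^bsub>M\<^esub> E i a (E j \<lbrakk>c, b\<rbrakk>\<^bsub>L\<^esub> u)"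
      using ij c u ab by (simp add: E_bracket[of j c b] E_comm[of j i c a] linmap_add[OF linmap_E])
    moreover have "E i a (E j b (?D u)) = E i a (E j b (E i c u)) \<oplus>\<^bsub>M\<^esub> E i a (E j b (E j c u))"
      using ij c u ab by (simp add: linmap_add[OF linmap_E])
    ultimately show "?D (?\<phi> a b) = E i a (E j b (?D u)) \<oplus>\<^bsub>M\<^esub> ?B a b"
      using ij c u ab cvs by (simp add: cvs_add_add)
  qed
  also have "\<dots> = tens i j (?D u) \<oplus>\<^bsub>M\<^esub> tensor_lift M ?B t"
    unfolding tens_def using ij c u cvs by (intro tensor_lift_plus[OF t_formal cvs]) auto
  finally show ?thesis using B ij c u cvs by simp
qed

lemma E_tens_commute:
  assumes "i \<in> I" "j \<in> I" "k \<in> I" "k \<noteq> i" "k \<noteq> j" "c \<in> carrier L" "u \<in> carrier M"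
  shows "E k c (tens i j u) = tens i j (E k c u)"
  using assms by (intro tens_commute linmap_E) (simp_all add: E_comm[of k i c] E_comm[of k j c])

lemma tens_comm4:
  assumes "{i, j, k, l} \<subseteq> I" "distinct [i, j, k, l]" "u \<in> carrier M"
  shows "tens i j (tens k l u) = tens k l (tens i j u)"
  using assms by (intro tens_commute linmap_tens) (simp_all flip: E_tens_commute)

text \<open>\<open>t\<^sup>i\<^sup>k + t\<^sup>j\<^sup>k\<close> is the sum over t of the diagonal
  action of the first leg at places i and j, composed with the second leg at k. The former commutes
  with \<open>t\<^sup>i\<^sup>j\<close> by invariance, the latter because k is a third
  place.\<close>

lemma tens_comm3:
  assumes ijk: "{i, j, k} \<subseteq> I" "distinct [i, j, k]" and u: "u \<in> carrier M"
  shows "tens i j (tens i k u \<oplus>\<^bsub>M\<^esub> tens j k u) = tens i k (tens i j u) \<oplus>\<^bsub>M\<^esub> tens j k (tens i j u)"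
proof -
  have sum: "tens i k v \<oplus>\<^bsub>M\<^esub> tens j k v
      = tensor_lift M (\<lambda>c d. E i c (E k d v) \<oplus>\<^bsub>M\<^esub> E j c (E k d v)) t" if "v \<in> carrier M" for v
    unfolding tens_def using ijk that by (intro tensor_lift_plus[symmetric, OF t_formal cvs]) auto
  have "tens i j (tens i k u \<oplus>\<^bsub>M\<^esub> tens j k u)
      = tensor_lift M (\<lambda>c d. tens i j (E i c (E k d u) \<oplus>\<^bsub>M\<^esub> E j c (E k d u))) t"
    unfolding sum[OF u] using ijk u cvs
    by (intro linmap_comp_tensor_lift[OF linmap_tens cvs cvs t_formal]) auto
  also have "\<dots> = tensor_lift M (\<lambda>c d. E i c (E k d (tens i j u)) \<oplus>\<^bsub>M\<^esub> E j c (E k d (tens i j u))) t"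
    using ijk u by (intro tensor_lift_cong[OF t_formal]) (simp add: E_tens_commute tens_invariant)
  also have "\<dots> = tens i k (tens i j u) \<oplus>\<^bsub>M\<^esub> tens j k (tens i j u)"
    using ijk u by (intro sum[symmetric]) auto
  finally show ?thesis .
qed

lemma dk_operators_tens:
  assumes "I = {1..m}"
  shows "dk_operators M m (\<lambda>(i, j). tens i j)"
proof (intro dk_operators.intro operators.intro dk_operators_axioms.intro)
  fix p assume "p \<in> dk_index m"
  then show "linmap M M (case p of (i, j) \<Rightarrow> tens i j)"
    using assms by (auto simp: dk_index_def intro!: linmap_tens)
next
  fix i j k l u assume "{i, j, k, l} \<subseteq> {1..m}" "distinct [i, j, k, l]" "u \<in> carrier M"
  then show "(case (i, j) of (i, j) \<Rightarrow> tens i j) ((case (k, l) of (i, j) \<Rightarrow> tens i j) u)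
    = (case (k, l) of (i, j) \<Rightarrow> tens i j) ((case (i, j) of (i, j) \<Rightarrow> tens i j) u)"
    using assms tens_comm4[of i j k l u] by simp
next
  fix i j k u assume "{i, j, k} \<subseteq> {1..m}" "distinct [i, j, k]" "u \<in> carrier M"
  then show "(case (i, j) of (i, j) \<Rightarrow> tens i j)
      ((case (i, k) of (i, j) \<Rightarrow> tens i j) u \<oplus>\<^bsub>M\<^esub> (case (j, k) of (i, j) \<Rightarrow> tens i j) u)
    = (case (i, k) of (i, j) \<Rightarrow> tens i j) ((case (i, j) of (i, j) \<Rightarrow> tens i j) u)
      \<oplus>\<^bsub>M\<^esub> (case (j, k) of (i, j) \<Rightarrow> tens i j) ((case (i, j) of (i, j) \<Rightarrow> tens i j) u)"
    using assms tens_comm3[of i j k u] by simp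
qed (use cvs assms tens_sym in auto)

end

section \<open>Lie modules and their tensor products\<close>

lemma lie_moduleD:
  assumes "lie_module L X"
  shows lie_module_lie: "lie_algebra L" and lie_module_cvs: "cvs X"
    and linmap_act: "a \<in> carrier L \<Longrightarrow> linmap X X (act X a)"
    and linmap_act_left: "x \<in> carrier X \<Longrightarrow> linmap L X (\<lambda>a. act X a x)"
    and lie_module_act_closed: "a \<in> carrier L \<Longrightarrow> x \<in> carrier X \<Longrightarrow> act X a x \<in> carrier X"
    and lie_module_bracket: "\<lbrakk>a \<in> carrier L; b \<in> carrier L; x \<in> carrier X\<rbrakk> \<Longrightarrow>
      act X a (act X b x) = act X b (act X a x) \<oplus>\<^bsub>X\<^esub> act X \<lbrakk>a, b\<rbrakk>\<^bsub>L\<^esub> x"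
proof -
  interpret lie_module L X by fact
  show "lie_algebra L" "cvs X" by unfold_locales
  then have "cvs X" by simp
  show "a \<in> carrier L \<Longrightarrow> x \<in> carrier X \<Longrightarrow> act X a x \<in> carrier X" by (rule act_closed)
  show "a \<in> carrier L \<Longrightarrow> linmap X X (act X a)"
    by (rule linmapI) (simp_all add: act_closed act_add_right act_smult_right)
  show "x \<in> carrier X \<Longrightarrow> linmap L X (\<lambda>a. act X a x)"
    by (rule linmapI) (simp_all add: act_closed act_add_left act_smult_left)
  show "act X a (act X b x) = act X b (act X a x) \<oplus>\<^bsub>X\<^esub> act X \<lbrakk>a, b\<rbrakk>\<^bsub>L\<^esub> x"
    if "a \<in> carrier L" "b \<in> carrier L" "x \<in> carrier X"
    using that act_bracket[of a b x] \<open>cvs X\<close>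
      cvs_minus_eq_iff[of X "act X a (act X b x)" "act X b (act X a x)" "act X \<lbrakk>a, b\<rbrakk>\<^bsub>L\<^esub> x"]
    by (simp add: act_closed L.bracket_closed cvs_add_comm)
qed

lemma lie_moduleI:
  assumes L: "lie_algebra L" and X: "cvs X"
    and l: "\<And>a. a \<in> carrier L \<Longrightarrow> linmap X X (act X a)"
    and r: "\<And>x. x \<in> carrier X \<Longrightarrow> linmap L X (\<lambda>a. act X a x)"
    and b: "\<And>a b x. \<lbrakk>a \<in> carrier L; b \<in> carrier L; x \<in> carrier X\<rbrakk> \<Longrightarrow>
      act X a (act X b x) = act X b (act X a x) \<oplus>\<^bsub>X\<^esub> act X \<lbrakk>a, b\<rbrakk>\<^bsub>L\<^esub> x"
  shows "lie_module L X"
proof (intro lie_module.intro lie_module_axioms.intro L X)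
  note c = linmap_closed[OF l]
  fix a b x assume ab: "a \<in> carrier L" "b \<in> carrier L" "x \<in> carrier X"
  have "\<lbrakk>a, b\<rbrakk>\<^bsub>L\<^esub> \<in> carrier L" using L ab by (simp add: lie_algebra.bracket_closed)
  then show "act X \<lbrakk>a, b\<rbrakk>\<^bsub>L\<^esub> x = act X a (act X b x) \<ominus>\<^bsub>X\<^esub> act X b (act X a x)"
    using b[OF ab] ab X c by (simp add: cvs_minus_eq_iff cvs_add_comm)
qed (use linmap_closed[OF l] linmap_add[OF l] linmap_smult[OF l] linmap_add[OF r] linmap_smult[OF r] in auto)

lemma bilin_act:
  assumes "lie_module L X" "lie_module L Y" "a \<in> carrier L"
  shows "bilin X Y (tensor X Y)
    (\<lambda>x y. pure_tensor X Y (act X a x) y \<oplus>\<^bsub>tensor X Y\<^esub> pure_tensor X Y x (act Y a y))"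
proof -
  note facts = assms lie_module_cvs[OF assms(1)] lie_module_cvs[OF assms(2)]
    lie_module_act_closed[OF assms(1)] lie_module_act_closed[OF assms(2)]
  note b = bilin_pure_tensor[of X Y]
  show ?thesis
    by (intro bilinI linmap_plus linmap_comp[OF bilinD(1)[OF b] linmap_act[OF assms(1,3)]]
        linmap_comp[OF bilinD(2)[OF b] linmap_act[OF assms(2,3)]] bilinD[OF b])
      (use facts in auto)
qed

lemma act_tensor_eq:
  "act (X \<boxtimes> Y) a u = Tensor (tensor_lift (tensor X Y)
    (\<lambda>x y. pure_tensor X Y (act X a x) y \<oplus>\<^bsub>tensor X Y\<^esub> pure_tensor X Y x (act Y a y)) (untensor u))"
  by (simp add: tensor_module_def)

lemma linmap_act_tensor:
  assumes "lie_module L X" "lie_module L Y" "a \<in> carrier L"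
  shows "linmap (X \<boxtimes> Y) (X \<boxtimes> Y) (act (X \<boxtimes> Y) a)"
  unfolding act_tensor_eq[abs_def]
  by (rule linmap_comp[OF linmap_Tensor])
    (use assms lie_module_cvs in \<open>auto intro!: linmap_tlift bilin_act\<close>)

lemma act_tensor_elem:
  assumes "lie_module L X" "lie_module L Y" "a \<in> carrier L" "x \<in> carrier X" "y \<in> carrier Y"
  shows "act (X \<boxtimes> Y) a (elem_tensor X Y x y)
    = elem_tensor X Y (act X a x) y \<oplus>\<^bsub>X \<boxtimes> Y\<^esub> elem_tensor X Y x (act Y a y)"
  unfolding act_tensor_eq
  by (subst tlift_elem)
    (use assms bilin_act[OF assms(1-3)] in \<open>auto simp: elem_tensor_def tensor_module_simps lie_module_cvs\<close>)

text \<open>Writes the action through the coproduct as a sum of two one-sided operators, so that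
  equivariance can be checked one factor at a time.\<close>

lemma act_tensor_map:
  assumes X: "lie_module L X" and Y: "lie_module L Y" and a: "a \<in> carrier L" and u: "u \<in> carrier (X \<boxtimes> Y)"
  shows "act (X \<boxtimes> Y) a u
    = map_tensor X Y X Y (act X a) (\<lambda>y. y) u \<oplus>\<^bsub>X \<boxtimes> Y\<^esub> map_tensor X Y X Y (\<lambda>x. x) (act Y a) u"
proof -
  note [simp] = lie_module_cvs[OF X] lie_module_cvs[OF Y] linmap_act[OF X a] linmap_act[OF Y a] linmap_id
  show ?thesis
    by (rule linmap_tensor_ext[OF _ linmap_act_tensor[OF X Y a] _ _ u])
      (auto simp: act_tensor_elem[OF X Y a] intro!: linmap_plus linmap_map_tensor)
qed

text \<open>Linearity in the acting element, as opposed to the vector acted upon; it makes the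
  extended actions linear in \<open>L\<close>.\<close>

lemma linmap_map_tensor_left:
  assumes "cvs X" "cvs Y" "cvs X'" "cvs Y'" "cvs Z" "linmap Y Y' g" "u \<in> carrier (X \<boxtimes> Y)"
    and f: "\<And>a. a \<in> carrier Z \<Longrightarrow> linmap X X' (f a)" "\<And>x. x \<in> carrier X \<Longrightarrow> linmap Z X' (\<lambda>a. f a x)"
  shows "linmap Z (X' \<boxtimes> Y') (\<lambda>a. map_tensor X Y X' Y' (f a) g u)"
  unfolding map_tensor_def using assms
  by (intro linmap_module_lift_parameter linmap_comp[OF linmap_elem_left]) (auto simp: linmap_closed)

lemma linmap_map_tensor_right:
  assumes "cvs X" "cvs Y" "cvs X'" "cvs Y'" "cvs Z" "linmap X X' f" "u \<in> carrier (X \<boxtimes> Y)"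
    and g: "\<And>a. a \<in> carrier Z \<Longrightarrow> linmap Y Y' (g a)" "\<And>x. x \<in> carrier Y \<Longrightarrow> linmap Z Y' (\<lambda>a. g a x)"
  shows "linmap Z (X' \<boxtimes> Y') (\<lambda>a. map_tensor X Y X' Y' f (g a) u)"
  unfolding map_tensor_def using assms
  by (intro linmap_module_lift_parameter linmap_comp[OF linmap_elem_right]) (auto simp: linmap_closed)

text \<open>Given actions on \<open>M\<close> at the places \<open>1, \<dots>, m\<close>, the actions on \<open>M \<otimes> Z\<close> at the places \<open>1, \<dots>, m + 1\<close>.\<close>

definition extend_acts ::
    "nat \<Rightarrow> ('l, 'a) umod \<Rightarrow> (nat \<Rightarrow> 'l \<Rightarrow> 'a tuniv \<Rightarrow> 'a tuniv) \<Rightarrow> ('l, 'a) umod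
      \<Rightarrow> nat \<Rightarrow> 'l \<Rightarrow> 'a tuniv \<Rightarrow> 'a tuniv" where
  "extend_acts m M E Z i a =
     (if i \<le> m then map_tensor M Z M Z (E i a) (\<lambda>z. z) else map_tensor M Z M Z (\<lambda>u. u) (act Z a))"

lemma map_tensor_comp:
  assumes "cvs X" "cvs Y" "cvs X'" "cvs Y'" "cvs X''" "cvs Y''"
    "linmap X X' f" "linmap Y Y' g" "linmap X' X'' f'" "linmap Y' Y'' g'" "u \<in> carrier (X \<boxtimes> Y)"
  shows "map_tensor X' Y' X'' Y'' f' g' (map_tensor X Y X' Y' f g u)
    = map_tensor X Y X'' Y'' (\<lambda>x. f' (f x)) (\<lambda>y. g' (g y)) u"
  by (rule linmap_tensor_ext[of "X'' \<boxtimes> Y''" X Y])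
    (use assms linmap_comp[OF assms(9,7)] linmap_comp[OF assms(10,8)] in
      \<open>auto intro!: linmap_comp[OF linmap_map_tensor] linmap_map_tensor simp: linmap_closed\<close>)

lemma map_tensor_add_left:
  assumes "cvs X" "cvs Y" "cvs X'" "cvs Y'" "linmap X X' f" "linmap X X' f'" "linmap Y Y' g"
    "u \<in> carrier (X \<boxtimes> Y)"
  shows "map_tensor X Y X' Y' (\<lambda>x. f x \<oplus>\<^bsub>X'\<^esub> f' x) g u
    = map_tensor X Y X' Y' f g u \<oplus>\<^bsub>X' \<boxtimes> Y'\<^esub> map_tensor X Y X' Y' f' g u"
  by (rule linmap_tensor_ext[of "X' \<boxtimes> Y'" X Y "map_tensor X Y X' Y' (\<lambda>x. f x \<oplus>\<^bsub>X'\<^esub> f' x) g"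
        "\<lambda>u. map_tensor X Y X' Y' f g u \<oplus>\<^bsub>X' \<boxtimes> Y'\<^esub> map_tensor X Y X' Y' f' g u"])
    (use assms in \<open>auto intro!: linmap_map_tensor linmap_plus
      simp: linmap_plus linmap_closed linmap_add[OF linmap_elem_left]\<close>)

lemma map_tensor_add_right:
  assumes "cvs X" "cvs Y" "cvs X'" "cvs Y'" "linmap X X' f" "linmap Y Y' g" "linmap Y Y' g'"
    "u \<in> carrier (X \<boxtimes> Y)"
  shows "map_tensor X Y X' Y' f (\<lambda>y. g y \<oplus>\<^bsub>Y'\<^esub> g' y) u
    = map_tensor X Y X' Y' f g u \<oplus>\<^bsub>X' \<boxtimes> Y'\<^esub> map_tensor X Y X' Y' f g' u"
  by (rule linmap_tensor_ext[of "X' \<boxtimes> Y'" X Y "map_tensor X Y X' Y' f (\<lambda>y. g y \<oplus>\<^bsub>Y'\<^esub> g' y)"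
        "\<lambda>u. map_tensor X Y X' Y' f g u \<oplus>\<^bsub>X' \<boxtimes> Y'\<^esub> map_tensor X Y X' Y' f g' u"])
    (use assms in \<open>auto intro!: linmap_map_tensor linmap_plus
      simp: linmap_plus linmap_closed linmap_add[OF linmap_elem_right]\<close>)

text \<open>Functions agreeing only on the carriers are not equal as terms, so rewriting under
  \<open>map_tensor\<close> has to go through pure tensors.\<close>

lemma map_tensor_cong:
  assumes "cvs X" "cvs Y" "cvs X'" "cvs Y'" "linmap X X' f" "linmap Y Y' g" "linmap X X' f'" "linmap Y Y' g'"
    "\<And>x. x \<in> carrier X \<Longrightarrow> f x = f' x" "\<And>y. y \<in> carrier Y \<Longrightarrow> g y = g' y" "u \<in> carrier (X \<boxtimes> Y)"
  shows "map_tensor X Y X' Y' f g u = map_tensor X Y X' Y' f' g' u"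
  by (rule linmap_tensor_ext[of "X' \<boxtimes> Y'" X Y]) (use assms in \<open>auto intro!: linmap_map_tensor\<close>)

lemma lie_actions_single:
  assumes "lie_module L X" "t \<in> sym_square_invariants L"
  shows "lie_actions L X {1..1} (\<lambda>_. act X) t"
  by (intro lie_actions.intro assms(2) lie_module_lie[OF assms(1)] lie_module_cvs[OF assms(1)]
      linmap_act[OF assms(1)] linmap_act_left[OF assms(1)] lie_module_bracket[OF assms(1)]) auto

text \<open>The old places act in the factor \<open>M\<close> and the new one in \<open>Z\<close>.
  An old and the new action commute because they touch different factors; all other laws are
  inherited from \<open>M\<close> and \<open>Z\<close>.\<close>

lemma lie_actions_extend:
  assumes "lie_actions L M {1..m} E t" and Z: "lie_module L Z"
  shows "lie_actions L (M \<boxtimes> Z) {1..Suc m} (extend_acts m M E Z) t"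
proof -
  interpret lie_actions L M "{1..m}" E t by fact
  note [simp] = cvs lie_module_cvs[OF Z] linmap_act[OF Z] linmap_E linmap_id cvs_L
  show ?thesis
  proof (intro lie_actions.intro)
    show "linmap (M \<boxtimes> Z) (M \<boxtimes> Z) (extend_acts m M E Z i a)" if "i \<in> {1..Suc m}" "a \<in> carrier L" for i a
      using that by (auto simp: extend_acts_def intro!: linmap_map_tensor)
    show "linmap L (M \<boxtimes> Z) (\<lambda>a. extend_acts m M E Z i a u)" if "i \<in> {1..Suc m}" "u \<in> carrier (M \<boxtimes> Z)" for i u
      using that linmap_act_left[OF Z] linmap_E_left
      by (cases "i \<le> m")
        (auto simp: extend_acts_def intro!: linmap_map_tensor_left linmap_map_tensor_right)
    show "extend_acts m M E Z i a (extend_acts m M E Z j b u)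
        = extend_acts m M E Z j b (extend_acts m M E Z i a u)"
      if "i \<in> {1..Suc m}" "j \<in> {1..Suc m}" "i \<noteq> j" "a \<in> carrier L" "b \<in> carrier L" "u \<in> carrier (M \<boxtimes> Z)" for i j a b u
      using that E_comm[of i j a b]
      by (auto simp: extend_acts_def map_tensor_comp linmap_comp[of M M "E _ _" M "E _ _"] intro!: map_tensor_cong)
    show "extend_acts m M E Z i a (extend_acts m M E Z i b u)
        = extend_acts m M E Z i b (extend_acts m M E Z i a u) \<oplus>\<^bsub>M \<boxtimes> Z\<^esub> extend_acts m M E Z i \<lbrakk>a, b\<rbrakk>\<^bsub>L\<^esub> u"
      if "i \<in> {1..Suc m}" "a \<in> carrier L" "b \<in> carrier L" "u \<in> carrier (M \<boxtimes> Z)" for i a b u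
      using that E_bracket[of i a b] lie_module_bracket[OF Z, of a b]
      by (auto simp: extend_acts_def map_tensor_comp linmap_comp[of M M "E _ _" M "E _ _"]
          linmap_comp[of Z Z "act Z _" Z "act Z _"] linmap_plus
          simp flip: map_tensor_add_left map_tensor_add_right intro!: map_tensor_cong)
  qed (use lie t in auto)
qed

lemma lie_module_tensor:
  assumes X: "lie_module L X" and Y: "lie_module L Y"
  shows "lie_module L (X \<boxtimes> Y)"
proof (rule lie_moduleI[OF lie_module_lie[OF X] cvs_tensor_module linmap_act_tensor[OF X Y]])
  note [simp] = lie_module_cvs[OF X] lie_module_cvs[OF Y] linmap_act[OF X] linmap_act[OF Y] linmap_id
    lie_algebra_cvs[OF lie_module_lie[OF X]] lie_algebra.bracket_closed[OF lie_module_lie[OF X]]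
    lie_module_act_closed[OF X] lie_module_act_closed[OF Y]
  show "linmap L (X \<boxtimes> Y) (\<lambda>a. act (X \<boxtimes> Y) a u)" if "u \<in> carrier (X \<boxtimes> Y)" for u
  proof -
    have "linmap L (X \<boxtimes> Y) (\<lambda>a. map_tensor X Y X Y (act X a) (\<lambda>y. y) u
        \<oplus>\<^bsub>X \<boxtimes> Y\<^esub> map_tensor X Y X Y (\<lambda>x. x) (act Y a) u)"
      using that linmap_act_left[OF X] linmap_act_left[OF Y]
      by (intro linmap_plus linmap_map_tensor_left linmap_map_tensor_right) auto
    then show ?thesis using that act_tensor_map[OF X Y _ that] by (simp add: linmap_def)
  qed
  fix a b u assume ab: "a \<in> carrier L" "b \<in> carrier L" and u: "u \<in> carrier (X \<boxtimes> Y)"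
  note act = act_tensor_elem[OF X Y] linmap_add[OF linmap_act_tensor[OF X Y]]
  show "act (X \<boxtimes> Y) a (act (X \<boxtimes> Y) b u)
      = act (X \<boxtimes> Y) b (act (X \<boxtimes> Y) a u) \<oplus>\<^bsub>X \<boxtimes> Y\<^esub> act (X \<boxtimes> Y) \<lbrakk>a, b\<rbrakk>\<^bsub>L\<^esub> u"
  proof (rule linmap_tensor_ext[OF _ _ _ _ u])
    fix x y assume xy: "x \<in> carrier X" "y \<in> carrier Y"
    let ?e = "elem_tensor X Y"
    have "act (X \<boxtimes> Y) a (act (X \<boxtimes> Y) b (?e x y))
      = (?e (act X a (act X b x)) y \<oplus>\<^bsub>X \<boxtimes> Y\<^esub> ?e (act X b x) (act Y a y))
        \<oplus>\<^bsub>X \<boxtimes> Y\<^esub> (?e (act X a x) (act Y b y) \<oplus>\<^bsub>X \<boxtimes> Y\<^esub> ?e x (act Y a (act Y b y)))"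
      using xy ab by (simp add: act)
    also have "?e (act X a (act X b x)) y
        = ?e (act X b (act X a x)) y \<oplus>\<^bsub>X \<boxtimes> Y\<^esub> ?e (act X \<lbrakk>a, b\<rbrakk>\<^bsub>L\<^esub> x) y"
      using xy ab by (simp add: lie_module_bracket[OF X, of a b x] linmap_add[OF linmap_elem_left])
    also have "?e x (act Y a (act Y b y))
        = ?e x (act Y b (act Y a y)) \<oplus>\<^bsub>X \<boxtimes> Y\<^esub> ?e x (act Y \<lbrakk>a, b\<rbrakk>\<^bsub>L\<^esub> y)"
      using xy ab by (simp add: lie_module_bracket[OF Y, of a b y] linmap_add[OF linmap_elem_right])
    \<comment> \<open>The mixed terms, with one element acting on each factor, are the same on both
      sides; the expansions above account for the two bracket terms.\<close>
    finally show "act (X \<boxtimes> Y) a (act (X \<boxtimes> Y) b (?e x y))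
      = act (X \<boxtimes> Y) b (act (X \<boxtimes> Y) a (?e x y)) \<oplus>\<^bsub>X \<boxtimes> Y\<^esub> act (X \<boxtimes> Y) \<lbrakk>a, b\<rbrakk>\<^bsub>L\<^esub> (?e x y)"
      using xy ab by (simp add: act cvs_add_assoc cvs_add_left_comm cvs_add_comm)
  qed (use ab in \<open>auto intro!: linmap_plus linmap_act_tensor[OF X Y] linmap_comp[OF linmap_act_tensor[OF X Y]]\<close>)
qed

lemma lie_module_trivial: "lie_algebra L \<Longrightarrow> lie_module L trivial_module"
proof (rule lie_moduleI)
  show "cvs trivial_module"
    by (rule cvsI) (auto simp: trivial_module_def algebra_simps)
qed (auto simp: trivial_module_def linmap_def)

section \<open>The operators of the Drinfeld category\<close>

lemma intertwines_comp:
  assumes f: "lin_hmap f X Y" and g: "lin_hmap g Y Z"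
    and "intertwines f T S" "intertwines g S R" "linmap X X T" "linmap Z Z R"
  shows "intertwines (g \<circ>\<^sub>h f) T R"
  unfolding intertwines_def
proof (intro allI ballI)
  fix n x assume "x \<in> carrier (source (g \<circ>\<^sub>h f))"
  then have x: "x \<in> carrier X" by (simp add: comp_hmap_def lin_hmapD(3)[OF f])
  note D = lin_hmapD[OF f] lin_hmapD[OF g]
  have "terms (g \<circ>\<^sub>h f) n (T x) = finsum Z (\<lambda>k. terms g k (terms f (n - k) (T x))) {..n}"
    using x assms(5) by (intro terms_comp[OF f g]) (rule linmap_closed)
  also have "\<dots> = finsum Z (\<lambda>k. R (terms g k (terms f (n - k) x))) {..n}"
    using x assms D linmap_closed[OF assms(6)] by (intro cvs_finsum_cong) (auto simp: intertwines_def)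
  also have "\<dots> = R (terms (g \<circ>\<^sub>h f) n x)"
    unfolding terms_comp[OF f g x] using x D by (intro linmap_finsum[symmetric, OF assms(6)]) auto
  finally show "terms (g \<circ>\<^sub>h f) n (T x) = R (terms (g \<circ>\<^sub>h f) n x)" .
qed

lemma intertwines_const:
  assumes "cvs X" "cvs Y" "\<And>x. x \<in> carrier X \<Longrightarrow> p (T x) = S (p x)" "linmap X X T" "linmap Y Y S"
  shows "intertwines (const_hmap X Y p) T S"
  using assms linmap_closed[OF assms(4)] linmap_zero[OF assms(5)]
  by (auto simp: intertwines_def const_hmap_def)

lemma intertwines_cong:
  assumes "intertwines f T S" "lin_hmap f X Y"
    and "\<And>x. x \<in> carrier X \<Longrightarrow> T x = T' x" "\<And>y. y \<in> carrier Y \<Longrightarrow> S y = S' y"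
  shows "intertwines f T' S'"
  using assms by (auto simp: intertwines_def lin_hmapD(3,7)[OF assms(2)])

lemma intertwines_plus:
  assumes f: "lin_hmap f X Y" and "intertwines f T S" "intertwines f T' S'" "linmap X X T" "linmap X X T'"
  shows "intertwines f (\<lambda>x. T x \<oplus>\<^bsub>X\<^esub> T' x) (\<lambda>y. S y \<oplus>\<^bsub>Y\<^esub> S' y)"
  using assms(2-) linmap_closed[OF assms(4)] linmap_closed[OF assms(5)]
  by (auto simp: intertwines_def lin_hmapD(3)[OF f] linmap_add[OF lin_hmapD(5)[OF f]])

lemma intertwines_id: "intertwines f (\<lambda>x. x) (\<lambda>y. y)"
  by (simp add: intertwines_def)

lemma intertwines_tensor:
  assumes f: "lin_hmap f X X'" and g: "lin_hmap g Y Y'"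
    and p: "intertwines f p p'" "linmap X X p" "linmap X' X' p'"
    and q: "intertwines g q q'" "linmap Y Y q" "linmap Y' Y' q'"
  shows "intertwines (f \<otimes>\<^sub>h g) (map_tensor X Y X Y p q) (map_tensor X' Y' X' Y' p' q')"
  unfolding intertwines_def
proof (intro allI ballI)
  note D = lin_hmapD[OF f] lin_hmapD[OF g]
  note fg = lin_hmap_tensor[OF f g]
  fix n u assume "u \<in> carrier (source (f \<otimes>\<^sub>h g))"
  then have u: "u \<in> carrier (X \<boxtimes> Y)" by (simp add: lin_hmapD(3)[OF fg])
  show "terms (f \<otimes>\<^sub>h g) n (map_tensor X Y X Y p q u) = map_tensor X' Y' X' Y' p' q' (terms (f \<otimes>\<^sub>h g) n u)"
  proof (rule linmap_tensor_ext[where f = "\<lambda>u. terms (f \<otimes>\<^sub>h g) n (map_tensor X Y X Y p q u)"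
        and g = "\<lambda>u. map_tensor X' Y' X' Y' p' q' (terms (f \<otimes>\<^sub>h g) n u)", OF _ _ _ _ u])
    show "linmap (X \<boxtimes> Y) (X' \<boxtimes> Y') (\<lambda>u. terms (f \<otimes>\<^sub>h g) n (map_tensor X Y X Y p q u))"
      by (rule linmap_comp[OF lin_hmapD(5)[OF fg] linmap_map_tensor]) (use D p q in auto)
    show "linmap (X \<boxtimes> Y) (X' \<boxtimes> Y') (\<lambda>u. map_tensor X' Y' X' Y' p' q' (terms (f \<otimes>\<^sub>h g) n u))"
      by (rule linmap_comp[OF linmap_map_tensor lin_hmapD(5)[OF fg]]) (use D p q in auto)
    fix x y assume xy: "x \<in> carrier X" "y \<in> carrier Y"
    have "terms (f \<otimes>\<^sub>h g) n (map_tensor X Y X Y p q (elem_tensor X Y x y))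
        = finsum (X' \<boxtimes> Y') (\<lambda>k. elem_tensor X' Y' (terms f k (p x)) (terms g (n - k) (q y))) {..n}"
      using xy D p q by (simp add: terms_tensor_elem[OF f g] linmap_closed[OF p(2)] linmap_closed[OF q(2)])
    also have "\<dots> = finsum (X' \<boxtimes> Y') (\<lambda>k. map_tensor X' Y' X' Y' p' q'
        (elem_tensor X' Y' (terms f k x) (terms g (n - k) y))) {..n}"
      using xy D p q linmap_closed[OF p(3)] linmap_closed[OF q(3)]
      by (intro cvs_finsum_cong) (auto simp: intertwines_def)
    also have "\<dots> = map_tensor X' Y' X' Y' p' q' (terms (f \<otimes>\<^sub>h g) n (elem_tensor X Y x y))"
      unfolding terms_tensor_elem[OF f g xy] using xy D p q
      by (intro linmap_finsum[symmetric] linmap_map_tensor) auto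
    finally show "terms (f \<otimes>\<^sub>h g) n (map_tensor X Y X Y p q (elem_tensor X Y x y))
        = map_tensor X' Y' X' Y' p' q' (terms (f \<otimes>\<^sub>h g) n (elem_tensor X Y x y))" .
  qed simp
qed

text \<open>For fixed \<open>z\<close> the map u \<mapsto> u \<otimes> z is linear and intertwines
  \<open>T i\<close> with \<open>T i\<close> \<otimes> id, hence it commutes with the evaluation of
  series.\<close>

lemma series_hmap_tensor_id:
  assumes "operators M A T" "cvs Z"
  shows "series_hmap M A T f \<otimes>\<^sub>h id_hmap Z
    = series_hmap (M \<boxtimes> Z) A (\<lambda>i. map_tensor M Z M Z (T i) (\<lambda>z. z)) f"
proof (rule hmap_tensor_eqI)
  interpret M: operators M A T by fact
  note [simp] = M.cvs assms linmap_id
  have op: "operators (M \<boxtimes> Z) A (\<lambda>i. map_tensor M Z M Z (T i) (\<lambda>z. z))"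
    using M.finite_index M.linmap_op by (intro operators.intro linmap_map_tensor) auto
  show "lin_hmap (series_hmap M A T f \<otimes>\<^sub>h id_hmap Z) (M \<boxtimes> Z) (M \<boxtimes> Z)"
    by (intro lin_hmap_tensor lin_hmap_series lin_hmap_id assms)
  show "lin_hmap (series_hmap (M \<boxtimes> Z) A (\<lambda>i. map_tensor M Z M Z (T i) (\<lambda>z. z)) f) (M \<boxtimes> Z) (M \<boxtimes> Z)"
    using op by auto
  fix n u z assume uz: "u \<in> carrier M" "z \<in> carrier Z"
  have "terms (series_hmap M A T f \<otimes>\<^sub>h id_hmap Z) n (elem_tensor M Z u z)
      = elem_tensor M Z (series_value M A T f n u) z"
    using uz by (subst terms_tensor_const[OF lin_hmap_series]) (auto simp: terms_series_hmap)
  also have "\<dots> = series_value (M \<boxtimes> Z) A (\<lambda>i. map_tensor M Z M Z (T i) (\<lambda>z. z)) f n (elem_tensor M Z u z)"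
    using uz M.linmap_op
    by (intro series_value_intertwine[OF assms(1) op, of "\<lambda>u. elem_tensor M Z u z"] linmap_elem_left) auto
  finally show "terms (series_hmap M A T f \<otimes>\<^sub>h id_hmap Z) n (elem_tensor M Z u z)
      = terms (series_hmap (M \<boxtimes> Z) A (\<lambda>i. map_tensor M Z M Z (T i) (\<lambda>z. z)) f) n (elem_tensor M Z u z)"
    using uz by (simp add: terms_series_hmap)
qed

lemma id_tensor_series_hmap:
  assumes "operators M A T" "cvs Z"
  shows "id_hmap Z \<otimes>\<^sub>h series_hmap M A T f
    = series_hmap (Z \<boxtimes> M) A (\<lambda>i. map_tensor Z M Z M (\<lambda>z. z) (T i)) f"
proof (rule hmap_tensor_eqI)
  interpret M: operators M A T by fact
  note [simp] = M.cvs assms linmap_id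
  have op: "operators (Z \<boxtimes> M) A (\<lambda>i. map_tensor Z M Z M (\<lambda>z. z) (T i))"
    using M.finite_index M.linmap_op by (intro operators.intro linmap_map_tensor) auto
  show "lin_hmap (id_hmap Z \<otimes>\<^sub>h series_hmap M A T f) (Z \<boxtimes> M) (Z \<boxtimes> M)"
    by (intro lin_hmap_tensor lin_hmap_series lin_hmap_id assms)
  show "lin_hmap (series_hmap (Z \<boxtimes> M) A (\<lambda>i. map_tensor Z M Z M (\<lambda>z. z) (T i)) f) (Z \<boxtimes> M) (Z \<boxtimes> M)"
    using op by auto
  fix n z u assume uz: "z \<in> carrier Z" "u \<in> carrier M"
  have "terms (id_hmap Z \<otimes>\<^sub>h series_hmap M A T f) n (elem_tensor Z M z u)
      = elem_tensor Z M z (series_value M A T f n u)"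
    using uz by (subst terms_const_tensor[OF _ lin_hmap_series]) (auto simp: terms_series_hmap)
  also have "\<dots> = series_value (Z \<boxtimes> M) A (\<lambda>i. map_tensor Z M Z M (\<lambda>z. z) (T i)) f n (elem_tensor Z M z u)"
    using uz M.linmap_op
    by (intro series_value_intertwine[OF assms(1) op, of "elem_tensor Z M z"] linmap_elem_right) auto
  finally show "terms (id_hmap Z \<otimes>\<^sub>h series_hmap M A T f) n (elem_tensor Z M z u)
      = terms (series_hmap (Z \<boxtimes> M) A (\<lambda>i. map_tensor Z M Z M (\<lambda>z. z) (T i)) f) n (elem_tensor Z M z u)"
    using uz by (simp add: terms_series_hmap)
qed

locale lie_form =
  fixes L :: "('l, 'y) lie_scheme" and t :: "('l, 'l) formal_sum"
  assumes lie: "lie_algebra L" and form: "t \<in> sym_square_invariants L"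
begin

abbreviation lmod :: "('l, 'a) umod \<Rightarrow> bool" where
  "lmod X \<equiv> lie_module L X"

lemma t_formal: "t \<in> formal_sums L L"
  using form by (auto simp: sym_square_invariants_def sym_square_def carrier_tensor_iff)

lemma lmod_rules [simp]:
  "lmod X \<Longrightarrow> cvs X" "\<lbrakk>lmod X; a \<in> carrier L\<rbrakk> \<Longrightarrow> linmap X X (act X a)"
  "\<lbrakk>lmod X; a \<in> carrier L; x \<in> carrier X\<rbrakk> \<Longrightarrow> act X a x \<in> carrier X"
  "\<lbrakk>lmod X; lmod Y\<rbrakk> \<Longrightarrow> lmod (X \<boxtimes> Y)"
  by (fact lie_module_cvs linmap_act lie_module_act_closed lie_module_tensor)+

text \<open>Common shape of the operators built from t: a family \<omega> indexed by the two legs,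
  evaluated at t. An identity between operators is then checked for fixed legs \<open>a\<close> and
  \<open>b\<close>.\<close>

definition lift_op :: "('l, 'a) umod \<Rightarrow> ('l \<Rightarrow> 'l \<Rightarrow> 'a tuniv \<Rightarrow> 'a tuniv) \<Rightarrow> 'a tuniv \<Rightarrow> 'a tuniv" where
  "lift_op M \<omega> u = tensor_lift M (\<lambda>a b. \<omega> a b u) t"

lemma linmap_lift_op:
  assumes "cvs M" "\<And>a b. \<lbrakk>a \<in> carrier L; b \<in> carrier L\<rbrakk> \<Longrightarrow> linmap M M (\<omega> a b)"
  shows "linmap M M (lift_op M \<omega>)"
  unfolding lift_op_def[abs_def] using assms by (intro linmap_of_tensor_lift[OF t_formal])

lemma lift_op_transport:
  assumes "cvs M" "cvs N" and P: "linmap M N P"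
    and \<omega>: "\<And>a b. \<lbrakk>a \<in> carrier L; b \<in> carrier L\<rbrakk> \<Longrightarrow> linmap M M (\<omega> a b)"
    and PO: "\<And>a b. \<lbrakk>a \<in> carrier L; b \<in> carrier L\<rbrakk> \<Longrightarrow> P (\<omega> a b u) = \<omega>' a b (P u)"
    and u: "u \<in> carrier M"
  shows "P (lift_op M \<omega> u) = lift_op N \<omega>' (P u)"
proof -
  have "P (lift_op M \<omega> u) = tensor_lift N (\<lambda>a b. P (\<omega> a b u)) t"
    unfolding lift_op_def using linmap_closed[OF \<omega>] u
    by (intro linmap_comp_tensor_lift[OF P assms(1,2) t_formal]) auto
  also have "\<dots> = lift_op N \<omega>' (P u)"
    unfolding lift_op_def by (rule tensor_lift_cong[OF t_formal]) (rule PO)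
  finally show ?thesis .
qed

lemma lift_op_plus:
  assumes "cvs M" "\<And>a b. \<lbrakk>a \<in> carrier L; b \<in> carrier L\<rbrakk> \<Longrightarrow> linmap M M (\<omega> a b)"
    "\<And>a b. \<lbrakk>a \<in> carrier L; b \<in> carrier L\<rbrakk> \<Longrightarrow> linmap M M (\<omega>' a b)" "u \<in> carrier M"
  shows "lift_op M \<omega> u \<oplus>\<^bsub>M\<^esub> lift_op M \<omega>' u = lift_op M (\<lambda>a b u. \<omega> a b u \<oplus>\<^bsub>M\<^esub> \<omega>' a b u) u"
  unfolding lift_op_def
  by (rule tensor_lift_plus[symmetric, OF t_formal assms(1)])
    (use linmap_closed[OF assms(2)] linmap_closed[OF assms(3)] assms(4) in auto)

lemma intertwines_lift_op:
  assumes F: "lin_hmap F M N"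
    and "\<And>a b. \<lbrakk>a \<in> carrier L; b \<in> carrier L\<rbrakk> \<Longrightarrow> linmap M M (\<omega> a b)"
    and "\<And>a b. \<lbrakk>a \<in> carrier L; b \<in> carrier L\<rbrakk> \<Longrightarrow> intertwines F (\<omega> a b) (\<omega>' a b)"
  shows "intertwines F (lift_op M \<omega>) (lift_op N \<omega>')"
  unfolding intertwines_def
  using assms(3) lin_hmapD(3)[OF F]
  by (intro allI ballI lift_op_transport[OF lin_hmapD(1,2,5)[OF F] assms(2)]) (auto simp: intertwines_def)

abbreviation t12_op where "t12_op X Y Z \<equiv>
  \<lambda>a b. map_tensor (X \<boxtimes> Y) Z (X \<boxtimes> Y) Z (map_tensor X Y X Y (act X a) (act Y b)) (\<lambda>z. z)"
abbreviation t23_op where "t23_op X Y Z \<equiv>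
  \<lambda>a b. map_tensor (X \<boxtimes> Y) Z (X \<boxtimes> Y) Z (map_tensor X Y X Y (\<lambda>x. x) (act Y a)) (act Z b)"
abbreviation t_op where "t_op X Y \<equiv> \<lambda>a b. map_tensor X Y X Y (act X a) (act Y b)"

lemma t_act_eq: "t_act t X Y = lift_op (X \<boxtimes> Y) (t_op X Y)"
  "t12_act t X Y Z = lift_op ((X \<boxtimes> Y) \<boxtimes> Z) (t12_op X Y Z)"
  "t23_act t X Y Z = lift_op ((X \<boxtimes> Y) \<boxtimes> Z) (t23_op X Y Z)"
  by (auto simp: t_act_def t12_act_def t23_act_def lift_op_def)

lemma linmap_t_op:
  assumes "lmod X" "lmod Y" "a \<in> carrier L" "b \<in> carrier L"
  shows "linmap (X \<boxtimes> Y) (X \<boxtimes> Y) (t_op X Y a b)"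
    and "lmod Z \<Longrightarrow> linmap ((X \<boxtimes> Y) \<boxtimes> Z) ((X \<boxtimes> Y) \<boxtimes> Z) (t12_op X Y Z a b)"
    and "lmod Z \<Longrightarrow> linmap ((X \<boxtimes> Y) \<boxtimes> Z) ((X \<boxtimes> Y) \<boxtimes> Z) (t23_op X Y Z a b)"
  using assms by (auto intro!: linmap_map_tensor linmap_id)

lemma linmap_t_act [simp]:
  assumes "lmod X" "lmod Y"
  shows "linmap (X \<boxtimes> Y) (X \<boxtimes> Y) (t_act t X Y)"
    and "lmod Z \<Longrightarrow> linmap ((X \<boxtimes> Y) \<boxtimes> Z) ((X \<boxtimes> Y) \<boxtimes> Z) (t12_act t X Y Z)"
    and "lmod Z \<Longrightarrow> linmap ((X \<boxtimes> Y) \<boxtimes> Z) ((X \<boxtimes> Y) \<boxtimes> Z) (t23_act t X Y Z)"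
  unfolding t_act_eq using assms by (auto intro!: linmap_lift_op linmap_t_op)

text \<open>The left-bracketed product with the factors in their given order serves as the space of
  reference; on it \<open>T3 X Y Z i j\<close> is the operator
  \<open>t\<^sup>i\<^sup>j\<close>.\<close>

definition acts3 :: "('l, 'a) umod \<Rightarrow> ('l, 'a) umod \<Rightarrow> ('l, 'a) umod \<Rightarrow> nat \<Rightarrow> 'l \<Rightarrow> 'a tuniv \<Rightarrow> 'a tuniv" where
  "acts3 X Y Z = extend_acts 2 (X \<boxtimes> Y) (extend_acts 1 X (\<lambda>_. act X) Y) Z"

definition acts4 :: "('l, 'a) umod \<Rightarrow> ('l, 'a) umod \<Rightarrow> ('l, 'a) umod \<Rightarrow> ('l, 'a) umod
    \<Rightarrow> nat \<Rightarrow> 'l \<Rightarrow> 'a tuniv \<Rightarrow> 'a tuniv" where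
  "acts4 W X Y Z = extend_acts 3 ((W \<boxtimes> X) \<boxtimes> Y) (acts3 W X Y) Z"

abbreviation T3 where "T3 X Y Z i j \<equiv> lie_actions.tens ((X \<boxtimes> Y) \<boxtimes> Z) (acts3 X Y Z) t i j"
abbreviation T4 where "T4 W X Y Z i j \<equiv> lie_actions.tens (((W \<boxtimes> X) \<boxtimes> Y) \<boxtimes> Z) (acts4 W X Y Z) t i j"

lemma lie_actions2:
  assumes "lmod X" "lmod Y"
  shows "lie_actions L (X \<boxtimes> Y) {1..2} (extend_acts 1 X (\<lambda>_. act X) Y) t"
  using lie_actions_extend[OF lie_actions_single[OF assms(1) form] assms(2)] by (simp add: numeral_2_eq_2)

lemma lie_actions3:
  assumes "lmod X" "lmod Y" "lmod Z"
  shows "lie_actions L ((X \<boxtimes> Y) \<boxtimes> Z) {1..3} (acts3 X Y Z) t"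
  using lie_actions_extend[OF lie_actions2[OF assms(1,2)] assms(3)] by (simp add: acts3_def numeral_3_eq_3)

lemma lie_actions4:
  assumes "lmod W" "lmod X" "lmod Y" "lmod Z"
  shows "lie_actions L (((W \<boxtimes> X) \<boxtimes> Y) \<boxtimes> Z) {1..4} (acts4 W X Y Z) t"
  using lie_actions_extend[OF lie_actions3[OF assms(1-3)] assms(4)] by (simp add: acts4_def)

lemma linmap_acts:
  "\<lbrakk>lmod X; lmod Y; a \<in> carrier L; i \<in> {1..2}\<rbrakk>
    \<Longrightarrow> linmap (X \<boxtimes> Y) (X \<boxtimes> Y) (extend_acts 1 X (\<lambda>_. act X) Y i a)"
  "\<lbrakk>lmod X; lmod Y; lmod Z; a \<in> carrier L; i \<in> {1..3}\<rbrakk>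
    \<Longrightarrow> linmap ((X \<boxtimes> Y) \<boxtimes> Z) ((X \<boxtimes> Y) \<boxtimes> Z) (acts3 X Y Z i a)"
  "\<lbrakk>lmod W; lmod X; lmod Y; lmod Z; a \<in> carrier L; i \<in> {1..4}\<rbrakk>
    \<Longrightarrow> linmap (((W \<boxtimes> X) \<boxtimes> Y) \<boxtimes> Z) (((W \<boxtimes> X) \<boxtimes> Y) \<boxtimes> Z) (acts4 W X Y Z i a)"
  by (rule lie_actions.linmap_E[OF lie_actions2] lie_actions.linmap_E[OF lie_actions3]
      lie_actions.linmap_E[OF lie_actions4]; assumption)+

lemma acts2_elem [simp]:
  assumes "lmod X" "lmod Y" "a \<in> carrier L" "x \<in> carrier X" "y \<in> carrier Y"
  shows "extend_acts (Suc 0) X (\<lambda>_. act X) Y (Suc 0) a (elem_tensor X Y x y) = elem_tensor X Y (act X a x) y"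
    and "extend_acts (Suc 0) X (\<lambda>_. act X) Y 2 a (elem_tensor X Y x y) = elem_tensor X Y x (act Y a y)"
  using assms by (auto simp: extend_acts_def linmap_id)

lemma acts3_elem [simp]:
  assumes "lmod X" "lmod Y" "lmod Z" "a \<in> carrier L" "x \<in> carrier X" "y \<in> carrier Y" "z \<in> carrier Z"
  shows "acts3 X Y Z (Suc 0) a (elem_tensor (X \<boxtimes> Y) Z (elem_tensor X Y x y) z)
      = elem_tensor (X \<boxtimes> Y) Z (elem_tensor X Y (act X a x) y) z"
    and "acts3 X Y Z 2 a (elem_tensor (X \<boxtimes> Y) Z (elem_tensor X Y x y) z)
      = elem_tensor (X \<boxtimes> Y) Z (elem_tensor X Y x (act Y a y)) z"
    and "acts3 X Y Z 3 a (elem_tensor (X \<boxtimes> Y) Z (elem_tensor X Y x y) z)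
      = elem_tensor (X \<boxtimes> Y) Z (elem_tensor X Y x y) (act Z a z)"
  using assms linmap_acts(1)[OF assms(1,2,4), of 1] linmap_acts(1)[OF assms(1,2,4), of 2]
  by (auto simp: acts3_def extend_acts_def[of 2] linmap_id)

lemma acts4_elem [simp]:
  assumes "lmod W" "lmod X" "lmod Y" "lmod Z" "a \<in> carrier L" "u \<in> carrier ((W \<boxtimes> X) \<boxtimes> Y)" "z \<in> carrier Z"
  shows "i \<in> {1..3} \<Longrightarrow> acts4 W X Y Z i a (elem_tensor ((W \<boxtimes> X) \<boxtimes> Y) Z u z)
      = elem_tensor ((W \<boxtimes> X) \<boxtimes> Y) Z (acts3 W X Y i a u) z"
    and "acts4 W X Y Z 4 a (elem_tensor ((W \<boxtimes> X) \<boxtimes> Y) Z u z)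
      = elem_tensor ((W \<boxtimes> X) \<boxtimes> Y) Z u (act Z a z)"
  using assms linmap_acts(2)[OF assms(1-3,5), of i]
  by (auto simp: acts4_def extend_acts_def[of 3] linmap_id)

lemma T3_eq: "\<lbrakk>lmod X; lmod Y; lmod Z\<rbrakk> \<Longrightarrow>
    T3 X Y Z i j = lift_op ((X \<boxtimes> Y) \<boxtimes> Z) (\<lambda>a b u. acts3 X Y Z i a (acts3 X Y Z j b u))"
  by (auto simp: fun_eq_iff lift_op_def lie_actions.tens_def[OF lie_actions3])

lemma T4_eq: "\<lbrakk>lmod W; lmod X; lmod Y; lmod Z\<rbrakk> \<Longrightarrow> T4 W X Y Z i j
    = lift_op (((W \<boxtimes> X) \<boxtimes> Y) \<boxtimes> Z) (\<lambda>a b u. acts4 W X Y Z i a (acts4 W X Y Z j b u))"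
  by (auto simp: fun_eq_iff lift_op_def lie_actions.tens_def[OF lie_actions4])

lemma acts3_comp:
  "\<lbrakk>lmod X; lmod Y; lmod Z; a \<in> carrier L; b \<in> carrier L; i \<in> {1..3}; j \<in> {1..3}\<rbrakk> \<Longrightarrow>
    linmap ((X \<boxtimes> Y) \<boxtimes> Z) ((X \<boxtimes> Y) \<boxtimes> Z) (\<lambda>u. acts3 X Y Z i a (acts3 X Y Z j b u))"
  by (intro linmap_comp[OF linmap_acts(2) linmap_acts(2)])

lemma acts4_comp:
  "\<lbrakk>lmod W; lmod X; lmod Y; lmod Z; a \<in> carrier L; b \<in> carrier L; i \<in> {1..4}; j \<in> {1..4}\<rbrakk> \<Longrightarrow>
    linmap (((W \<boxtimes> X) \<boxtimes> Y) \<boxtimes> Z) (((W \<boxtimes> X) \<boxtimes> Y) \<boxtimes> Z) (\<lambda>u. acts4 W X Y Z i a (acts4 W X Y Z j b u))"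
  by (intro linmap_comp[OF linmap_acts(3) linmap_acts(3)])

lemma T3_plus:
  assumes "lmod X" "lmod Y" "lmod Z" "i \<in> {1..3}" "j \<in> {1..3}" "k \<in> {1..3}" "l \<in> {1..3}" "u \<in> carrier ((X \<boxtimes> Y) \<boxtimes> Z)"
  shows "T3 X Y Z i j u \<oplus>\<^bsub>(X \<boxtimes> Y) \<boxtimes> Z\<^esub> T3 X Y Z k l u
    = lift_op ((X \<boxtimes> Y) \<boxtimes> Z) (\<lambda>a b u. acts3 X Y Z i a (acts3 X Y Z j b u)
        \<oplus>\<^bsub>(X \<boxtimes> Y) \<boxtimes> Z\<^esub> acts3 X Y Z k a (acts3 X Y Z l b u)) u"
  unfolding T3_eq[OF assms(1-3)] using assms by (intro lift_op_plus acts3_comp) simp_all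

lemma T4_plus:
  assumes "lmod W" "lmod X" "lmod Y" "lmod Z" "i \<in> {1..4}" "j \<in> {1..4}" "k \<in> {1..4}" "l \<in> {1..4}"
    "u \<in> carrier (((W \<boxtimes> X) \<boxtimes> Y) \<boxtimes> Z)"
  shows "T4 W X Y Z i j u \<oplus>\<^bsub>((W \<boxtimes> X) \<boxtimes> Y) \<boxtimes> Z\<^esub> T4 W X Y Z k l u
    = lift_op (((W \<boxtimes> X) \<boxtimes> Y) \<boxtimes> Z) (\<lambda>a b u. acts4 W X Y Z i a (acts4 W X Y Z j b u)
        \<oplus>\<^bsub>((W \<boxtimes> X) \<boxtimes> Y) \<boxtimes> Z\<^esub> acts4 W X Y Z k a (acts4 W X Y Z l b u)) u"
  unfolding T4_eq[OF assms(1-4)] using assms by (intro lift_op_plus acts4_comp) simp_all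

text \<open>Reduces the comparison of operators across a structural map \<open>P\<close> to one
  computation with fixed legs on a pure tensor.\<close>

lemma lift_op_transport3:
  assumes XYZ: "lmod X" "lmod Y" "lmod Z" and N: "cvs N" and P: "linmap ((X \<boxtimes> Y) \<boxtimes> Z) N P"
    and \<omega>: "\<And>a b. \<lbrakk>a \<in> carrier L; b \<in> carrier L\<rbrakk> \<Longrightarrow> linmap ((X \<boxtimes> Y) \<boxtimes> Z) ((X \<boxtimes> Y) \<boxtimes> Z) (\<omega> a b)"
    and \<omega>': "\<And>a b. \<lbrakk>a \<in> carrier L; b \<in> carrier L\<rbrakk> \<Longrightarrow> linmap N N (\<omega>' a b)"
    and pure: "\<And>a b x y z. \<lbrakk>a \<in> carrier L; b \<in> carrier L; x \<in> carrier X; y \<in> carrier Y; z \<in> carrier Z\<rbrakk> \<Longrightarrow>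
      P (\<omega> a b (elem_tensor (X \<boxtimes> Y) Z (elem_tensor X Y x y) z))
      = \<omega>' a b (P (elem_tensor (X \<boxtimes> Y) Z (elem_tensor X Y x y) z))"
    and u: "u \<in> carrier ((X \<boxtimes> Y) \<boxtimes> Z)"
  shows "P (lift_op ((X \<boxtimes> Y) \<boxtimes> Z) \<omega> u) = lift_op N \<omega>' (P u)"
proof (rule lift_op_transport[OF cvs_tensor_module N P \<omega> _ u])
  fix a b assume ab: "a \<in> carrier L" "b \<in> carrier L"
  show "P (\<omega> a b u) = \<omega>' a b (P u)"
    by (rule linmap_tensor_ext3[where f = "\<lambda>u. P (\<omega> a b u)" and g = "\<lambda>u. \<omega>' a b (P u)",
          OF lmod_rules(1) lmod_rules(1) lmod_rules(1) N linmap_comp[OF P \<omega>] linmap_comp[OF \<omega>' P] pure u])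
      (use ab XYZ in auto)
qed

lemma lift_op_transport4:
  assumes WXYZ: "lmod W" "lmod X" "lmod Y" "lmod Z" and N: "cvs N" and P: "linmap (((W \<boxtimes> X) \<boxtimes> Y) \<boxtimes> Z) N P"
    and \<omega>: "\<And>a b. \<lbrakk>a \<in> carrier L; b \<in> carrier L\<rbrakk> \<Longrightarrow>
      linmap (((W \<boxtimes> X) \<boxtimes> Y) \<boxtimes> Z) (((W \<boxtimes> X) \<boxtimes> Y) \<boxtimes> Z) (\<omega> a b)"
    and \<omega>': "\<And>a b. \<lbrakk>a \<in> carrier L; b \<in> carrier L\<rbrakk> \<Longrightarrow> linmap N N (\<omega>' a b)"
    and pure: "\<And>a b w x y z. \<lbrakk>a \<in> carrier L; b \<in> carrier L; w \<in> carrier W; x \<in> carrier X; y \<in> carrier Y; z \<in> carrier Z\<rbrakk> \<Longrightarrow>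
      P (\<omega> a b (elem_tensor ((W \<boxtimes> X) \<boxtimes> Y) Z (elem_tensor (W \<boxtimes> X) Y (elem_tensor W X w x) y) z))
      = \<omega>' a b (P (elem_tensor ((W \<boxtimes> X) \<boxtimes> Y) Z (elem_tensor (W \<boxtimes> X) Y (elem_tensor W X w x) y) z))"
    and u: "u \<in> carrier (((W \<boxtimes> X) \<boxtimes> Y) \<boxtimes> Z)"
  shows "P (lift_op (((W \<boxtimes> X) \<boxtimes> Y) \<boxtimes> Z) \<omega> u) = lift_op N \<omega>' (P u)"
proof (rule lift_op_transport[OF cvs_tensor_module N P \<omega> _ u])
  fix a b assume ab: "a \<in> carrier L" "b \<in> carrier L"
  show "P (\<omega> a b u) = \<omega>' a b (P u)"
    by (rule linmap_tensor_ext4[where f = "\<lambda>u. P (\<omega> a b u)" and g = "\<lambda>u. \<omega>' a b (P u)",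
          OF lmod_rules(1) lmod_rules(1) lmod_rules(1) lmod_rules(1) N linmap_comp[OF P \<omega>] linmap_comp[OF \<omega>' P] pure u])
      (use ab WXYZ in auto)
qed

text \<open>With the second factor fixed, \<open>elem_tensor\<close> is linear in the first and can
  be moved inside the sum over t.\<close>

lemma map_tensor_lift_op:
  assumes "lmod X" "lmod Y" "linmap Y Y g" "u \<in> carrier (X \<boxtimes> Y)"
    and "\<And>a b. \<lbrakk>a \<in> carrier L; b \<in> carrier L\<rbrakk> \<Longrightarrow> linmap X X (\<omega> a b)"
  shows "map_tensor X Y X Y (lift_op X \<omega>) g u = lift_op (X \<boxtimes> Y) (\<lambda>a b. map_tensor X Y X Y (\<omega> a b) g) u"
proof (rule linmap_tensor_ext[where f = "map_tensor X Y X Y (lift_op X \<omega>) g", OF _ _ _ _ assms(4)])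
  note l = linmap_lift_op[OF lmod_rules(1)[OF assms(1)] assms(5)]
  show "linmap (X \<boxtimes> Y) (X \<boxtimes> Y) (map_tensor X Y X Y (lift_op X \<omega>) g)"
    "linmap (X \<boxtimes> Y) (X \<boxtimes> Y) (lift_op (X \<boxtimes> Y) (\<lambda>a b. map_tensor X Y X Y (\<omega> a b) g))"
    using assms l by (auto intro!: linmap_map_tensor linmap_lift_op)
  fix x y assume xy: "x \<in> carrier X" "y \<in> carrier Y"
  then show "map_tensor X Y X Y (lift_op X \<omega>) g (elem_tensor X Y x y)
      = lift_op (X \<boxtimes> Y) (\<lambda>a b. map_tensor X Y X Y (\<omega> a b) g) (elem_tensor X Y x y)"
    using assms l linmap_closed[OF assms(3)] linmap_closed[OF assms(5)]
      linmap_comp_tensor_lift[OF linmap_elem_left[of X Y "g y"] _ _ t_formal, of "\<lambda>a b. \<omega> a b x"]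
    by (auto simp: lift_op_def intro!: tensor_lift_cong[OF t_formal])
qed simp

lemma map_tensor_lift_op_right:
  assumes "lmod X" "lmod Y" "linmap X X f" "u \<in> carrier (X \<boxtimes> Y)"
    and "\<And>a b. \<lbrakk>a \<in> carrier L; b \<in> carrier L\<rbrakk> \<Longrightarrow> linmap Y Y (\<omega> a b)"
  shows "map_tensor X Y X Y f (lift_op Y \<omega>) u = lift_op (X \<boxtimes> Y) (\<lambda>a b. map_tensor X Y X Y f (\<omega> a b)) u"
proof (rule linmap_tensor_ext[where f = "map_tensor X Y X Y f (lift_op Y \<omega>)", OF _ _ _ _ assms(4)])
  note l = linmap_lift_op[OF lmod_rules(1)[OF assms(2)] assms(5)]
  show "linmap (X \<boxtimes> Y) (X \<boxtimes> Y) (map_tensor X Y X Y f (lift_op Y \<omega>))"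
    "linmap (X \<boxtimes> Y) (X \<boxtimes> Y) (lift_op (X \<boxtimes> Y) (\<lambda>a b. map_tensor X Y X Y f (\<omega> a b)))"
    using assms l by (auto intro!: linmap_map_tensor linmap_lift_op)
  fix x y assume xy: "x \<in> carrier X" "y \<in> carrier Y"
  then show "map_tensor X Y X Y f (lift_op Y \<omega>) (elem_tensor X Y x y)
      = lift_op (X \<boxtimes> Y) (\<lambda>a b. map_tensor X Y X Y f (\<omega> a b)) (elem_tensor X Y x y)"
    using assms l linmap_closed[OF assms(3)] linmap_closed[OF assms(5)]
      linmap_comp_tensor_lift[OF linmap_elem_right[of X Y "f x"] _ _ t_formal, of "\<lambda>a b. \<omega> a b y"]
    by (auto simp: lift_op_def intro!: tensor_lift_cong[OF t_formal])
qed simp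

lemma act_elem:
  "\<lbrakk>lmod X; lmod Y; a \<in> carrier L; x \<in> carrier X; y \<in> carrier Y\<rbrakk> \<Longrightarrow> act (X \<boxtimes> Y) a (elem_tensor X Y x y)
    = elem_tensor X Y (act X a x) y \<oplus>\<^bsub>X \<boxtimes> Y\<^esub> elem_tensor X Y x (act Y a y)"
  by (rule act_tensor_elem)

lemmas linmap_tensor_simps =
  linmap_id linmap_map_tensor linmap_flip_tensor linmap_assoc_tensor linmap_assoc_tensor_inv

text \<open>Evaluates structural maps and actions on pure tensors; the collection after it proves
  linearity of composites along their structure.\<close>

lemmas tensor_calc = linmap_tensor_simps act_elem
  linmap_add[OF linmap_map_tensor] linmap_add[OF linmap_flip_tensor] linmap_add[OF linmap_assoc_tensor]
  linmap_add[OF linmap_assoc_tensor_inv] linmap_add[OF linmap_elem_left] linmap_add[OF linmap_elem_right]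

lemmas linmap_op_rules = linmap_plus linmap_comp[OF linmap_map_tensor] linmap_comp[OF linmap_flip_tensor]
  linmap_comp[OF linmap_assoc_tensor] linmap_comp[OF linmap_assoc_tensor_inv] linmap_tensor_simps
  acts3_comp acts4_comp

section \<open>The operators of t on three tensor factors\<close>

context
  fixes X Y Z :: "('l, 'a) umod"
  assumes XYZ [simp]: "lmod X" "lmod Y" "lmod Z"
begin

lemma t12_T3: "u \<in> carrier ((X \<boxtimes> Y) \<boxtimes> Z) \<Longrightarrow> T3 X Y Z 1 2 u = t12_act t X Y Z u"
  unfolding t_act_eq T3_eq[OF XYZ]
  by (rule lift_op_transport3[OF XYZ, where P = "\<lambda>u. u"]) (auto simp: tensor_calc intro!: linmap_op_rules)

lemma t23_T3: "u \<in> carrier ((X \<boxtimes> Y) \<boxtimes> Z) \<Longrightarrow> T3 X Y Z 2 3 u = t23_act t X Y Z u"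
  unfolding t_act_eq T3_eq[OF XYZ]
  by (rule lift_op_transport3[OF XYZ, where P = "\<lambda>u. u"]) (auto simp: tensor_calc intro!: linmap_op_rules)

lemma t12_act_map:
  assumes "u \<in> carrier ((X \<boxtimes> Y) \<boxtimes> Z)"
  shows "map_tensor (X \<boxtimes> Y) Z (X \<boxtimes> Y) Z (t_act t X Y) (\<lambda>z. z) u = t12_act t X Y Z u"
  unfolding t_act_eq using assms by (intro map_tensor_lift_op) (auto intro!: linmap_op_rules)

text \<open>In the other bracketing \<open>t\<^sup>2\<^sup>3\<close> is id \<otimes> t. This form
  yields its equivariance and the transport of a braiding of the last two factors.\<close>

lemma t23_assoc:
  assumes "u \<in> carrier ((X \<boxtimes> Y) \<boxtimes> Z)"
  shows "assoc_tensor X Y Z (T3 X Y Z 2 3 u)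
    = map_tensor X (Y \<boxtimes> Z) X (Y \<boxtimes> Z) (\<lambda>x. x) (t_act t Y Z) (assoc_tensor X Y Z u)"
proof -
  have "assoc_tensor X Y Z u \<in> carrier (X \<boxtimes> (Y \<boxtimes> Z))"
    using assms by (auto intro: linmap_closed[OF linmap_assoc_tensor])
  then have "map_tensor X (Y \<boxtimes> Z) X (Y \<boxtimes> Z) (\<lambda>x. x) (t_act t Y Z) (assoc_tensor X Y Z u)
      = lift_op (X \<boxtimes> (Y \<boxtimes> Z)) (\<lambda>a b. map_tensor X (Y \<boxtimes> Z) X (Y \<boxtimes> Z) (\<lambda>x. x) (t_op Y Z a b)) (assoc_tensor X Y Z u)"
    unfolding t_act_eq by (intro map_tensor_lift_op_right) (auto intro!: linmap_op_rules)
  then show ?thesis unfolding T3_eq[OF XYZ] using assms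
    by (subst lift_op_transport3[OF XYZ]) (auto simp: tensor_calc intro!: linmap_op_rules)
qed

text \<open>This is (id \<otimes> \<Delta>)(t) =
  \<open>t\<^sup>1\<^sup>2 + t\<^sup>1\<^sup>3\<close>: the second leg acts on
  \<open>Y \<boxtimes> Z\<close> through its coproduct.\<close>

lemma t_act_right_tensor:
  assumes "u \<in> carrier ((X \<boxtimes> Y) \<boxtimes> Z)"
  shows "assoc_tensor X Y Z (T3 X Y Z 1 2 u \<oplus>\<^bsub>(X \<boxtimes> Y) \<boxtimes> Z\<^esub> T3 X Y Z 1 3 u)
    = t_act t X (Y \<boxtimes> Z) (assoc_tensor X Y Z u)"
  unfolding t_act_eq using assms
  by (subst T3_plus[OF XYZ], simp_all)
    (rule lift_op_transport3[OF XYZ]; auto simp: tensor_calc intro!: linmap_op_rules)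

lemma t_act_left_tensor:
  assumes "u \<in> carrier ((X \<boxtimes> Y) \<boxtimes> Z)"
  shows "T3 X Y Z 1 3 u \<oplus>\<^bsub>(X \<boxtimes> Y) \<boxtimes> Z\<^esub> T3 X Y Z 2 3 u = t_act t (X \<boxtimes> Y) Z u"
  unfolding t_act_eq using assms
  by (subst T3_plus[OF XYZ], simp_all)
    (rule lift_op_transport3[OF XYZ, where P = "\<lambda>u. u"]; auto simp: tensor_calc intro!: linmap_op_rules)

text \<open>The four permutations through which the hexagons lead: to the orders Y, Z, X and Y, X, Z
  and X, Z, Y and Z, X, Y. The last is composed of two transpositions, as on the right-hand side of
  the second hexagon.\<close>

abbreviation rotate_XYZ where "rotate_XYZ u \<equiv> flip_tensor X (Y \<boxtimes> Z) (assoc_tensor X Y Z u)"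
abbreviation swap12_XYZ where "swap12_XYZ \<equiv> map_tensor (X \<boxtimes> Y) Z (Y \<boxtimes> X) Z (flip_tensor X Y) (\<lambda>z. z)"
abbreviation swap23_XYZ where "swap23_XYZ u \<equiv> assoc_tensor_inv X Z Y
  (map_tensor X (Y \<boxtimes> Z) X (Z \<boxtimes> Y) (\<lambda>x. x) (flip_tensor Y Z) (assoc_tensor X Y Z u))"
abbreviation rotate_inv_XYZ where "rotate_inv_XYZ u \<equiv>
  map_tensor (X \<boxtimes> Z) Y (Z \<boxtimes> X) Y (flip_tensor X Z) (\<lambda>y. y) (swap23_XYZ u)"

text \<open>After the rotation, places 1, 2, 3 are occupied by the factors that were numbered 2, 3,
  1. The pair (3, 1) keeps the order of the two legs of t.\<close>

lemma t_rotate: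
  assumes "u \<in> carrier ((X \<boxtimes> Y) \<boxtimes> Z)"
  shows "rotate_XYZ (T3 X Y Z 2 3 u) = t12_act t Y Z X (rotate_XYZ u)"
    and "rotate_XYZ (T3 X Y Z 3 1 u) = t23_act t Y Z X (rotate_XYZ u)"
  unfolding t_act_eq T3_eq[OF XYZ] using assms
  by (rule_tac [!] lift_op_transport3[OF XYZ, where P = rotate_XYZ]; auto simp: tensor_calc intro!: linmap_op_rules)+

lemma t_swap12:
  assumes "u \<in> carrier ((X \<boxtimes> Y) \<boxtimes> Z)"
  shows "swap12_XYZ (T3 X Y Z 2 1 u) = t12_act t Y X Z (swap12_XYZ u)"
    and "swap12_XYZ (T3 X Y Z 1 3 u) = t23_act t Y X Z (swap12_XYZ u)"
  unfolding t_act_eq T3_eq[OF XYZ] using assms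
  by (rule_tac [!] lift_op_transport3[OF XYZ, where P = swap12_XYZ]; auto simp: tensor_calc intro!: linmap_op_rules)+

lemma t_swap23:
  assumes "u \<in> carrier ((X \<boxtimes> Y) \<boxtimes> Z)"
  shows "swap23_XYZ (T3 X Y Z 1 3 u) = t12_act t X Z Y (swap23_XYZ u)"
    and "swap23_XYZ (T3 X Y Z 3 2 u) = t23_act t X Z Y (swap23_XYZ u)"
  unfolding t_act_eq T3_eq[OF XYZ] using assms
  by (rule_tac [!] lift_op_transport3[OF XYZ, where P = swap23_XYZ]; auto simp: tensor_calc intro!: linmap_op_rules)+

lemma t_rotate_inv:
  assumes "u \<in> carrier ((X \<boxtimes> Y) \<boxtimes> Z)"
  shows "rotate_inv_XYZ (T3 X Y Z 3 1 u) = t12_act t Z X Y (rotate_inv_XYZ u)"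
    and "rotate_inv_XYZ (T3 X Y Z 1 2 u) = t23_act t Z X Y (rotate_inv_XYZ u)"
  unfolding t_act_eq T3_eq[OF XYZ] using assms
  by (rule_tac [!] lift_op_transport3[OF XYZ, where P = rotate_inv_XYZ]; auto simp: tensor_calc intro!: linmap_op_rules)+

end

section \<open>The operators of t on four tensor factors\<close>

context
  fixes W X Y Z :: "('l, 'a) umod"
  assumes WXYZ [simp]: "lmod W" "lmod X" "lmod Y" "lmod Z"
begin

abbreviation "M4 \<equiv> ((W \<boxtimes> X) \<boxtimes> Y) \<boxtimes> Z"
abbreviation "assoc_id \<equiv> map_tensor ((W \<boxtimes> X) \<boxtimes> Y) Z (W \<boxtimes> (X \<boxtimes> Y)) Z (assoc_tensor W X Y) (\<lambda>z. z)"
abbreviation "assoc2_id u \<equiv> assoc_tensor W (X \<boxtimes> Y) Z (assoc_id u)"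

text \<open>This statement and the next four belong to the five arrows of the pentagon: \<Phi>
  \<otimes> id, the middle arrow and id \<otimes> \<Phi> on the long side, then the two arrows of
  the short side.\<close>

lemma t4_left:
  assumes "u \<in> carrier M4"
  shows "T4 W X Y Z 1 2 u = map_tensor ((W \<boxtimes> X) \<boxtimes> Y) Z ((W \<boxtimes> X) \<boxtimes> Y) Z (t12_act t W X Y) (\<lambda>z. z) u"
    and "T4 W X Y Z 2 3 u = map_tensor ((W \<boxtimes> X) \<boxtimes> Y) Z ((W \<boxtimes> X) \<boxtimes> Y) Z (t23_act t W X Y) (\<lambda>z. z) u"
proof -
  note m = map_tensor_lift_op[OF _ _ linmap_id assms, of "t12_op W X Y"]
    map_tensor_lift_op[OF _ _ linmap_id assms, of "t23_op W X Y"]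
  show "T4 W X Y Z 1 2 u = map_tensor ((W \<boxtimes> X) \<boxtimes> Y) Z ((W \<boxtimes> X) \<boxtimes> Y) Z (t12_act t W X Y) (\<lambda>z. z) u"
    unfolding t_act_eq T4_eq[OF WXYZ] using assms
    by (subst m(1), (auto simp: tensor_calc intro!: linmap_op_rules)[3],
        rule_tac lift_op_transport4[OF WXYZ, where P = "\<lambda>u. u"])
      (auto simp: tensor_calc intro!: linmap_op_rules)
  show "T4 W X Y Z 2 3 u = map_tensor ((W \<boxtimes> X) \<boxtimes> Y) Z ((W \<boxtimes> X) \<boxtimes> Y) Z (t23_act t W X Y) (\<lambda>z. z) u"
    unfolding t_act_eq T4_eq[OF WXYZ] using assms
    by (subst m(2), (auto simp: tensor_calc intro!: linmap_op_rules)[3],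
        rule_tac lift_op_transport4[OF WXYZ, where P = "\<lambda>u. u"])
      (auto simp: tensor_calc intro!: linmap_op_rules)
qed

text \<open>The middle factor is \<open>X \<boxtimes> Y\<close>, on which a leg of t acts through
  the coproduct; place 2 of three is doubled into places 2 and 3 of four.\<close>

lemma t4_middle:
  assumes "u \<in> carrier M4"
  shows "assoc_id (T4 W X Y Z 1 2 u \<oplus>\<^bsub>M4\<^esub> T4 W X Y Z 1 3 u) = t12_act t W (X \<boxtimes> Y) Z (assoc_id u)"
    and "assoc_id (T4 W X Y Z 2 4 u \<oplus>\<^bsub>M4\<^esub> T4 W X Y Z 3 4 u) = t23_act t W (X \<boxtimes> Y) Z (assoc_id u)"
proof -
  show "assoc_id (T4 W X Y Z 1 2 u \<oplus>\<^bsub>M4\<^esub> T4 W X Y Z 1 3 u) = t12_act t W (X \<boxtimes> Y) Z (assoc_id u)"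
    unfolding t_act_eq using assms
    by (subst T4_plus[OF WXYZ], simp_all, rule_tac lift_op_transport4[OF WXYZ, where P = assoc_id];
      auto simp: tensor_calc intro!: linmap_op_rules)
  show "assoc_id (T4 W X Y Z 2 4 u \<oplus>\<^bsub>M4\<^esub> T4 W X Y Z 3 4 u) = t23_act t W (X \<boxtimes> Y) Z (assoc_id u)"
    unfolding t_act_eq using assms
    by (subst T4_plus[OF WXYZ], simp_all, rule_tac lift_op_transport4[OF WXYZ, where P = assoc_id];
      auto simp: tensor_calc intro!: linmap_op_rules)
qed

lemma t4_right:
  assumes "u \<in> carrier M4"
  shows "assoc2_id (T4 W X Y Z 2 3 u) = map_tensor W ((X \<boxtimes> Y) \<boxtimes> Z) W ((X \<boxtimes> Y) \<boxtimes> Z) (\<lambda>w. w) (t12_act t X Y Z) (assoc2_id u)"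
    and "assoc2_id (T4 W X Y Z 3 4 u) = map_tensor W ((X \<boxtimes> Y) \<boxtimes> Z) W ((X \<boxtimes> Y) \<boxtimes> Z) (\<lambda>w. w) (t23_act t X Y Z) (assoc2_id u)"
proof -
  have "linmap M4 (W \<boxtimes> ((X \<boxtimes> Y) \<boxtimes> Z)) assoc2_id" by (auto intro!: linmap_op_rules)
  then have c: "assoc2_id u \<in> carrier (W \<boxtimes> ((X \<boxtimes> Y) \<boxtimes> Z))" using assms by (rule linmap_closed)
  note m = map_tensor_lift_op_right[OF _ _ linmap_id c, of "t12_op X Y Z"]
    map_tensor_lift_op_right[OF _ _ linmap_id c, of "t23_op X Y Z"]
  show "assoc2_id (T4 W X Y Z 2 3 u) = map_tensor W ((X \<boxtimes> Y) \<boxtimes> Z) W ((X \<boxtimes> Y) \<boxtimes> Z) (\<lambda>w. w) (t12_act t X Y Z) (assoc2_id u)"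
    unfolding t_act_eq T4_eq[OF WXYZ] using assms
    by (subst m(1), (auto simp: tensor_calc intro!: linmap_op_rules)[3],
        rule_tac lift_op_transport4[OF WXYZ, where P = assoc2_id])
      (auto simp: tensor_calc intro!: linmap_op_rules)
  show "assoc2_id (T4 W X Y Z 3 4 u) = map_tensor W ((X \<boxtimes> Y) \<boxtimes> Z) W ((X \<boxtimes> Y) \<boxtimes> Z) (\<lambda>w. w) (t23_act t X Y Z) (assoc2_id u)"
    unfolding t_act_eq T4_eq[OF WXYZ] using assms
    by (subst m(2), (auto simp: tensor_calc intro!: linmap_op_rules)[3],
        rule_tac lift_op_transport4[OF WXYZ, where P = assoc2_id])
      (auto simp: tensor_calc intro!: linmap_op_rules)
qed

lemma t4_outer:
  assumes "u \<in> carrier M4"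
  shows "T4 W X Y Z 1 3 u \<oplus>\<^bsub>M4\<^esub> T4 W X Y Z 2 3 u = t12_act t (W \<boxtimes> X) Y Z u"
    and "T4 W X Y Z 3 4 u = t23_act t (W \<boxtimes> X) Y Z u"
proof -
  show "T4 W X Y Z 1 3 u \<oplus>\<^bsub>M4\<^esub> T4 W X Y Z 2 3 u = t12_act t (W \<boxtimes> X) Y Z u"
    unfolding t_act_eq using assms
    by (subst T4_plus[OF WXYZ], simp_all, rule_tac lift_op_transport4[OF WXYZ, where P = "\<lambda>u. u"];
      auto simp: tensor_calc intro!: linmap_op_rules)
  show "T4 W X Y Z 3 4 u = t23_act t (W \<boxtimes> X) Y Z u"
    unfolding t_act_eq T4_eq[OF WXYZ] using assms
    by (rule_tac lift_op_transport4[OF WXYZ, where P = "\<lambda>u. u"]; auto simp: tensor_calc intro!: linmap_op_rules)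
qed

lemma t4_assoc:
  assumes "u \<in> carrier M4"
  shows "assoc_tensor (W \<boxtimes> X) Y Z (T4 W X Y Z 1 2 u) = t12_act t W X (Y \<boxtimes> Z) (assoc_tensor (W \<boxtimes> X) Y Z u)"
    and "assoc_tensor (W \<boxtimes> X) Y Z (T4 W X Y Z 2 3 u \<oplus>\<^bsub>M4\<^esub> T4 W X Y Z 2 4 u)
      = t23_act t W X (Y \<boxtimes> Z) (assoc_tensor (W \<boxtimes> X) Y Z u)"
proof -
  show "assoc_tensor (W \<boxtimes> X) Y Z (T4 W X Y Z 1 2 u) = t12_act t W X (Y \<boxtimes> Z) (assoc_tensor (W \<boxtimes> X) Y Z u)"
    unfolding t_act_eq T4_eq[OF WXYZ] using assms
    by (rule_tac lift_op_transport4[OF WXYZ]; auto simp: tensor_calc intro!: linmap_op_rules)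
  show "assoc_tensor (W \<boxtimes> X) Y Z (T4 W X Y Z 2 3 u \<oplus>\<^bsub>M4\<^esub> T4 W X Y Z 2 4 u)
      = t23_act t W X (Y \<boxtimes> Z) (assoc_tensor (W \<boxtimes> X) Y Z u)"
    unfolding t_act_eq using assms
    by (subst T4_plus[OF WXYZ], simp_all, rule_tac lift_op_transport4[OF WXYZ];
      auto simp: tensor_calc intro!: linmap_op_rules)
qed

end

end

section \<open>The braided monoidal category\<close>

text \<open>Typing as a property of the arrow itself: \<open>source\<close> and
  \<open>target\<close> are computed by simplification, so long composites can be rewritten without
  annotating the intermediate objects.\<close>

definition wf_hmap :: "('l, 'a) hmap \<Rightarrow> bool" where
  "wf_hmap f \<longleftrightarrow> lin_hmap f (source f) (target f)"

lemma lin_hmap_iff: "lin_hmap f X Y \<longleftrightarrow> wf_hmap f \<and> source f = X \<and> target f = Y"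
  by (auto simp: wf_hmap_def lin_hmap_def)

lemma hmap_source_target [simp]:
  "source (g \<circ>\<^sub>h f) = source f" "target (g \<circ>\<^sub>h f) = target g"
  "source (f \<otimes>\<^sub>h g) = source f \<boxtimes> source g" "target (f \<otimes>\<^sub>h g) = target f \<boxtimes> target g"
  "source (const_hmap X Y p) = X" "target (const_hmap X Y p) = Y"
  "source (series_hmap M A T F) = M" "target (series_hmap M A T F) = M"
  by (simp_all add: comp_hmap_def tensor_hmap_def const_hmap_def series_hmap_def)

lemma wf_hmap_simps [simp]:
  "\<lbrakk>wf_hmap f; wf_hmap g; target f = source g\<rbrakk> \<Longrightarrow> wf_hmap (g \<circ>\<^sub>h f)"
  "\<lbrakk>wf_hmap f; wf_hmap g\<rbrakk> \<Longrightarrow> wf_hmap (f \<otimes>\<^sub>h g)"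
  "\<lbrakk>cvs X; cvs Y; linmap X Y p\<rbrakk> \<Longrightarrow> wf_hmap (const_hmap X Y p)"
  "operators M A T \<Longrightarrow> wf_hmap (series_hmap M A T F)"
  using lin_hmap_comp[of f "source f" "source g" g "target g"]
    lin_hmap_tensor[of f "source f" "target f" g "source g" "target g"]
  by (auto simp: wf_hmap_def)

lemma wf_comp_assoc:
  "\<lbrakk>wf_hmap f; wf_hmap g; wf_hmap h; target f = source g; target g = source h\<rbrakk>
    \<Longrightarrow> h \<circ>\<^sub>h g \<circ>\<^sub>h f = h \<circ>\<^sub>h (g \<circ>\<^sub>h f)"
  using comp_hmap_assoc[of f "source f" "source g" g "source h" h "target h"] by (simp add: wf_hmap_def)

text \<open>In a composite nested to the right, neighbouring constant maps are separated by
  brackets; this rule fuses them.\<close>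

lemma wf_const_comp_const:
  "\<lbrakk>cvs X; cvs Y; cvs Z; linmap X Y p; linmap Y Z q; wf_hmap f; target f = X\<rbrakk>
    \<Longrightarrow> const_hmap Y Z q \<circ>\<^sub>h (const_hmap X Y p \<circ>\<^sub>h f) = const_hmap X Z (\<lambda>x. q (p x)) \<circ>\<^sub>h f"
  using const_comp_const[of X Y Z p q] by (simp flip: wf_comp_assoc)

lemma wf_id_comp: "\<lbrakk>wf_hmap f; target f = X\<rbrakk> \<Longrightarrow> id_hmap X \<circ>\<^sub>h f = f"
  "\<lbrakk>wf_hmap f; source f = X\<rbrakk> \<Longrightarrow> f \<circ>\<^sub>h id_hmap X = f"
  by (auto simp: wf_hmap_def)

lemma wf_comp_tensor_id:
  "\<lbrakk>wf_hmap f; wf_hmap g; target f = source g; cvs Y\<rbrakk>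
    \<Longrightarrow> (g \<circ>\<^sub>h f) \<otimes>\<^sub>h id_hmap Y = (g \<otimes>\<^sub>h id_hmap Y) \<circ>\<^sub>h (f \<otimes>\<^sub>h id_hmap Y)"
  using comp_tensor_id[of f "source f" "source g" g "target g" Y] by (simp add: wf_hmap_def)

lemma wf_id_tensor_comp:
  "\<lbrakk>wf_hmap f; wf_hmap g; target f = source g; cvs Y\<rbrakk>
    \<Longrightarrow> id_hmap Y \<otimes>\<^sub>h (g \<circ>\<^sub>h f) = (id_hmap Y \<otimes>\<^sub>h g) \<circ>\<^sub>h (id_hmap Y \<otimes>\<^sub>h f)"
  using id_tensor_comp[of f "source f" "source g" g "target g" Y] by (simp add: wf_hmap_def)

lemma const_comp_eq:
  assumes f: "lin_hmap f X Y" and p: "linmap Y Z p" and "cvs Z"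
  shows "const_hmap Y Z p \<circ>\<^sub>h f
    = \<lparr>source = X, target = Z, terms = (\<lambda>n. \<lambda>u\<in>carrier X. p (terms f n u))\<rparr>"
proof (rule hmap.equality)
  have l: "lin_hmap (const_hmap Y Z p \<circ>\<^sub>h f) X Z" using assms lin_hmapD(2)[OF f] by auto
  show "terms (const_hmap Y Z p \<circ>\<^sub>h f)
      = terms \<lparr>source = X, target = Z, terms = (\<lambda>n. \<lambda>u\<in>carrier X. p (terms f n u))\<rparr>"
  proof (intro ext)
    fix n x
    show "terms (const_hmap Y Z p \<circ>\<^sub>h f) n x
        = terms \<lparr>source = X, target = Z, terms = (\<lambda>n. \<lambda>u\<in>carrier X. p (terms f n u))\<rparr> n x"
      using terms_const_comp[OF f p assms(3)] lin_hmapD(6)[OF l, of n]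
      by (cases "x \<in> carrier X") (auto simp: extensional_def)
  qed
qed (use lin_hmapD(3)[OF f] in auto)

text \<open>The key exchange: when a constant map \<open>P\<close> moves to the left past a series,
  the operators \<open>S j\<close> of the target turn into the linear forms \<open>a j\<close> in
  the operators of the source. The forms, evaluated on \<open>M\<close>, are an intermediate family
  of operators that \<open>P\<close> intertwines with \<open>S\<close>.\<close>

lemma series_hmap_transport:
  fixes \<Phi> :: "'j ncseries"
  assumes M: "operators M A T" and N: "operators N UNIV S" and fin: "finite (UNIV :: 'j set)"
    and a: "\<And>j. homogeneous1 (a j)" and P: "linmap M N P"
    and PS: "\<And>j u. u \<in> carrier M \<Longrightarrow> P (series_value M A T (a j) (Suc 0) u) = S j (P u)"
  shows "series_hmap N UNIV S \<Phi> \<circ>\<^sub>h const_hmap M N P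
    = const_hmap M N P \<circ>\<^sub>h series_hmap M A T (nc_gsubst \<Phi> a)"
proof -
  let ?S = "\<lambda>j. series_value M A T (a j) 1"
  have S: "operators M UNIV ?S"
    using fin operators.cvs[OF M] operators.linmap_val[OF M] by (intro operators.intro)
  have "const_hmap M N P \<circ>\<^sub>h series_hmap M UNIV ?S \<Phi> = series_hmap N UNIV S \<Phi> \<circ>\<^sub>h const_hmap M N P"
    using operators.cvs[OF M] operators.cvs[OF N] P PS operators.linmap_val[OF M] operators.linmap_op[OF N]
    by (intro series_hmap_natural[OF S N] lin_hmap_const intertwines_const) auto
  then show ?thesis using series_hmap_gsubst[OF M fin a, where S = ?S and \<Phi> = \<Phi>] by simp
qed

text \<open>Inversion and substitution are not compared directly. Inserting
  \<open>nc_inverse \<Phi> * \<Phi> = 1\<close> and transporting \<Phi> across \<open>P\<close> lets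
  the transported factor cancel against its own inverse.\<close>

lemma series_hmap_inverse_transport:
  fixes \<Phi> :: "'j ncseries"
  assumes M: "operators M A T" and N: "operators N UNIV S" and fin: "finite (UNIV :: 'j set)"
    and a: "\<And>j. homogeneous1 (a j)" and P: "linmap M N P"
    and PS: "\<And>j u. u \<in> carrier M \<Longrightarrow> P (series_value M A T (a j) (Suc 0) u) = S j (P u)"
    and \<Phi>: "coeff \<Phi> [] = 1"
  shows "series_hmap N UNIV S (nc_inverse \<Phi>) \<circ>\<^sub>h const_hmap M N P
    = const_hmap M N P \<circ>\<^sub>h series_hmap M A T (nc_inverse (nc_gsubst \<Phi> a))"
proof -
  let ?f = "nc_gsubst \<Phi> a"
  note [simp] = operators.cvs[OF M] operators.cvs[OF N] P M N
  have inv: "?f * nc_inverse ?f = 1" "nc_inverse \<Phi> * \<Phi> = 1" using nc_inverse[of ?f] nc_inverse[of \<Phi>] \<Phi> by simp_all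
  have "const_hmap M N P \<circ>\<^sub>h series_hmap M A T (nc_inverse ?f)
      = series_hmap N UNIV S (nc_inverse \<Phi> * \<Phi>) \<circ>\<^sub>h const_hmap M N P \<circ>\<^sub>h series_hmap M A T (nc_inverse ?f)"
    unfolding inv by (simp add: series_hmap_one wf_id_comp)
  also have "\<dots> = series_hmap N UNIV S (nc_inverse \<Phi>) \<circ>\<^sub>h (series_hmap N UNIV S \<Phi> \<circ>\<^sub>h const_hmap M N P)
      \<circ>\<^sub>h series_hmap M A T (nc_inverse ?f)"
    by (simp add: series_hmap_mult[OF N] wf_comp_assoc)
  also have "series_hmap N UNIV S \<Phi> \<circ>\<^sub>h const_hmap M N P = const_hmap M N P \<circ>\<^sub>h series_hmap M A T ?f"
    using assms by (intro series_hmap_transport)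
  also have "series_hmap N UNIV S (nc_inverse \<Phi>) \<circ>\<^sub>h \<dots> \<circ>\<^sub>h series_hmap M A T (nc_inverse ?f)
      = series_hmap N UNIV S (nc_inverse \<Phi>) \<circ>\<^sub>h const_hmap M N P
      \<circ>\<^sub>h series_hmap M A T (?f * nc_inverse ?f)"
    by (simp add: series_hmap_mult[OF M] wf_comp_assoc)
  also have "\<dots> = series_hmap N UNIV S (nc_inverse \<Phi>) \<circ>\<^sub>h const_hmap M N P"
    unfolding inv by (simp add: series_hmap_one wf_id_comp)
  finally show ?thesis by simp
qed

locale drinfeld = lie_form L t for L :: "('l, 'y) lie_scheme" and t +
  fixes \<Phi> :: "letter ncseries"
  assumes associator: "drinfeld_associator \<Phi>"
begin

abbreviation "\<D> \<equiv> drinfeld_category \<Phi> L t"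

abbreviation assoc_ops where "assoc_ops X Y Z \<equiv> case_letter (t12_act t X Y Z) (t23_act t X Y Z)"

text \<open>Separating the rebracketing, which is constant in \<hbar>, from the series allows
  constants to be collected on the left of a composite and series on the right.\<close>

definition assoc_hmap :: "('l, 'a) umod \<Rightarrow> ('l, 'a) umod \<Rightarrow> ('l, 'a) umod \<Rightarrow> ('l, 'a) hmap" where
  "assoc_hmap X Y Z = const_hmap ((X \<boxtimes> Y) \<boxtimes> Z) (X \<boxtimes> (Y \<boxtimes> Z)) (assoc_tensor X Y Z)
     \<circ>\<^sub>h series_hmap ((X \<boxtimes> Y) \<boxtimes> Z) UNIV (assoc_ops X Y Z) \<Phi>"

definition assoc_inv_hmap :: "('l, 'a) umod \<Rightarrow> ('l, 'a) umod \<Rightarrow> ('l, 'a) umod \<Rightarrow> ('l, 'a) hmap" where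
  "assoc_inv_hmap X Y Z = series_hmap ((X \<boxtimes> Y) \<boxtimes> Z) UNIV (assoc_ops X Y Z) (nc_inverse \<Phi>)
     \<circ>\<^sub>h const_hmap (X \<boxtimes> (Y \<boxtimes> Z)) ((X \<boxtimes> Y) \<boxtimes> Z) (assoc_tensor_inv X Y Z)"

definition braid_hmap :: "('l, 'a) umod \<Rightarrow> ('l, 'a) umod \<Rightarrow> ('l, 'a) hmap" where
  "braid_hmap X Y = const_hmap (X \<boxtimes> Y) (Y \<boxtimes> X) (flip_tensor X Y)
     \<circ>\<^sub>h series_hmap (X \<boxtimes> Y) UNIV (\<lambda>_ :: unit. t_act t X Y) half_exp"

definition braid_inv_hmap :: "('l, 'a) umod \<Rightarrow> ('l, 'a) umod \<Rightarrow> ('l, 'a) hmap" where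
  "braid_inv_hmap X Y = series_hmap (X \<boxtimes> Y) UNIV (\<lambda>_ :: unit. t_act t X Y) (nc_inverse half_exp)
     \<circ>\<^sub>h const_hmap (Y \<boxtimes> X) (X \<boxtimes> Y) (flip_tensor Y X)"

lemma \<Phi>_Nil: "coeff \<Phi> [] = 1"
  using associator by (simp add: drinfeld_associator_def grouplike_def)

lemma half_exp_Nil: "coeff half_exp [] = 1"
  by (simp add: half_exp_def)

lemma operators_assoc [simp]:
  assumes "lmod X" "lmod Y" "lmod Z"
  shows "operators ((X \<boxtimes> Y) \<boxtimes> Z) UNIV (assoc_ops X Y Z)"
  using assms finite_UNIV_letter by (intro operators.intro) (auto split: letter.split)

lemma operators_braid [simp]:
  assumes "lmod X" "lmod Y"
  shows "operators (X \<boxtimes> Y) (UNIV :: unit set) (\<lambda>_. t_act t X Y)"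
  using assms by (intro operators.intro) auto

lemma associator_eq:
  assumes "lmod X" "lmod Y" "lmod Z"
  shows "associator \<D> X Y Z = assoc_hmap X Y Z"
  unfolding assoc_hmap_def
  by (subst const_comp_eq[OF lin_hmap_series linmap_assoc_tensor])
    (use assms in \<open>auto simp: drinfeld_category_def series_act_eq terms_series_hmap intro!: restrict_ext ext\<close>)

lemma braiding_eq:
  assumes "lmod X" "lmod Y"
  shows "braiding \<D> X Y = braid_hmap X Y"
  unfolding braid_hmap_def
  by (subst const_comp_eq[OF lin_hmap_series linmap_flip_tensor])
    (use assms in \<open>auto simp: drinfeld_category_def half_exp_act_eq terms_series_hmap intro!: restrict_ext ext\<close>)

lemma assoc_tensor_inverse:
  assumes "cvs X" "cvs Y" "cvs Z"
  shows "u \<in> carrier ((X \<boxtimes> Y) \<boxtimes> Z) \<Longrightarrow> assoc_tensor_inv X Y Z (assoc_tensor X Y Z u) = u"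
    and "v \<in> carrier (X \<boxtimes> (Y \<boxtimes> Z)) \<Longrightarrow> assoc_tensor X Y Z (assoc_tensor_inv X Y Z v) = v"
proof -
  show "assoc_tensor_inv X Y Z (assoc_tensor X Y Z u) = u" if "u \<in> carrier ((X \<boxtimes> Y) \<boxtimes> Z)"
    by (rule linmap_tensor_ext3[OF assms cvs_tensor_module, where g = "\<lambda>u. u", OF _ _ _ that])
      (use assms in \<open>auto intro!: linmap_op_rules\<close>)
  show "assoc_tensor X Y Z (assoc_tensor_inv X Y Z v) = v" if "v \<in> carrier (X \<boxtimes> (Y \<boxtimes> Z))"
    by (rule linmap_tensor_ext3'[OF assms cvs_tensor_module, where g = "\<lambda>u. u", OF _ _ _ that])
      (use assms in \<open>auto intro!: linmap_op_rules\<close>)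
qed

lemma flip_flip:
  assumes "cvs X" "cvs Y" "u \<in> carrier (X \<boxtimes> Y)"
  shows "flip_tensor Y X (flip_tensor X Y u) = u"
  by (rule linmap_tensor_ext[where g = "\<lambda>u. u", OF cvs_tensor_module _ _ _ assms(3)])
    (use assms in \<open>auto intro!: linmap_op_rules\<close>)

subsection \<open>Equivariance\<close>

definition equivariant :: "('l, 'a) hmap \<Rightarrow> ('l, 'a) umod \<Rightarrow> ('l, 'a) umod \<Rightarrow> bool" where
  "equivariant f X Y \<longleftrightarrow> (\<forall>a\<in>carrier L. intertwines f (act X a) (act Y a))"

lemma hom_iff:
  assumes "lmod X" "lmod Y"
  shows "f \<in> hom_set \<D> X Y \<longleftrightarrow> lin_hmap f X Y \<and> equivariant f X Y"
  using assms
  by (auto simp: drinfeld_category_def module_homs_def lin_hmap_def linmap_def equivariant_def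
      intertwines_def PiE_def Pi_def)

lemma equivariant_const:
  assumes "lmod X" "lmod Y" "\<And>a x. a \<in> carrier L \<Longrightarrow> x \<in> carrier X \<Longrightarrow> p (act X a x) = act Y a (p x)"
  shows "equivariant (const_hmap X Y p) X Y"
  unfolding equivariant_def using assms by (auto intro!: intertwines_const)

lemma equivariant_comp:
  assumes "lmod X" "lmod Y" "lmod Z" "lin_hmap f X Y" "lin_hmap g Y Z" "equivariant f X Y" "equivariant g Y Z"
  shows "equivariant (g \<circ>\<^sub>h f) X Z"
  unfolding equivariant_def
  using assms(1-3,6,7) by (auto simp: equivariant_def intro!: intertwines_comp[OF assms(4,5)])

text \<open>The action on a tensor product is a sum of two one-sided operators, and f \<otimes> g
  intertwines each of them, because any arrow intertwines the identity with the identity.\<close>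

lemma equivariant_tensor:
  assumes "lmod X" "lmod X'" "lmod Y" "lmod Y'" "lin_hmap f X X'" "lin_hmap g Y Y'"
    "equivariant f X X'" "equivariant g Y Y'"
  shows "equivariant (f \<otimes>\<^sub>h g) (X \<boxtimes> Y) (X' \<boxtimes> Y')"
  unfolding equivariant_def
proof
  fix a assume a: "a \<in> carrier L"
  note fg = lin_hmap_tensor[OF assms(5,6)]
  have "intertwines (f \<otimes>\<^sub>h g) (map_tensor X Y X Y (act X a) (\<lambda>y. y)) (map_tensor X' Y' X' Y' (act X' a) (\<lambda>y. y))"
    "intertwines (f \<otimes>\<^sub>h g) (map_tensor X Y X Y (\<lambda>x. x) (act Y a)) (map_tensor X' Y' X' Y' (\<lambda>x. x) (act Y' a))"
    using assms a by (auto simp: equivariant_def linmap_id intro!: intertwines_tensor intertwines_id)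
  from intertwines_plus[OF fg this] show "intertwines (f \<otimes>\<^sub>h g) (act (X \<boxtimes> Y) a) (act (X' \<boxtimes> Y') a)"
    by (rule intertwines_cong[OF _ fg])
      (use assms a in \<open>auto simp: act_tensor_map linmap_tensor_simps\<close>)
qed

text \<open>The action of \<open>a\<close> is itself a linear endomorphism commuting with the
  operators, hence with every series in them.\<close>

lemma equivariant_series:
  assumes "operators M A T" "lmod M"
    and "\<And>i a u. \<lbrakk>i \<in> A; a \<in> carrier L; u \<in> carrier M\<rbrakk> \<Longrightarrow> act M a (T i u) = T i (act M a u)"
  shows "equivariant (series_hmap M A T F) M M"
  unfolding equivariant_def intertwines_def
proof (intro ballI allI)
  fix a n u assume a: "a \<in> carrier L" and "u \<in> carrier (source (series_hmap M A T F))"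
  then have u: "u \<in> carrier M" by simp
  have "act M a (series_value M A T F n u) = series_value M A T F n (act M a u)"
    using a u assms(2,3) by (intro series_value_intertwine[OF assms(1,1)]) auto
  then show "terms (series_hmap M A T F) n (act M a u) = act M a (terms (series_hmap M A T F) n u)"
    using a u assms(2) by (simp add: terms_series_hmap)
qed

text \<open>On \<open>X \<boxtimes> Y\<close> an element acts by the sum of its actions at the two
  places, so the claim is the invariance of t in the form \<open>tens_invariant\<close>.\<close>

lemma t_act_equivariant:
  assumes "lmod X" "lmod Y" and a: "a \<in> carrier L" and u: "u \<in> carrier (X \<boxtimes> Y)"
  shows "act (X \<boxtimes> Y) a (t_act t X Y u) = t_act t X Y (act (X \<boxtimes> Y) a u)"
proof -
  interpret lie_actions L "X \<boxtimes> Y" "{1..2}" "extend_acts 1 X (\<lambda>_. act X) Y" t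
    using assms(1,2) by (rule lie_actions2)
  have act: "act (X \<boxtimes> Y) a v = extend_acts 1 X (\<lambda>_. act X) Y 1 a v \<oplus>\<^bsub>X \<boxtimes> Y\<^esub> extend_acts 1 X (\<lambda>_. act X) Y 2 a v"
    if "v \<in> carrier (X \<boxtimes> Y)" for v
    using act_tensor_map[OF assms(1-3) that] by (simp add: extend_acts_def)
  have t: "t_act t X Y v = tens 1 2 v" if v: "v \<in> carrier (X \<boxtimes> Y)" for v
    unfolding t_act_def tens_def
  proof (rule tensor_lift_cong[OF t_formal])
    fix a b assume "a \<in> carrier L" "b \<in> carrier L"
    then show "map_tensor X Y X Y (act X a) (act Y b) v
        = extend_acts 1 X (\<lambda>_. act X) Y 1 a (extend_acts 1 X (\<lambda>_. act X) Y 2 b v)"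
      using assms v by (simp add: extend_acts_def map_tensor_comp linmap_id)
  qed
  have "act (X \<boxtimes> Y) a u \<in> carrier (X \<boxtimes> Y)" using assms by simp
  then show ?thesis using tens_invariant[of 1 2 a u] a u act[OF u] act[OF tens_closed[of 1 2 u]] by (simp add: t)
qed

lemma act_assoc:
  assumes [simp]: "lmod X" "lmod Y" "lmod Z" "a \<in> carrier L" and u: "u \<in> carrier ((X \<boxtimes> Y) \<boxtimes> Z)"
  shows "assoc_tensor X Y Z (act ((X \<boxtimes> Y) \<boxtimes> Z) a u) = act (X \<boxtimes> (Y \<boxtimes> Z)) a (assoc_tensor X Y Z u)"
  by (rule linmap_tensor_ext3[where f = "\<lambda>u. assoc_tensor X Y Z (act ((X \<boxtimes> Y) \<boxtimes> Z) a u)"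
        and g = "\<lambda>u. act (X \<boxtimes> (Y \<boxtimes> Z)) a (assoc_tensor X Y Z u)", OF _ _ _ _ _ _ _ u])
    (auto simp: tensor_calc cvs_add_assoc intro!: linmap_op_rules linmap_comp[OF lmod_rules(2)])

lemma t12_act_equivariant:
  assumes [simp]: "lmod X" "lmod Y" "lmod Z" "a \<in> carrier L" and u: "u \<in> carrier ((X \<boxtimes> Y) \<boxtimes> Z)"
  shows "act ((X \<boxtimes> Y) \<boxtimes> Z) a (t12_act t X Y Z u) = t12_act t X Y Z (act ((X \<boxtimes> Y) \<boxtimes> Z) a u)"
  by (rule linmap_tensor_ext[where f = "\<lambda>u. act ((X \<boxtimes> Y) \<boxtimes> Z) a (t12_act t X Y Z u)"
        and g = "\<lambda>u. t12_act t X Y Z (act ((X \<boxtimes> Y) \<boxtimes> Z) a u)", OF _ _ _ _ u])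
    (auto simp: tensor_calc t_act_equivariant linmap_add[OF linmap_t_act(2)] linmap_closed[OF linmap_t_act(1)]
      simp flip: t12_act_map intro!: linmap_comp[OF lmod_rules(2)] linmap_comp[OF linmap_t_act(2)])

lemma map_t_act_equivariant:
  assumes [simp]: "lmod X" "lmod Y" "lmod Z" "a \<in> carrier L" and u: "u \<in> carrier (X \<boxtimes> (Y \<boxtimes> Z))"
  shows "act (X \<boxtimes> (Y \<boxtimes> Z)) a (map_tensor X (Y \<boxtimes> Z) X (Y \<boxtimes> Z) (\<lambda>x. x) (t_act t Y Z) u)
    = map_tensor X (Y \<boxtimes> Z) X (Y \<boxtimes> Z) (\<lambda>x. x) (t_act t Y Z) (act (X \<boxtimes> (Y \<boxtimes> Z)) a u)"
  by (rule linmap_tensor_ext[where f = "\<lambda>u. act (X \<boxtimes> (Y \<boxtimes> Z)) a (map_tensor X (Y \<boxtimes> Z) X (Y \<boxtimes> Z) (\<lambda>x. x) (t_act t Y Z) u)"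
        and g = "\<lambda>u. map_tensor X (Y \<boxtimes> Z) X (Y \<boxtimes> Z) (\<lambda>x. x) (t_act t Y Z) (act (X \<boxtimes> (Y \<boxtimes> Z)) a u)", OF _ _ _ _ u])
    (auto simp: tensor_calc t_act_equivariant linmap_closed[OF linmap_t_act(1)]
      intro!: linmap_op_rules linmap_comp[OF lmod_rules(2)])

text \<open>Passing to the right-bracketed product turns \<open>t\<^sup>2\<^sup>3\<close> into id
  \<otimes> t, for which equivariance is known; the rebracketing is then cancelled by its
  inverse.\<close>

lemma t23_act_equivariant:
  assumes [simp]: "lmod X" "lmod Y" "lmod Z" "a \<in> carrier L" and u: "u \<in> carrier ((X \<boxtimes> Y) \<boxtimes> Z)"
  shows "act ((X \<boxtimes> Y) \<boxtimes> Z) a (t23_act t X Y Z u) = t23_act t X Y Z (act ((X \<boxtimes> Y) \<boxtimes> Z) a u)"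
proof -
  note [simp] = linmap_closed[OF linmap_t_act(3)] linmap_closed[OF linmap_assoc_tensor]
  have t23: "assoc_tensor X Y Z (t23_act t X Y Z v)
      = map_tensor X (Y \<boxtimes> Z) X (Y \<boxtimes> Z) (\<lambda>x. x) (t_act t Y Z) (assoc_tensor X Y Z v)"
    if "v \<in> carrier ((X \<boxtimes> Y) \<boxtimes> Z)" for v
    using t23_assoc[of X Y Z v] t23_T3[of X Y Z v] that by simp
  have "assoc_tensor X Y Z (act ((X \<boxtimes> Y) \<boxtimes> Z) a (t23_act t X Y Z u))
      = assoc_tensor X Y Z (t23_act t X Y Z (act ((X \<boxtimes> Y) \<boxtimes> Z) a u))"
    using u by (simp add: act_assoc t23 map_t_act_equivariant)
  from arg_cong[OF this, of "assoc_tensor_inv X Y Z"] show ?thesis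
    using u by (simp add: assoc_tensor_inverse)
qed

end

text \<open>A commuting square inside a composite nested to the right comes with a tail
  \<open>x\<close>; this is the square in the form of a rewrite rule.\<close>

lemma comp_eq_tail:
  assumes "g \<circ>\<^sub>h f = f' \<circ>\<^sub>h g'" "wf_hmap f" "wf_hmap g" "wf_hmap f'" "wf_hmap g'" "wf_hmap x"
    "target f = source g" "target g' = source f'" "target x = source f" "target x = source g'"
  shows "g \<circ>\<^sub>h (f \<circ>\<^sub>h x) = f' \<circ>\<^sub>h (g' \<circ>\<^sub>h x)"
  using assms by (simp flip: wf_comp_assoc)

lemma series_subst_transport:
  assumes M: "operators M A T" and N: "operators N UNIV S" and ab: "homogeneous1 a" "homogeneous1 b"
    and P: "linmap M N P"
    and PS: "\<And>u. u \<in> carrier M \<Longrightarrow> P (series_value M A T a (Suc 0) u) = S LX (P u)"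
      "\<And>u. u \<in> carrier M \<Longrightarrow> P (series_value M A T b (Suc 0) u) = S LY (P u)"
  shows "series_hmap N UNIV S \<Phi> \<circ>\<^sub>h const_hmap M N P
      = const_hmap M N P \<circ>\<^sub>h series_hmap M A T (nc_subst \<Phi> a b)"
    and "coeff \<Phi> [] = 1 \<Longrightarrow> series_hmap N UNIV S (nc_inverse \<Phi>) \<circ>\<^sub>h const_hmap M N P
      = const_hmap M N P \<circ>\<^sub>h series_hmap M A T (nc_inverse (nc_subst \<Phi> a b))"
proof -
  have hom: "homogeneous1 (case_letter a b j)" for j using ab by (cases j) auto
  have PS': "P (series_value M A T (case_letter a b j) (Suc 0) u) = S j (P u)" if "u \<in> carrier M" for j u
    using PS that by (cases j) auto
  show "series_hmap N UNIV S \<Phi> \<circ>\<^sub>h const_hmap M N P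
      = const_hmap M N P \<circ>\<^sub>h series_hmap M A T (nc_subst \<Phi> a b)"
    unfolding nc_subst_eq_gsubst
    by (rule series_hmap_transport[OF M N finite_UNIV_letter hom P PS'])
  show "series_hmap N UNIV S (nc_inverse \<Phi>) \<circ>\<^sub>h const_hmap M N P
      = const_hmap M N P \<circ>\<^sub>h series_hmap M A T (nc_inverse (nc_subst \<Phi> a b))" if "coeff \<Phi> [] = 1"
    unfolding nc_subst_eq_gsubst
    by (rule series_hmap_inverse_transport[OF M N finite_UNIV_letter hom P PS' that])
qed

lemma series_exp_transport:
  assumes M: "operators M A T" and N: "operators N UNIV S" and a: "homogeneous1 a" and P: "linmap M N P"
    and PS: "\<And>u. u \<in> carrier M \<Longrightarrow> P (series_value M A T a (Suc 0) u) = S () (P u)"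
  shows "series_hmap N UNIV S half_exp \<circ>\<^sub>h const_hmap M N P
      = const_hmap M N P \<circ>\<^sub>h series_hmap M A T (nc_exp (nc_const (1/2) * a))"
  unfolding nc_exp_half by (rule series_hmap_transport[OF M N]) (use a P PS in auto)

lemma (in operators) val_var_plus:
  "\<lbrakk>i \<in> A; j \<in> A; u \<in> carrier M\<rbrakk> \<Longrightarrow> val (nc_var i + nc_var j) (Suc 0) u = T i u \<oplus>\<^bsub>M\<^esub> T j u"
  by (simp add: val_add val_var)

context drinfeld
begin

abbreviation "half_exp_nc a \<equiv> nc_exp (nc_const (1/2) * a)"

abbreviation T3_ops where "T3_ops X Y Z \<equiv> \<lambda>(i, j). T3 X Y Z i j"
abbreviation T4_ops where "T4_ops W X Y Z \<equiv> \<lambda>(i, j). T4 W X Y Z i j"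

lemma dk_operators3: "\<lbrakk>lmod X; lmod Y; lmod Z\<rbrakk> \<Longrightarrow> dk_operators ((X \<boxtimes> Y) \<boxtimes> Z) 3 (T3_ops X Y Z)"
  using lie_actions.dk_operators_tens[OF lie_actions3 refl] by blast

lemma dk_operators4: "\<lbrakk>lmod W; lmod X; lmod Y; lmod Z\<rbrakk> \<Longrightarrow>
    dk_operators (((W \<boxtimes> X) \<boxtimes> Y) \<boxtimes> Z) 4 (T4_ops W X Y Z)"
  using lie_actions.dk_operators_tens[OF lie_actions4 refl] by blast

lemma coeff_subst_Nil [simp]: "coeff (nc_subst \<Psi> a b) [] = coeff \<Psi> []"
  by (simp add: nc_subst_eq_gsubst)

section \<open>The hexagons\<close>

context
  fixes X Y Z :: "('l, 'a) umod"
  assumes XYZ [simp]: "lmod X" "lmod Y" "lmod Z"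
begin

lemma op3 [simp]: "operators ((X \<boxtimes> Y) \<boxtimes> Z) (dk_index 3) (T3_ops X Y Z)"
  using dk_operators3[OF XYZ] by (simp add: dk_operators_def)

lemma val3:
  assumes "i \<in> {1..3}" "j \<in> {1..3}" "u \<in> carrier ((X \<boxtimes> Y) \<boxtimes> Z)"
  shows "series_value ((X \<boxtimes> Y) \<boxtimes> Z) (dk_index 3) (T3_ops X Y Z) (dk_t i j) (Suc 0) u = T3 X Y Z i j u"
    and "\<lbrakk>k \<in> {1..3}; l \<in> {1..3}\<rbrakk> \<Longrightarrow>
      series_value ((X \<boxtimes> Y) \<boxtimes> Z) (dk_index 3) (T3_ops X Y Z) (dk_t i j + dk_t k l) (Suc 0) u
      = T3 X Y Z i j u \<oplus>\<^bsub>(X \<boxtimes> Y) \<boxtimes> Z\<^esub> T3 X Y Z k l u"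
  using assms by (simp_all add: operators.val_var[OF op3] operators.val_var_plus[OF op3])

lemma T3_sym:
  "\<lbrakk>i \<in> {1..3}; j \<in> {1..3}; i \<noteq> j; u \<in> carrier ((X \<boxtimes> Y) \<boxtimes> Z)\<rbrakk> \<Longrightarrow> T3 X Y Z i j u = T3 X Y Z j i u"
  by (rule lie_actions.tens_sym[OF lie_actions3[OF XYZ]])

abbreviation "E3 \<equiv> series_hmap ((X \<boxtimes> Y) \<boxtimes> Z) (dk_index 3) (T3_ops X Y Z)"

lemma linmap_moves [simp]:
  "linmap ((X \<boxtimes> Y) \<boxtimes> Z) ((Y \<boxtimes> Z) \<boxtimes> X) (\<lambda>u. flip_tensor X (Y \<boxtimes> Z) (assoc_tensor X Y Z u))"
  "linmap ((X \<boxtimes> Y) \<boxtimes> Z) ((Y \<boxtimes> X) \<boxtimes> Z) (map_tensor (X \<boxtimes> Y) Z (Y \<boxtimes> X) Z (flip_tensor X Y) (\<lambda>z. z))"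
  "linmap ((X \<boxtimes> Y) \<boxtimes> Z) ((X \<boxtimes> Z) \<boxtimes> Y) (\<lambda>u. assoc_tensor_inv X Z Y
    (map_tensor X (Y \<boxtimes> Z) X (Z \<boxtimes> Y) (\<lambda>x. x) (flip_tensor Y Z) (assoc_tensor X Y Z u)))"
  "linmap ((X \<boxtimes> Y) \<boxtimes> Z) (X \<boxtimes> (Z \<boxtimes> Y))
    (\<lambda>u. map_tensor X (Y \<boxtimes> Z) X (Z \<boxtimes> Y) (\<lambda>x. x) (flip_tensor Y Z) (assoc_tensor X Y Z u))"
  "linmap ((X \<boxtimes> Y) \<boxtimes> Z) ((Z \<boxtimes> X) \<boxtimes> Y) (\<lambda>u. map_tensor (X \<boxtimes> Z) Y (Z \<boxtimes> X) Y (flip_tensor X Z) (\<lambda>y. y) (assoc_tensor_inv X Z Y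
    (map_tensor X (Y \<boxtimes> Z) X (Z \<boxtimes> Y) (\<lambda>x. x) (flip_tensor Y Z) (assoc_tensor X Y Z u))))"
  "linmap ((X \<boxtimes> Y) \<boxtimes> Z) (Y \<boxtimes> (X \<boxtimes> Z))
    (\<lambda>u. assoc_tensor Y X Z (map_tensor (X \<boxtimes> Y) Z (Y \<boxtimes> X) Z (flip_tensor X Y) (\<lambda>z. z) u))"
  by (auto intro!: linmap_op_rules)

text \<open>Transport along the identity map: the two operators of the associator are replaced by
  the operators \<open>T3\<close>, so that all series are evaluated in one family.\<close>

lemma series_assoc_eq: "series_hmap ((X \<boxtimes> Y) \<boxtimes> Z) UNIV (assoc_ops X Y Z) \<Phi> = E3 (nc_subst \<Phi> (dk_t 1 2) (dk_t 2 3))"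
  "series_hmap ((X \<boxtimes> Y) \<boxtimes> Z) UNIV (assoc_ops X Y Z) (nc_inverse \<Phi>) = E3 (nc_inverse (nc_subst \<Phi> (dk_t 1 2) (dk_t 2 3)))"
  using series_subst_transport[OF op3 operators_assoc[OF XYZ], of "dk_t 1 2" "dk_t 2 3" "\<lambda>u. u" \<Phi>]
  by (simp_all add: linmap_id val3 t12_T3[OF XYZ, simplified] t23_T3[OF XYZ] wf_id_comp \<Phi>_Nil)

lemma series_braid_id_eq:
  "series_hmap (X \<boxtimes> Y) UNIV (\<lambda>_ :: unit. t_act t X Y) half_exp \<otimes>\<^sub>h id_hmap Z = E3 (half_exp_nc (dk_t 1 2))"
proof -
  have op: "operators ((X \<boxtimes> Y) \<boxtimes> Z) UNIV (\<lambda>_ :: unit. map_tensor (X \<boxtimes> Y) Z (X \<boxtimes> Y) Z (t_act t X Y) (\<lambda>z. z))"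
    by (intro operators.intro) (auto intro!: linmap_op_rules)
  show ?thesis
    unfolding series_hmap_tensor_id[OF operators_braid[OF XYZ(1,2)] lmod_rules(1)[OF XYZ(3)]]
    using series_exp_transport[OF op3 op, of "dk_t 1 2" "\<lambda>u. u"]
    by (simp add: linmap_id val3 t12_T3[OF XYZ, simplified] t12_act_map wf_id_comp op)
qed

text \<open>By the formula for (id \<otimes> \<Delta>)(t), the braiding of \<open>X\<close> with
  \<open>Y \<boxtimes> Z\<close> contributes the exponential of half of
  \<open>t\<^sup>1\<^sup>2 + t\<^sup>1\<^sup>3\<close>.\<close>

lemma braid_left_transport:
  "series_hmap (X \<boxtimes> (Y \<boxtimes> Z)) UNIV (\<lambda>_ :: unit. t_act t X (Y \<boxtimes> Z)) half_exp
      \<circ>\<^sub>h const_hmap ((X \<boxtimes> Y) \<boxtimes> Z) (X \<boxtimes> (Y \<boxtimes> Z)) (assoc_tensor X Y Z)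
    = const_hmap ((X \<boxtimes> Y) \<boxtimes> Z) (X \<boxtimes> (Y \<boxtimes> Z)) (assoc_tensor X Y Z)
      \<circ>\<^sub>h E3 (half_exp_nc (dk_t 1 2 + dk_t 1 3))"
  by (rule series_exp_transport)
    (simp_all add: val3 t_act_right_tensor[OF XYZ, simplified] linmap_tensor_simps)

lemma braid_right_eq:
  "series_hmap ((X \<boxtimes> Y) \<boxtimes> Z) UNIV (\<lambda>_ :: unit. t_act t (X \<boxtimes> Y) Z) half_exp
    = E3 (half_exp_nc (dk_t 1 3 + dk_t 2 3))"
  using series_exp_transport[OF op3 operators_braid, of "X \<boxtimes> Y" Z "dk_t 1 3 + dk_t 2 3" "\<lambda>u. u"]
  by (simp add: linmap_id val3 t_act_left_tensor[OF XYZ, simplified] wf_id_comp)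

lemma id_braid_transport:
  "(id_hmap X \<otimes>\<^sub>h series_hmap (Y \<boxtimes> Z) UNIV (\<lambda>_ :: unit. t_act t Y Z) half_exp)
      \<circ>\<^sub>h const_hmap ((X \<boxtimes> Y) \<boxtimes> Z) (X \<boxtimes> (Y \<boxtimes> Z)) (assoc_tensor X Y Z)
    = const_hmap ((X \<boxtimes> Y) \<boxtimes> Z) (X \<boxtimes> (Y \<boxtimes> Z)) (assoc_tensor X Y Z) \<circ>\<^sub>h E3 (half_exp_nc (dk_t 2 3))"
proof -
  have op: "operators (X \<boxtimes> (Y \<boxtimes> Z)) UNIV (\<lambda>_ :: unit. map_tensor X (Y \<boxtimes> Z) X (Y \<boxtimes> Z) (\<lambda>x. x) (t_act t Y Z))"
    by (intro operators.intro) (auto intro!: linmap_op_rules)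
  show ?thesis
    unfolding id_tensor_series_hmap[OF operators_braid[OF XYZ(2,3)] lmod_rules(1)[OF XYZ(1)]]
    by (rule series_exp_transport[OF op3 op]) (simp_all add: val3 t23_assoc linmap_tensor_simps)
qed

text \<open>The axioms for \<Phi> use increasing indices, whereas a permuted product yields the legs
  in the order of the permutation; these rules mediate.\<close>

lemma T3_31: "u \<in> carrier ((X \<boxtimes> Y) \<boxtimes> Z) \<Longrightarrow> T3 X Y Z (Suc 0) 3 u = T3 X Y Z 3 (Suc 0) u"
  and T3_21: "u \<in> carrier ((X \<boxtimes> Y) \<boxtimes> Z) \<Longrightarrow> T3 X Y Z (Suc 0) 2 u = T3 X Y Z 2 (Suc 0) u"
  and T3_32: "u \<in> carrier ((X \<boxtimes> Y) \<boxtimes> Z) \<Longrightarrow> T3 X Y Z 2 3 u = T3 X Y Z 3 2 u"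
  by (rule T3_sym; simp)+

text \<open>Places 1, 2, 3 of Y, Z, X are places 2, 3, 1 of X, Y, Z, so
  \<open>\<Phi>(t\<^sup>1\<^sup>2, t\<^sup>2\<^sup>3)\<close> becomes
  \<open>\<Phi>(t\<^sup>2\<^sup>3, t\<^sup>1\<^sup>3)\<close>, the factor whose inverse stands in
  the axiom for \<open>t\<^sup>1\<^sup>2 + t\<^sup>1\<^sup>3\<close>.\<close>

lemma rotate_transport:
  "series_hmap ((Y \<boxtimes> Z) \<boxtimes> X) UNIV (assoc_ops Y Z X) \<Phi>
      \<circ>\<^sub>h const_hmap ((X \<boxtimes> Y) \<boxtimes> Z) ((Y \<boxtimes> Z) \<boxtimes> X) (\<lambda>u. flip_tensor X (Y \<boxtimes> Z) (assoc_tensor X Y Z u))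
    = const_hmap ((X \<boxtimes> Y) \<boxtimes> Z) ((Y \<boxtimes> Z) \<boxtimes> X) (\<lambda>u. flip_tensor X (Y \<boxtimes> Z) (assoc_tensor X Y Z u))
      \<circ>\<^sub>h E3 (nc_subst \<Phi> (dk_t 2 3) (dk_t 1 3))"
  by (rule series_subst_transport)
    (simp_all add: val3 T3_31 t_rotate(1)[OF XYZ] t_rotate(2)[OF XYZ, simplified])

lemma swap12_transport:
  "series_hmap ((Y \<boxtimes> X) \<boxtimes> Z) UNIV (assoc_ops Y X Z) \<Phi>
      \<circ>\<^sub>h const_hmap ((X \<boxtimes> Y) \<boxtimes> Z) ((Y \<boxtimes> X) \<boxtimes> Z) (map_tensor (X \<boxtimes> Y) Z (Y \<boxtimes> X) Z (flip_tensor X Y) (\<lambda>z. z))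
    = const_hmap ((X \<boxtimes> Y) \<boxtimes> Z) ((Y \<boxtimes> X) \<boxtimes> Z) (map_tensor (X \<boxtimes> Y) Z (Y \<boxtimes> X) Z (flip_tensor X Y) (\<lambda>z. z))
      \<circ>\<^sub>h E3 (nc_subst \<Phi> (dk_t 1 2) (dk_t 1 3))"
  by (rule series_subst_transport)
    (simp_all add: val3 T3_21 t_swap12[OF XYZ, simplified])

text \<open>Once X and Y are exchanged, the braiding of X with Z concerns the last two places, which
  are places 1 and 3 of the original order.\<close>

lemma swap12_assoc_transport:
  "(id_hmap Y \<otimes>\<^sub>h series_hmap (X \<boxtimes> Z) UNIV (\<lambda>_ :: unit. t_act t X Z) half_exp)
      \<circ>\<^sub>h const_hmap ((X \<boxtimes> Y) \<boxtimes> Z) (Y \<boxtimes> (X \<boxtimes> Z))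
        (\<lambda>u. assoc_tensor Y X Z (map_tensor (X \<boxtimes> Y) Z (Y \<boxtimes> X) Z (flip_tensor X Y) (\<lambda>z. z) u))
    = const_hmap ((X \<boxtimes> Y) \<boxtimes> Z) (Y \<boxtimes> (X \<boxtimes> Z))
        (\<lambda>u. assoc_tensor Y X Z (map_tensor (X \<boxtimes> Y) Z (Y \<boxtimes> X) Z (flip_tensor X Y) (\<lambda>z. z) u))
      \<circ>\<^sub>h E3 (half_exp_nc (dk_t 1 3))"
proof -
  have op: "operators (Y \<boxtimes> (X \<boxtimes> Z)) UNIV (\<lambda>_ :: unit. map_tensor Y (X \<boxtimes> Z) Y (X \<boxtimes> Z) (\<lambda>x. x) (t_act t X Z))"
    by (intro operators.intro) (auto intro!: linmap_op_rules)
  have c: "map_tensor (X \<boxtimes> Y) Z (Y \<boxtimes> X) Z (flip_tensor X Y) (\<lambda>z. z) u \<in> carrier ((Y \<boxtimes> X) \<boxtimes> Z)"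
    if "u \<in> carrier ((X \<boxtimes> Y) \<boxtimes> Z)" for u
    using linmap_closed[OF linmap_moves(2) that] .
  show ?thesis
    unfolding id_tensor_series_hmap[OF operators_braid[OF XYZ(1,3)] lmod_rules(1)[OF XYZ(2)]]
    by (rule series_exp_transport[OF op3 op])
      (simp_all add: val3 c t_swap12[OF XYZ, simplified] t23_T3[OF XYZ(2,1,3), symmetric] t23_assoc)
qed

text \<open>The order X, Z, Y lists the places 1, 3, 2, so the pair
  \<open>t\<^sup>1\<^sup>2\<close>, \<open>t\<^sup>2\<^sup>3\<close> of the permuted product is
  \<open>t\<^sup>1\<^sup>3\<close>, \<open>t\<^sup>3\<^sup>2\<close>.\<close>

lemma swap23_transport:
  "series_hmap ((X \<boxtimes> Z) \<boxtimes> Y) UNIV (assoc_ops X Z Y) (nc_inverse \<Phi>)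
      \<circ>\<^sub>h const_hmap ((X \<boxtimes> Y) \<boxtimes> Z) ((X \<boxtimes> Z) \<boxtimes> Y) (\<lambda>u. assoc_tensor_inv X Z Y
        (map_tensor X (Y \<boxtimes> Z) X (Z \<boxtimes> Y) (\<lambda>x. x) (flip_tensor Y Z) (assoc_tensor X Y Z u)))
    = const_hmap ((X \<boxtimes> Y) \<boxtimes> Z) ((X \<boxtimes> Z) \<boxtimes> Y) (\<lambda>u. assoc_tensor_inv X Z Y
        (map_tensor X (Y \<boxtimes> Z) X (Z \<boxtimes> Y) (\<lambda>x. x) (flip_tensor Y Z) (assoc_tensor X Y Z u)))
      \<circ>\<^sub>h E3 (nc_inverse (nc_subst \<Phi> (dk_t 1 3) (dk_t 2 3)))"
  by (rule series_subst_transport(2))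
    (simp_all add: val3 T3_32 \<Phi>_Nil t_swap23(1)[OF XYZ, simplified] t_swap23(2)[OF XYZ])

text \<open>The order Z, X, Y lists the places 3, 1, 2, so the pair
  \<open>t\<^sup>1\<^sup>2\<close>, \<open>t\<^sup>2\<^sup>3\<close> of the permuted product is
  \<open>t\<^sup>3\<^sup>1\<close>, \<open>t\<^sup>1\<^sup>2\<close>.\<close>

lemma rotate_inv_transport:
  "series_hmap ((Z \<boxtimes> X) \<boxtimes> Y) UNIV (assoc_ops Z X Y) (nc_inverse \<Phi>)
      \<circ>\<^sub>h const_hmap ((X \<boxtimes> Y) \<boxtimes> Z) ((Z \<boxtimes> X) \<boxtimes> Y) (\<lambda>u. map_tensor (X \<boxtimes> Z) Y (Z \<boxtimes> X) Y (flip_tensor X Z) (\<lambda>y. y)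
        (assoc_tensor_inv X Z Y (map_tensor X (Y \<boxtimes> Z) X (Z \<boxtimes> Y) (\<lambda>x. x) (flip_tensor Y Z) (assoc_tensor X Y Z u))))
    = const_hmap ((X \<boxtimes> Y) \<boxtimes> Z) ((Z \<boxtimes> X) \<boxtimes> Y) (\<lambda>u. map_tensor (X \<boxtimes> Z) Y (Z \<boxtimes> X) Y (flip_tensor X Z) (\<lambda>y. y)
        (assoc_tensor_inv X Z Y (map_tensor X (Y \<boxtimes> Z) X (Z \<boxtimes> Y) (\<lambda>x. x) (flip_tensor Y Z) (assoc_tensor X Y Z u))))
      \<circ>\<^sub>h E3 (nc_inverse (nc_subst \<Phi> (dk_t 1 3) (dk_t 1 2)))"
  by (rule series_subst_transport(2))
    (simp_all add: val3 T3_31 \<Phi>_Nil t_rotate_inv[OF XYZ, simplified])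

lemma swap23_braid_transport:
  "(series_hmap (X \<boxtimes> Z) UNIV (\<lambda>_ :: unit. t_act t X Z) half_exp \<otimes>\<^sub>h id_hmap Y)
      \<circ>\<^sub>h const_hmap ((X \<boxtimes> Y) \<boxtimes> Z) ((X \<boxtimes> Z) \<boxtimes> Y) (\<lambda>u. assoc_tensor_inv X Z Y
        (map_tensor X (Y \<boxtimes> Z) X (Z \<boxtimes> Y) (\<lambda>x. x) (flip_tensor Y Z) (assoc_tensor X Y Z u)))
    = const_hmap ((X \<boxtimes> Y) \<boxtimes> Z) ((X \<boxtimes> Z) \<boxtimes> Y) (\<lambda>u. assoc_tensor_inv X Z Y
        (map_tensor X (Y \<boxtimes> Z) X (Z \<boxtimes> Y) (\<lambda>x. x) (flip_tensor Y Z) (assoc_tensor X Y Z u)))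
      \<circ>\<^sub>h E3 (half_exp_nc (dk_t 1 3))"
proof -
  have op: "operators ((X \<boxtimes> Z) \<boxtimes> Y) UNIV (\<lambda>_ :: unit. map_tensor (X \<boxtimes> Z) Y (X \<boxtimes> Z) Y (t_act t X Z) (\<lambda>y. y))"
    by (intro operators.intro) (auto intro!: linmap_op_rules)
  have c: "assoc_tensor_inv X Z Y
      (map_tensor X (Y \<boxtimes> Z) X (Z \<boxtimes> Y) (\<lambda>x. x) (flip_tensor Y Z) (assoc_tensor X Y Z u)) \<in> carrier ((X \<boxtimes> Z) \<boxtimes> Y)"
    if "u \<in> carrier ((X \<boxtimes> Y) \<boxtimes> Z)" for u
    using linmap_closed[OF linmap_moves(3) that] .
  show ?thesis
    unfolding series_hmap_tensor_id[OF operators_braid[OF XYZ(1,3)] lmod_rules(1)[OF XYZ(2)]]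
    by (rule series_exp_transport[OF op3 op])
      (simp_all add: val3 c t_swap23(1)[OF XYZ, simplified] t12_act_map)
qed

text \<open>The axioms are solved for the exponential of a sum. Multiplication by suitable
  \<Phi>-factors on both sides, or by their inverses in the second case, cancels the outer factors
  and leaves the products that the two sides of a hexagon produce.\<close>

lemma dk_hexagons:
  "E3 (nc_subst \<Phi> (dk_t 2 3) (dk_t 1 3) * half_exp_nc (dk_t 1 2 + dk_t 1 3) * nc_subst \<Phi> (dk_t 1 2) (dk_t 2 3))
    = E3 (half_exp_nc (dk_t 1 3) * nc_subst \<Phi> (dk_t 1 2) (dk_t 1 3) * half_exp_nc (dk_t 1 2))"
  "E3 (nc_inverse (nc_subst \<Phi> (dk_t 1 3) (dk_t 1 2)) * half_exp_nc (dk_t 1 3 + dk_t 2 3)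
      * nc_inverse (nc_subst \<Phi> (dk_t 1 2) (dk_t 2 3)))
    = E3 (half_exp_nc (dk_t 1 3) * nc_inverse (nc_subst \<Phi> (dk_t 1 3) (dk_t 2 3)) * half_exp_nc (dk_t 2 3))"
proof -
  have inv: "nc_subst \<Phi> a b * nc_inverse (nc_subst \<Phi> a b) = 1" "nc_inverse (nc_subst \<Phi> a b) * nc_subst \<Phi> a b = 1"
    for a b :: "(nat \<times> nat) ncseries"
    by (rule nc_inverse; simp add: \<Phi>_Nil)+
  have inv': "nc_inverse (nc_subst \<Phi> a b) * (nc_subst \<Phi> a b * f) = f"
    "nc_subst \<Phi> a b * (nc_inverse (nc_subst \<Phi> a b) * f) = f" for a b f :: "(nat \<times> nat) ncseries"
    by (simp_all add: inv flip: mult.assoc)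
  \<comment> \<open>A congruence modulo the Drinfeld--Kohno relations becomes an equality only after
    evaluation; multiplicativity of \<open>E3\<close> then permits replacing a factor inside a
    product.\<close>
  have replace: "E3 (f * e * g) = E3 (f * e' * g)" if "dk_eq 3 e e'" for e e' f g
    using series_hmap_dk_eq[OF dk_operators3[OF XYZ] that] by (simp only: series_hmap_mult[OF op3])
  have dk: "dk_eq 3 (half_exp_nc (dk_t 1 2 + dk_t 1 3))
       (nc_inverse (nc_subst \<Phi> (dk_t 2 3) (dk_t 1 3)) * half_exp_nc (dk_t 1 3)
         * nc_subst \<Phi> (dk_t 1 2) (dk_t 1 3) * half_exp_nc (dk_t 1 2)
         * nc_inverse (nc_subst \<Phi> (dk_t 1 2) (dk_t 2 3)))"
    "dk_eq 3 (half_exp_nc (dk_t 1 3 + dk_t 2 3))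
       (nc_subst \<Phi> (dk_t 1 3) (dk_t 1 2) * half_exp_nc (dk_t 1 3)
         * nc_inverse (nc_subst \<Phi> (dk_t 1 3) (dk_t 2 3)) * half_exp_nc (dk_t 2 3)
         * nc_subst \<Phi> (dk_t 1 2) (dk_t 2 3))"
    using associator unfolding drinfeld_associator_def by blast+
  show "E3 (nc_subst \<Phi> (dk_t 2 3) (dk_t 1 3) * half_exp_nc (dk_t 1 2 + dk_t 1 3) * nc_subst \<Phi> (dk_t 1 2) (dk_t 2 3))
    = E3 (half_exp_nc (dk_t 1 3) * nc_subst \<Phi> (dk_t 1 2) (dk_t 1 3) * half_exp_nc (dk_t 1 2))"
    unfolding replace[OF dk(1)] by (simp add: inv inv' mult.assoc)
  show "E3 (nc_inverse (nc_subst \<Phi> (dk_t 1 3) (dk_t 1 2)) * half_exp_nc (dk_t 1 3 + dk_t 2 3)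
      * nc_inverse (nc_subst \<Phi> (dk_t 1 2) (dk_t 2 3)))
    = E3 (half_exp_nc (dk_t 1 3) * nc_inverse (nc_subst \<Phi> (dk_t 1 3) (dk_t 2 3)) * half_exp_nc (dk_t 2 3))"
    unfolding replace[OF dk(2)] by (simp add: inv inv' mult.assoc)
qed

lemma hexagon_left_hmap:
  "assoc_hmap Y Z X \<circ>\<^sub>h braid_hmap X (Y \<boxtimes> Z) \<circ>\<^sub>h assoc_hmap X Y Z
    = (id_hmap Y \<otimes>\<^sub>h braid_hmap X Z) \<circ>\<^sub>h assoc_hmap Y X Z \<circ>\<^sub>h (braid_hmap X Y \<otimes>\<^sub>h id_hmap Z)"
proof -
  let ?M = "(X \<boxtimes> Y) \<boxtimes> Z"
  let ?rot = "\<lambda>u. flip_tensor X (Y \<boxtimes> Z) (assoc_tensor X Y Z u)"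
  let ?swap = "map_tensor (X \<boxtimes> Y) Z (Y \<boxtimes> X) Z (flip_tensor X Y) (\<lambda>z. z)"
  note [simp] = linmap_tensor_simps
  note tails = comp_eq_tail[OF braid_left_transport] comp_eq_tail[OF rotate_transport]
    comp_eq_tail[OF swap12_transport] comp_eq_tail[OF swap12_assoc_transport]
  have final: "linmap ?M (Y \<boxtimes> (Z \<boxtimes> X)) (\<lambda>u. assoc_tensor Y Z X (?rot u))"
    "linmap ?M (Y \<boxtimes> (Z \<boxtimes> X)) (\<lambda>u. map_tensor Y (X \<boxtimes> Z) Y (Z \<boxtimes> X) (\<lambda>y. y) (flip_tensor X Z) (assoc_tensor Y X Z (?swap u)))"
    by (auto intro!: linmap_op_rules)
  \<comment> \<open>At \<hbar> = 0 the hexagon is coherence of the flip: both sides send (x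
    \<otimes> y) \<otimes> z to y \<otimes> (z \<otimes> x).\<close>
  have eq: "assoc_tensor Y Z X (?rot u)
      = map_tensor Y (X \<boxtimes> Z) Y (Z \<boxtimes> X) (\<lambda>y. y) (flip_tensor X Z) (assoc_tensor Y X Z (?swap u))"
    if "u \<in> carrier ?M" for u
    by (rule linmap_tensor_ext3[OF _ _ _ _ final _ that]) simp_all
  \<comment> \<open>The constant maps are moved to the left and fused; each series they pass is
    rewritten as a series on \<open>?M\<close>.\<close>
  have "assoc_hmap Y Z X \<circ>\<^sub>h braid_hmap X (Y \<boxtimes> Z) \<circ>\<^sub>h assoc_hmap X Y Z
     = const_hmap ?M (Y \<boxtimes> (Z \<boxtimes> X)) (\<lambda>u. assoc_tensor Y Z X (?rot u))
       \<circ>\<^sub>h E3 (nc_subst \<Phi> (dk_t 2 3) (dk_t 1 3) * half_exp_nc (dk_t 1 2 + dk_t 1 3) * nc_subst \<Phi> (dk_t 1 2) (dk_t 2 3))"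
    by (simp add: assoc_hmap_def[of X Y Z] series_assoc_eq assoc_hmap_def[of Y Z X] braid_hmap_def wf_comp_assoc
        wf_const_comp_const tails series_hmap_mult[OF op3])
  moreover have "(id_hmap Y \<otimes>\<^sub>h braid_hmap X Z) \<circ>\<^sub>h assoc_hmap Y X Z \<circ>\<^sub>h (braid_hmap X Y \<otimes>\<^sub>h id_hmap Z)
     = const_hmap ?M (Y \<boxtimes> (Z \<boxtimes> X)) (\<lambda>u. map_tensor Y (X \<boxtimes> Z) Y (Z \<boxtimes> X) (\<lambda>y. y) (flip_tensor X Z) (assoc_tensor Y X Z (?swap u)))
       \<circ>\<^sub>h E3 (half_exp_nc (dk_t 1 3) * nc_subst \<Phi> (dk_t 1 2) (dk_t 1 3) * half_exp_nc (dk_t 1 2))"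
    by (simp add: assoc_hmap_def braid_hmap_def wf_comp_assoc wf_comp_tensor_id wf_id_tensor_comp
        const_tensor_const wf_const_comp_const tails series_braid_id_eq series_hmap_mult[OF op3])
  ultimately show ?thesis
    using dk_hexagons(1) const_hmap_cong[where X = ?M and Y = "Y \<boxtimes> (Z \<boxtimes> X)", OF eq] by simp
qed

text \<open>The composites start at \<open>X \<boxtimes> (Y \<boxtimes> Z)\<close>, not at the space
  of reference. They are compared after precomposition with the rebracketing \<open>?A\<close>,
  which \<open>?B\<close> undoes at the end.\<close>

lemma hexagon_right_hmap:
  "assoc_inv_hmap Z X Y \<circ>\<^sub>h braid_hmap (X \<boxtimes> Y) Z \<circ>\<^sub>h assoc_inv_hmap X Y Z
    = (braid_hmap X Z \<otimes>\<^sub>h id_hmap Y) \<circ>\<^sub>h assoc_inv_hmap X Z Y \<circ>\<^sub>h (id_hmap X \<otimes>\<^sub>h braid_hmap Y Z)"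
    (is "?l = ?r")
proof -
  let ?M = "(X \<boxtimes> Y) \<boxtimes> Z"
  let ?A = "const_hmap ?M (X \<boxtimes> (Y \<boxtimes> Z)) (assoc_tensor X Y Z)"
  let ?B = "const_hmap (X \<boxtimes> (Y \<boxtimes> Z)) ?M (assoc_tensor_inv X Y Z)"
  let ?swap = "\<lambda>u. assoc_tensor_inv X Z Y
    (map_tensor X (Y \<boxtimes> Z) X (Z \<boxtimes> Y) (\<lambda>x. x) (flip_tensor Y Z) (assoc_tensor X Y Z u))"
  let ?rot = "\<lambda>u. map_tensor (X \<boxtimes> Z) Y (Z \<boxtimes> X) Y (flip_tensor X Z) (\<lambda>y. y) (?swap u)"
  note [simp] = linmap_tensor_simps
  have [simp]: "linmap (X \<boxtimes> (Y \<boxtimes> Z)) ((X \<boxtimes> Z) \<boxtimes> Y)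
      (\<lambda>u. assoc_tensor_inv X Z Y (map_tensor X (Y \<boxtimes> Z) X (Z \<boxtimes> Y) (\<lambda>x. x) (flip_tensor Y Z) u))"
    by (auto intro!: linmap_op_rules)
  have rot': "linmap ?M ((Z \<boxtimes> X) \<boxtimes> Y) (\<lambda>u. assoc_tensor_inv Z X Y (flip_tensor (X \<boxtimes> Y) Z u))"
    by (auto intro!: linmap_op_rules)
  have eq: "assoc_tensor_inv Z X Y (flip_tensor (X \<boxtimes> Y) Z u) = ?rot u" if "u \<in> carrier ?M" for u
    by (rule linmap_tensor_ext3[OF _ _ _ _ rot' linmap_moves(5) _ that]) simp_all
  have AB: "?A \<circ>\<^sub>h ?B = id_hmap (X \<boxtimes> (Y \<boxtimes> Z))"
    by (simp add: const_comp_const) (rule const_hmap_cong, simp add: assoc_tensor_inverse)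
  have BA: "?B \<circ>\<^sub>h ?A = id_hmap ?M"
    by (simp add: const_comp_const) (rule const_hmap_cong, simp add: assoc_tensor_inverse)
  note rot_eq = const_hmap_cong[where X = ?M and Y = "(Z \<boxtimes> X) \<boxtimes> Y", OF eq]
  note tails = comp_eq_tail[OF rotate_inv_transport] comp_eq_tail[OF swap23_transport]
    comp_eq_tail[OF swap23_braid_transport]
  have "?l \<circ>\<^sub>h ?A = const_hmap ?M ((Z \<boxtimes> X) \<boxtimes> Y) ?rot
     \<circ>\<^sub>h E3 (nc_inverse (nc_subst \<Phi> (dk_t 1 3) (dk_t 1 2)) * half_exp_nc (dk_t 1 3 + dk_t 2 3)
      * nc_inverse (nc_subst \<Phi> (dk_t 1 2) (dk_t 2 3)))"
    by (simp add: assoc_inv_hmap_def[of X Y Z] series_assoc_eq assoc_inv_hmap_def[of Z X Y] braid_hmap_def wf_comp_assoc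
        wf_const_comp_const braid_right_eq BA wf_id_comp rot_eq rot' tails series_hmap_mult[OF op3])
  moreover have "?r \<circ>\<^sub>h ?A = const_hmap ?M ((Z \<boxtimes> X) \<boxtimes> Y) ?rot
     \<circ>\<^sub>h E3 (half_exp_nc (dk_t 1 3) * nc_inverse (nc_subst \<Phi> (dk_t 1 3) (dk_t 2 3)) * half_exp_nc (dk_t 2 3))"
    by (simp add: assoc_inv_hmap_def braid_hmap_def wf_comp_assoc wf_comp_tensor_id wf_id_tensor_comp
        const_tensor_const wf_const_comp_const id_braid_transport tails series_hmap_mult[OF op3])
  ultimately have "?l \<circ>\<^sub>h ?A \<circ>\<^sub>h ?B = ?r \<circ>\<^sub>h ?A \<circ>\<^sub>h ?B"
    using dk_hexagons(2) by simp
  then show ?thesis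
    by (simp add: assoc_inv_hmap_def braid_hmap_def wf_comp_assoc AB wf_id_comp)
qed

end

end

text \<open>With all operators zero only the empty word contributes, and it has coefficient 1. This
  handles associators with the unit object in the middle.\<close>

lemma series_hmap_zero:
  assumes "operators M A T" and "coeff f [] = 1" and zero: "\<And>i u. i \<in> A \<Longrightarrow> u \<in> carrier M \<Longrightarrow> T i u = \<zero>\<^bsub>M\<^esub>"
  shows "series_hmap M A T f = id_hmap M"
proof (rule hmap_eqI[of _ M M])
  interpret operators M A T by fact
  show "lin_hmap (series_hmap M A T f) M M" "lin_hmap (id_hmap M) M M" using assms(1) cvs by auto
  fix n u assume u: "u \<in> carrier M"
  show "terms (series_hmap M A T f) n u = terms (id_hmap M) n u"
  proof (cases n)
    case 0
    then show ?thesis using val_single[of "[]" f u] u assms(2) cvs by (simp add: terms_series_hmap terms_const)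
  next
    case (Suc k)
    have "series_value M A T f n u = finsum M (\<lambda>_. \<zero>\<^bsub>M\<^esub>) (words A n)"
      unfolding series_value_def
    proof (rule cvs_finsum_cong[OF cvs refl])
      fix w assume "w \<in> words A n"
      then show "coeff f w \<odot>\<^bsub>M\<^esub> foldr T w u = \<zero>\<^bsub>M\<^esub>"
        using Suc u cvs by (cases w) (auto simp: zero)
    qed (use cvs in simp)
    then show ?thesis using Suc u cvs by (simp add: terms_series_hmap terms_const)
  qed
qed

text \<open>Both sides give the sum over all i + j + k = n of the triple tensors of coefficients;
  the two bracketings differ in the order of summation.\<close>

lemma const_assoc_natural:
  assumes f: "lin_hmap f X X'" and g: "lin_hmap g Y Y'" and h: "lin_hmap h Z Z'"
  shows "const_hmap ((X' \<boxtimes> Y') \<boxtimes> Z') (X' \<boxtimes> (Y' \<boxtimes> Z')) (assoc_tensor X' Y' Z') \<circ>\<^sub>h ((f \<otimes>\<^sub>h g) \<otimes>\<^sub>h h)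
    = (f \<otimes>\<^sub>h (g \<otimes>\<^sub>h h)) \<circ>\<^sub>h const_hmap ((X \<boxtimes> Y) \<boxtimes> Z) (X \<boxtimes> (Y \<boxtimes> Z)) (assoc_tensor X Y Z)" (is "?l = ?r")
proof (rule hmap_eqI)
  let ?N = "X' \<boxtimes> (Y' \<boxtimes> Z')" and ?M = "(X \<boxtimes> Y) \<boxtimes> Z"
  note D = lin_hmapD[OF f] lin_hmapD[OF g] lin_hmapD[OF h]
  note fg = lin_hmap_tensor[OF f g] and gh = lin_hmap_tensor[OF g h]
  note fgh = lin_hmap_tensor[OF fg h] and fgh' = lin_hmap_tensor[OF f gh]
  have A: "linmap ?M (X \<boxtimes> (Y \<boxtimes> Z)) (assoc_tensor X Y Z)"
    and A': "linmap ((X' \<boxtimes> Y') \<boxtimes> Z') ?N (assoc_tensor X' Y' Z')"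
    using D by (auto intro: linmap_assoc_tensor)
  show l: "lin_hmap ?l ?M ?N" using fgh A' by (intro lin_hmap_comp[OF fgh] lin_hmap_const) auto
  show r: "lin_hmap ?r ?M ?N" using fgh' A by (intro lin_hmap_comp[OF _ fgh'] lin_hmap_const) auto
  fix n u assume u: "u \<in> carrier ?M"
  show "terms ?l n u = terms ?r n u"
  proof (rule linmap_tensor_ext3[where f = "terms ?l n" and g = "terms ?r n", OF D(1) _ _ _ lin_hmapD(5)[OF l] lin_hmapD(5)[OF r] _ u])
    fix x y z assume xyz: "x \<in> carrier X" "y \<in> carrier Y" "z \<in> carrier Z"
    let ?e = "elem_tensor (X \<boxtimes> Y) Z (elem_tensor X Y x y) z"
    let ?p = "\<lambda>i j k. elem_tensor X' (Y' \<boxtimes> Z') (terms f i x) (elem_tensor Y' Z' (terms g j y) (terms h k z))"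
    have "terms ?l n ?e = assoc_tensor X' Y' Z' (terms ((f \<otimes>\<^sub>h g) \<otimes>\<^sub>h h) n ?e)"
      using xyz D A' by (intro terms_const_comp[OF fgh]) auto
    also have "\<dots> = finsum ?N (\<lambda>k. assoc_tensor X' Y' Z'
        (elem_tensor (X' \<boxtimes> Y') Z' (terms (f \<otimes>\<^sub>h g) k (elem_tensor X Y x y)) (terms h (n - k) z))) {..n}"
      unfolding terms_tensor_elem[OF fg h elem_tensor_closed[OF xyz(1,2)] xyz(3)]
      using xyz D lin_hmapD(7)[OF fg] by (intro linmap_finsum[OF A']) simp_all
    \<comment> \<open>As in the associativity of composition, n - k is expressed through j and k - j
      to prepare the exchange of sums.\<close>
    also have "\<dots> = finsum ?N (\<lambda>k. finsum ?N (\<lambda>j. ?p j (k - j) (n - j - (k - j))) {..k}) {..n}"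
    proof (rule cvs_finsum_cong)
      fix k assume k: "k \<in> {..n}"
      let ?P = "\<lambda>v. assoc_tensor X' Y' Z' (elem_tensor (X' \<boxtimes> Y') Z' v (terms h (n - k) z))"
      have P: "linmap (X' \<boxtimes> Y') ?N ?P"
        using D xyz by (intro linmap_comp[OF A'] linmap_elem_left) auto
      have "?P (terms (f \<otimes>\<^sub>h g) k (elem_tensor X Y x y))
          = finsum ?N (\<lambda>j. ?P (elem_tensor X' Y' (terms f j x) (terms g (k - j) y))) {..k}"
        unfolding terms_tensor_elem[OF f g xyz(1,2)] using xyz D by (intro linmap_finsum[OF P]) simp_all
      also have "\<dots> = finsum ?N (\<lambda>j. ?p j (k - j) (n - j - (k - j))) {..k}"
        using xyz D k by (intro cvs_finsum_cong) auto
      finally show "?P (terms (f \<otimes>\<^sub>h g) k (elem_tensor X Y x y))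
          = finsum ?N (\<lambda>j. ?p j (k - j) (n - j - (k - j))) {..k}" .
    qed (use xyz D in \<open>auto intro!: cvs_finsum(1)\<close>)
    also have "\<dots> = finsum ?N (\<lambda>j. finsum ?N (\<lambda>i. ?p j i (n - j - i)) {..n - j}) {..n}"
      using xyz D by (intro cvs_finsum_triangle[where f = "\<lambda>j i. ?p j i (n - j - i)"]) auto
    also have "\<dots> = finsum ?N (\<lambda>j. elem_tensor X' (Y' \<boxtimes> Z') (terms f j x)
        (terms (g \<otimes>\<^sub>h h) (n - j) (elem_tensor Y Z y z))) {..n}"
    proof (rule cvs_finsum_cong)
      fix j assume j: "j \<in> {..n}"
      show "finsum ?N (\<lambda>i. ?p j i (n - j - i)) {..n - j}
          = elem_tensor X' (Y' \<boxtimes> Z') (terms f j x) (terms (g \<otimes>\<^sub>h h) (n - j) (elem_tensor Y Z y z))"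
        using xyz D by (subst terms_tensor_elem[OF g h])
          (auto intro!: linmap_finsum[OF linmap_elem_right, symmetric])
    qed (use xyz D lin_hmapD(7)[OF gh] in auto)
    also have "\<dots> = terms (f \<otimes>\<^sub>h (g \<otimes>\<^sub>h h)) n (elem_tensor X (Y \<boxtimes> Z) x (elem_tensor Y Z y z))"
      using xyz D by (intro terms_tensor_elem[OF f gh, symmetric]) auto
    also have "\<dots> = terms ?r n ?e"
      using xyz D by (subst terms_comp_const[OF fgh' A]) auto
    finally show "terms ?l n ?e = terms ?r n ?e" .
  qed (use D in auto)
qed

lemma const_flip_natural:
  assumes f: "lin_hmap f X X'" and g: "lin_hmap g Y Y'"
  shows "const_hmap (X' \<boxtimes> Y') (Y' \<boxtimes> X') (flip_tensor X' Y') \<circ>\<^sub>h (f \<otimes>\<^sub>h g)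
    = (g \<otimes>\<^sub>h f) \<circ>\<^sub>h const_hmap (X \<boxtimes> Y) (Y \<boxtimes> X) (flip_tensor X Y)" (is "?l = ?r")
proof (rule hmap_tensor_eqI)
  note D = lin_hmapD[OF f] lin_hmapD[OF g]
  note fg = lin_hmap_tensor[OF f g] and gf = lin_hmap_tensor[OF g f]
  have F: "linmap (X \<boxtimes> Y) (Y \<boxtimes> X) (flip_tensor X Y)" and F': "linmap (X' \<boxtimes> Y') (Y' \<boxtimes> X') (flip_tensor X' Y')"
    using D by (auto intro: linmap_flip_tensor)
  show "lin_hmap ?l (X \<boxtimes> Y) (Y' \<boxtimes> X')" "lin_hmap ?r (X \<boxtimes> Y) (Y' \<boxtimes> X')"
    using F F' fg gf by (auto intro!: lin_hmap_comp[OF fg] lin_hmap_comp[OF _ gf])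
  fix n x y assume xy: "x \<in> carrier X" "y \<in> carrier Y"
  have "terms ?l n (elem_tensor X Y x y) = flip_tensor X' Y' (terms (f \<otimes>\<^sub>h g) n (elem_tensor X Y x y))"
    using xy F' by (intro terms_const_comp[OF fg]) auto
  also have "\<dots> = finsum (Y' \<boxtimes> X') (\<lambda>k. elem_tensor Y' X' (terms g (n - k) y) (terms f k x)) {..n}"
    using xy D by (subst terms_tensor_elem[OF f g]) (auto simp: linmap_finsum[OF F'] intro!: cvs_finsum_cong)
  also have "\<dots> = finsum (Y' \<boxtimes> X') (\<lambda>k. elem_tensor Y' X' (terms g k y) (terms f (n - k) x)) {..n}"
    using xy D by (subst cvs_finsum_reflect) (auto intro!: cvs_finsum_cong)
  also have "\<dots> = terms (g \<otimes>\<^sub>h f) n (elem_tensor Y X y x)"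
    using xy by (intro terms_tensor_elem[OF g f, symmetric])
  also have "\<dots> = terms ?r n (elem_tensor X Y x y)"
    using xy D by (subst terms_comp_const[OF gf F]) auto
  finally show "terms ?l n (elem_tensor X Y x y) = terms ?r n (elem_tensor X Y x y)" .
qed

lemma cvs_trivial_module [simp]: "cvs trivial_module"
  by (rule cvsI) (auto simp: trivial_module_def algebra_simps)

context drinfeld
begin

section \<open>The pentagon\<close>

context
  fixes W X Y Z :: "('l, 'a) umod"
  assumes WXYZ [simp]: "lmod W" "lmod X" "lmod Y" "lmod Z"
begin

abbreviation "N4 \<equiv> ((W \<boxtimes> X) \<boxtimes> Y) \<boxtimes> Z"

lemma op4 [simp]: "operators N4 (dk_index 4) (T4_ops W X Y Z)"
  using dk_operators4[OF WXYZ] by (simp add: dk_operators_def)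

lemma val4:
  assumes "i \<in> {1..4}" "j \<in> {1..4}" "u \<in> carrier N4"
  shows "series_value N4 (dk_index 4) (T4_ops W X Y Z) (dk_t i j) (Suc 0) u = T4 W X Y Z i j u"
    and "\<lbrakk>k \<in> {1..4}; l \<in> {1..4}\<rbrakk> \<Longrightarrow>
      series_value N4 (dk_index 4) (T4_ops W X Y Z) (dk_t i j + dk_t k l) (Suc 0) u
      = T4 W X Y Z i j u \<oplus>\<^bsub>N4\<^esub> T4 W X Y Z k l u"
  using assms by (simp_all add: operators.val_var[OF op4] operators.val_var_plus[OF op4])

abbreviation "E4 \<equiv> series_hmap N4 (dk_index 4) (T4_ops W X Y Z)"
abbreviation "assoc_id_map \<equiv> map_tensor ((W \<boxtimes> X) \<boxtimes> Y) Z (W \<boxtimes> (X \<boxtimes> Y)) Z (assoc_tensor W X Y) (\<lambda>z. z)"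
abbreviation "assoc2_id_map u \<equiv> assoc_tensor W (X \<boxtimes> Y) Z (assoc_id_map u)"

lemma linmap_assoc_moves [simp]:
  "linmap N4 ((W \<boxtimes> (X \<boxtimes> Y)) \<boxtimes> Z) assoc_id_map"
  "linmap N4 (W \<boxtimes> ((X \<boxtimes> Y) \<boxtimes> Z)) assoc2_id_map"
  "linmap N4 (W \<boxtimes> (X \<boxtimes> (Y \<boxtimes> Z))) (\<lambda>u. map_tensor W ((X \<boxtimes> Y) \<boxtimes> Z) W (X \<boxtimes> (Y \<boxtimes> Z)) (\<lambda>w. w) (assoc_tensor X Y Z) (assoc2_id_map u))"
  "linmap N4 (W \<boxtimes> (X \<boxtimes> (Y \<boxtimes> Z))) (\<lambda>u. assoc_tensor W X (Y \<boxtimes> Z) (assoc_tensor (W \<boxtimes> X) Y Z u))"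
  by (auto intro!: linmap_op_rules)

lemma series_assoc_id_eq:
  "series_hmap ((W \<boxtimes> X) \<boxtimes> Y) UNIV (assoc_ops W X Y) \<Phi> \<otimes>\<^sub>h id_hmap Z = E4 (nc_subst \<Phi> (dk_t 1 2) (dk_t 2 3))"
proof -
  have op: "operators N4 UNIV (\<lambda>i. map_tensor ((W \<boxtimes> X) \<boxtimes> Y) Z ((W \<boxtimes> X) \<boxtimes> Y) Z (assoc_ops W X Y i) (\<lambda>z. z))"
    using finite_UNIV_letter by (intro operators.intro) (auto intro!: linmap_op_rules split: letter.split)
  show ?thesis
    unfolding series_hmap_tensor_id[OF operators_assoc[OF WXYZ(1-3)] lmod_rules(1)[OF WXYZ(4)]]
    using series_subst_transport(1)[OF op4 op, of "dk_t 1 2" "dk_t 2 3" "\<lambda>u. u" \<Phi>]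
    by (simp add: linmap_id val4 t4_left[OF WXYZ, simplified] wf_id_comp op)
qed

lemma assoc_id_transport:
  "series_hmap ((W \<boxtimes> (X \<boxtimes> Y)) \<boxtimes> Z) UNIV (assoc_ops W (X \<boxtimes> Y) Z) \<Phi>
      \<circ>\<^sub>h const_hmap N4 ((W \<boxtimes> (X \<boxtimes> Y)) \<boxtimes> Z) assoc_id_map
    = const_hmap N4 ((W \<boxtimes> (X \<boxtimes> Y)) \<boxtimes> Z) assoc_id_map
      \<circ>\<^sub>h E4 (nc_subst \<Phi> (dk_t 1 2 + dk_t 1 3) (dk_t 2 4 + dk_t 3 4))"
  by (rule series_subst_transport(1)) (simp_all add: val4 t4_middle[OF WXYZ, simplified])

lemma assoc2_id_transport:
  "(id_hmap W \<otimes>\<^sub>h series_hmap ((X \<boxtimes> Y) \<boxtimes> Z) UNIV (assoc_ops X Y Z) \<Phi>)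
      \<circ>\<^sub>h const_hmap N4 (W \<boxtimes> ((X \<boxtimes> Y) \<boxtimes> Z)) assoc2_id_map
    = const_hmap N4 (W \<boxtimes> ((X \<boxtimes> Y) \<boxtimes> Z)) assoc2_id_map \<circ>\<^sub>h E4 (nc_subst \<Phi> (dk_t 2 3) (dk_t 3 4))"
proof -
  have op: "operators (W \<boxtimes> ((X \<boxtimes> Y) \<boxtimes> Z)) UNIV
      (\<lambda>i. map_tensor W ((X \<boxtimes> Y) \<boxtimes> Z) W ((X \<boxtimes> Y) \<boxtimes> Z) (\<lambda>w. w) (assoc_ops X Y Z i))"
    using finite_UNIV_letter by (intro operators.intro) (auto intro!: linmap_op_rules split: letter.split)
  show ?thesis
    unfolding id_tensor_series_hmap[OF operators_assoc[OF WXYZ(2-4)] lmod_rules(1)[OF WXYZ(1)]]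
    by (rule series_subst_transport(1)[OF op4 op]) (simp_all add: val4 t4_right[OF WXYZ])
qed

lemma series_assoc_outer_eq:
  "series_hmap N4 UNIV (assoc_ops (W \<boxtimes> X) Y Z) \<Phi> = E4 (nc_subst \<Phi> (dk_t 1 3 + dk_t 2 3) (dk_t 3 4))"
  using series_subst_transport(1)[OF op4 operators_assoc, of "W \<boxtimes> X" Y Z "dk_t 1 3 + dk_t 2 3" "dk_t 3 4" "\<lambda>u. u" \<Phi>]
  by (simp add: linmap_id val4 t4_outer[OF WXYZ, simplified] wf_id_comp)

lemma assoc_outer_transport:
  "series_hmap ((W \<boxtimes> X) \<boxtimes> (Y \<boxtimes> Z)) UNIV (assoc_ops W X (Y \<boxtimes> Z)) \<Phi>
      \<circ>\<^sub>h const_hmap N4 ((W \<boxtimes> X) \<boxtimes> (Y \<boxtimes> Z)) (assoc_tensor (W \<boxtimes> X) Y Z)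
    = const_hmap N4 ((W \<boxtimes> X) \<boxtimes> (Y \<boxtimes> Z)) (assoc_tensor (W \<boxtimes> X) Y Z)
      \<circ>\<^sub>h E4 (nc_subst \<Phi> (dk_t 1 2) (dk_t 2 3 + dk_t 2 4))"
  by (rule series_subst_transport(1)) (simp_all add: val4 t4_assoc[OF WXYZ, simplified] linmap_tensor_simps)

lemma dk_pentagon:
  "E4 (nc_subst \<Phi> (dk_t 2 3) (dk_t 3 4) * nc_subst \<Phi> (dk_t 1 2 + dk_t 1 3) (dk_t 2 4 + dk_t 3 4)
         * nc_subst \<Phi> (dk_t 1 2) (dk_t 2 3))
   = E4 (nc_subst \<Phi> (dk_t 1 2) (dk_t 2 3 + dk_t 2 4) * nc_subst \<Phi> (dk_t 1 3 + dk_t 2 3) (dk_t 3 4))"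
proof (rule series_hmap_dk_eq[OF dk_operators4[OF WXYZ], symmetric])
  show "dk_eq 4 (nc_subst \<Phi> (dk_t 1 2) (dk_t 2 3 + dk_t 2 4) * nc_subst \<Phi> (dk_t 1 3 + dk_t 2 3) (dk_t 3 4))
     (nc_subst \<Phi> (dk_t 2 3) (dk_t 3 4) * nc_subst \<Phi> (dk_t 1 2 + dk_t 1 3) (dk_t 2 4 + dk_t 3 4)
         * nc_subst \<Phi> (dk_t 1 2) (dk_t 2 3))"
    using associator unfolding drinfeld_associator_def by blast
qed

lemma pentagon_hmap:
  "(id_hmap W \<otimes>\<^sub>h assoc_hmap X Y Z) \<circ>\<^sub>h assoc_hmap W (X \<boxtimes> Y) Z \<circ>\<^sub>h (assoc_hmap W X Y \<otimes>\<^sub>h id_hmap Z)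
    = assoc_hmap W X (Y \<boxtimes> Z) \<circ>\<^sub>h assoc_hmap (W \<boxtimes> X) Y Z"
proof -
  let ?N = "W \<boxtimes> (X \<boxtimes> (Y \<boxtimes> Z))"
  let ?P = "\<lambda>u. map_tensor W ((X \<boxtimes> Y) \<boxtimes> Z) W (X \<boxtimes> (Y \<boxtimes> Z)) (\<lambda>w. w) (assoc_tensor X Y Z) (assoc2_id_map u)"
  let ?Q = "\<lambda>u. assoc_tensor W X (Y \<boxtimes> Z) (assoc_tensor (W \<boxtimes> X) Y Z u)"
  note [simp] = linmap_tensor_simps
  \<comment> \<open>At \<hbar> = 0 the pentagon compares two ways of rebracketing, which agree on
    pure tensors.\<close>
  have eq: "?P u = ?Q u" if "u \<in> carrier N4" for u
    by (rule linmap_tensor_ext4[where f = ?P and g = ?Q, OF _ _ _ _ _ linmap_assoc_moves(3,4) _ that]) simp_all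
  note tails = comp_eq_tail[OF assoc_id_transport] comp_eq_tail[OF assoc2_id_transport]
    comp_eq_tail[OF assoc_outer_transport]
  have "(id_hmap W \<otimes>\<^sub>h assoc_hmap X Y Z) \<circ>\<^sub>h assoc_hmap W (X \<boxtimes> Y) Z \<circ>\<^sub>h (assoc_hmap W X Y \<otimes>\<^sub>h id_hmap Z)
    = const_hmap N4 ?N ?P \<circ>\<^sub>h E4 (nc_subst \<Phi> (dk_t 2 3) (dk_t 3 4)
        * nc_subst \<Phi> (dk_t 1 2 + dk_t 1 3) (dk_t 2 4 + dk_t 3 4) * nc_subst \<Phi> (dk_t 1 2) (dk_t 2 3))"
    by (simp add: assoc_hmap_def wf_comp_assoc wf_comp_tensor_id wf_id_tensor_comp const_tensor_const
        wf_const_comp_const tails series_assoc_id_eq series_hmap_mult[OF op4])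
  moreover have "assoc_hmap W X (Y \<boxtimes> Z) \<circ>\<^sub>h assoc_hmap (W \<boxtimes> X) Y Z
    = const_hmap N4 ?N ?Q \<circ>\<^sub>h E4 (nc_subst \<Phi> (dk_t 1 2) (dk_t 2 3 + dk_t 2 4) * nc_subst \<Phi> (dk_t 1 3 + dk_t 2 3) (dk_t 3 4))"
    by (simp add: assoc_hmap_def wf_comp_assoc wf_const_comp_const tails series_assoc_outer_eq
        series_hmap_mult[OF op4])
  ultimately show ?thesis
    using dk_pentagon const_hmap_cong[where X = N4 and Y = ?N, OF eq] by simp
qed

end

text \<open>Equivariance of the arrows enters here: the legs of t act through the module structures,
  so (f \<otimes> g) \<otimes> h commutes with \<open>t\<^sup>1\<^sup>2\<close> and
  \<open>t\<^sup>2\<^sup>3\<close>, hence with \<Phi>. The rebracketing is natural for arbitrary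
  series of linear maps.\<close>

lemma assoc_natural:
  assumes lm: "lmod X" "lmod X'" "lmod Y" "lmod Y'" "lmod Z" "lmod Z'"
    and f: "lin_hmap f X X'" "equivariant f X X'" and g: "lin_hmap g Y Y'" "equivariant g Y Y'"
    and h: "lin_hmap h Z Z'" "equivariant h Z Z'"
  shows "assoc_hmap X' Y' Z' \<circ>\<^sub>h ((f \<otimes>\<^sub>h g) \<otimes>\<^sub>h h) = (f \<otimes>\<^sub>h (g \<otimes>\<^sub>h h)) \<circ>\<^sub>h assoc_hmap X Y Z"
proof -
  note [simp] = lm linmap_tensor_simps
  note fg = lin_hmap_tensor[OF f(1) g(1)]
  note fgh = lin_hmap_tensor[OF fg h(1)]
  note eqv = f(2) g(2) h(2)
  have "intertwines ((f \<otimes>\<^sub>h g) \<otimes>\<^sub>h h) (t12_act t X Y Z) (t12_act t X' Y' Z')"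
    unfolding t_act_eq using eqv
    by (intro intertwines_lift_op[OF fgh] intertwines_tensor[OF fg h(1)] intertwines_tensor[OF f(1) g(1)]
        intertwines_id linmap_t_op) (auto simp: equivariant_def)
  moreover have "intertwines ((f \<otimes>\<^sub>h g) \<otimes>\<^sub>h h) (t23_act t X Y Z) (t23_act t X' Y' Z')"
    unfolding t_act_eq using eqv
    by (intro intertwines_lift_op[OF fgh] intertwines_tensor[OF fg h(1)] intertwines_tensor[OF f(1) g(1)]
        intertwines_id linmap_t_op) (auto simp: equivariant_def)
  ultimately have nat: "((f \<otimes>\<^sub>h g) \<otimes>\<^sub>h h) \<circ>\<^sub>h series_hmap ((X \<boxtimes> Y) \<boxtimes> Z) UNIV (assoc_ops X Y Z) \<Phi>
      = series_hmap ((X' \<boxtimes> Y') \<boxtimes> Z') UNIV (assoc_ops X' Y' Z') \<Phi> \<circ>\<^sub>h ((f \<otimes>\<^sub>h g) \<otimes>\<^sub>h h)"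
    by (intro series_hmap_natural[OF _ _ fgh]) (auto split: letter.split)
  have [simp]: "wf_hmap f" "wf_hmap g" "wf_hmap h" "source f = X" "source g = Y" "source h = Z"
    "target f = X'" "target g = Y'" "target h = Z'" using f(1) g(1) h(1) by (auto simp: lin_hmap_iff)
  show ?thesis
    unfolding assoc_hmap_def
    by (simp add: wf_comp_assoc flip: nat) (simp add: const_assoc_natural[OF f(1) g(1) h(1)] flip: wf_comp_assoc)
qed

lemma braid_natural:
  assumes lm: "lmod X" "lmod X'" "lmod Y" "lmod Y'"
    and f: "lin_hmap f X X'" "equivariant f X X'" and g: "lin_hmap g Y Y'" "equivariant g Y Y'"
  shows "braid_hmap X' Y' \<circ>\<^sub>h (f \<otimes>\<^sub>h g) = (g \<otimes>\<^sub>h f) \<circ>\<^sub>h braid_hmap X Y"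
proof -
  note [simp] = lm linmap_tensor_simps
  note fg = lin_hmap_tensor[OF f(1) g(1)]
  have "intertwines (f \<otimes>\<^sub>h g) (t_act t X Y) (t_act t X' Y')"
    unfolding t_act_eq using f(2) g(2)
    by (intro intertwines_lift_op[OF fg] intertwines_tensor[OF f(1) g(1)] linmap_t_op) (auto simp: equivariant_def)
  then have nat: "(f \<otimes>\<^sub>h g) \<circ>\<^sub>h series_hmap (X \<boxtimes> Y) UNIV (\<lambda>_ :: unit. t_act t X Y) half_exp
      = series_hmap (X' \<boxtimes> Y') UNIV (\<lambda>_ :: unit. t_act t X' Y') half_exp \<circ>\<^sub>h (f \<otimes>\<^sub>h g)"
    by (intro series_hmap_natural[OF _ _ fg]) auto
  have [simp]: "wf_hmap f" "wf_hmap g" "source f = X" "source g = Y"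
    "target f = X'" "target g = Y'" using f(1) g(1) by (auto simp: lin_hmap_iff)
  show ?thesis
    unfolding braid_hmap_def
    by (simp add: wf_comp_assoc flip: nat) (simp add: const_flip_natural[OF f(1) g(1)] flip: wf_comp_assoc)
qed

text \<open>In both \<open>t\<^sup>1\<^sup>2\<close> and \<open>t\<^sup>2\<^sup>3\<close> one leg
  falls on the trivial module, where every element acts by zero.\<close>

lemma t_act_trivial:
  fixes X Y :: "('l, 'b) umod"
  assumes X: "lmod X" and Y: "lmod Y" and u: "u \<in> carrier ((X \<boxtimes> trivial_module) \<boxtimes> Y)"
  shows "assoc_ops X trivial_module Y i u = \<zero>\<^bsub>(X \<boxtimes> trivial_module) \<boxtimes> Y\<^esub>"
proof -
  have I: "lmod trivial_module" using lie by (rule lie_module_trivial)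
  have zero: "act trivial_module a c = \<zero>\<^bsub>trivial_module :: ('l, 'b) umod\<^esub>" for a and c :: "'b tuniv"
    by (simp add: trivial_module_def)
  note [simp] = X Y I linmap_tensor_simps
  let ?M = "(X \<boxtimes> trivial_module) \<boxtimes> Y"
  have zero_elem: "elem_tensor (X \<boxtimes> trivial_module) Y (elem_tensor X trivial_module x \<zero>\<^bsub>trivial_module :: ('l, 'b) umod\<^esub>) y = \<zero>\<^bsub>?M\<^esub>"
    if "x \<in> carrier X" "y \<in> carrier Y" for x y
    using that by simp
  have "t12_op X trivial_module Y a b u = \<zero>\<^bsub>?M\<^esub>" "t23_op X trivial_module Y a b u = \<zero>\<^bsub>?M\<^esub>"
    if ab: "a \<in> carrier L" "b \<in> carrier L" for a b
    by (rule linmap_tensor_ext3[where f = "t12_op X trivial_module Y a b" and g = "\<lambda>u. \<zero>\<^bsub>?M\<^esub>", OF _ _ _ _ _ linmap_zero_map _ u]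
        linmap_tensor_ext3[where f = "t23_op X trivial_module Y a b" and g = "\<lambda>u. \<zero>\<^bsub>?M\<^esub>", OF _ _ _ _ _ linmap_zero_map _ u];
        use ab in \<open>simp add: zero zero_elem\<close>)+
  then show ?thesis
    by (cases i) (auto simp: t12_act_def t23_act_def intro!: tensor_lift_zero[OF t_formal])
qed

lemma unitors:
  fixes X :: "('l, 'b) umod"
  assumes X: "lmod X"
  shows "linmap (trivial_module \<boxtimes> X) X (module_lift trivial_module X X (\<lambda>c x. scalar c \<odot>\<^bsub>X\<^esub> x))"
    "linmap (X \<boxtimes> trivial_module) X (module_lift X trivial_module X (\<lambda>x c. scalar c \<odot>\<^bsub>X\<^esub> x))"
    "\<lbrakk>c \<in> carrier (trivial_module :: ('l, 'b) umod); x \<in> carrier X\<rbrakk> \<Longrightarrow>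
      module_lift trivial_module X X (\<lambda>c x. scalar c \<odot>\<^bsub>X\<^esub> x) (elem_tensor trivial_module X c x) = scalar c \<odot>\<^bsub>X\<^esub> x"
    "\<lbrakk>c \<in> carrier (trivial_module :: ('l, 'b) umod); x \<in> carrier X\<rbrakk> \<Longrightarrow>
      module_lift X trivial_module X (\<lambda>x c. scalar c \<odot>\<^bsub>X\<^esub> x) (elem_tensor X trivial_module x c) = scalar c \<odot>\<^bsub>X\<^esub> x"
proof -
  have [simp]: "cvs X" using X by simp
  have "bilin (trivial_module :: ('l, 'b) umod) X X (\<lambda>c x. scalar c \<odot>\<^bsub>X\<^esub> x)" "bilin X (trivial_module :: ('l, 'b) umod) X (\<lambda>x c. scalar c \<odot>\<^bsub>X\<^esub> x)"
    by (auto intro!: bilinI linmap_scale linmap_id linmapI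
        simp: trivial_module_def cvs_smult_add_left cvs_smult_smult)
  then show "linmap (trivial_module \<boxtimes> X) X (module_lift trivial_module X X (\<lambda>c x. scalar c \<odot>\<^bsub>X\<^esub> x))"
    "linmap (X \<boxtimes> trivial_module) X (module_lift X trivial_module X (\<lambda>x c. scalar c \<odot>\<^bsub>X\<^esub> x))"
    "\<lbrakk>c \<in> carrier (trivial_module :: ('l, 'b) umod); x \<in> carrier X\<rbrakk> \<Longrightarrow>
      module_lift trivial_module X X (\<lambda>c x. scalar c \<odot>\<^bsub>X\<^esub> x) (elem_tensor trivial_module X c x) = scalar c \<odot>\<^bsub>X\<^esub> x"
    "\<lbrakk>c \<in> carrier (trivial_module :: ('l, 'b) umod); x \<in> carrier X\<rbrakk> \<Longrightarrow>
      module_lift X trivial_module X (\<lambda>x c. scalar c \<odot>\<^bsub>X\<^esub> x) (elem_tensor X trivial_module x c) = scalar c \<odot>\<^bsub>X\<^esub> x"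
    using module_lift_elem[of "trivial_module :: ('l, 'b) umod" X X "\<lambda>c x. scalar c \<odot>\<^bsub>X\<^esub> x" c x]
      module_lift_elem[of X "trivial_module :: ('l, 'b) umod" X "\<lambda>x c. scalar c \<odot>\<^bsub>X\<^esub> x" x c]
    by (auto intro: linmap_module_lift)
qed

lemma category_simps:
  "X \<in> obj \<D> \<longleftrightarrow> lmod X" "ident \<D> X = id_hmap X" "comp_arr \<D> g f = g \<circ>\<^sub>h f"
  "tens_obj \<D> X Y = X \<boxtimes> Y" "tens_arr \<D> f g = f \<otimes>\<^sub>h g" "unit_obj \<D> = trivial_module"
  "left_unitor \<D> X = const_hmap (trivial_module \<boxtimes> X) X (module_lift trivial_module X X (\<lambda>c x. scalar c \<odot>\<^bsub>X\<^esub> x))"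
  "right_unitor \<D> X = const_hmap (X \<boxtimes> trivial_module) X (module_lift X trivial_module X (\<lambda>x c. scalar c \<odot>\<^bsub>X\<^esub> x))"
  by (simp_all add: drinfeld_category_def)

lemma inverse_arrows_iff:
  assumes "lmod X" "lmod Y"
  shows "inverse_arrows \<D> X Y f g \<longleftrightarrow> lin_hmap f X Y \<and> equivariant f X Y \<and> lin_hmap g Y X \<and> equivariant g Y X
    \<and> g \<circ>\<^sub>h f = id_hmap X \<and> f \<circ>\<^sub>h g = id_hmap Y"
  using assms by (auto simp: inverse_arrows_def hom_iff category_simps)

text \<open>Inverses are unique, so exhibiting one determines the definite description that occurs
  in the second hexagon.\<close>

lemma arrow_inverse_eq:
  assumes "lmod X" "lmod Y" and inv: "inverse_arrows \<D> X Y f g"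
  shows "arrow_inverse \<D> X Y f = g"
  unfolding arrow_inverse_def
proof (rule the_equality[where P = "inverse_arrows \<D> X Y f", OF inv])
  fix g' assume inv': "inverse_arrows \<D> X Y f g'"
  note D = inv[unfolded inverse_arrows_iff[OF assms(1,2)]] inv'[unfolded inverse_arrows_iff[OF assms(1,2)]]
  have "g' = g' \<circ>\<^sub>h (f \<circ>\<^sub>h g)" using D comp_id_hmap[of g' Y X] by simp
  also have "\<dots> = (g' \<circ>\<^sub>h f) \<circ>\<^sub>h g" using D comp_hmap_assoc[of g Y X f Y g' X] by simp
  also have "\<dots> = g" using D id_comp_hmap[of g Y X] by simp
  finally show "g' = g" .
qed

lemma assoc_inverse_arrows:
  assumes [simp]: "lmod X" "lmod Y" "lmod Z"
  shows "inverse_arrows \<D> ((X \<boxtimes> Y) \<boxtimes> Z) (X \<boxtimes> (Y \<boxtimes> Z)) (assoc_hmap X Y Z) (assoc_inv_hmap X Y Z)"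
proof -
  let ?M = "(X \<boxtimes> Y) \<boxtimes> Z" and ?N = "X \<boxtimes> (Y \<boxtimes> Z)"
  let ?A = "const_hmap ?M ?N (assoc_tensor X Y Z)" and ?B = "const_hmap ?N ?M (assoc_tensor_inv X Y Z)"
  let ?S = "series_hmap ?M UNIV (assoc_ops X Y Z)"
  note [simp] = linmap_tensor_simps
  have AB: "?A \<circ>\<^sub>h ?B = id_hmap ?N"
    by (simp add: const_comp_const) (rule const_hmap_cong, simp add: assoc_tensor_inverse)
  have BA: "?B \<circ>\<^sub>h ?A = id_hmap ?M"
    by (simp add: const_comp_const) (rule const_hmap_cong, simp add: assoc_tensor_inverse)
  have S: "?S \<Phi> \<circ>\<^sub>h ?S (nc_inverse \<Phi>) = id_hmap ?M" "?S (nc_inverse \<Phi>) \<circ>\<^sub>h ?S \<Phi> = id_hmap ?M"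
    by (simp_all add: nc_inverse[OF \<Phi>_Nil] series_hmap_one flip: series_hmap_mult)
  have tails: "?B \<circ>\<^sub>h (?A \<circ>\<^sub>h x) = x" "?S \<Phi> \<circ>\<^sub>h (?S (nc_inverse \<Phi>) \<circ>\<^sub>h x) = x"
    if "wf_hmap x" "target x = ?M" for x
    using that by (simp_all add: BA S wf_id_comp flip: wf_comp_assoc)
  have eqA: "equivariant ?A ?M ?N" by (intro equivariant_const) (simp_all add: act_assoc)
  have eqB: "equivariant ?B ?N ?M"
  proof (intro equivariant_const)
    fix a v assume a: "a \<in> carrier L" and v: "v \<in> carrier ?N"
    note c = linmap_closed[OF linmap_assoc_tensor_inv]
    \<comment> \<open>The inverse is equivariant because the map is: the two sides agree after
      applying the rebracketing, which is then undone.\<close>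
    have "assoc_tensor X Y Z (act ?M a (assoc_tensor_inv X Y Z v)) = act ?N a v"
      using a v by (simp add: act_assoc c assoc_tensor_inverse)
    from arg_cong[OF this, of "assoc_tensor_inv X Y Z"]
    show "assoc_tensor_inv X Y Z (act ?N a v) = act ?M a (assoc_tensor_inv X Y Z v)"
      using a v by (simp add: c assoc_tensor_inverse)
  qed simp_all
  have eqS: "equivariant (?S F) ?M ?M" for F
    by (intro equivariant_series) (auto simp: t12_act_equivariant t23_act_equivariant split: letter.split)
  have "equivariant (assoc_hmap X Y Z) ?M ?N" "equivariant (assoc_inv_hmap X Y Z) ?N ?M"
    unfolding assoc_hmap_def assoc_inv_hmap_def
    by (rule equivariant_comp[OF _ _ _ _ _ eqS eqA] equivariant_comp[OF _ _ _ _ _ eqB eqS]; simp add: lin_hmap_iff)+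
  then show ?thesis
    by (simp add: inverse_arrows_iff lin_hmap_iff)
      (simp add: assoc_hmap_def assoc_inv_hmap_def wf_comp_assoc tails S AB)
qed

lemma braid_inverse_arrows:
  assumes [simp]: "lmod X" "lmod Y"
  shows "inverse_arrows \<D> (X \<boxtimes> Y) (Y \<boxtimes> X) (braid_hmap X Y) (braid_inv_hmap X Y)"
proof -
  let ?A = "const_hmap (X \<boxtimes> Y) (Y \<boxtimes> X) (flip_tensor X Y)" and ?B = "const_hmap (Y \<boxtimes> X) (X \<boxtimes> Y) (flip_tensor Y X)"
  let ?S = "series_hmap (X \<boxtimes> Y) UNIV (\<lambda>_ :: unit. t_act t X Y)"
  note [simp] = linmap_tensor_simps
  have AB: "?A \<circ>\<^sub>h ?B = id_hmap (Y \<boxtimes> X)"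
    by (simp add: const_comp_const) (rule const_hmap_cong, simp add: flip_flip)
  have BA: "?B \<circ>\<^sub>h ?A = id_hmap (X \<boxtimes> Y)"
    by (simp add: const_comp_const) (rule const_hmap_cong, simp add: flip_flip)
  have S: "?S half_exp \<circ>\<^sub>h ?S (nc_inverse half_exp) = id_hmap (X \<boxtimes> Y)"
    "?S (nc_inverse half_exp) \<circ>\<^sub>h ?S half_exp = id_hmap (X \<boxtimes> Y)"
    by (simp_all add: nc_inverse[OF half_exp_Nil] series_hmap_one flip: series_hmap_mult)
  have tails: "?B \<circ>\<^sub>h (?A \<circ>\<^sub>h x) = x" "?S half_exp \<circ>\<^sub>h (?S (nc_inverse half_exp) \<circ>\<^sub>h x) = x"
    if "wf_hmap x" "target x = X \<boxtimes> Y" for x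
    using that by (simp_all add: BA S wf_id_comp flip: wf_comp_assoc)
  \<comment> \<open>Formulated for an arbitrary pair of modules, as both orders of \<open>X\<close>
    and \<open>Y\<close> occur.\<close>
  have flip: "flip_tensor V V' (act (V \<boxtimes> V') a u) = act (V' \<boxtimes> V) a (flip_tensor V V' u)"
    if [simp]: "lmod V" "lmod V'" "a \<in> carrier L" and u: "u \<in> carrier (V \<boxtimes> V')" for V V' :: "('l, 'b) umod" and a u
    by (rule linmap_tensor_ext[where f = "\<lambda>u. flip_tensor V V' (act (V \<boxtimes> V') a u)"
          and g = "\<lambda>u. act (V' \<boxtimes> V) a (flip_tensor V V' u)", OF _ _ _ _ u])
      (auto simp: tensor_calc intro!: linmap_op_rules linmap_comp[OF lmod_rules(2)] cvs_add_comm)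
  have eqA: "equivariant ?A (X \<boxtimes> Y) (Y \<boxtimes> X)" and eqB: "equivariant ?B (Y \<boxtimes> X) (X \<boxtimes> Y)"
    by (intro equivariant_const; simp add: flip)+
  have eqS: "equivariant (?S F) (X \<boxtimes> Y) (X \<boxtimes> Y)" for F
    by (intro equivariant_series) (auto simp: t_act_equivariant)
  have "equivariant (braid_hmap X Y) (X \<boxtimes> Y) (Y \<boxtimes> X)" "equivariant (braid_inv_hmap X Y) (Y \<boxtimes> X) (X \<boxtimes> Y)"
    unfolding braid_hmap_def braid_inv_hmap_def
    by (rule equivariant_comp[OF _ _ _ _ _ eqS eqA] equivariant_comp[OF _ _ _ _ _ eqB eqS]; simp add: lin_hmap_iff)+
  then show ?thesis
    by (simp add: inverse_arrows_iff lin_hmap_iff)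
      (simp add: braid_hmap_def braid_inv_hmap_def wf_comp_assoc tails S AB)
qed

text \<open>Every element of the unit object is a multiple of \<open>Scalar 1\<close>, and the
  multiple can be moved across the tensor sign; hence inserting 1 inverts the unitor.\<close>

lemma unitor_inverse_arrows:
  fixes X :: "('l, 'b) umod"
  assumes [simp]: "lmod X"
  shows "inverse_arrows \<D> (trivial_module \<boxtimes> X) X (left_unitor \<D> X)
      (const_hmap X (trivial_module \<boxtimes> X) (elem_tensor trivial_module X (Scalar 1)))"
    and "inverse_arrows \<D> (X \<boxtimes> trivial_module) X (right_unitor \<D> X)
      (const_hmap X (X \<boxtimes> trivial_module) (\<lambda>x. elem_tensor X trivial_module x (Scalar 1)))"
proof -
  let ?I = "trivial_module :: ('l, 'b) umod"
  have I [simp]: "lmod ?I" using lie by (rule lie_module_trivial)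
  have one [simp]: "Scalar 1 \<in> carrier ?I" by (simp add: trivial_module_def)
  have act [simp]: "act ?I a c = \<zero>\<^bsub>?I\<^esub>" for a c by (simp add: trivial_module_def)
  have c: "c = scalar c \<odot>\<^bsub>?I\<^esub> Scalar 1" if "c \<in> carrier ?I" for c
    using that by (auto simp: trivial_module_def)
  note l = unitors[OF assms]
  note [simp] = l(3,4) linmap_elem_left linmap_elem_right linmap_id
  let ?l = "module_lift ?I X X (\<lambda>c x. scalar c \<odot>\<^bsub>X\<^esub> x)" and ?r = "module_lift X ?I X (\<lambda>x c. scalar c \<odot>\<^bsub>X\<^esub> x)"
  have scal: "elem_tensor ?I X (Scalar 1) (scalar c \<odot>\<^bsub>X\<^esub> x) = elem_tensor ?I X c x"
    "elem_tensor X ?I (scalar c \<odot>\<^bsub>X\<^esub> x) (Scalar 1) = elem_tensor X ?I x c"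
    if "c \<in> carrier ?I" "x \<in> carrier X" for c x
  proof -
    have "elem_tensor ?I X c x = elem_tensor ?I X (scalar c \<odot>\<^bsub>?I\<^esub> Scalar 1) x"
      "elem_tensor X ?I x c = elem_tensor X ?I x (scalar c \<odot>\<^bsub>?I\<^esub> Scalar 1)" using c[OF that(1)] by simp_all
    then show "elem_tensor ?I X (Scalar 1) (scalar c \<odot>\<^bsub>X\<^esub> x) = elem_tensor ?I X c x"
      "elem_tensor X ?I (scalar c \<odot>\<^bsub>X\<^esub> x) (Scalar 1) = elem_tensor X ?I x c"
      using that by (simp_all add: linmap_smult[OF linmap_elem_left] linmap_smult[OF linmap_elem_right])
  qed
  have inv: "elem_tensor ?I X (Scalar 1) (?l u) = u" if u: "u \<in> carrier (?I \<boxtimes> X)" for u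
    by (rule linmap_tensor_ext[where f = "\<lambda>u. elem_tensor ?I X (Scalar 1) (?l u)" and g = "\<lambda>u. u", OF _ _ _ _ u])
      (auto simp: scal intro!: linmap_comp[OF linmap_elem_right l(1)] linmap_id)
  have inv': "elem_tensor X ?I (?r u) (Scalar 1) = u" if u: "u \<in> carrier (X \<boxtimes> ?I)" for u
    by (rule linmap_tensor_ext[where f = "\<lambda>u. elem_tensor X ?I (?r u) (Scalar 1)" and g = "\<lambda>u. u", OF _ _ _ _ u])
      (auto simp: scal intro!: linmap_comp[OF linmap_elem_left l(2)] linmap_id)
  have eq: "?l (act (?I \<boxtimes> X) a u) = act X a (?l u)" if [simp]: "a \<in> carrier L" and u: "u \<in> carrier (?I \<boxtimes> X)" for a u
    by (rule linmap_tensor_ext[where f = "\<lambda>u. ?l (act (?I \<boxtimes> X) a u)" and g = "\<lambda>u. act X a (?l u)", OF _ _ _ _ u])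
      (auto simp: act_elem linmap_add[OF l(1)] linmap_smult[OF lmod_rules(2)]
        intro!: linmap_comp[OF l(1)] linmap_comp[OF lmod_rules(2)] l)
  have eq': "?r (act (X \<boxtimes> ?I) a u) = act X a (?r u)" if [simp]: "a \<in> carrier L" and u: "u \<in> carrier (X \<boxtimes> ?I)" for a u
    by (rule linmap_tensor_ext[where f = "\<lambda>u. ?r (act (X \<boxtimes> ?I) a u)" and g = "\<lambda>u. act X a (?r u)", OF _ _ _ _ u])
      (auto simp: act_elem linmap_add[OF l(2)] linmap_smult[OF lmod_rules(2)]
        intro!: linmap_comp[OF l(2)] linmap_comp[OF lmod_rules(2)] l)
  show "inverse_arrows \<D> (?I \<boxtimes> X) X (left_unitor \<D> X) (const_hmap X (?I \<boxtimes> X) (elem_tensor ?I X (Scalar 1)))"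
    by (auto simp: inverse_arrows_iff category_simps lin_hmap_iff l const_comp_const inv act_elem eq
        intro!: equivariant_const const_hmap_cong)
  show "inverse_arrows \<D> (X \<boxtimes> ?I) X (right_unitor \<D> X) (const_hmap X (X \<boxtimes> ?I) (\<lambda>x. elem_tensor X ?I x (Scalar 1)))"
    by (auto simp: inverse_arrows_iff category_simps lin_hmap_iff l const_comp_const inv' act_elem eq'
        intro!: equivariant_const const_hmap_cong)
qed

lemma unitor_natural:
  fixes X X' :: "('l, 'b) umod"
  assumes [simp]: "lmod X" "lmod X'" and f: "lin_hmap f X X'"
  shows "left_unitor \<D> X' \<circ>\<^sub>h (id_hmap trivial_module \<otimes>\<^sub>h f) = f \<circ>\<^sub>h left_unitor \<D> X"
    and "right_unitor \<D> X' \<circ>\<^sub>h (f \<otimes>\<^sub>h id_hmap trivial_module) = f \<circ>\<^sub>h right_unitor \<D> X"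
proof -
  let ?I = "trivial_module :: ('l, 'b) umod"
  have I [simp]: "lmod ?I" using lie by (rule lie_module_trivial)
  note l = unitors[OF assms(1)] and l' = unitors[OF assms(2)]
  note D = lin_hmapD[OF f]
  have idf: "lin_hmap (id_hmap ?I \<otimes>\<^sub>h f) (?I \<boxtimes> X) (?I \<boxtimes> X')" "lin_hmap (f \<otimes>\<^sub>h id_hmap ?I) (X \<boxtimes> ?I) (X' \<boxtimes> ?I)"
    using f by auto
  show "left_unitor \<D> X' \<circ>\<^sub>h (id_hmap ?I \<otimes>\<^sub>h f) = f \<circ>\<^sub>h left_unitor \<D> X"
  proof (rule hmap_tensor_eqI[of _ ?I X X'])
    show "lin_hmap (left_unitor \<D> X' \<circ>\<^sub>h (id_hmap ?I \<otimes>\<^sub>h f)) (?I \<boxtimes> X) X'"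
      "lin_hmap (f \<circ>\<^sub>h left_unitor \<D> X) (?I \<boxtimes> X) X'"
      using l l' by (auto simp: category_simps intro!: lin_hmap_comp[OF idf(1)] lin_hmap_comp[OF _ f])
    fix n c x assume cx: "c \<in> carrier ?I" "x \<in> carrier X"
    then show "terms (left_unitor \<D> X' \<circ>\<^sub>h (id_hmap ?I \<otimes>\<^sub>h f)) n (elem_tensor ?I X c x)
        = terms (f \<circ>\<^sub>h left_unitor \<D> X) n (elem_tensor ?I X c x)"
      using D by (simp add: category_simps terms_const_comp[OF idf(1) l'(1)] terms_comp_const[OF f l(1)]
          terms_const_tensor[OF linmap_id f] l l' linmap_smult[OF D(5)])
  qed
  show "right_unitor \<D> X' \<circ>\<^sub>h (f \<otimes>\<^sub>h id_hmap ?I) = f \<circ>\<^sub>h right_unitor \<D> X"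
  proof (rule hmap_tensor_eqI[of _ X ?I X'])
    show "lin_hmap (right_unitor \<D> X' \<circ>\<^sub>h (f \<otimes>\<^sub>h id_hmap ?I)) (X \<boxtimes> ?I) X'"
      "lin_hmap (f \<circ>\<^sub>h right_unitor \<D> X) (X \<boxtimes> ?I) X'"
      using l l' by (auto simp: category_simps intro!: lin_hmap_comp[OF idf(2)] lin_hmap_comp[OF _ f])
    fix n x c assume cx: "x \<in> carrier X" "c \<in> carrier ?I"
    then show "terms (right_unitor \<D> X' \<circ>\<^sub>h (f \<otimes>\<^sub>h id_hmap ?I)) n (elem_tensor X ?I x c)
        = terms (f \<circ>\<^sub>h right_unitor \<D> X) n (elem_tensor X ?I x c)"
      using D by (simp add: category_simps terms_const_comp[OF idf(2) l'(2)] terms_comp_const[OF f l(2)]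
          terms_tensor_const[OF f linmap_id] l l' linmap_smult[OF D(5)])
  qed
qed

text \<open>t acts by zero when the unit stands in the middle, so \<Phi> contributes its constant
  term 1 only, and the triangle of ordinary vector spaces is left.\<close>

lemma triangle_hmap:
  fixes X Y :: "('l, 'b) umod"
  assumes [simp]: "lmod X" "lmod Y"
  shows "(id_hmap X \<otimes>\<^sub>h left_unitor \<D> Y) \<circ>\<^sub>h assoc_hmap X trivial_module Y = right_unitor \<D> X \<otimes>\<^sub>h id_hmap Y"
proof -
  let ?I = "trivial_module :: ('l, 'b) umod" and ?M = "(X \<boxtimes> trivial_module) \<boxtimes> Y"
  have I [simp]: "lmod ?I" using lie by (rule lie_module_trivial)
  note l = unitors[OF assms(2)] and r = unitors[OF assms(1)]
  let ?l = "module_lift ?I Y Y (\<lambda>c x. scalar c \<odot>\<^bsub>Y\<^esub> x)" and ?r = "module_lift X ?I X (\<lambda>x c. scalar c \<odot>\<^bsub>X\<^esub> x)"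
  note [simp] = linmap_tensor_simps l r
  have eq: "map_tensor X (?I \<boxtimes> Y) X Y (\<lambda>x. x) ?l (assoc_tensor X ?I Y u) = map_tensor (X \<boxtimes> ?I) Y X Y ?r (\<lambda>y. y) u"
    if u: "u \<in> carrier ?M" for u
  proof (rule linmap_tensor_ext3[where f = "\<lambda>u. map_tensor X (?I \<boxtimes> Y) X Y (\<lambda>x. x) ?l (assoc_tensor X ?I Y u)"
        and g = "map_tensor (X \<boxtimes> ?I) Y X Y ?r (\<lambda>y. y)", OF _ _ _ _ _ _ _ u])
    fix x c y assume "x \<in> carrier X" "c \<in> carrier ?I" "y \<in> carrier Y"
    then show "map_tensor X (?I \<boxtimes> Y) X Y (\<lambda>x. x) ?l (assoc_tensor X ?I Y (elem_tensor (X \<boxtimes> ?I) Y (elem_tensor X ?I x c) y))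
        = map_tensor (X \<boxtimes> ?I) Y X Y ?r (\<lambda>y. y) (elem_tensor (X \<boxtimes> ?I) Y (elem_tensor X ?I x c) y)"
      by (simp add: linmap_smult[OF linmap_elem_left] linmap_smult[OF linmap_elem_right])
  qed (auto intro!: linmap_op_rules)
  have "series_hmap ?M UNIV (assoc_ops X ?I Y) \<Phi> = id_hmap ?M"
    by (rule series_hmap_zero) (simp_all add: \<Phi>_Nil t_act_trivial)
  then show ?thesis
    by (simp add: assoc_hmap_def wf_id_comp category_simps const_tensor_const const_comp_const)
      (rule const_hmap_cong, rule eq)
qed

lemma equivariant_id: "lmod X \<Longrightarrow> equivariant (id_hmap X) X X"
  by (rule equivariant_const) auto

theorem drinfeld_category_braided_monoidal:
  "braided_monoidal_category (drinfeld_category \<Phi> L t :: (('l, 'b) umod, ('l, 'b) hmap) bmcat)"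
proof -
  have I [simp]: "lmod trivial_module" using lie by (rule lie_module_trivial)
  have isoI: "f \<in> iso_arrows \<D> X Y" if "inverse_arrows \<D> X Y f g" for f g :: "('l, 'b) hmap" and X Y
    using that by (auto simp: iso_arrows_def)
  have inv: "arrow_inverse \<D> ((X \<boxtimes> Y) \<boxtimes> Z) (X \<boxtimes> Y \<boxtimes> Z) (assoc_hmap X Y Z) = assoc_inv_hmap X Y Z"
    if "lmod X" "lmod Y" "lmod Z" for X Y Z :: "('l, 'b) umod"
    using that by (intro arrow_inverse_eq assoc_inverse_arrows) auto
  note S = category_simps(1-6) hom_iff associator_eq braiding_eq
  show ?thesis
  proof
    fix X Y Z :: "('l, 'b) umod" and f g assume "X \<in> obj \<D>" "Y \<in> obj \<D>" "Z \<in> obj \<D>" "f \<in> Hom\<^bsub>\<D>\<^esub> X Y" "g \<in> Hom\<^bsub>\<D>\<^esub> Y Z"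
    then show "g \<cdot>\<^bsub>\<D>\<^esub> f \<in> Hom\<^bsub>\<D>\<^esub> X Z"
      by (auto simp: S intro!: equivariant_comp[of X Y Z] lin_hmap_comp[of f X Y])
  next
    fix W X Y Z :: "('l, 'b) umod" and f g h
    assume "W \<in> obj \<D>" "X \<in> obj \<D>" "Y \<in> obj \<D>" "Z \<in> obj \<D>" "f \<in> Hom\<^bsub>\<D>\<^esub> W X" "g \<in> Hom\<^bsub>\<D>\<^esub> X Y" "h \<in> Hom\<^bsub>\<D>\<^esub> Y Z"
    then show "h \<cdot>\<^bsub>\<D>\<^esub> g \<cdot>\<^bsub>\<D>\<^esub> f = h \<cdot>\<^bsub>\<D>\<^esub> (g \<cdot>\<^bsub>\<D>\<^esub> f)"
      by (auto simp: S comp_hmap_assoc[of f W X g Y h Z])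
  next
    fix X X' Y Y' :: "('l, 'b) umod" and f g
    assume "X \<in> obj \<D>" "X' \<in> obj \<D>" "Y \<in> obj \<D>" "Y' \<in> obj \<D>" "f \<in> Hom\<^bsub>\<D>\<^esub> X X'" "g \<in> Hom\<^bsub>\<D>\<^esub> Y Y'"
    then show "f \<odot>\<^sub>a\<^bsub>\<D>\<^esub> g \<in> Hom\<^bsub>\<D>\<^esub> (X \<odot>\<^sub>o\<^bsub>\<D>\<^esub> Y) (X' \<odot>\<^sub>o\<^bsub>\<D>\<^esub> Y')"
      and "\<b>\<^bsub>\<D>\<^esub> X' Y' \<cdot>\<^bsub>\<D>\<^esub> (f \<odot>\<^sub>a\<^bsub>\<D>\<^esub> g) = (g \<odot>\<^sub>a\<^bsub>\<D>\<^esub> f) \<cdot>\<^bsub>\<D>\<^esub> \<b>\<^bsub>\<D>\<^esub> X Y"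
      by (auto simp: S intro!: equivariant_tensor lin_hmap_tensor braid_natural)
  next
    fix X X' X'' Y Y' Y'' :: "('l, 'b) umod" and f f' g g'
    assume "X \<in> obj \<D>" "X' \<in> obj \<D>" "X'' \<in> obj \<D>" "Y \<in> obj \<D>" "Y' \<in> obj \<D>" "Y'' \<in> obj \<D>"
      "f \<in> Hom\<^bsub>\<D>\<^esub> X X'" "f' \<in> Hom\<^bsub>\<D>\<^esub> X' X''" "g \<in> Hom\<^bsub>\<D>\<^esub> Y Y'" "g' \<in> Hom\<^bsub>\<D>\<^esub> Y' Y''"
    then show "(f' \<cdot>\<^bsub>\<D>\<^esub> f) \<odot>\<^sub>a\<^bsub>\<D>\<^esub> (g' \<cdot>\<^bsub>\<D>\<^esub> g) = (f' \<odot>\<^sub>a\<^bsub>\<D>\<^esub> g') \<cdot>\<^bsub>\<D>\<^esub> (f \<odot>\<^sub>a\<^bsub>\<D>\<^esub> g)"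
      by (auto simp: S comp_tensor_comp[of f X X' f' X'' g Y Y' g' Y''])
  next
    fix X X' Y Y' Z Z' :: "('l, 'b) umod" and f g h
    assume "X \<in> obj \<D>" "X' \<in> obj \<D>" "Y \<in> obj \<D>" "Y' \<in> obj \<D>" "Z \<in> obj \<D>" "Z' \<in> obj \<D>"
      "f \<in> Hom\<^bsub>\<D>\<^esub> X X'" "g \<in> Hom\<^bsub>\<D>\<^esub> Y Y'" "h \<in> Hom\<^bsub>\<D>\<^esub> Z Z'"
    then show "\<a>\<^bsub>\<D>\<^esub> X' Y' Z' \<cdot>\<^bsub>\<D>\<^esub> ((f \<odot>\<^sub>a\<^bsub>\<D>\<^esub> g) \<odot>\<^sub>a\<^bsub>\<D>\<^esub> h) = (f \<odot>\<^sub>a\<^bsub>\<D>\<^esub> g \<odot>\<^sub>a\<^bsub>\<D>\<^esub> h) \<cdot>\<^bsub>\<D>\<^esub> \<a>\<^bsub>\<D>\<^esub> X Y Z"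
      by (auto simp: S intro!: assoc_natural)
  qed (auto simp: S inv equivariant_id id_tensor_id pentagon_hmap triangle_hmap hexagon_left_hmap hexagon_right_hmap
      unitor_natural
      intro: isoI[OF assoc_inverse_arrows] isoI[OF braid_inverse_arrows] isoI[OF unitor_inverse_arrows(1)]
        isoI[OF unitor_inverse_arrows(2)])
qed

end

section \<open>Direct sums of Lie algebras\<close>

lemma lie_sum_simps:
  "carrier (lie_sum G H) = carrier G \<times> carrier H" "\<zero>\<^bsub>lie_sum G H\<^esub> = (\<zero>\<^bsub>G\<^esub>, \<zero>\<^bsub>H\<^esub>)"
  "(x, y) \<oplus>\<^bsub>lie_sum G H\<^esub> (x', y') = (x \<oplus>\<^bsub>G\<^esub> x', y \<oplus>\<^bsub>H\<^esub> y')"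
  "a \<odot>\<^bsub>lie_sum G H\<^esub> (x, y) = (a \<odot>\<^bsub>G\<^esub> x, a \<odot>\<^bsub>H\<^esub> y)"
  "\<lbrakk>(x, y), (x', y')\<rbrakk>\<^bsub>lie_sum G H\<^esub> = (\<lbrakk>x, x'\<rbrakk>\<^bsub>G\<^esub>, \<lbrakk>y, y'\<rbrakk>\<^bsub>H\<^esub>)"
  by (simp_all add: lie_sum_def)

lemma lie_algebra_lie_sum:
  assumes G: "lie_algebra G" and H: "lie_algebra H"
  shows "lie_algebra (lie_sum G H)"
proof -
  note [simp] = lie_algebra_cvs[OF G] lie_algebra_cvs[OF H]
  interpret G: lie_algebra G by fact
  interpret H: lie_algebra H by fact
  show ?thesis
  proof (intro lie_algebra.intro lie_algebra_axioms.intro)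
    show "cvs (lie_sum G H)"
      by (rule cvsI) (auto simp: lie_sum_simps cvs_add_assoc cvs_smult_add_left cvs_smult_add cvs_smult_smult
          cvs_add_comm[of G] cvs_add_comm[of H])
  qed (auto simp: lie_sum_simps G.bracket_closed H.bracket_closed G.bracket_add_left H.bracket_add_left
      G.bracket_add_right H.bracket_add_right G.bracket_smult_left H.bracket_smult_left
      G.bracket_smult_right H.bracket_smult_right G.bracket_self H.bracket_self G.jacobi H.jacobi)
qed

lemma lie_bracket_zero:
  assumes "lie_algebra L" "x \<in> carrier L"
  shows "\<lbrakk>x, \<zero>\<^bsub>L\<^esub>\<rbrakk>\<^bsub>L\<^esub> = \<zero>\<^bsub>L\<^esub>" "\<lbrakk>\<zero>\<^bsub>L\<^esub>, x\<rbrakk>\<^bsub>L\<^esub> = \<zero>\<^bsub>L\<^esub>"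
proof -
  interpret lie_algebra L by fact
  note c = lie_algebra_cvs[OF assms(1)]
  show "\<lbrakk>x, \<zero>\<^bsub>L\<^esub>\<rbrakk>\<^bsub>L\<^esub> = \<zero>\<^bsub>L\<^esub>" "\<lbrakk>\<zero>\<^bsub>L\<^esub>, x\<rbrakk>\<^bsub>L\<^esub> = \<zero>\<^bsub>L\<^esub>"
    using bracket_smult_right[of x "\<zero>\<^bsub>L\<^esub>" 0] bracket_smult_left[of "\<zero>\<^bsub>L\<^esub>" x 0] c assms(2) bracket_closed
    by simp_all
qed

lemma bilin_pure_maps:
  assumes "cvs V" "cvs W" "linmap V' V f" "linmap W' W g"
  shows "bilin V' W' (tensor V W) (\<lambda>x y. pure_tensor V W (f x) (g y))"
  using assms
  by (intro bilinI linmap_comp[OF bilinD(1)[OF bilin_pure_tensor]] linmap_comp[OF bilinD(2)[OF bilin_pure_tensor]])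
    (auto simp: linmap_closed)

lemma linmap_tensor_map:
  assumes "cvs V" "cvs W" "cvs V'" "cvs W'" "linmap V' V f" "linmap W' W g"
  shows "linmap (tensor V' W') (tensor V W) (tensor_map V W f g)"
  unfolding tensor_map_def using assms by (intro linmap_tensor_lift bilin_pure_maps) auto

lemma tensor_lift_tensor_map:
  assumes "cvs V" "cvs W" "cvs M" "linmap V' V f" "linmap W' W g" "bilin V W M \<phi>" "l \<in> formal_sums V' W'"
  shows "tensor_lift M \<phi> (tensor_map V W f g l) = tensor_lift M (\<lambda>x y. \<phi> (f x) (g y)) l"
proof -
  note c = linmap_closed[OF assms(4)] linmap_closed[OF assms(5)]
  have "tensor_lift M \<phi> (tensor_map V W f g l)
      = tensor_lift M (\<lambda>x y. tensor_lift M \<phi> (pure_tensor V W (f x) (g y))) l"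
    unfolding tensor_map_def using assms c
    by (intro linmap_comp_tensor_lift[OF linmap_tensor_lift[OF assms(1-3,6)]]) auto
  also have "\<dots> = tensor_lift M (\<lambda>x y. \<phi> (f x) (g y)) l"
    using assms c by (intro tensor_lift_cong[OF assms(7)]) (simp add: tensor_lift_pure)
  finally show ?thesis .
qed

text \<open>The premise on brackets says that each element of \<open>S\<close> acts on the image of
  \<iota> as some element of \<open>G\<close> does. For a summand of a direct sum this is the
  component in that summand. Symmetry and invariance of t can then be pushed forward.\<close>

lemma sym_square_invariants_image:
  assumes G: "lie_algebra G" and S: "lie_algebra S" and \<iota>: "linmap G S \<iota>"
    and ad: "\<And>u. u \<in> carrier S \<Longrightarrow> \<exists>c\<in>carrier G. \<forall>x\<in>carrier G. \<lbrakk>u, \<iota> x\<rbrakk>\<^bsub>S\<^esub> = \<iota> \<lbrakk>c, x\<rbrakk>\<^bsub>G\<^esub>"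
    and t: "t \<in> sym_square_invariants G"
  shows "tensor_map S S \<iota> \<iota> t \<in> sym_square_invariants S"
proof -
  note [simp] = lie_algebra_cvs[OF G] lie_algebra_cvs[OF S] lie_algebra.bracket_closed[OF G]
    lie_algebra.bracket_closed[OF S] linmap_closed[OF \<iota>]
  let ?T = "tensor_map S S \<iota> \<iota>"
  have T: "linmap (tensor G G) (tensor S S) ?T" using \<iota> by (intro linmap_tensor_map) auto
  have t_formal: "t \<in> formal_sums G G" and t_carrier: "t \<in> carrier (tensor G G)"
    using t by (auto simp: sym_square_invariants_def sym_square_def carrier_tensor_iff)
  have T_pure: "?T (pure_tensor G G x y) = pure_tensor S S (\<iota> x) (\<iota> y)" if "x \<in> carrier G" "y \<in> carrier G" for x y
    unfolding tensor_map_def using that \<iota> by (subst tensor_lift_pure) (auto intro: bilin_pure_maps)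
  \<comment> \<open>A bilinear operation on \<open>S\<close> that corresponds along \<iota> to an
    operation on \<open>G\<close> may be applied before or after pushing t forward. It is used with
    the flip and with the adjoint action.\<close>
  have push: "tensor_lift (tensor S S) \<phi> (?T t) = ?T (tensor_lift (tensor G G) \<psi> t)"
    if \<phi>: "bilin S S (tensor S S) \<phi>"
      and \<psi>: "\<And>x y. x \<in> carrier G \<Longrightarrow> y \<in> carrier G \<Longrightarrow> \<psi> x y \<in> carrier (tensor G G)"
      and eq: "\<And>x y. x \<in> carrier G \<Longrightarrow> y \<in> carrier G \<Longrightarrow> \<phi> (\<iota> x) (\<iota> y) = ?T (\<psi> x y)" for \<phi> \<psi>
  proof -
    have "tensor_lift (tensor S S) \<phi> (?T t) = tensor_lift (tensor S S) (\<lambda>x y. \<phi> (\<iota> x) (\<iota> y)) t"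
      using \<phi> \<iota> t_formal by (intro tensor_lift_tensor_map) auto
    also have "\<dots> = tensor_lift (tensor S S) (\<lambda>x y. ?T (\<psi> x y)) t"
      by (rule tensor_lift_cong[OF t_formal]) (rule eq)
    also have "\<dots> = ?T (tensor_lift (tensor G G) \<psi> t)"
      using \<psi> by (intro linmap_comp_tensor_lift[symmetric, OF T _ _ t_formal]) auto
    finally show ?thesis .
  qed
  have "tensor_lift (tensor S S) (\<lambda>x y. pure_tensor S S y x) (?T t)
      = ?T (tensor_lift (tensor G G) (\<lambda>x y. pure_tensor G G y x) t)"
    by (intro push bilinI) (simp_all add: T_pure bilinD[OF bilin_pure_tensor])
  then have "?T t \<in> sym_square S"
    using t linmap_closed[OF T t_carrier] by (simp add: sym_square_invariants_def sym_square_def)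
  moreover have "tensor_lift (tensor S S)
      (\<lambda>x y. pure_tensor S S \<lbrakk>u, x\<rbrakk>\<^bsub>S\<^esub> y \<oplus>\<^bsub>tensor S S\<^esub> pure_tensor S S x \<lbrakk>u, y\<rbrakk>\<^bsub>S\<^esub>) (?T t) = \<zero>\<^bsub>tensor S S\<^esub>"
    if u: "u \<in> carrier S" for u
  proof -
    obtain c where c: "c \<in> carrier G" "\<And>x. x \<in> carrier G \<Longrightarrow> \<lbrakk>u, \<iota> x\<rbrakk>\<^bsub>S\<^esub> = \<iota> \<lbrakk>c, x\<rbrakk>\<^bsub>G\<^esub>"
      using ad[OF u] by auto
    have br: "linmap S S (\<lambda>x. \<lbrakk>u, x\<rbrakk>\<^bsub>S\<^esub>)"
      using u S by (intro linmapI) (simp_all add: lie_algebra.bracket_add_right lie_algebra.bracket_smult_right)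
    have "tensor_lift (tensor S S)
        (\<lambda>x y. pure_tensor S S \<lbrakk>u, x\<rbrakk>\<^bsub>S\<^esub> y \<oplus>\<^bsub>tensor S S\<^esub> pure_tensor S S x \<lbrakk>u, y\<rbrakk>\<^bsub>S\<^esub>) (?T t)
      = ?T (tensor_lift (tensor G G)
        (\<lambda>x y. pure_tensor G G \<lbrakk>c, x\<rbrakk>\<^bsub>G\<^esub> y \<oplus>\<^bsub>tensor G G\<^esub> pure_tensor G G x \<lbrakk>c, y\<rbrakk>\<^bsub>G\<^esub>) t)"
      using c(1) u
      by (intro push bilinI linmap_plus linmap_comp[OF bilinD(1)[OF bilin_pure_tensor] br]
          linmap_comp[OF bilinD(2)[OF bilin_pure_tensor] br])
        (simp_all add: linmap_add[OF T] T_pure c(2) bilinD[OF bilin_pure_tensor])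
    also have "\<dots> = \<zero>\<^bsub>tensor S S\<^esub>"
      using t c(1) linmap_zero[OF T] by (simp add: sym_square_invariants_def)
    finally show ?thesis .
  qed
  ultimately show ?thesis by (simp add: sym_square_invariants_def)
qed

text \<open>The flip and the adjoint action are linear maps on \<open>tensor L L\<close>, so their
  conditions on t are closed under sums.\<close>

lemma sym_square_invariants_add:
  assumes L: "lie_algebra L" and s: "s \<in> sym_square_invariants L" and t: "t \<in> sym_square_invariants L"
  shows "s \<oplus>\<^bsub>tensor L L\<^esub> t \<in> sym_square_invariants L"
proof -
  note [simp] = lie_algebra_cvs[OF L] lie_algebra.bracket_closed[OF L]
  have swap: "linmap (tensor L L) (tensor L L) (tensor_lift (tensor L L) (\<lambda>x y. pure_tensor L L y x))"
    by (intro linmap_tensor_lift bilinI) (simp_all add: bilinD[OF bilin_pure_tensor])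
  have ad: "linmap (tensor L L) (tensor L L) (tensor_lift (tensor L L)
      (\<lambda>x y. pure_tensor L L \<lbrakk>u, x\<rbrakk>\<^bsub>L\<^esub> y \<oplus>\<^bsub>tensor L L\<^esub> pure_tensor L L x \<lbrakk>u, y\<rbrakk>\<^bsub>L\<^esub>))"
    if u: "u \<in> carrier L" for u
  proof -
    have br: "linmap L L (\<lambda>x. \<lbrakk>u, x\<rbrakk>\<^bsub>L\<^esub>)"
      using u L by (intro linmapI) (simp_all add: lie_algebra.bracket_add_right lie_algebra.bracket_smult_right)
    show ?thesis
      using u by (intro linmap_tensor_lift bilinI linmap_plus linmap_comp[OF bilinD(1)[OF bilin_pure_tensor] br]
          linmap_comp[OF bilinD(2)[OF bilin_pure_tensor] br])
        (simp_all add: bilinD[OF bilin_pure_tensor])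
  qed
  show ?thesis
    using s t linmap_add[OF swap] linmap_add[OF ad] by (simp add: sym_square_invariants_def sym_square_def)
qed

lemma sum_form_invariant:
  assumes G: "lie_algebra G" and H: "lie_algebra H"
    and "tG \<in> sym_square_invariants G" "tH \<in> sym_square_invariants H"
  shows "sum_form G H tG tH \<in> sym_square_invariants (lie_sum G H)"
proof -
  note [simp] = lie_algebra_cvs[OF G] lie_algebra_cvs[OF H]
  note S = lie_algebra_lie_sum[OF G H]
  have "linmap G (lie_sum G H) (\<lambda>x. (x, \<zero>\<^bsub>H\<^esub>))" "linmap H (lie_sum G H) (\<lambda>y. (\<zero>\<^bsub>G\<^esub>, y))"
    by (auto intro!: linmapI simp: lie_sum_simps)
  then show ?thesis
    unfolding sum_form_def using assms
    by (intro sym_square_invariants_add[OF S] sym_square_invariants_image[OF _ S])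
      (auto simp: lie_sum_simps lie_bracket_zero)
qed

section \<open>Coisotropic subalgebras\<close>

lemma coisotropic_lift_zero:
  assumes G: "cvs G" and K: "submodule K complex_ring G" and M: "cvs M"
    and t: "t \<in> formal_sums G G" and co: "coisotropic K G t"
    and \<gamma>: "bilin G G M \<gamma>"
    and zero: "\<And>k a. k \<in> K \<Longrightarrow> a \<in> carrier G \<Longrightarrow> \<gamma> k a = \<zero>\<^bsub>M\<^esub>" "\<And>k a. k \<in> K \<Longrightarrow> a \<in> carrier G \<Longrightarrow> \<gamma> a k = \<zero>\<^bsub>M\<^esub>"
  shows "tensor_lift M \<gamma> t = \<zero>\<^bsub>M\<^esub>"
proof -
  note [simp] = G M
  interpret G: module complex_ring G by fact
  interpret K: submodule K complex_ring G by fact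
  have KG: "k \<in> carrier G" if "k \<in> K" for k using G.submoduleE(1)[OF K] that by auto
  interpret abelian_subgroup K G
    using K cvs_abelian_group[OF G]
    by (intro abelian_subgroupI3 additive_subgroup.intro) (simp_all add: submodule_def)
  let ?Q = "quotient_space G K" and ?\<pi> = "\<lambda>x. K +>\<^bsub>G\<^esub> x"
  have coset: "K +>\<^bsub>G\<^esub> x = (\<lambda>k. k \<oplus>\<^bsub>G\<^esub> x) ` K" for x by (auto simp: a_r_coset_def')
  have carrier_Q: "carrier ?Q = ?\<pi> ` carrier G" by (auto simp: quotient_space_def A_RCOSETS_def')
  \<comment> \<open>The zero of the quotient is \<open>K\<close> itself, which must be recognised as
    the coset of zero.\<close>
  have K0: "K = ?\<pi> \<zero>\<^bsub>G\<^esub>" using G.a_coset_join2[of "\<zero>\<^bsub>G\<^esub>" K] submodule.axioms(1)[OF K] by simp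
  have \<pi>_add: "?\<pi> x \<oplus>\<^bsub>?Q\<^esub> ?\<pi> y = ?\<pi> (x \<oplus>\<^bsub>G\<^esub> y)" if "x \<in> carrier G" "y \<in> carrier G" for x y
    using a_rcos_sum[OF that] by (simp add: quotient_space_def)
  have \<pi>_eq: "?\<pi> (k \<oplus>\<^bsub>G\<^esub> x) = ?\<pi> x" if "k \<in> K" "x \<in> carrier G" for k x
    using G.a_repr_independence[of "k \<oplus>\<^bsub>G\<^esub> x" K x] submodule.axioms(1)[OF K] that KG
    by (auto simp: coset)
  \<comment> \<open>\<open>quotient_space\<close> scales a coset by a union over its members, so
    every member has to give the same coset.\<close>
  have \<pi>_smult: "c \<odot>\<^bsub>?Q\<^esub> ?\<pi> x = ?\<pi> (c \<odot>\<^bsub>G\<^esub> x)" if x: "x \<in> carrier G" for c x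
  proof -
    have "K +>\<^bsub>G\<^esub> (c \<odot>\<^bsub>G\<^esub> y) = ?\<pi> (c \<odot>\<^bsub>G\<^esub> x)" if y: "y \<in> ?\<pi> x" for y
    proof -
      obtain k where k: "k \<in> K" "y = k \<oplus>\<^bsub>G\<^esub> x" using y unfolding coset by blast
      have "c \<odot>\<^bsub>G\<^esub> k \<in> K" using k(1) by simp
      then show ?thesis using \<pi>_eq[of "c \<odot>\<^bsub>G\<^esub> k" "c \<odot>\<^bsub>G\<^esub> x"] k x KG by (simp add: cvs_smult_add)
    qed
    moreover have "x \<in> ?\<pi> x" using x by (rule a_rcos_self)
    ultimately have "(\<Union>y\<in>?\<pi> x. K +>\<^bsub>G\<^esub> (c \<odot>\<^bsub>G\<^esub> y)) = ?\<pi> (c \<odot>\<^bsub>G\<^esub> x)" by blast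
    then show ?thesis by (simp add: quotient_space_def)
  qed
  have zero_Q: "\<zero>\<^bsub>?Q\<^esub> = ?\<pi> \<zero>\<^bsub>G\<^esub>" using K0 by (simp add: quotient_space_def)
  have Q [simp]: "cvs ?Q"
  proof (rule cvsI)
    show "A \<oplus>\<^bsub>?Q\<^esub> B = B \<oplus>\<^bsub>?Q\<^esub> A" if "A \<in> carrier ?Q" "B \<in> carrier ?Q" for A B
      using that cvs_add_comm[OF G] unfolding carrier_Q by (elim imageE) (simp only: \<pi>_add)
  qed (auto simp: carrier_Q \<pi>_add \<pi>_smult zero_Q cvs_add_assoc cvs_smult_add cvs_smult_add_left cvs_smult_smult)
  have \<pi>: "linmap G ?Q ?\<pi>" by (rule linmapI) (auto simp: carrier_Q \<pi>_add \<pi>_smult)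
  \<comment> \<open>The descended form takes arbitrary representatives of its two cosets; a change
    by elements of \<open>K\<close> is invisible since \<gamma> vanishes on \<open>K\<close> in
    either argument.\<close>
  define \<psi> where "\<psi> A B = \<gamma> (SOME a. a \<in> A) (SOME b. b \<in> B)" for A B
  have \<psi>: "\<psi> (?\<pi> x) (?\<pi> y) = \<gamma> x y" if xy: "x \<in> carrier G" "y \<in> carrier G" for x y
  proof -
    have "(SOME a. a \<in> ?\<pi> x) \<in> ?\<pi> x" "(SOME b. b \<in> ?\<pi> y) \<in> ?\<pi> y"
      by (rule someI, rule a_rcos_self, rule xy)+
    then obtain k l where kl: "k \<in> K" "l \<in> K" "(SOME a. a \<in> ?\<pi> x) = k \<oplus>\<^bsub>G\<^esub> x" "(SOME b. b \<in> ?\<pi> y) = l \<oplus>\<^bsub>G\<^esub> y"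
      by (auto simp: coset)
    then have "\<psi> (?\<pi> x) (?\<pi> y) = \<gamma> (k \<oplus>\<^bsub>G\<^esub> x) (l \<oplus>\<^bsub>G\<^esub> y)" by (simp add: \<psi>_def)
    then show ?thesis
      using kl xy KG zero by (simp add: linmap_add[OF bilinD(1)[OF \<gamma>]] linmap_add[OF bilinD(2)[OF \<gamma>]] bilin_closed[OF \<gamma>])
  qed
  have bil: "bilin ?Q ?Q M \<psi>"
    by (intro bilinI linmapI)
      (auto simp: carrier_Q \<pi>_add \<pi>_smult \<psi> bilin_closed[OF \<gamma>]
        linmap_add[OF bilinD(1)[OF \<gamma>]] linmap_add[OF bilinD(2)[OF \<gamma>]]
        linmap_smult[OF bilinD(1)[OF \<gamma>]] linmap_smult[OF bilinD(2)[OF \<gamma>]])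
  have "\<zero>\<^bsub>M\<^esub> = tensor_lift M \<psi> (tensor_map ?Q ?Q ?\<pi> ?\<pi> t)"
    using co linmap_zero[OF linmap_tensor_lift[OF Q Q M bil]] by (simp add: coisotropic_def)
  also have "\<dots> = tensor_lift M (\<lambda>x y. \<psi> (?\<pi> x) (?\<pi> y)) t"
    using \<pi> bil t by (intro tensor_lift_tensor_map) auto
  also have "\<dots> = tensor_lift M \<gamma> t" by (rule tensor_lift_cong[OF t]) (rule \<psi>)
  finally show ?thesis by simp
qed

section \<open>The functor of invariants\<close>

lemma invariants_simps:
  "x \<in> carrier (invariants G H K X) \<longleftrightarrow> x \<in> carrier X \<and> (\<forall>u\<in>K. act X (u, \<zero>\<^bsub>H\<^esub>) x = \<zero>\<^bsub>X\<^esub>)"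
  "\<zero>\<^bsub>invariants G H K X\<^esub> = \<zero>\<^bsub>X\<^esub>" "add (invariants G H K X) = add X" "smult (invariants G H K X) = smult X"
  "act (invariants G H K X) v = act X (\<zero>\<^bsub>G\<^esub>, v)"
  by (simp_all add: invariants_def)

locale coisotropic_invariants =
  fixes \<Phi> :: "letter ncseries" and G :: "'g lie" and H :: "'h lie"
    and tG :: "('g, 'g) formal_sum" and tH :: "('h, 'h) formal_sum" and K :: "'g set"
  assumes assoc: "drinfeld_associator \<Phi>" and G: "lie_algebra G" and H: "lie_algebra H"
    and tG: "tG \<in> sym_square_invariants G" and tH: "tH \<in> sym_square_invariants H"
    and K: "lie_subalgebra K G" and co: "coisotropic K G tG"
begin

abbreviation "S \<equiv> lie_sum G H"
abbreviation "tS \<equiv> sum_form G H tG tH"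
abbreviation F :: "('g \<times> 'h, 'a) umod \<Rightarrow> ('h, 'a) umod" where "F \<equiv> invariants G H K"

sublocale C: drinfeld S tS \<Phi>
  using lie_algebra_lie_sum[OF G H] sum_form_invariant[OF G H tG tH] assoc
  by (intro drinfeld.intro lie_form.intro drinfeld_axioms.intro)

sublocale D: drinfeld H tH \<Phi>
  using H tH assoc by (intro drinfeld.intro lie_form.intro drinfeld_axioms.intro)

lemma submodule_K: "submodule K complex_ring G"
  using K by (simp add: lie_subalgebra_def)

lemma K_carrier: "k \<in> K \<Longrightarrow> k \<in> carrier G"
  using module.submoduleE(1)[OF lie_algebra_cvs[OF G] submodule_K] by auto

lemma sum_carrier [simp]: "v \<in> carrier H \<Longrightarrow> (\<zero>\<^bsub>G\<^esub>, v) \<in> carrier S" "u \<in> carrier G \<Longrightarrow> (u, \<zero>\<^bsub>H\<^esub>) \<in> carrier S"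
  using lie_algebra_cvs[OF G] lie_algebra_cvs[OF H] by (simp_all add: lie_sum_simps)

lemma F_carrier: "x \<in> carrier (F X) \<Longrightarrow> x \<in> carrier X"
  by (simp add: invariants_simps)

lemma act_zero:
  fixes X :: "('g \<times> 'h, 'a) umod"
  shows "lie_module S X \<Longrightarrow> a \<in> carrier S \<Longrightarrow> act X a \<zero>\<^bsub>X\<^esub> = \<zero>\<^bsub>X\<^esub>"
  by (rule linmap_zero) simp_all

lemma cvs_F:
  assumes X: "lie_module S X"
  shows "cvs (F X)"
proof -
  have [simp]: "cvs X" using X by simp
  note act = linmap_act[OF X sum_carrier(2)[OF K_carrier]]
  show ?thesis
    by (rule cvsI) (auto simp: invariants_simps cvs_add_assoc cvs_smult_add cvs_smult_add_left cvs_smult_smult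
        linmap_add[OF act] linmap_smult[OF act] linmap_zero[OF act] cvs_add_comm[of X])
qed

lemma linmap_into_F: "linmap N (F X) p \<Longrightarrow> linmap N X p"
  by (simp add: linmap_def invariants_simps)

lemma linmap_from_F: "linmap X N p \<Longrightarrow> linmap (F X) N p"
  by (simp add: linmap_def invariants_simps)

text \<open>\<open>F X\<close> inherits its operations from \<open>X\<close>, so linearity can be
  proved in \<open>X\<close>, where the rules for structural maps apply, and invariance of the
  values separately.\<close>

lemma linmap_F_iff: "linmap N (F X) p \<longleftrightarrow> linmap N X p \<and> (\<forall>x\<in>carrier N. p x \<in> carrier (F X))"
  by (auto simp: linmap_def invariants_simps)

lemma lie_module_F [simp]:
  assumes X: "lie_module S X"
  shows "lie_module H (F X)"
proof (rule lie_moduleI[OF H cvs_F[OF X]])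
  note [simp] = lie_algebra_cvs[OF G] lie_algebra_cvs[OF H] lie_bracket_zero[OF G] lie_bracket_zero[OF H]
    lie_module_act_closed[OF X] lie_module_cvs[OF X]
  have inv: "act X (\<zero>\<^bsub>G\<^esub>, v) x \<in> carrier (F X)" if v: "v \<in> carrier H" and x: "x \<in> carrier (F X)" for v x
    unfolding invariants_simps
  proof (intro conjI ballI)
    fix u assume u: "u \<in> K"
    \<comment> \<open>The bracket of (u, 0) and (0, v) is zero and zero acts by zero, so the two
      actions commute on \<open>x\<close> and invariance survives.\<close>
    have "act X \<zero>\<^bsub>S\<^esub> x = \<zero>\<^bsub>X\<^esub>"
      using x by (intro linmap_zero[OF linmap_act_left[OF X]]) (simp_all add: F_carrier lie_algebra_cvs C.lie)
    then show "act X (u, \<zero>\<^bsub>H\<^esub>) (act X (\<zero>\<^bsub>G\<^esub>, v) x) = \<zero>\<^bsub>X\<^esub>"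
      using lie_module_bracket[OF X, of "(u, \<zero>\<^bsub>H\<^esub>)" "(\<zero>\<^bsub>G\<^esub>, v)" x] x u v act_zero[OF X, of "(\<zero>\<^bsub>G\<^esub>, v)"]
      by (simp add: K_carrier F_carrier lie_sum_simps(2,5)) (simp add: invariants_simps)
  qed (use v x in \<open>simp add: F_carrier\<close>)
  show "linmap (F X) (F X) (act (F X) a)" if "a \<in> carrier H" for a
    unfolding linmap_F_iff using that inv linmap_from_F[OF linmap_act[OF X]]
    by (simp add: invariants_simps(5)[abs_def])
  show "linmap H (F X) (\<lambda>a. act (F X) a x)" if x: "x \<in> carrier (F X)" for x
  proof -
    have "linmap H S (\<lambda>v. (\<zero>\<^bsub>G\<^esub>, v))" by (auto intro!: linmapI simp: lie_sum_simps)
    from linmap_comp[OF linmap_act_left[OF X F_carrier[OF x]] this] show ?thesis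
      unfolding linmap_F_iff using inv x by (simp add: invariants_simps(5))
  qed
  show "act (F X) a (act (F X) b x) = act (F X) b (act (F X) a x) \<oplus>\<^bsub>F X\<^esub> act (F X) \<lbrakk>a, b\<rbrakk>\<^bsub>H\<^esub> x"
    if "a \<in> carrier H" "b \<in> carrier H" "x \<in> carrier (F X)" for a b x
    using that lie_module_bracket[OF X, of "(\<zero>\<^bsub>G\<^esub>, a)" "(\<zero>\<^bsub>G\<^esub>, b)" x]
    by (simp add: invariants_simps(3,5) F_carrier lie_sum_simps(5))
qed

text \<open>An element of \<open>F X \<boxtimes> F Y\<close> represents a class modulo relations
  among invariants only. It is therefore not reused as it stands: its formal sum is evaluated anew
  in \<open>X \<boxtimes> Y\<close>.\<close>

definition J_map :: "('g \<times> 'h, 'a) umod \<Rightarrow> ('g \<times> 'h, 'a) umod \<Rightarrow> 'a tuniv \<Rightarrow> 'a tuniv" where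
  "J_map X Y u = tensor_lift (X \<boxtimes> Y) (elem_tensor X Y) (untensor u)"

lemma invariants_incl_eq: "invariants_incl G H K X Y = const_hmap (F X \<boxtimes> F Y) (F (X \<boxtimes> Y)) (J_map X Y)"
  by (simp add: invariants_incl_def J_map_def[abs_def])

context
  fixes X Y :: "('g \<times> 'h, 'a) umod"
  assumes X [simp]: "lie_module S X" and Y [simp]: "lie_module S Y"
begin

lemma bilin_elem_F: "bilin (F X) (F Y) (X \<boxtimes> Y) (elem_tensor X Y)"
  by (intro bilinI linmap_from_F linmap_elem_left linmap_elem_right) (simp_all add: F_carrier)

lemma J_elem [simp]:
  "\<lbrakk>x \<in> carrier (F X); y \<in> carrier (F Y)\<rbrakk> \<Longrightarrow> J_map X Y (elem_tensor (F X) (F Y) x y) = elem_tensor X Y x y"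
  unfolding J_map_def by (rule tlift_elem) (simp_all add: bilin_elem_F)

lemma linmap_J_weak: "linmap (F X \<boxtimes> F Y) (X \<boxtimes> Y) (J_map X Y)"
  unfolding J_map_def[abs_def] by (rule linmap_tlift) (simp_all add: bilin_elem_F)

text \<open>Both terms of the Leibniz rule vanish, as each contains an element of \<open>K\<close>
  acting on an invariant.\<close>

lemma elem_invariant:
  assumes "x \<in> carrier (F X)" "y \<in> carrier (F Y)"
  shows "elem_tensor X Y x y \<in> carrier (F (X \<boxtimes> Y))"
  using assms by (auto simp: invariants_simps C.act_elem K_carrier)

lemma linmap_J [simp]: "linmap (F X \<boxtimes> F Y) (F (X \<boxtimes> Y)) (J_map X Y)"
proof -
  have "act (X \<boxtimes> Y) (k, \<zero>\<^bsub>H\<^esub>) (J_map X Y u) = \<zero>\<^bsub>X \<boxtimes> Y\<^esub>" if k: "k \<in> K" and u: "u \<in> carrier (F X \<boxtimes> F Y)" for k u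
  proof (rule linmap_tensor_ext[where f = "\<lambda>u. act (X \<boxtimes> Y) (k, \<zero>\<^bsub>H\<^esub>) (J_map X Y u)" and g = "\<lambda>u. \<zero>\<^bsub>X \<boxtimes> Y\<^esub>", OF _ _ _ _ u])
    show "linmap (F X \<boxtimes> F Y) (X \<boxtimes> Y) (\<lambda>u. act (X \<boxtimes> Y) (k, \<zero>\<^bsub>H\<^esub>) (J_map X Y u))"
      using k by (intro linmap_comp[OF linmap_act linmap_J_weak, of S]) (simp_all add: K_carrier)
    show "act (X \<boxtimes> Y) (k, \<zero>\<^bsub>H\<^esub>) (J_map X Y (elem_tensor (F X) (F Y) x y)) = \<zero>\<^bsub>X \<boxtimes> Y\<^esub>"
      if "x \<in> carrier (F X)" "y \<in> carrier (F Y)" for x y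
      using elem_invariant[OF that] that k by (simp add: invariants_simps(1)[of _ G H K "X \<boxtimes> Y"])
  qed (simp_all add: linmap_zero_map)
  then show ?thesis
    unfolding linmap_F_iff using linmap_J_weak linmap_closed[OF linmap_J_weak] by (simp add: invariants_simps)
qed

lemma J_act:
  assumes a: "a \<in> carrier H" and u: "u \<in> carrier (F X \<boxtimes> F Y)"
  shows "J_map X Y (act (F X \<boxtimes> F Y) a u) = act (F (X \<boxtimes> Y)) a (J_map X Y u)"
proof (rule linmap_tensor_ext[where f = "\<lambda>u. J_map X Y (act (F X \<boxtimes> F Y) a u)" and g = "\<lambda>u. act (F (X \<boxtimes> Y)) a (J_map X Y u)"
      and M = "F (X \<boxtimes> Y)", OF _ _ _ _ u])
  show "linmap (F X \<boxtimes> F Y) (F (X \<boxtimes> Y)) (\<lambda>u. J_map X Y (act (F X \<boxtimes> F Y) a u))"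
    using a by (intro linmap_comp[OF linmap_J linmap_act, of H]) simp_all
  show "linmap (F X \<boxtimes> F Y) (F (X \<boxtimes> Y)) (\<lambda>u. act (F (X \<boxtimes> Y)) a (J_map X Y u))"
    using a by (intro linmap_comp[OF linmap_act linmap_J, of H]) simp_all
  fix x y assume xy: "x \<in> carrier (F X)" "y \<in> carrier (F Y)"
  have c: "act X (\<zero>\<^bsub>G\<^esub>, a) x \<in> carrier (F X)" "act Y (\<zero>\<^bsub>G\<^esub>, a) y \<in> carrier (F Y)"
    using lie_module_act_closed[of H "F X" a x] lie_module_act_closed[of H "F Y" a y] a xy
    by (simp_all add: invariants_simps(5))
  show "J_map X Y (act (F X \<boxtimes> F Y) a (elem_tensor (F X) (F Y) x y))
      = act (F (X \<boxtimes> Y)) a (J_map X Y (elem_tensor (F X) (F Y) x y))"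
    using a xy c by (simp add: D.act_elem C.act_elem linmap_add[OF linmap_J_weak] invariants_simps(5) F_carrier)
qed simp

lemma linmap_sum_incl: "linmap G S (\<lambda>x. (x, \<zero>\<^bsub>H\<^esub>))" "linmap H S (\<lambda>y. (\<zero>\<^bsub>G\<^esub>, y))"
  using lie_algebra_cvs[OF G] lie_algebra_cvs[OF H] by (auto intro!: linmapI simp: lie_sum_simps)

text \<open>The two sides are compared on x \<otimes> y with x and y invariant. With these fixed,
  the legs act through a bilinear map on \<open>S\<close>, and t splits into its two summands: the
  one from \<open>G\<close> vanishes by coisotropy, and the one from \<open>H\<close> is what acts
  on the invariants.\<close>

lemma J_t_act:
  assumes u: "u \<in> carrier (F X \<boxtimes> F Y)"
  shows "J_map X Y (t_act tH (F X) (F Y) u) = t_act tS X Y (J_map X Y u)"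
proof (rule linmap_tensor_ext[where f = "\<lambda>u. J_map X Y (t_act tH (F X) (F Y) u)" and g = "\<lambda>u. t_act tS X Y (J_map X Y u)"
      and M = "X \<boxtimes> Y", OF _ _ _ _ u])
  show "linmap (F X \<boxtimes> F Y) (X \<boxtimes> Y) (\<lambda>u. J_map X Y (t_act tH (F X) (F Y) u))"
    by (intro linmap_comp[OF linmap_J_weak D.linmap_t_act(1)]) simp_all
  show "linmap (F X \<boxtimes> F Y) (X \<boxtimes> Y) (\<lambda>u. t_act tS X Y (J_map X Y u))"
    by (intro linmap_comp[OF C.linmap_t_act(1) linmap_J_weak]) simp_all
  fix x y assume xy: "x \<in> carrier (F X)" "y \<in> carrier (F Y)"
  note xy' = F_carrier[OF xy(1)] F_carrier[OF xy(2)]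
  note cvsG [simp] = lie_algebra_cvs[OF G] and cvsH [simp] = lie_algebra_cvs[OF H] and cvsS = lie_algebra_cvs[OF C.lie]
  let ?e = "elem_tensor X Y"
  let ?\<beta> = "\<lambda>a b. ?e (act X a x) (act Y b y)"
  have tGf: "tG \<in> formal_sums G G" using tG by (auto simp: sym_square_invariants_def sym_square_def carrier_tensor_iff)
  have \<beta>: "bilin S S (X \<boxtimes> Y) ?\<beta>"
    using xy' by (intro bilin_elem_maps[of X Y S] linmap_act_left) simp_all
  note lift = linmap_tensor_lift[OF cvsS cvsS cvs_tensor_module \<beta>]
  have \<iota>: "tensor_map S S (\<lambda>x. (x, \<zero>\<^bsub>H\<^esub>)) (\<lambda>x. (x, \<zero>\<^bsub>H\<^esub>)) tG \<in> carrier (tensor S S)"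
    "tensor_map S S (\<lambda>y. (\<zero>\<^bsub>G\<^esub>, y)) (\<lambda>y. (\<zero>\<^bsub>G\<^esub>, y)) tH \<in> carrier (tensor S S)"
    using tG tH linmap_sum_incl cvsS
    by (auto intro!: linmap_closed[OF linmap_tensor_map] simp: sym_square_invariants_def sym_square_def)
  have "bilin G G (X \<boxtimes> Y) (\<lambda>a b. ?\<beta> (a, \<zero>\<^bsub>H\<^esub>) (b, \<zero>\<^bsub>H\<^esub>))"
    using xy' by (intro bilin_elem_maps[of X Y G] linmap_comp[OF linmap_act_left linmap_sum_incl(1)]) simp_all
  then have G0: "tensor_lift (X \<boxtimes> Y) (\<lambda>a b. ?\<beta> (a, \<zero>\<^bsub>H\<^esub>) (b, \<zero>\<^bsub>H\<^esub>)) tG = \<zero>\<^bsub>X \<boxtimes> Y\<^esub>"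
    using xy xy' by (intro coisotropic_lift_zero[OF cvsG submodule_K _ tGf co]) (auto simp: invariants_simps)
  have "t_act tS X Y (?e x y) = tensor_lift (X \<boxtimes> Y) ?\<beta> tS"
    unfolding t_act_def by (rule tensor_lift_cong[OF C.t_formal]) (use xy' in simp)
  also have "\<dots> = tensor_lift (X \<boxtimes> Y) ?\<beta> (tensor_map S S (\<lambda>x. (x, \<zero>\<^bsub>H\<^esub>)) (\<lambda>x. (x, \<zero>\<^bsub>H\<^esub>)) tG)
      \<oplus>\<^bsub>X \<boxtimes> Y\<^esub> tensor_lift (X \<boxtimes> Y) ?\<beta> (tensor_map S S (\<lambda>y. (\<zero>\<^bsub>G\<^esub>, y)) (\<lambda>y. (\<zero>\<^bsub>G\<^esub>, y)) tH)"
    unfolding sum_form_def using \<iota> by (rule linmap_add[OF lift])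
  also have "tensor_lift (X \<boxtimes> Y) ?\<beta> (tensor_map S S (\<lambda>x. (x, \<zero>\<^bsub>H\<^esub>)) (\<lambda>x. (x, \<zero>\<^bsub>H\<^esub>)) tG) = \<zero>\<^bsub>X \<boxtimes> Y\<^esub>"
    using G0 by (subst tensor_lift_tensor_map[OF cvsS cvsS cvs_tensor_module linmap_sum_incl(1) linmap_sum_incl(1) \<beta> tGf]) simp
  also have "tensor_lift (X \<boxtimes> Y) ?\<beta> (tensor_map S S (\<lambda>y. (\<zero>\<^bsub>G\<^esub>, y)) (\<lambda>y. (\<zero>\<^bsub>G\<^esub>, y)) tH)
      = tensor_lift (X \<boxtimes> Y) (\<lambda>a b. ?\<beta> (\<zero>\<^bsub>G\<^esub>, a) (\<zero>\<^bsub>G\<^esub>, b)) tH"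
    by (rule tensor_lift_tensor_map[OF cvsS cvsS cvs_tensor_module linmap_sum_incl(2) linmap_sum_incl(2) \<beta> D.t_formal])
  also have "\<zero>\<^bsub>X \<boxtimes> Y\<^esub> \<oplus>\<^bsub>X \<boxtimes> Y\<^esub> \<dots> = \<dots>"
    using xy' by (intro cvs_closed(5) tensor_lift_closed[OF D.t_formal]) auto
  also have "\<dots> = tensor_lift (X \<boxtimes> Y) (\<lambda>a b. J_map X Y (D.t_op (F X) (F Y) a b (elem_tensor (F X) (F Y) x y))) tH"
  proof (rule tensor_lift_cong[OF D.t_formal])
    fix a b assume ab: "a \<in> carrier H" "b \<in> carrier H"
    have "act (F X) a x \<in> carrier (F X)" "act (F Y) b y \<in> carrier (F Y)" using ab xy by simp_all
    then show "?\<beta> (\<zero>\<^bsub>G\<^esub>, a) (\<zero>\<^bsub>G\<^esub>, b) = J_map X Y (D.t_op (F X) (F Y) a b (elem_tensor (F X) (F Y) x y))"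
      using ab xy by simp (simp add: invariants_simps(5))
  qed
  also have "\<dots> = J_map X Y (t_act tH (F X) (F Y) (elem_tensor (F X) (F Y) x y))"
    unfolding t_act_def
    by (rule linmap_comp_tensor_lift[symmetric, OF linmap_J_weak _ _ D.t_formal]) (use xy in simp_all)
  finally show "J_map X Y (t_act tH (F X) (F Y) (elem_tensor (F X) (F Y) x y))
      = t_act tS X Y (J_map X Y (elem_tensor (F X) (F Y) x y))"
    using xy by simp
qed simp

end

text \<open>Equivariance is used twice: for (u, 0) with u in \<open>K\<close> it keeps the
  coefficients inside the invariants, and for (0, v) it gives equivariance over
  \<open>H\<close>.\<close>

lemma F_hmap:
  assumes X: "lie_module S X" and Y: "lie_module S Y" and f: "lin_hmap f X Y" "C.equivariant f X Y"
  shows "lin_hmap (invariants_map G H K f) (F X) (F Y)"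
    and "D.equivariant (invariants_map G H K f) (F X) (F Y)"
    and "x \<in> carrier (F X) \<Longrightarrow> terms (invariants_map G H K f) n x = terms f n x"
    and "x \<in> carrier (F X) \<Longrightarrow> terms f n x \<in> carrier (F Y)"
proof -
  note [simp] = X Y
  note D = lin_hmapD[OF f(1)]
  show terms: "terms (invariants_map G H K f) n x = terms f n x" if "x \<in> carrier (F X)" for n x
    using that by (simp add: invariants_map_def D(3))
  show closed: "terms f n x \<in> carrier (F Y)" if x: "x \<in> carrier (F X)" for n x
    unfolding invariants_simps
  proof (intro conjI ballI)
    fix u assume u: "u \<in> K"
    have "act Y (u, \<zero>\<^bsub>H\<^esub>) (terms f n x) = terms f n (act X (u, \<zero>\<^bsub>H\<^esub>) x)"
      using f(2) u x by (simp add: C.equivariant_def intertwines_def D(3) K_carrier F_carrier)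
    also have "\<dots> = \<zero>\<^bsub>Y\<^esub>" using x u linmap_zero[OF D(5)] by (simp add: invariants_simps)
    finally show "act Y (u, \<zero>\<^bsub>H\<^esub>) (terms f n x) = \<zero>\<^bsub>Y\<^esub>" .
  qed (use x D in \<open>simp add: F_carrier\<close>)
  have "linmap (F X) (F Y) (terms f n)" for n
    unfolding linmap_F_iff using linmap_from_F[OF D(5)] closed by simp
  then show "lin_hmap (invariants_map G H K f) (F X) (F Y)"
    unfolding lin_hmap_def by (auto simp: invariants_map_def D(3,4) linmap_restrict)
  show "D.equivariant (invariants_map G H K f) (F X) (F Y)"
    unfolding D.equivariant_def intertwines_def
  proof (intro ballI allI)
    fix a n x assume a: "a \<in> carrier H" and "x \<in> carrier (source (invariants_map G H K f))"
    then have x: "x \<in> carrier (F X)" by (simp add: invariants_map_def D(3))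
    have "act (F X) a x \<in> carrier (F X)" using a x by simp
    then show "terms (invariants_map G H K f) n (act (F X) a x) = act (F Y) a (terms (invariants_map G H K f) n x)"
      using f(2) a x by (simp add: terms invariants_simps(5) C.equivariant_def intertwines_def D(3) F_carrier)
  qed
qed

lemma F_const:
  assumes "linmap X Y p" "cvs X" "cvs Y" "lie_module S X"
  shows "invariants_map G H K (const_hmap X Y p) = const_hmap (F X) (F Y) p"
  by (rule hmap.equality)
    (auto simp: invariants_map_def const_hmap_def fun_eq_iff restrict_def invariants_simps(1,2))

lemma J_lin_hmap [simp]:
  "\<lbrakk>lie_module S X; lie_module S Y\<rbrakk> \<Longrightarrow> lin_hmap (invariants_incl G H K X Y) (F X \<boxtimes> F Y) (F (X \<boxtimes> Y))"
  unfolding invariants_incl_eq by (intro lin_hmap_const) simp_all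

lemma terms_comp_J:
  assumes "lie_module S X" "lie_module S Y" "lin_hmap f (F (X \<boxtimes> Y)) M" "u \<in> carrier (F X \<boxtimes> F Y)"
  shows "terms (f \<circ>\<^sub>h invariants_incl G H K X Y) n u = terms f n (J_map X Y u)"
  unfolding invariants_incl_eq using assms by (intro terms_comp_const[OF assms(3)]) simp_all

lemma F_comp_hmap:
  assumes X: "lie_module S X" and Y: "lie_module S Y" and Z: "lie_module S Z"
    and f: "lin_hmap f X Y" "C.equivariant f X Y" and g: "lin_hmap g Y Z" "C.equivariant g Y Z"
  shows "invariants_map G H K (g \<circ>\<^sub>h f) = invariants_map G H K g \<circ>\<^sub>h invariants_map G H K f"
proof (rule hmap_eqI)
  note [simp] = X Y Z
  note gf = lin_hmap_comp[OF f(1) g(1)] C.equivariant_comp[OF X Y Z f(1) g(1) f(2) g(2)]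
  note Ff = F_hmap[OF X Y f] and Fg = F_hmap[OF Y Z g] and Fgf = F_hmap[OF X Z gf]
  show "lin_hmap (invariants_map G H K (g \<circ>\<^sub>h f)) (F X) (F Z)" by (rule Fgf(1))
  show "lin_hmap (invariants_map G H K g \<circ>\<^sub>h invariants_map G H K f) (F X) (F Z)"
    using Ff(1) Fg(1) by (rule lin_hmap_comp)
  fix n x assume x: "x \<in> carrier (F X)"
  have "terms (invariants_map G H K g \<circ>\<^sub>h invariants_map G H K f) n x
      = finsum (F Z) (\<lambda>k. terms g k (terms f (n - k) x)) {..n}"
    unfolding terms_comp[OF Ff(1) Fg(1) x]
    by (intro cvs_finsum_cong) (use x Ff(3,4) Fg(3,4) in auto)
  \<comment> \<open>\<open>finsum\<close> in \<open>F Z\<close> and \<open>finsum\<close> in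
    \<open>Z\<close> are different terms; the inclusion, being linear, identifies them.\<close>
  also have "\<dots> = finsum Z (\<lambda>k. terms g k (terms f (n - k) x)) {..n}"
    using x Ff(4) Fg(4) by (intro linmap_finsum[where f = "\<lambda>z. z"] linmap_from_F linmap_id) simp_all
  also have "\<dots> = terms (invariants_map G H K (g \<circ>\<^sub>h f)) n x"
    using x by (simp add: Fgf(3) terms_comp[OF f(1) g(1)] F_carrier)
  finally show "terms (invariants_map G H K (g \<circ>\<^sub>h f)) n x
      = terms (invariants_map G H K g \<circ>\<^sub>h invariants_map G H K f) n x" by simp
qed

lemma J_natural_hmap:
  assumes X: "lie_module S X" and X': "lie_module S X'" and Y: "lie_module S Y" and Y': "lie_module S Y'"
    and f: "lin_hmap f X X'" "C.equivariant f X X'" and g: "lin_hmap g Y Y'" "C.equivariant g Y Y'"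
  shows "invariants_map G H K (f \<otimes>\<^sub>h g) \<circ>\<^sub>h invariants_incl G H K X Y
    = invariants_incl G H K X' Y' \<circ>\<^sub>h (invariants_map G H K f \<otimes>\<^sub>h invariants_map G H K g)" (is "?l = ?r")
proof (rule hmap_tensor_eqI)
  note [simp] = X X' Y Y'
  note fg = lin_hmap_tensor[OF f(1) g(1)] C.equivariant_tensor[OF X X' Y Y' f(1) g(1) f(2) g(2)]
  note Ff = F_hmap[OF X X' f] and Fg = F_hmap[OF Y Y' g]
  have Ffg: "lin_hmap (invariants_map G H K (f \<otimes>\<^sub>h g)) (F (X \<boxtimes> Y)) (F (X' \<boxtimes> Y'))"
    using fg by (intro F_hmap(1)) simp_all
  note FfFg = lin_hmap_tensor[OF Ff(1) Fg(1)]
  show "lin_hmap ?l (F X \<boxtimes> F Y) (F (X' \<boxtimes> Y'))" by (rule lin_hmap_comp[OF J_lin_hmap Ffg]) simp_all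
  show "lin_hmap ?r (F X \<boxtimes> F Y) (F (X' \<boxtimes> Y'))" by (rule lin_hmap_comp[OF FfFg J_lin_hmap]) simp_all
  fix n x y assume xy: "x \<in> carrier (F X)" "y \<in> carrier (F Y)"
  have "terms ?r n (elem_tensor (F X) (F Y) x y)
      = J_map X' Y' (terms (invariants_map G H K f \<otimes>\<^sub>h invariants_map G H K g) n (elem_tensor (F X) (F Y) x y))"
    unfolding invariants_incl_eq using xy by (intro terms_const_comp[OF FfFg]) simp_all
  also have "\<dots> = finsum (X' \<boxtimes> Y') (\<lambda>k. J_map X' Y' (elem_tensor (F X') (F Y')
      (terms (invariants_map G H K f) k x) (terms (invariants_map G H K g) (n - k) y))) {..n}"
    unfolding terms_tensor_elem[OF Ff(1) Fg(1) xy] using xy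
    by (intro linmap_finsum[OF linmap_J_weak]) (simp_all add: Ff(3,4) Fg(3,4))
  also have "\<dots> = finsum (X' \<boxtimes> Y') (\<lambda>k. elem_tensor X' Y' (terms f k x) (terms g (n - k) y)) {..n}"
    using xy by (intro cvs_finsum_cong) (auto simp: Ff(3,4) Fg(3,4) F_carrier)
  also have "\<dots> = terms (f \<otimes>\<^sub>h g) n (elem_tensor X Y x y)"
    using xy by (intro terms_tensor_elem[OF f(1) g(1), symmetric]) (simp_all add: F_carrier)
  also have "\<dots> = terms (invariants_map G H K (f \<otimes>\<^sub>h g)) n (elem_tensor X Y x y)"
    using xy fg by (intro F_hmap(3)[of "X \<boxtimes> Y" "X' \<boxtimes> Y'", symmetric]) (simp_all add: elem_invariant)
  also have "\<dots> = terms ?l n (elem_tensor (F X) (F Y) x y)"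
    using xy by (simp add: terms_comp_J[OF X Y Ffg])
  finally show "terms ?l n (elem_tensor (F X) (F Y) x y) = terms ?r n (elem_tensor (F X) (F Y) x y)" by simp
qed

lemma braid_props:
  assumes "lie_module S X" "lie_module S Y"
  shows "lin_hmap (C.braid_hmap X Y) (X \<boxtimes> Y) (Y \<boxtimes> X)" "C.equivariant (C.braid_hmap X Y) (X \<boxtimes> Y) (Y \<boxtimes> X)"
  using C.braid_inverse_arrows[OF assms] assms by (simp_all add: C.inverse_arrows_iff)

lemma assoc_props:
  assumes "lie_module S X" "lie_module S Y" "lie_module S Z"
  shows "lin_hmap (C.assoc_hmap X Y Z) ((X \<boxtimes> Y) \<boxtimes> Z) (X \<boxtimes> (Y \<boxtimes> Z))"
    "C.equivariant (C.assoc_hmap X Y Z) ((X \<boxtimes> Y) \<boxtimes> Z) (X \<boxtimes> (Y \<boxtimes> Z))"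
  using C.assoc_inverse_arrows[OF assms] assms by (simp_all add: C.inverse_arrows_iff)

lemma J_braided_hmap:
  assumes X [simp]: "lie_module S X" and Y [simp]: "lie_module S Y"
  shows "invariants_map G H K (C.braid_hmap X Y) \<circ>\<^sub>h invariants_incl G H K X Y
    = invariants_incl G H K Y X \<circ>\<^sub>h D.braid_hmap (F X) (F Y)" (is "?l = ?r")
proof (rule hmap_eqI)
  note [simp] = C.linmap_tensor_simps
  note Fb = F_hmap[OF _ _ braid_props[OF X Y]]
  have Db: "lin_hmap (D.braid_hmap (F X) (F Y)) (F X \<boxtimes> F Y) (F Y \<boxtimes> F X)"
    using D.braid_inverse_arrows[of "F X" "F Y"] by (simp add: D.inverse_arrows_iff)
  show "lin_hmap ?l (F X \<boxtimes> F Y) (F (Y \<boxtimes> X))" by (rule lin_hmap_comp[OF J_lin_hmap Fb(1)]) simp_all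
  show "lin_hmap ?r (F X \<boxtimes> F Y) (F (Y \<boxtimes> X))" by (rule lin_hmap_comp[OF Db J_lin_hmap]) simp_all
  fix n u assume u: "u \<in> carrier (F X \<boxtimes> F Y)"
  let ?V = "series_value (F X \<boxtimes> F Y) UNIV (\<lambda>_ :: unit. t_act tH (F X) (F Y)) half_exp n u"
  have Ju: "J_map X Y u \<in> carrier (F (X \<boxtimes> Y))" using u by (rule linmap_closed[OF linmap_J[OF X Y]])
  have V: "?V \<in> carrier (F X \<boxtimes> F Y)"
    using u by (intro operators.val_closed D.operators_braid) simp_all
  have "terms ?l n u = terms (C.braid_hmap X Y) n (J_map X Y u)"
    using u Ju by (simp add: terms_comp_J[OF X Y Fb(1)] Fb(3))
  also have "\<dots> = flip_tensor X Y (series_value (X \<boxtimes> Y) UNIV (\<lambda>_ :: unit. t_act tS X Y) half_exp n (J_map X Y u))"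
    unfolding C.braid_hmap_def using Ju
    by (subst terms_const_comp[OF lin_hmap_series]) (simp_all add: F_carrier terms_series_hmap)
  also have "\<dots> = flip_tensor X Y (J_map X Y ?V)"
    using u by (subst series_value_intertwine[OF D.operators_braid C.operators_braid linmap_J_weak]) (simp_all add: J_t_act)
  also have "\<dots> = J_map Y X (flip_tensor (F X) (F Y) ?V)"
    by (rule linmap_tensor_ext[where f = "\<lambda>u. flip_tensor X Y (J_map X Y u)"
          and g = "\<lambda>u. J_map Y X (flip_tensor (F X) (F Y) u)" and M = "Y \<boxtimes> X", OF _ _ _ _ V])
      (auto simp: F_carrier intro!: linmap_comp[OF linmap_flip_tensor linmap_J_weak] linmap_comp[OF linmap_J_weak linmap_flip_tensor])
  also have "\<dots> = J_map Y X (terms (D.braid_hmap (F X) (F Y)) n u)"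
    unfolding D.braid_hmap_def using u
    by (subst terms_const_comp[OF lin_hmap_series]) (simp_all add: terms_series_hmap)
  also have "\<dots> = terms ?r n u"
    unfolding invariants_incl_eq using u by (subst terms_const_comp[OF Db]) simp_all
  finally show "terms ?l n u = terms ?r n u" .
qed

text \<open>The inclusions \<open>?P\<close> and \<open>?Q\<close> of triple products, one for each
  bracketing, are compatible with rebracketing. It remains that \<open>?P\<close> intertwines
  \<open>t\<^sup>1\<^sup>2\<close> and \<open>t\<^sup>2\<^sup>3\<close>. The former is treated in
  the left bracketing, where it is t \<otimes> id, the latter in the right one, where it is id
  \<otimes> t.\<close>

lemma J_assoc_hmap:
  assumes X [simp]: "lie_module S X" and Y [simp]: "lie_module S Y" and Z [simp]: "lie_module S Z"
  shows "invariants_map G H K (C.assoc_hmap X Y Z) \<circ>\<^sub>h invariants_incl G H K (X \<boxtimes> Y) Z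
      \<circ>\<^sub>h (invariants_incl G H K X Y \<otimes>\<^sub>h id_hmap (F Z))
    = invariants_incl G H K X (Y \<boxtimes> Z) \<circ>\<^sub>h (id_hmap (F X) \<otimes>\<^sub>h invariants_incl G H K Y Z)
      \<circ>\<^sub>h D.assoc_hmap (F X) (F Y) (F Z)" (is "?l = ?r")
proof -
  note [simp] = C.linmap_tensor_simps
  let ?M = "(F X \<boxtimes> F Y) \<boxtimes> F Z" and ?N = "F X \<boxtimes> (F Y \<boxtimes> F Z)"
  let ?p = "map_tensor (F X \<boxtimes> F Y) (F Z) (F (X \<boxtimes> Y)) (F Z) (J_map X Y) (\<lambda>z. z)"
  let ?q = "map_tensor (F X) (F Y \<boxtimes> F Z) (F X) (F (Y \<boxtimes> Z)) (\<lambda>x. x) (J_map Y Z)"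
  let ?P = "\<lambda>u. J_map (X \<boxtimes> Y) Z (?p u)" and ?Q = "\<lambda>u. J_map X (Y \<boxtimes> Z) (?q u)"
  have p: "linmap ?M (F (X \<boxtimes> Y) \<boxtimes> F Z) ?p" and q: "linmap ?N (F X \<boxtimes> F (Y \<boxtimes> Z)) ?q" by simp_all
  have P: "linmap ?M (F ((X \<boxtimes> Y) \<boxtimes> Z)) ?P" and Q: "linmap ?N (F (X \<boxtimes> (Y \<boxtimes> Z))) ?Q"
    by (rule linmap_comp[OF linmap_J p] linmap_comp[OF linmap_J q]; simp)+
  note P' = linmap_into_F[OF P] and Q' = linmap_into_F[OF Q]
  have invJ: "elem_tensor X Y x y \<in> carrier (F (X \<boxtimes> Y))" "elem_tensor Y Z y z \<in> carrier (F (Y \<boxtimes> Z))"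
    if "x \<in> carrier (F X)" "y \<in> carrier (F Y)" "z \<in> carrier (F Z)" for x y z
    using that by (simp_all add: elem_invariant)
  have aPQ: "assoc_tensor X Y Z (?P u) = ?Q (assoc_tensor (F X) (F Y) (F Z) u)" if u: "u \<in> carrier ?M" for u
    by (rule linmap_tensor_ext3[where f = "\<lambda>u. assoc_tensor X Y Z (?P u)" and g = "\<lambda>u. ?Q (assoc_tensor (F X) (F Y) (F Z) u)"
          and M = "X \<boxtimes> (Y \<boxtimes> Z)", OF _ _ _ _ _ _ _ u])
      (auto simp: F_carrier invJ intro!: linmap_comp[OF linmap_assoc_tensor P'] linmap_comp[OF Q' linmap_assoc_tensor])
  have t12: "?P (t12_act tH (F X) (F Y) (F Z) u) = t12_act tS X Y Z (?P u)" if u: "u \<in> carrier ?M" for u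
  proof (rule linmap_tensor_ext[where f = "\<lambda>u. ?P (t12_act tH (F X) (F Y) (F Z) u)" and g = "\<lambda>u. t12_act tS X Y Z (?P u)"
          and M = "(X \<boxtimes> Y) \<boxtimes> Z", OF _ _ _ _ u])
    fix v z assume v: "v \<in> carrier (F X \<boxtimes> F Y)" and z: "z \<in> carrier (F Z)"
    have t: "t_act tH (F X) (F Y) v \<in> carrier (F X \<boxtimes> F Y)"
      by (rule linmap_closed[OF D.linmap_t_act(1) v]) simp_all
    note J = linmap_closed[OF linmap_J[OF X Y] v] linmap_closed[OF linmap_J[OF X Y] t]
    show "?P (t12_act tH (F X) (F Y) (F Z) (elem_tensor (F X \<boxtimes> F Y) (F Z) v z))
        = t12_act tS X Y Z (?P (elem_tensor (F X \<boxtimes> F Y) (F Z) v z))"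
      using v z J t by (simp add: F_carrier flip: C.t12_act_map D.t12_act_map) (simp add: J_t_act)
  qed (auto intro!: linmap_comp[OF P' D.linmap_t_act(2)] linmap_comp[OF C.linmap_t_act(2) P'])
  have assoc_t23: "assoc_tensor X' Y' Z' (t23_act tH X' Y' Z' v)
      = map_tensor X' (Y' \<boxtimes> Z') X' (Y' \<boxtimes> Z') (\<lambda>x. x) (t_act tH Y' Z') (assoc_tensor X' Y' Z' v)"
    if "lie_module H X'" "lie_module H Y'" "lie_module H Z'" "v \<in> carrier ((X' \<boxtimes> Y') \<boxtimes> Z')"
    for X' Y' Z' :: "('h, 'b) umod" and v
    using that D.t23_assoc[of X' Y' Z' v] D.t23_T3[of X' Y' Z' v] by simp
  have assoc_t23': "assoc_tensor X Y Z (t23_act tS X Y Z v)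
      = map_tensor X (Y \<boxtimes> Z) X (Y \<boxtimes> Z) (\<lambda>x. x) (t_act tS Y Z) (assoc_tensor X Y Z v)"
    if "v \<in> carrier ((X \<boxtimes> Y) \<boxtimes> Z)" for v
    using that C.t23_assoc[of X Y Z v] C.t23_T3[of X Y Z v] by simp
  have Qt: "?Q (map_tensor (F X) (F Y \<boxtimes> F Z) (F X) (F Y \<boxtimes> F Z) (\<lambda>x. x) (t_act tH (F Y) (F Z)) w)
      = map_tensor X (Y \<boxtimes> Z) X (Y \<boxtimes> Z) (\<lambda>x. x) (t_act tS Y Z) (?Q w)" if w: "w \<in> carrier ?N" for w
  proof (rule linmap_tensor_ext[where f = "\<lambda>w. ?Q (map_tensor (F X) (F Y \<boxtimes> F Z) (F X) (F Y \<boxtimes> F Z) (\<lambda>x. x) (t_act tH (F Y) (F Z)) w)"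
        and g = "\<lambda>w. map_tensor X (Y \<boxtimes> Z) X (Y \<boxtimes> Z) (\<lambda>x. x) (t_act tS Y Z) (?Q w)" and M = "X \<boxtimes> (Y \<boxtimes> Z)", OF _ _ _ _ w])
    fix x v assume x: "x \<in> carrier (F X)" and v: "v \<in> carrier (F Y \<boxtimes> F Z)"
    have t: "t_act tH (F Y) (F Z) v \<in> carrier (F Y \<boxtimes> F Z)"
      by (rule linmap_closed[OF D.linmap_t_act(1) v]) simp_all
    note J = linmap_closed[OF linmap_J[OF Y Z] v] linmap_closed[OF linmap_J[OF Y Z] t]
    show "?Q (map_tensor (F X) (F Y \<boxtimes> F Z) (F X) (F Y \<boxtimes> F Z) (\<lambda>x. x) (t_act tH (F Y) (F Z)) (elem_tensor (F X) (F Y \<boxtimes> F Z) x v))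
        = map_tensor X (Y \<boxtimes> Z) X (Y \<boxtimes> Z) (\<lambda>x. x) (t_act tS Y Z) (?Q (elem_tensor (F X) (F Y \<boxtimes> F Z) x v))"
      using x v J t by (simp add: F_carrier) (simp add: J_t_act)
  qed (auto intro!: linmap_comp[OF Q' linmap_map_tensor] linmap_comp[OF linmap_map_tensor Q'])
  \<comment> \<open>After rebracketing, the claim is \<open>Qt\<close>; the inverse of the
    rebracketing leads back to \<open>?P\<close>.\<close>
  have t23: "?P (t23_act tH (F X) (F Y) (F Z) u) = t23_act tS X Y Z (?P u)" if u: "u \<in> carrier ?M" for u
  proof -
    have c: "?P u \<in> carrier ((X \<boxtimes> Y) \<boxtimes> Z)" "t23_act tH (F X) (F Y) (F Z) u \<in> carrier ?M"
      "assoc_tensor (F X) (F Y) (F Z) u \<in> carrier ?N"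
      by (rule linmap_closed[OF P' u], rule linmap_closed[OF D.linmap_t_act(3) u],
          simp_all, rule linmap_closed[OF linmap_assoc_tensor u], simp_all)
    have "assoc_tensor X Y Z (?P (t23_act tH (F X) (F Y) (F Z) u)) = assoc_tensor X Y Z (t23_act tS X Y Z (?P u))"
      using u c by (simp add: aPQ assoc_t23 Qt assoc_t23' del: map_tensor_elem)
    from arg_cong[OF this, of "assoc_tensor_inv X Y Z"] show ?thesis
      using linmap_closed[OF P' c(2)] linmap_closed[OF C.linmap_t_act(3)[OF X Y Z] c(1)]
      by (simp add: C.assoc_tensor_inverse)
  qed
  have J1: "invariants_incl G H K (X \<boxtimes> Y) Z \<circ>\<^sub>h (invariants_incl G H K X Y \<otimes>\<^sub>h id_hmap (F Z)) = const_hmap ?M (F ((X \<boxtimes> Y) \<boxtimes> Z)) ?P"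
    unfolding invariants_incl_eq by (simp add: const_tensor_const const_comp_const)
  have J2: "invariants_incl G H K X (Y \<boxtimes> Z) \<circ>\<^sub>h (id_hmap (F X) \<otimes>\<^sub>h invariants_incl G H K Y Z) = const_hmap ?N (F (X \<boxtimes> (Y \<boxtimes> Z))) ?Q"
    unfolding invariants_incl_eq by (simp add: const_tensor_const const_comp_const)
  note Fa = F_hmap[OF _ _ assoc_props[OF X Y Z]]
  have Da: "lin_hmap (D.assoc_hmap (F X) (F Y) (F Z)) ?M ?N"
    using D.assoc_inverse_arrows[of "F X" "F Y" "F Z"] by (simp add: D.inverse_arrows_iff)
  \<comment> \<open>\<open>?l\<close> is nested to the left, with the image of the associator
    innermost on the left; the two inclusions are regrouped so that they fuse into
    \<open>?P\<close>.\<close>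
  have l: "?l = invariants_map G H K (C.assoc_hmap X Y Z) \<circ>\<^sub>h const_hmap ?M (F ((X \<boxtimes> Y) \<boxtimes> Z)) ?P"
    unfolding J1[symmetric]
    by (rule comp_hmap_assoc[OF lin_hmap_tensor[OF J_lin_hmap lin_hmap_id] J_lin_hmap Fa(1)]) simp_all
  show ?thesis
    unfolding l J2
  proof (rule hmap_eqI)
    show "lin_hmap (invariants_map G H K (C.assoc_hmap X Y Z) \<circ>\<^sub>h const_hmap ?M (F ((X \<boxtimes> Y) \<boxtimes> Z)) ?P) ?M (F (X \<boxtimes> (Y \<boxtimes> Z)))"
      by (rule lin_hmap_comp[OF lin_hmap_const Fa(1)]) (simp_all add: P)
    show "lin_hmap (const_hmap ?N (F (X \<boxtimes> (Y \<boxtimes> Z))) ?Q \<circ>\<^sub>h D.assoc_hmap (F X) (F Y) (F Z)) ?M (F (X \<boxtimes> (Y \<boxtimes> Z)))"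
      by (rule lin_hmap_comp[OF Da lin_hmap_const]) (simp_all add: Q)
    fix n u assume u: "u \<in> carrier ?M"
    let ?V = "series_value ?M UNIV (D.assoc_ops (F X) (F Y) (F Z)) \<Phi> n u"
    have Pu: "?P u \<in> carrier (F ((X \<boxtimes> Y) \<boxtimes> Z))" using u by (rule linmap_closed[OF P])
    have V: "?V \<in> carrier ?M" using u by (intro operators.val_closed D.operators_assoc) simp_all
    have "terms (invariants_map G H K (C.assoc_hmap X Y Z) \<circ>\<^sub>h const_hmap ?M (F ((X \<boxtimes> Y) \<boxtimes> Z)) ?P) n u
        = terms (C.assoc_hmap X Y Z) n (?P u)"
      using u Pu by (subst terms_comp_const[OF Fa(1) P]) (simp_all add: Fa(3))
    also have "\<dots> = assoc_tensor X Y Z (series_value ((X \<boxtimes> Y) \<boxtimes> Z) UNIV (C.assoc_ops X Y Z) \<Phi> n (?P u))"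
      unfolding C.assoc_hmap_def using F_carrier[OF Pu]
      by (subst terms_const_comp[OF lin_hmap_series]) (simp_all add: terms_series_hmap)
    also have "\<dots> = assoc_tensor X Y Z (?P ?V)"
      using u t12 t23
      by (subst series_value_intertwine[OF D.operators_assoc C.operators_assoc P']) (auto split: letter.split)
    also have "\<dots> = ?Q (assoc_tensor (F X) (F Y) (F Z) ?V)" using V by (rule aPQ)
    also have "\<dots> = ?Q (terms (D.assoc_hmap (F X) (F Y) (F Z)) n u)"
      unfolding D.assoc_hmap_def using u
      by (subst terms_const_comp[OF lin_hmap_series]) (simp_all add: terms_series_hmap)
    also have "\<dots> = terms (const_hmap ?N (F (X \<boxtimes> (Y \<boxtimes> Z))) ?Q \<circ>\<^sub>h D.assoc_hmap (F X) (F Y) (F Z)) n u"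
      using u by (subst terms_const_comp[OF Da Q]) simp_all
    finally show "terms (invariants_map G H K (C.assoc_hmap X Y Z) \<circ>\<^sub>h const_hmap ?M (F ((X \<boxtimes> Y) \<boxtimes> Z)) ?P) n u
        = terms (const_hmap ?N (F (X \<boxtimes> (Y \<boxtimes> Z))) ?Q \<circ>\<^sub>h D.assoc_hmap (F X) (F Y) (F Z)) n u" .
  qed
qed

lemma J_unit_hmap:
  fixes X :: "('g \<times> 'h, 'a) umod"
  assumes X [simp]: "lie_module S X"
  shows "invariants_map G H K (left_unitor (drinfeld_category \<Phi> S tS) X) \<circ>\<^sub>h invariants_incl G H K trivial_module X
      \<circ>\<^sub>h (invariants_unit G H K \<otimes>\<^sub>h id_hmap (F X)) = left_unitor (drinfeld_category \<Phi> H tH) (F X)"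
    and "invariants_map G H K (right_unitor (drinfeld_category \<Phi> S tS) X) \<circ>\<^sub>h invariants_incl G H K X trivial_module
      \<circ>\<^sub>h (id_hmap (F X) \<otimes>\<^sub>h invariants_unit G H K) = right_unitor (drinfeld_category \<Phi> H tH) (F X)"
proof -
  let ?I = "trivial_module :: ('g \<times> 'h, 'a) umod" and ?J = "trivial_module :: ('h, 'a) umod"
  have I [simp]: "lie_module S ?I" using C.lie by (rule lie_module_trivial)
  have J [simp]: "lie_module H ?J" using H by (rule lie_module_trivial)
  have id [simp]: "linmap ?J (F ?I) (\<lambda>c. c)"
    by (auto simp: linmap_def invariants_simps trivial_module_def)
  have c: "c \<in> carrier ?I" "c \<in> carrier (F ?I)" if "c \<in> carrier ?J" for c
    using that by (auto simp: invariants_simps trivial_module_def)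
  have sm: "smult (F X) = smult X" by (simp add: invariants_simps)
  note [simp] = C.unitors[OF X] D.unitors[OF lie_module_F[OF X], unfolded sm] C.linmap_tensor_simps
  let ?l = "module_lift ?I X X (\<lambda>c x. scalar c \<odot>\<^bsub>X\<^esub> x)" and ?r = "module_lift X ?I X (\<lambda>x c. scalar c \<odot>\<^bsub>X\<^esub> x)"
  have linmap_F: "linmap (F M) (F X) p"
    if M: "lie_module S M" and p: "linmap M X p" "C.equivariant (const_hmap M X p) M X" for M p
    using F_hmap(4)[OF M X _ p(2), where n = 0] linmap_from_F[OF p(1)] M p(1)
    unfolding linmap_F_iff by (simp add: lin_hmap_const terms_const F_carrier)
  \<comment> \<open>The unitors are isomorphisms of the category, hence equivariant, and so they
    send invariants to invariants.\<close>
  have l: "linmap (F (?I \<boxtimes> X)) (F X) ?l" and r: "linmap (F (X \<boxtimes> ?I)) (F X) ?r"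
    using C.unitor_inverse_arrows[OF X]
    by (auto intro!: linmap_F simp: C.inverse_arrows_iff C.category_simps)
  show "invariants_map G H K (left_unitor (drinfeld_category \<Phi> S tS) X) \<circ>\<^sub>h invariants_incl G H K ?I X
      \<circ>\<^sub>h (invariants_unit G H K \<otimes>\<^sub>h id_hmap (F X)) = left_unitor (drinfeld_category \<Phi> H tH) (F X)"
  proof -
    let ?p = "\<lambda>u. ?l (J_map ?I X (map_tensor ?J (F X) (F ?I) (F X) (\<lambda>c. c) (\<lambda>x. x) u))"
      and ?q = "module_lift ?J (F X) (F X) (\<lambda>c x. scalar c \<odot>\<^bsub>X\<^esub> x)"
    have p: "linmap (?J \<boxtimes> F X) (F X) ?p"
      by (intro linmap_comp[OF l] linmap_comp[OF linmap_J]) simp_all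
    have "?p u = ?q u" if u: "u \<in> carrier (?J \<boxtimes> F X)" for u
      by (rule linmap_tensor_ext[where f = ?p and g = ?q, OF _ p _ _ u]) (simp_all add: c F_carrier)
    then show ?thesis
      unfolding invariants_incl_eq invariants_unit_def C.category_simps D.category_simps sm
      by (simp add: F_const const_tensor_const const_comp_const linmap_comp[OF l linmap_J] l)
        (rule const_hmap_cong)
  qed
  show "invariants_map G H K (right_unitor (drinfeld_category \<Phi> S tS) X) \<circ>\<^sub>h invariants_incl G H K X ?I
      \<circ>\<^sub>h (id_hmap (F X) \<otimes>\<^sub>h invariants_unit G H K) = right_unitor (drinfeld_category \<Phi> H tH) (F X)"
  proof -
    let ?p = "\<lambda>u. ?r (J_map X ?I (map_tensor (F X) ?J (F X) (F ?I) (\<lambda>x. x) (\<lambda>c. c) u))"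
      and ?q = "module_lift (F X) ?J (F X) (\<lambda>x c. scalar c \<odot>\<^bsub>X\<^esub> x)"
    have p: "linmap (F X \<boxtimes> ?J) (F X) ?p"
      by (intro linmap_comp[OF r] linmap_comp[OF linmap_J]) simp_all
    have "?p u = ?q u" if u: "u \<in> carrier (F X \<boxtimes> ?J)" for u
      by (rule linmap_tensor_ext[where f = ?p and g = ?q, OF _ p _ _ u]) (simp_all add: c F_carrier)
    then show ?thesis
      unfolding invariants_incl_eq invariants_unit_def C.category_simps D.category_simps sm
      by (simp add: F_const const_tensor_const const_comp_const linmap_comp[OF r linmap_J] r)
        (rule const_hmap_cong)
  qed
qed

lemma invariants_functor:
  "braided_monoidal_functor
    (drinfeld_category \<Phi> S tS :: (('g \<times> 'h, 'a) umod, ('g \<times> 'h, 'a) hmap) bmcat) (drinfeld_category \<Phi> H tH)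
    F (invariants_map G H K) (invariants_incl G H K) (invariants_unit G H K)"
proof -
  have I [simp]: "lie_module S (trivial_module :: ('g \<times> 'h, 'a) umod)" using C.lie by (rule lie_module_trivial)
  have J [simp]: "lie_module H (trivial_module :: ('h, 'a) umod)" using H by (rule lie_module_trivial)
  note simps = C.category_simps(1-6) C.hom_iff C.associator_eq C.braiding_eq
    D.category_simps(1-6) D.hom_iff D.associator_eq D.braiding_eq
  show ?thesis
  \<comment> \<open>With both categories supplied, the remaining goals are the axioms of the
    functor, numbered in the order of their locale.\<close>
  proof (rule braided_monoidal_functor.intro[OF C.drinfeld_category_braided_monoidal D.drinfeld_category_braided_monoidal],
      unfold_locales, goal_cases)
    case 1 then show ?case by (simp add: simps)
  next
    case 2 then show ?case by (auto simp: simps F_hmap)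
  next
    case 3 then show ?case by (simp add: simps F_const linmap_id)
  next
    case 4 then show ?case by (auto simp: simps F_comp_hmap)
  next
    case 5 then show ?case 
      by (auto simp: simps J_act invariants_incl_eq intro!: D.equivariant_const)
  next
    case 6 then show ?case by (auto simp: simps intro: J_natural_hmap)
  next
    \<comment> \<open>Every element of the trivial module is invariant, so the two unit objects have
      the same elements and the identity map is an arrow between them.\<close>
    case 7
    have "linmap (trivial_module :: ('h, 'a) umod) (F trivial_module) (\<lambda>c. c)"
      by (auto simp: linmap_def invariants_simps trivial_module_def)
    moreover have "act (trivial_module :: ('h, 'a) umod) a c = act (F trivial_module) a c" for a c
      by (simp add: invariants_simps) (simp add: trivial_module_def)
    ultimately show ?case
      by (auto simp: simps invariants_unit_def intro!: D.equivariant_const)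
  next
    case 8 then show ?case by (simp add: simps J_assoc_hmap)
  next
    case 9 then show ?case by (simp add: simps J_unit_hmap)
  next
    case 10 then show ?case by (simp add: simps J_unit_hmap)
  next
    case 11 then show ?case by (simp add: simps J_braided_hmap)
  qed
qed

end

theorem proposition2:
  fixes \<Phi> :: "letter ncseries"
    and \<gg> :: "'g lie" and \<hh> :: "'h lie"
    and t\<^sub>g :: "('g, 'g) formal_sum" and t\<^sub>h :: "('h, 'h) formal_sum"
    and \<cc> :: "'g set"
  assumes "drinfeld_associator \<Phi>"
    and "lie_algebra \<gg>" and "lie_algebra \<hh>"
    and "t\<^sub>g \<in> sym_square_invariants \<gg>" and "t\<^sub>h \<in> sym_square_invariants \<hh>"
    and "lie_subalgebra \<cc> \<gg>" and "coisotropic \<cc> \<gg> t\<^sub>g"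
  shows "braided_monoidal_functor
    (drinfeld_category \<Phi> (lie_sum \<gg> \<hh>) (sum_form \<gg> \<hh> t\<^sub>g t\<^sub>h)
      :: (('g \<times> 'h, 'a) umod, ('g \<times> 'h, 'a) hmap) bmcat)
    (drinfeld_category \<Phi> \<hh> t\<^sub>h)
    (invariants \<gg> \<hh> \<cc>) (invariants_map \<gg> \<hh> \<cc>)
    (invariants_incl \<gg> \<hh> \<cc>) (invariants_unit \<gg> \<hh> \<cc>)"
proof -
  interpret coisotropic_invariants \<Phi> \<gg> \<hh> t\<^sub>g t\<^sub>h \<cc>
    using assms by (rule coisotropic_invariants.intro)
  show ?thesis by (rule invariants_functor)
qed

end
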